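(* Let $q\in(0,1)$, $t\in[0,1]$, and let $c_1,c_2\in\mathbb R$ with $c_1\neq 0$. On the Hilbert space of spinors $\mathcal H$, with orthonormal basis $v^l_{m,\pm}$ ($l=\tfrac12,\tfrac32,\dots$; $m=-l,-l+1,\dots,l$), let $\gamma$ and $D$ be the self-adjoint operators and let $J$ be the antiunitary operator given by $$\gamma v^l_{m,\pm}=\pm v^l_{m,\pm},\qquad D v^l_{m,\pm}=(c_1l+c_2)\,v^l_{m,\mp},\qquad Jv^l_{m,\pm}=(-1)^{m+1/2}\,v^l_{-m,\mp}.$$ Then $(\mathcal A(S^2_{qt}),\mathcal H,D,J,\gamma)$ is an equivariant real even spectral triple, where for all $a,b\in\mathcal A(S^2_{qt})$ $$[\pi(a),J\pi(b)J^{-1}]\in\mathcal I,\qquad [[D,\pi(a)],J\pi(b)J^{-1}]\in\mathcal I,$$ with $\mathcal I=\mathcal I(L_q^\alpha)$, for $\alpha\in(0,2)$ if $t\neq1$ and for $\alpha\in(0,1)$ if $t=1$.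
   Context: Let $[n]=(q^n-q^{-n})/(q-q^{-1})$ for $n\in\mathbb R$. Algebra. $\mathcal A(S^2_{qt})$ is the unital complex $*$-algebra generated by $x_{-1},x_0,x_1$ with relations $x_{-1}(x_0-t)=q^2(x_0-t)x_{-1}$, $x_1(x_0-t)=q^{-2}(x_0-t)x_1$, $-[2]x_{-1}x_1+(q^2x_0+t)(x_0-t)=[2]^2(1-t)$, $-[2]x_1x_{-1}+(q^{-2}x_0+t)(x_0-t)=[2]^2(1-t)$, and involution $x_{-1}^*=-q^{-1}x_1$, $x_0^*=x_0$. Symmetry. $\mathcal U=\mathcal U_q(\mathrm{su}(2))$ is the Hopf $*$-algebra generated by $e,f,k,k^{-1}$ with relations $kk^{-1}=k^{-1}k=1$, $k^2-k^{-2}=(q-q^{-1})(fe-ef)$, $kf=qfk$, $ke=q^{-1}ek$; coproduct $\Delta k=k\otimes k$, $\Delta f=f\otimes k+k^{-1}\otimes f$, $\Delta e=e\otimes k+k^{-1}\otimes e$; counit $\varepsilon(k)=1$, $\varepsilon(e)=\varepsilon(f)=0$; antipode $S(k)=k^{-1}$, $S(f)=-qf$, $S(e)=-q^{-1}e$; involution $k^*=k$, $f^*=e$. $\mathcal A(S^2_{qt})$ is a left $\mathcal U$-module $*$-algebra via $k\triangleright x_i=q^ix_i$; $f\triangleright x_{-1}=[2]^{1/2}x_0$, $f\triangleright x_0=[2]^{1/2}x_1$, $f\triangleright x_1=0$; $e\triangleright x_{-1}=0$, $e\triangleright x_0=[2]^{1/2}x_{-1}$, $e\triangleright x_1=[2]^{1/2}x_0$.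 Spinors. $\mathcal H$ is the Hilbert space with orthonormal basis $v^l_{m,\pm}$ ($l\in\tfrac12+\mathbb N_0$, $m=-l,\dots,l$); $\mathcal W$ is the (algebraic) linear span of the basis and $\mathcal W^l_m=\mathrm{span}\{v^l_{m,-},v^l_{m,+}\}$. $\mathcal U$ acts on $\mathcal W$ by $kv^l_{m,\pm}=q^mv^l_{m,\pm}$, $fv^l_{m,\pm}=[l-m]^{1/2}[l+m+1]^{1/2}v^l_{m+1,\pm}$, $ev^l_{m,\pm}=[l-m+1]^{1/2}[l+m]^{1/2}v^l_{m-1,\pm}$. The spinor representation $\pi$ of $\mathcal A(S^2_{qt})$ by bounded operators on $\mathcal H$ is $$\pi(x_i)v^l_{m,\pm}=\alpha_i^-(l,m;\pm\tfrac12)v^{l-1}_{m+i,\pm}+\alpha_i^0(l,m;\pm\tfrac12)v^l_{m+i,\pm}+\alpha_i^+(l,m;\pm\tfrac12)v^{l+1}_{m+i,\pm},$$ where a term is $0$ if the vector in it does not exist (i.e. $l-1<\tfrac12$ or $|m+i|$ exceeds the spin), and $\alpha^+_1(l,m;N)=q^{-l+m}[l+m+1]^{1/2}[l+m+2]^{1/2}[2l+1]^{-1/2}[2l+2]^{-1/2}\alpha_N(l+1)$, $\alpha^0_1(l,m;N)=-q^{m+2}[l-m]^{1/2}[l+m+1]^{1/2}[2]^{1/2}[2l]^{-1}\beta_N(l)$, $\alpha^-_1(l,m;N)=-q^{l+m+1}[l-m-1]^{1/2}[l-m]^{1/2}[2l-1]^{-1/2}[2l]^{-1/2}\alpha_N(l)$,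 $\alpha^+_0(l,m;N)=q^m[l-m+1]^{1/2}[l+m+1]^{1/2}[2]^{1/2}[2l+1]^{-1/2}[2l+2]^{-1/2}\alpha_N(l+1)$, $\alpha^0_0(l,m;N)=[2l]^{-1}\big([l-m+1][l+m]-q^2[l-m][l+m+1]\big)\beta_N(l)$, $\alpha^-_0(l,m;N)=q^m[l-m]^{1/2}[l+m]^{1/2}[2]^{1/2}[2l-1]^{-1/2}[2l]^{-1/2}\alpha_N(l)$, $\alpha^+_{-1}(l,m;N)=q^{l+m}[l-m+1]^{1/2}[l-m+2]^{1/2}[2l+1]^{-1/2}[2l+2]^{-1/2}\alpha_N(l+1)$, $\alpha^0_{-1}(l,m;N)=q^m[l-m+1]^{1/2}[l+m]^{1/2}[2]^{1/2}[2l]^{-1}\beta_N(l)$, $\alpha^-_{-1}(l,m;N)=-q^{-l+m-1}[l+m-1]^{1/2}[l+m]^{1/2}[2l-1]^{-1/2}[2l]^{-1/2}\alpha_N(l)$, with, for $\epsilon=\mathrm{sign}(N)$, $$\alpha_N(l)=\frac{[2]^{1/2}[l+N]^{1/2}[l-N]^{1/2}[2l]^{1/2}}{[2l+1]^{1/2}[l]}\Big(1-t+q^{-2N}[2l]^{-2}[l]^2(t-1+q^{2N})^2\Big)^{1/2},$$ $$\beta_N(l)=\frac{\epsilon[2|N|](q^{-1}+q-q^{\epsilon}t)+t(q-q^{-1})\{[|N|][|N|+1]-[l][l+1]\}}{q[2l+2]}.$$ $\pi$ is $\mathcal U$-equivariant on $\mathcal W$: $h\,\pi(x)\xi=\pi(h_{(1)}\triangleright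 x)h_{(2)}\xi$. $L_q$ is the compact operator $L_qv^l_{m,\pm}=q^lv^l_{m,\pm}$; $\mathcal I(L)$ denotes the two-sided ideal of $\mathcal B(\mathcal H)$ generated by $L$. Definitions. A spectral triple $(\mathcal A,\mathcal H,D)$: a complex unital $*$-algebra $\mathcal A$, a faithful $*$-representation $\pi$ by bounded operators on $\mathcal H$, and a self-adjoint $D$ with $(D+\mathrm i)^{-1}$ compact and $[D,\pi(a)]$ bounded for all $a\in\mathcal A$. It is even if there is $\gamma=\gamma^*$, $\gamma^2=1$, with $\gamma D=-D\gamma$, $\gamma\pi(a)=\pi(a)\gamma$. It is real (up to infinitesimals; dimension 2 signs) if there is an antiunitary $J$ with $J^2=-1$, $JD=DJ$, $[\pi(a),J\pi(b)J^{-1}]\in\mathcal I$, $[[D,\pi(a)],J\pi(b)J^{-1}]\in\mathcal I$ for all $a,b$, where $\mathcal I$ is an operator ideal of infinitesimals of arbitrary high order (compact operators $A$ whose singular values satisfy $k^ps_k(A)\to0$ for all $p>0$); in the real even case also $J\gamma=-\gamma J$. It is equivariant if $\pi$ is $\mathcal U$-equivariant on $\mathcal W$, $D$ and $\gamma$ commute on $\mathcal W$ with the action of all $h\in\mathcal U$, and $J$ leaves $\mathcal W$ invariant and is the antiunitary part in the polar decomposition of a closed antilinear operator $T$ with $Th\xi=S(h)^*T\xi$ for all $h\in\mathcal U$, $\xi\in\mathcal W$. *)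

theory Defs
  imports
    "HOL-Analysis.Analysis"
    "HOL-Library.Poly_Mapping"
    "HOL-Library.Product_Plus"
    "HOL-Algebra.QuotRing"
begin

section \<open>The Hilbert space of square-summable families\<close>

typedef 'i ell2 = "{x :: 'i \<Rightarrow> complex. (\<lambda>i. (cmod (x i))\<^sup>2) summable_on UNIV}"
  morphisms coeff Abs_ell2
  by (rule exI[of _ "\<lambda>_. 0"]) simp

setup_lifting type_definition_ell2

lemma summable_sq_add:
  fixes x y :: "'i \<Rightarrow> complex"
  assumes "(\<lambda>i. (cmod (x i))\<^sup>2) summable_on UNIV" "(\<lambda>i. (cmod (y i))\<^sup>2) summable_on UNIV"
  shows "(\<lambda>i. (cmod (x i + y i))\<^sup>2) summable_on UNIV"
proof (rule summable_on_comparison_test)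
  show "(\<lambda>i. 2 * (cmod (x i))\<^sup>2 + 2 * (cmod (y i))\<^sup>2) summable_on UNIV"
    by (intro summable_on_add summable_on_cmult_right assms)
  fix i
  have "(cmod (x i + y i))\<^sup>2 \<le> (cmod (x i) + cmod (y i))\<^sup>2"
    by (simp add: norm_triangle_ineq power_mono)
  also have "\<dots> \<le> 2 * (cmod (x i))\<^sup>2 + 2 * (cmod (y i))\<^sup>2"
    using zero_le_power2[of "cmod (x i) - cmod (y i)"] by (simp add: power2_eq_square algebra_simps)
  finally show "(cmod (x i + y i))\<^sup>2 \<le> 2 * (cmod (x i))\<^sup>2 + 2 * (cmod (y i))\<^sup>2" .
qed auto

lemma summable_sq_scale:
  fixes x :: "'i \<Rightarrow> complex"
  assumes "(\<lambda>i. (cmod (x i))\<^sup>2) summable_on UNIV"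
  shows "(\<lambda>i. (cmod (c * x i))\<^sup>2) summable_on UNIV"
  using summable_on_cmult_right[OF assms, of "(cmod c)\<^sup>2"] by (simp add: norm_mult power_mult_distrib)

lemma summable_cnj_mult:
  fixes x y :: "'i \<Rightarrow> complex"
  assumes "(\<lambda>i. (cmod (x i))\<^sup>2) summable_on UNIV" "(\<lambda>i. (cmod (y i))\<^sup>2) summable_on UNIV"
  shows "(\<lambda>i. cnj (x i) * y i) summable_on UNIV"
proof -
  have "(\<lambda>i. cmod (cnj (x i) * y i)) summable_on UNIV"
  proof (rule summable_on_comparison_test)
    show "(\<lambda>i. (cmod (x i))\<^sup>2 + (cmod (y i))\<^sup>2) summable_on UNIV"
      by (intro summable_on_add assms)
    fix i
    have "2 * (cmod (x i) * cmod (y i)) \<le> (cmod (x i))\<^sup>2 + (cmod (y i))\<^sup>2"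
      using zero_le_power2[of "cmod (x i) - cmod (y i)"] by (simp add: power2_eq_square algebra_simps)
    moreover have "0 \<le> cmod (x i) * cmod (y i)" by simp
    ultimately show "cmod (cnj (x i) * y i) \<le> (cmod (x i))\<^sup>2 + (cmod (y i))\<^sup>2"
      by (simp only: norm_mult complex_mod_cnj)
  qed auto
  then show ?thesis by (rule abs_summable_summable)
qed

lift_definition scaleC_ell2 :: "complex \<Rightarrow> 'i ell2 \<Rightarrow> 'i ell2" (infixr \<open>*\<^sub>C\<close> 75)
  is "\<lambda>c x i. c * x i"
  by (rule summable_sq_scale)

instantiation ell2 :: (type) ab_group_add
begin
lift_definition zero_ell2 :: "'a ell2" is "\<lambda>_. 0" by simp
lift_definition plus_ell2 :: "'a ell2 \<Rightarrow> 'a ell2 \<Rightarrow> 'a ell2" is "\<lambda>x y i. x i + y i"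
  by (rule summable_sq_add)
lift_definition uminus_ell2 :: "'a ell2 \<Rightarrow> 'a ell2" is "\<lambda>x i. - x i" by simp
lift_definition minus_ell2 :: "'a ell2 \<Rightarrow> 'a ell2 \<Rightarrow> 'a ell2" is "\<lambda>x y i. x i - y i"
  subgoal for x y using summable_sq_add[of x "\<lambda>i. - y i"] by simp
  done
instance by standard (transfer; force simp: algebra_simps)+
end

instantiation ell2 :: (type) real_vector
begin
lift_definition scaleR_ell2 :: "real \<Rightarrow> 'a ell2 \<Rightarrow> 'a ell2" is "\<lambda>r x i. complex_of_real r * x i"
  by (rule summable_sq_scale)
instance by standard (transfer; force simp: algebra_simps)+
end

global_interpretation ell2: vector_space "scaleC_ell2 :: complex \<Rightarrow> 'i ell2 \<Rightarrow> 'i ell2"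
  by standard (transfer; force simp: algebra_simps)+

text \<open>The inner product is antilinear in the first argument.\<close>

lift_definition cinner :: "'i ell2 \<Rightarrow> 'i ell2 \<Rightarrow> complex"
  is "\<lambda>x y. \<Sum>\<^sub>\<infinity>i. cnj (x i) * y i" .

lemma cinner_add_right: "cinner x (y + z) = cinner x y + cinner x z"
  by transfer (simp add: distrib_left infsum_add summable_cnj_mult)

lemma cinner_scale_right: "cinner x (c *\<^sub>C y) = c * cinner x y"
proof transfer
  fix x y :: "'a \<Rightarrow> complex" and c
  assume "(\<lambda>i. (cmod (x i))\<^sup>2) summable_on UNIV" "(\<lambda>i. (cmod (y i))\<^sup>2) summable_on UNIV"
  then have "(\<lambda>i. cnj (x i) * y i) summable_on UNIV" by (rule summable_cnj_mult)
  then have "(\<Sum>\<^sub>\<infinity>i. c * (cnj (x i) * y i)) = c * (\<Sum>\<^sub>\<infinity>i. cnj (x i) * y i)"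
    by (rule infsum_cmult_right)
  then show "(\<Sum>\<^sub>\<infinity>i. cnj (x i) * (c * y i)) = c * (\<Sum>\<^sub>\<infinity>i. cnj (x i) * y i)"
    by (simp add: mult.left_commute)
qed

lemma cinner_commute: "cinner y x = cnj (cinner x y)"
  by transfer (simp add: infsum_cnj[symmetric] mult.commute)

lemma cinner_self: "cinner x x = of_real (\<Sum>\<^sub>\<infinity>i. (cmod (coeff x i))\<^sup>2)"
proof -
  have "((\<lambda>i. (cmod (coeff x i))\<^sup>2) has_sum (\<Sum>\<^sub>\<infinity>i. (cmod (coeff x i))\<^sup>2)) UNIV"
    using coeff[of x] by (intro has_sum_infsum) simp
  then have "((\<lambda>i. of_real ((cmod (coeff x i))\<^sup>2)) has_sum
      complex_of_real (\<Sum>\<^sub>\<infinity>i. (cmod (coeff x i))\<^sup>2)) UNIV"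
    by (simp only: has_sum_of_real_iff)
  then have "((\<lambda>i. cnj (coeff x i) * coeff x i) has_sum
      complex_of_real (\<Sum>\<^sub>\<infinity>i. (cmod (coeff x i))\<^sup>2)) UNIV"
    by (simp only: complex_norm_square mult.commute)
  then show ?thesis by (simp add: cinner.rep_eq infsumI)
qed

lemma scaleR_scaleC: "r *\<^sub>R x = complex_of_real r *\<^sub>C x" for x :: "'i ell2"
  by transfer simp

instantiation ell2 :: (type) real_inner
begin
definition inner_ell2 :: "'a ell2 \<Rightarrow> 'a ell2 \<Rightarrow> real" where "inner_ell2 x y = Re (cinner x y)"
definition norm_ell2 :: "'a ell2 \<Rightarrow> real" where "norm_ell2 x = sqrt (inner x x)"
definition sgn_ell2 :: "'a ell2 \<Rightarrow> 'a ell2" where "sgn_ell2 x = x /\<^sub>R norm x"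
definition dist_ell2 :: "'a ell2 \<Rightarrow> 'a ell2 \<Rightarrow> real" where "dist_ell2 x y = norm (x - y)"
definition uniformity_ell2 :: "('a ell2 \<times> 'a ell2) filter"
  where "uniformity_ell2 = (INF e\<in>{0 <..}. principal {(x, y). dist x y < e})"
definition open_ell2 :: "'a ell2 set \<Rightarrow> bool"
  where "open_ell2 S = (\<forall>x\<in>S. \<forall>\<^sub>F (x', y) in uniformity. x' = x \<longrightarrow> y \<in> S)"
instance
proof
  fix x y z :: "'a ell2" and r :: real
  show "inner x y = inner y x" unfolding inner_ell2_def by (subst cinner_commute) simp
  then show "inner (x + y) z = inner x z + inner y z"
    unfolding inner_ell2_def
    by (metis cinner_add_right cinner_commute complex_cnj_add plus_complex.simps(1))
  show "inner (r *\<^sub>R x) y = r * inner x y"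
  proof -
    have "cinner (r *\<^sub>R x) y = of_real r * cinner x y"
      by (subst cinner_commute, subst (2) cinner_commute) (simp add: scaleR_scaleC cinner_scale_right)
    then show ?thesis by (simp add: inner_ell2_def)
  qed
  show "0 \<le> inner x x" by (simp add: inner_ell2_def cinner_self infsum_nonneg)
  show "(inner x x = 0) = (x = 0)"
  proof
    assume "inner x x = 0"
    then have 0: "(\<Sum>\<^sub>\<infinity>i. (cmod (coeff x i))\<^sup>2) = 0" by (simp add: inner_ell2_def cinner_self)
    have s: "(\<lambda>i. (cmod (coeff x i))\<^sup>2) summable_on UNIV" using coeff[of x] by simp
    have "(cmod (coeff x i))\<^sup>2 = 0" for i
      by (rule nonneg_infsum_le_0D[OF eq_refl[OF 0] s]) auto
    then show "x = 0" by (intro coeff_inject[THEN iffD1]) (simp add: zero_ell2.rep_eq fun_eq_iff)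
  next
    assume "x = 0"
    then show "inner x x = 0" by (simp add: inner_ell2_def cinner_self zero_ell2.rep_eq)
  qed
qed (simp_all add: norm_ell2_def sgn_ell2_def dist_ell2_def uniformity_ell2_def open_ell2_def)
end

lemma norm_ell2_sq: "(norm x)\<^sup>2 = (\<Sum>\<^sub>\<infinity>i. (cmod (coeff x i))\<^sup>2)"
  by (simp add: norm_ell2_def inner_ell2_def cinner_self infsum_nonneg)

lemma summable_coeff: "(\<lambda>i. (cmod (coeff x i))\<^sup>2) summable_on UNIV"
  using coeff[of x] by simp

lemma sum_coeff_le_norm: "finite F \<Longrightarrow> (\<Sum>i\<in>F. (cmod (coeff x i))\<^sup>2) \<le> (norm x)\<^sup>2"
  unfolding norm_ell2_sq by (rule finite_sum_le_infsum[OF summable_coeff]) auto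

lemma coeff_le_norm: "cmod (coeff x i) \<le> norm x"
  using sum_coeff_le_norm[of "{i}" x] by (simp add: power2_le_iff_abs_le)

instance ell2 :: (type) banach
proof
  fix X :: "nat \<Rightarrow> 'a ell2"
  assume C: "Cauchy X"
  have "Cauchy (\<lambda>n. coeff (X n) i)" for i
  proof (rule metric_CauchyI)
    fix e :: real assume "e > 0"
    then obtain M where M: "\<And>m n. m \<ge> M \<Longrightarrow> n \<ge> M \<Longrightarrow> norm (X m - X n) < e"
      using C unfolding Cauchy_iff by blast
    have "cmod (coeff (X m) i - coeff (X n) i) < e" if "m \<ge> M" "n \<ge> M" for m n
      using coeff_le_norm[of "X m - X n" i] M[OF that] by (simp add: minus_ell2.rep_eq)
    then show "\<exists>M. \<forall>m\<ge>M. \<forall>n\<ge>M. dist (coeff (X m) i) (coeff (X n) i) < e"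
      by (auto simp: dist_norm)
  qed
  then have "\<exists>g. \<forall>i. (\<lambda>n. coeff (X n) i) \<longlonglongrightarrow> g i"
    by (intro choice) (auto simp: Cauchy_convergent_iff convergent_def)
  then obtain g where g: "\<And>i. (\<lambda>n. coeff (X n) i) \<longlonglongrightarrow> g i" by blast
  have key: "\<exists>M. \<forall>n\<ge>M. \<forall>F. finite F \<longrightarrow> (\<Sum>i\<in>F. (cmod (coeff (X n) i - g i))\<^sup>2) \<le> e\<^sup>2"
    if "e > 0" for e
  proof -
    obtain M where M: "\<And>m n. m \<ge> M \<Longrightarrow> n \<ge> M \<Longrightarrow> norm (X m - X n) < e"
      using C \<open>e > 0\<close> unfolding Cauchy_iff by blast
    have "(\<Sum>i\<in>F. (cmod (coeff (X n) i - g i))\<^sup>2) \<le> e\<^sup>2" if "n \<ge> M" "finite F" for n F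
    proof (rule tendsto_upperbound)
      show "(\<lambda>m. \<Sum>i\<in>F. (cmod (coeff (X n) i - coeff (X m) i))\<^sup>2)
              \<longlonglongrightarrow> (\<Sum>i\<in>F. (cmod (coeff (X n) i - g i))\<^sup>2)"
        by (intro tendsto_intros g)
      have "(\<Sum>i\<in>F. (cmod (coeff (X n) i - coeff (X m) i))\<^sup>2) \<le> e\<^sup>2" if "m \<ge> M" for m
      proof -
        have "(\<Sum>i\<in>F. (cmod (coeff (X n) i - coeff (X m) i))\<^sup>2) \<le> (norm (X n - X m))\<^sup>2"
          using sum_coeff_le_norm[OF \<open>finite F\<close>, of "X n - X m"] by (simp add: minus_ell2.rep_eq)
        also have "\<dots> \<le> e\<^sup>2"
          using M[OF \<open>n \<ge> M\<close> that] by (intro power_mono) auto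
        finally show ?thesis .
      qed
      then show "\<forall>\<^sub>F m in sequentially. (\<Sum>i\<in>F. (cmod (coeff (X n) i - coeff (X m) i))\<^sup>2) \<le> e\<^sup>2"
        unfolding eventually_sequentially by blast
    qed simp
    then show ?thesis by blast
  qed
  have diff: "(\<lambda>i. (cmod (coeff (X n) i - g i))\<^sup>2) summable_on UNIV"
    if "\<forall>F. finite F \<longrightarrow> (\<Sum>i\<in>F. (cmod (coeff (X n) i - g i))\<^sup>2) \<le> b" for n and b :: real
    by (rule nonneg_bounded_partial_sums_imp_summable_on[where C = b])
      (use that in \<open>auto intro!: eventually_finite_subsets_at_top_weakI\<close>)
  obtain M where M: "\<And>n F. n \<ge> M \<Longrightarrow> finite F \<Longrightarrow> (\<Sum>i\<in>F. (cmod (coeff (X n) i - g i))\<^sup>2) \<le> 1\<^sup>2"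
    using key[of 1] by auto
  have "(\<lambda>i. (cmod (coeff (X M) i + - (coeff (X M) i - g i)))\<^sup>2) summable_on UNIV"
    by (rule summable_sq_add[OF summable_coeff])
      (subst norm_minus_cancel, rule diff, use M in blast)
  then have gs: "g \<in> {x. (\<lambda>i. (cmod (x i))\<^sup>2) summable_on UNIV}" by simp
  define Y where "Y = Abs_ell2 g"
  have Y: "coeff Y = g" unfolding Y_def by (rule Abs_ell2_inverse[OF gs])
  have "X \<longlonglongrightarrow> Y"
  proof (rule metric_LIMSEQ_I)
    fix r :: real assume "r > 0"
    then obtain M where M: "\<And>n F. n \<ge> M \<Longrightarrow> finite F
        \<Longrightarrow> (\<Sum>i\<in>F. (cmod (coeff (X n) i - g i))\<^sup>2) \<le> (r/2)\<^sup>2"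
      using key[of "r/2"] by auto
    have "norm (X n - Y) < r" if "n \<ge> M" for n
    proof -
      have "(norm (X n - Y))\<^sup>2 = (\<Sum>\<^sub>\<infinity>i. (cmod (coeff (X n) i - g i))\<^sup>2)"
        by (simp add: norm_ell2_sq minus_ell2.rep_eq Y)
      also have "\<dots> \<le> (r/2)\<^sup>2"
        by (rule infsum_le_finite_sums) (use M[OF that] in \<open>auto intro: diff\<close>)
      finally have "norm (X n - Y) \<le> r/2"
        using \<open>r > 0\<close> by (simp add: power2_le_iff_abs_le)
      then show ?thesis using \<open>r > 0\<close> by simp
    qed
    then show "\<exists>no. \<forall>n\<ge>no. dist (X n) Y < r" by (auto simp: dist_norm)
  qed
  then show "convergent X" by (auto simp: convergent_def)
qed

lift_definition ket :: "'i \<Rightarrow> 'i ell2" is "\<lambda>i j. if j = i then 1 else 0"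
  subgoal for i
    by (rule summable_on_cong_neutral[where S = "{i}" and f = "\<lambda>_. 1", THEN iffD1]) auto
  done


section \<open>Operators\<close>

subsection \<open>Bounded operators and ideals\<close>

type_synonym 'i op = "'i ell2 \<Rightarrow> 'i ell2"

definition bounded_clinear :: "'i op \<Rightarrow> bool" where
  "bounded_clinear A \<longleftrightarrow> bounded_linear A \<and> (\<forall>c x. A (c *\<^sub>C x) = c *\<^sub>C A x)"

definition compact_operator :: "'i op \<Rightarrow> bool" where
  "compact_operator A \<longleftrightarrow> bounded_clinear A \<and> compact (closure (A ` cball 0 1))"

definition antiunitary :: "'i op \<Rightarrow> bool" where
  "antiunitary J \<longleftrightarrow> (\<forall>x y. J (x + y) = J x + J y) \<and> (\<forall>c x. J (c *\<^sub>C x) = cnj c *\<^sub>C J x)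
     \<and> (\<forall>x y. cinner (J x) (J y) = cnj (cinner x y)) \<and> surj J"

definition cadjoint :: "'i op \<Rightarrow> 'i op" where
  "cadjoint A = (SOME B. \<forall>x y. cinner (B x) y = cinner x (A y))"

text \<open>
  The \<open>k\<close>-th singular value (counting from \<open>0\<close>) is the \<open>k\<close>-th entry in the decreasing list of the
  eigenvalues of \<open>(A\<^sup>*A)\<^sup>1\<^sup>/\<^sup>2\<close>, repeated according to multiplicity: the largest \<open>s\<^sub>k\<close> such that there
  are \<open>k + 1\<close> orthonormal eigenvectors of \<open>A\<^sup>*A\<close> with eigenvalues \<open>s\<^sub>0\<^sup>2 \<ge> \<dots> \<ge> s\<^sub>k\<^sup>2\<close>. Inserting \<open>0\<close> only
  matters on a finite-dimensional space or if eigenvectors run out. Meaningful for compact \<open>A\<close>.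
\<close>
definition singular_value :: "'i op \<Rightarrow> nat \<Rightarrow> real" where
  "singular_value A k = Sup (insert 0 {s k |s u.
     (\<forall>i\<le>k. \<forall>j\<le>k. cinner (u i) (u j) = (if i = j then 1 else 0)) \<and>
     (\<forall>i\<le>k. 0 \<le> s i \<and> cadjoint A (A (u i)) = complex_of_real ((s i)\<^sup>2) *\<^sub>C u i) \<and>
     (\<forall>i<k. s (Suc i) \<le> s i)})"

definition infinitesimal_of_arbitrary_order :: "'i op \<Rightarrow> bool" where
  "infinitesimal_of_arbitrary_order A \<longleftrightarrow> compact_operator A \<and>
     (\<forall>p>0. (\<lambda>k. real k powr p * singular_value A k) \<longlonglongrightarrow> 0)"

text \<open>Two-sided ideals of \<open>\<B>(\<H>)\<close>; closure under scalars follows from multiplication by scalar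
  operators. The ideal generated by \<open>L\<close> is \<open>operator_ideal hull {L}\<close>.\<close>
definition operator_ideal :: "'i op set \<Rightarrow> bool" where
  "operator_ideal I \<longleftrightarrow> I \<subseteq> Collect bounded_clinear \<and> (\<lambda>_. 0) \<in> I
     \<and> (\<forall>A\<in>I. \<forall>B\<in>I. (\<lambda>x. A x + B x) \<in> I)
     \<and> (\<forall>A\<in>I. \<forall>B. bounded_clinear B \<longrightarrow> A \<circ> B \<in> I \<and> B \<circ> A \<in> I)"

definition commutator :: "'i op \<Rightarrow> 'i op \<Rightarrow> 'i op" where
  "commutator A B = (\<lambda>x. A (B x) - B (A x))"

subsection \<open>Unbounded operators\<close>

text \<open>Unbounded operators are represented by their graphs. Composition is relational composition,
  so \<open>G O H\<close> is the graph of ``first \<open>G\<close>, then \<open>H\<close>'' on its natural domain.\<close>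

type_synonym 'i graph = "('i ell2 \<times> 'i ell2) set"

definition op_graph :: "'i op \<Rightarrow> 'i graph" where
  "op_graph A = {(x, A x) |x. True}"

definition adjoint_graph :: "'i graph \<Rightarrow> 'i graph" where
  "adjoint_graph G = {(y, z). \<forall>(x, w)\<in>G. cinner z x = cinner y w}"

definition selfadjoint :: "'i graph \<Rightarrow> bool" where
  "selfadjoint G \<longleftrightarrow> closure (Domain G) = UNIV \<and> adjoint_graph G = G"

definition positive_graph :: "'i graph \<Rightarrow> bool" where
  "positive_graph G \<longleftrightarrow> (\<forall>(x, y)\<in>G. cinner x y \<in> \<real> \<and> 0 \<le> Re (cinner x y))"

text \<open>\<open>(D + \<i>)\<^sup>-\<^sup>1\<close> is everywhere defined and compact.\<close>
definition compact_resolvent :: "'i graph \<Rightarrow> bool" where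
  "compact_resolvent D \<longleftrightarrow> (\<exists>K. compact_operator K \<and> {(y + \<i> *\<^sub>C x, x) |x y. (x, y) \<in> D} = op_graph K)"

text \<open>\<open>A\<close> maps the domain of \<open>D\<close> into itself and \<open>B\<close> is the bounded extension of \<open>[D, A]\<close>
  (unique if \<open>D\<close> is densely defined).\<close>
definition is_bounded_commutator :: "'i graph \<Rightarrow> 'i op \<Rightarrow> 'i op \<Rightarrow> bool" where
  "is_bounded_commutator D A B \<longleftrightarrow> bounded_clinear B \<and> (\<forall>(x, y)\<in>D. (A x, A y + B x) \<in> D)"

definition closed_antilinear :: "'i graph \<Rightarrow> bool" where
  "closed_antilinear T \<longleftrightarrow> closed T \<and> single_valued T \<and> closure (Domain T) = UNIV
     \<and> (\<forall>(x, y)\<in>T. \<forall>(x', y')\<in>T. (x + x', y + y') \<in> T)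
     \<and> (\<forall>c. \<forall>(x, y)\<in>T. (c *\<^sub>C x, cnj c *\<^sub>C y) \<in> T)"

definition antilinear_adjoint_graph :: "'i graph \<Rightarrow> 'i graph" where
  "antilinear_adjoint_graph T = {(y, z). \<forall>(x, w)\<in>T. cinner z x = cinner w y}"

text \<open>\<open>T = J |T|\<close> with \<open>|T| = (T\<^sup>*T)\<^sup>1\<^sup>/\<^sup>2\<close>; the two factors of a polar decomposition have the same
  kernel, which is zero here because \<open>J\<close> is antiunitary.\<close>
definition antiunitary_part :: "'i graph \<Rightarrow> 'i op \<Rightarrow> bool" where
  "antiunitary_part T J \<longleftrightarrow> antiunitary J \<and> (\<exists>P. selfadjoint P \<and> positive_graph P
     \<and> P O P = T O antilinear_adjoint_graph T
     \<and> T = P O op_graph J \<and> {x. (x, 0) \<in> P} = {0})"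


section \<open>Spectral triples\<close>

record 'a star_algebra = "'a ring" +
  cscale :: "complex \<Rightarrow> 'a \<Rightarrow> 'a"
  cstar :: "'a \<Rightarrow> 'a"

definition complex_star_algebra :: "('a, 'b) star_algebra_scheme \<Rightarrow> bool" where
  "complex_star_algebra A \<longleftrightarrow> ring A
     \<and> (\<forall>c. \<forall>x\<in>carrier A. cscale A c x \<in> carrier A)
     \<and> (\<forall>x\<in>carrier A. cscale A 1 x = x)
     \<and> (\<forall>c d. \<forall>x\<in>carrier A. cscale A (c * d) x = cscale A c (cscale A d x))
     \<and> (\<forall>c d. \<forall>x\<in>carrier A. cscale A (c + d) x = cscale A c x \<oplus>\<^bsub>A\<^esub> cscale A d x)
     \<and> (\<forall>c. \<forall>x\<in>carrier A. \<forall>y\<in>carrier A. cscale A c (x \<oplus>\<^bsub>A\<^esub> y) = cscale A c x \<oplus>\<^bsub>A\<^esub> cscale A c y)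
     \<and> (\<forall>c. \<forall>x\<in>carrier A. \<forall>y\<in>carrier A. cscale A c (x \<otimes>\<^bsub>A\<^esub> y) = cscale A c x \<otimes>\<^bsub>A\<^esub> y
            \<and> cscale A c (x \<otimes>\<^bsub>A\<^esub> y) = x \<otimes>\<^bsub>A\<^esub> cscale A c y)
     \<and> (\<forall>x\<in>carrier A. cstar A x \<in> carrier A \<and> cstar A (cstar A x) = x)
     \<and> (\<forall>x\<in>carrier A. \<forall>y\<in>carrier A. cstar A (x \<oplus>\<^bsub>A\<^esub> y) = cstar A x \<oplus>\<^bsub>A\<^esub> cstar A y)
     \<and> (\<forall>x\<in>carrier A. \<forall>y\<in>carrier A. cstar A (x \<otimes>\<^bsub>A\<^esub> y) = cstar A y \<otimes>\<^bsub>A\<^esub> cstar A x)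
     \<and> (\<forall>c. \<forall>x\<in>carrier A. cstar A (cscale A c x) = cscale A (cnj c) (cstar A x))"

definition star_representation :: "('a, 'b) star_algebra_scheme \<Rightarrow> ('a \<Rightarrow> 'i op) \<Rightarrow> bool" where
  "star_representation A \<pi> \<longleftrightarrow>
     (\<forall>a\<in>carrier A. bounded_clinear (\<pi> a))
     \<and> \<pi> \<one>\<^bsub>A\<^esub> = id
     \<and> (\<forall>a\<in>carrier A. \<forall>b\<in>carrier A. \<pi> (a \<oplus>\<^bsub>A\<^esub> b) = (\<lambda>x. \<pi> a x + \<pi> b x))
     \<and> (\<forall>a\<in>carrier A. \<forall>b\<in>carrier A. \<pi> (a \<otimes>\<^bsub>A\<^esub> b) = \<pi> a \<circ> \<pi> b)
     \<and> (\<forall>c. \<forall>a\<in>carrier A. \<pi> (cscale A c a) = (\<lambda>x. c *\<^sub>C \<pi> a x))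
     \<and> (\<forall>a\<in>carrier A. \<forall>x y. cinner (\<pi> (cstar A a) x) y = cinner x (\<pi> a y))"

definition spectral_triple :: "('a, 'b) star_algebra_scheme \<Rightarrow> ('a \<Rightarrow> 'i op) \<Rightarrow> 'i graph \<Rightarrow> bool" where
  "spectral_triple A \<pi> D \<longleftrightarrow> complex_star_algebra A
     \<and> star_representation A \<pi> \<and> inj_on \<pi> (carrier A)
     \<and> selfadjoint D \<and> compact_resolvent D
     \<and> (\<forall>a\<in>carrier A. \<exists>B. is_bounded_commutator D (\<pi> a) B)"

definition even_structure ::
  "('a, 'b) star_algebra_scheme \<Rightarrow> ('a \<Rightarrow> 'i op) \<Rightarrow> 'i graph \<Rightarrow> 'i op \<Rightarrow> bool" where
  "even_structure A \<pi> D \<gamma> \<longleftrightarrow> bounded_clinear \<gamma>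
     \<and> (\<forall>x y. cinner (\<gamma> x) y = cinner x (\<gamma> y)) \<and> \<gamma> \<circ> \<gamma> = id
     \<and> D O op_graph \<gamma> = op_graph \<gamma> O D O op_graph uminus
     \<and> (\<forall>a\<in>carrier A. \<gamma> \<circ> \<pi> a = \<pi> a \<circ> \<gamma>)"

text \<open>Reality up to infinitesimals in the ideal \<open>I\<close>, with the signs of dimension \<open>2\<close>.\<close>
definition real_structure ::
  "'i op set \<Rightarrow> ('a, 'b) star_algebra_scheme \<Rightarrow> ('a \<Rightarrow> 'i op) \<Rightarrow> 'i graph \<Rightarrow> 'i op \<Rightarrow> bool" where
  "real_structure I A \<pi> D J \<longleftrightarrow>
     operator_ideal I \<and> (\<forall>T\<in>I. infinitesimal_of_arbitrary_order T)
     \<and> antiunitary J \<and> (\<forall>x. J (J x) = - x) \<and> D O op_graph J = op_graph J O D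
     \<and> (\<forall>a\<in>carrier A. \<forall>b\<in>carrier A. commutator (\<pi> a) (J \<circ> \<pi> b \<circ> inv_into UNIV J) \<in> I)
     \<and> (\<forall>a\<in>carrier A. \<exists>B. is_bounded_commutator D (\<pi> a) B
            \<and> (\<forall>b\<in>carrier A. commutator B (J \<circ> \<pi> b \<circ> inv_into UNIV J) \<in> I))"

definition real_even_spectral_triple ::
  "'i op set \<Rightarrow> ('a, 'b) star_algebra_scheme \<Rightarrow> ('a \<Rightarrow> 'i op) \<Rightarrow> 'i graph \<Rightarrow> 'i op \<Rightarrow> 'i op \<Rightarrow> bool" where
  "real_even_spectral_triple I A \<pi> D J \<gamma> \<longleftrightarrow> spectral_triple A \<pi> D
     \<and> even_structure A \<pi> D \<gamma> \<and> real_structure I A \<pi> D J \<and> (\<forall>x. J (\<gamma> x) = - \<gamma> (J x))"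


section \<open>Algebras given by generators and relations\<close>

datatype 'g word = Word (letters: "'g list")

instantiation word :: (type) monoid_add
begin
definition zero_word :: "'a word" where "zero_word = Word []"
definition plus_word :: "'a word \<Rightarrow> 'a word \<Rightarrow> 'a word"
  where "plus_word v w = Word (letters v @ letters w)"
instance by standard (simp_all add: zero_word_def plus_word_def)
end

text \<open>The free algebra is the monoid algebra of the monoid of words: multiplication in
  \<^typ>\<open>'g word \<Rightarrow>\<^sub>0 complex\<close> is convolution.\<close>
type_synonym 'g free_algebra = "'g word \<Rightarrow>\<^sub>0 complex"

definition free_gen :: "'g \<Rightarrow> 'g free_algebra" where
  "free_gen g = Poly_Mapping.single (Word [g]) 1"

text \<open>Scalars are embedded as multiples of the empty word, also in tensor products.\<close>
definition scalar :: "complex \<Rightarrow> 'w::monoid_add \<Rightarrow>\<^sub>0 complex" where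
  "scalar c = Poly_Mapping.single 0 c"

abbreviation real_scalar :: "real \<Rightarrow> 'w::monoid_add \<Rightarrow>\<^sub>0 complex" where
  "real_scalar r \<equiv> scalar (complex_of_real r)"

definition free_ring :: "'g free_algebra ring" where
  "free_ring = \<lparr>carrier = UNIV, mult = (*), one = 1, zero = 0, add = (+)\<rparr>"

text \<open>The action of the free algebra on a complex vector space with scalar multiplication \<open>sc\<close>
  for which each generator \<open>g\<close> acts by \<open>\<rho> g\<close>.\<close>
definition free_action ::
  "(complex \<Rightarrow> 'v \<Rightarrow> 'v::comm_monoid_add) \<Rightarrow> ('g \<Rightarrow> 'v \<Rightarrow> 'v) \<Rightarrow> 'g free_algebra \<Rightarrow> 'v \<Rightarrow> 'v" where
  "free_action sc \<rho> p x = (\<Sum>w\<in>Poly_Mapping.keys p. sc (Poly_Mapping.lookup p w) (foldr \<rho> (letters w) x))"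

text \<open>The antimultiplicative extension of \<open>s\<close>; it is linear for \<open>\<kappa> = id\<close> and antilinear for
  \<open>\<kappa> = cnj\<close>.\<close>
definition anti_extension ::
  "(complex \<Rightarrow> complex) \<Rightarrow> ('g \<Rightarrow> 'g free_algebra) \<Rightarrow> 'g free_algebra \<Rightarrow> 'g free_algebra" where
  "anti_extension \<kappa> s p =
     (\<Sum>w\<in>Poly_Mapping.keys p. scalar (\<kappa> (Poly_Mapping.lookup p w)) * prod_list (map s (rev (letters w))))"

text \<open>The map of cosets of \<open>I\<close> induced by \<open>f\<close>.\<close>
definition coset_map ::
  "'g free_algebra set \<Rightarrow> ('g free_algebra \<Rightarrow> 'g free_algebra) \<Rightarrow> 'g free_algebra set \<Rightarrow> 'g free_algebra set"
  where "coset_map I f X = the_elem ((\<lambda>p. I +>\<^bsub>free_ring\<^esub> f p) ` X)"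

text \<open>\<^const>\<open>genideal\<close> is the two-sided ideal; \<open>s\<close> gives the involution on generators.\<close>
definition presented_star_algebra ::
  "('g \<Rightarrow> 'g free_algebra) \<Rightarrow> 'g free_algebra set \<Rightarrow> 'g free_algebra set star_algebra" where
  "presented_star_algebra s rels = (let I = genideal free_ring rels; Q = free_ring Quot I in
     \<lparr>carrier = carrier Q, mult = mult Q, one = one Q, zero = zero Q, add = add Q,
      cscale = (\<lambda>c. coset_map I (\<lambda>p. scalar c * p)),
      cstar = coset_map I (anti_extension cnj s)\<rparr>)"


section \<open>The quantum sphere and its symmetry\<close>

definition qnum :: "real \<Rightarrow> real \<Rightarrow> real" where
  "qnum q x = (q powr x - q powr (- x)) / (q - inverse q)"

datatype sphere_gen = X_minus | X_zero | X_plus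

fun sphere_index :: "sphere_gen \<Rightarrow> real" where
  "sphere_index X_minus = -1" | "sphere_index X_zero = 0" | "sphere_index X_plus = 1"

datatype u_gen = U_e | U_f | U_k | U_kinv

context
  fixes q t :: real
begin

subsection \<open>The algebra of the sphere\<close>

fun sphere_star_gen :: "sphere_gen \<Rightarrow> sphere_gen free_algebra" where
  "sphere_star_gen X_minus = real_scalar (- inverse q) * free_gen X_plus"
| "sphere_star_gen X_zero = free_gen X_zero"
| "sphere_star_gen X_plus = real_scalar (- q) * free_gen X_minus"

definition sphere_rels :: "sphere_gen free_algebra set" where
  "sphere_rels = (let xm = free_gen X_minus; x0 = free_gen X_zero; xp = free_gen X_plus; r = real_scalar in
    {xm * (x0 - r t) - r (q^2) * (x0 - r t) * xm,
     xp * (x0 - r t) - r (inverse (q^2)) * (x0 - r t) * xp,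
     - r (qnum q 2) * xm * xp + (r (q^2) * x0 + r t) * (x0 - r t) - r ((qnum q 2)^2 * (1 - t)),
     - r (qnum q 2) * xp * xm + (r (inverse (q^2)) * x0 + r t) * (x0 - r t)
       - r ((qnum q 2)^2 * (1 - t))})"

definition sphere_ideal :: "sphere_gen free_algebra set" where
  "sphere_ideal = genideal free_ring sphere_rels"

definition quantum_sphere :: "sphere_gen free_algebra set star_algebra" where
  "quantum_sphere = presented_star_algebra sphere_star_gen sphere_rels"

subsection \<open>The Hopf algebra\<close>

fun U_star_gen :: "u_gen \<Rightarrow> u_gen free_algebra" where
  "U_star_gen U_e = free_gen U_f" | "U_star_gen U_f = free_gen U_e"
| "U_star_gen U_k = free_gen U_k" | "U_star_gen U_kinv = free_gen U_kinv"

definition U_rels :: "u_gen free_algebra set" where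
  "U_rels = (let e = free_gen U_e; f = free_gen U_f; k = free_gen U_k; k' = free_gen U_kinv; r = real_scalar in
    {k * k' - 1, k' * k - 1,
     k * k - k' * k' - r (q - inverse q) * (f * e - e * f),
     k * f - r q * f * k,
     k * e - r (inverse q) * e * k})"

definition U_ideal :: "u_gen free_algebra set" where
  "U_ideal = genideal free_ring U_rels"

definition Uq_su2 :: "u_gen free_algebra set star_algebra" where
  "Uq_su2 = presented_star_algebra U_star_gen U_rels"

fun antipode_gen :: "u_gen \<Rightarrow> u_gen free_algebra" where
  "antipode_gen U_e = real_scalar (- inverse q) * free_gen U_e"
| "antipode_gen U_f = real_scalar (- q) * free_gen U_f"
| "antipode_gen U_k = free_gen U_kinv"
| "antipode_gen U_kinv = free_gen U_k"

definition antipode :: "u_gen free_algebra set \<Rightarrow> u_gen free_algebra set" where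
  "antipode = coset_map U_ideal (anti_extension id antipode_gen)"

text \<open>The tensor square of the free algebra is the monoid algebra of pairs of words.\<close>

definition tensor :: "u_gen \<Rightarrow> u_gen \<Rightarrow> (u_gen word \<times> u_gen word) \<Rightarrow>\<^sub>0 complex" where
  "tensor g h = Poly_Mapping.single (Word [g], Word [h]) 1"

fun coproduct_gen :: "u_gen \<Rightarrow> (u_gen word \<times> u_gen word) \<Rightarrow>\<^sub>0 complex" where
  "coproduct_gen U_e = tensor U_e U_k + tensor U_kinv U_e"
| "coproduct_gen U_f = tensor U_f U_k + tensor U_kinv U_f"
| "coproduct_gen U_k = tensor U_k U_k"
| "coproduct_gen U_kinv = tensor U_kinv U_kinv"

definition free_coproduct :: "u_gen free_algebra \<Rightarrow> (u_gen word \<times> u_gen word) \<Rightarrow>\<^sub>0 complex" where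
  "free_coproduct p =
     (\<Sum>w\<in>Poly_Mapping.keys p. scalar (Poly_Mapping.lookup p w) * prod_list (map coproduct_gen (letters w)))"

text \<open>\<open>sweedler h \<Phi>\<close> is the sum \<open>\<Phi> h\<^sub>(\<^sub>1\<^sub>) h\<^sub>(\<^sub>2\<^sub>)\<close> in Sweedler notation, for a bilinear map \<open>\<Phi>\<close> on
  \<open>\<U> \<times> \<U>\<close>.\<close>
definition sweedler :: "u_gen free_algebra set
    \<Rightarrow> (u_gen free_algebra set \<Rightarrow> u_gen free_algebra set \<Rightarrow> 'i ell2) \<Rightarrow> 'i ell2" where
  "sweedler h \<Phi> = the_elem ((\<lambda>p. \<Sum>(u, w)\<in>Poly_Mapping.keys (free_coproduct p).
     Poly_Mapping.lookup (free_coproduct p) (u, w) *\<^sub>C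
       \<Phi> (U_ideal +>\<^bsub>free_ring\<^esub> Poly_Mapping.single u 1)
         (U_ideal +>\<^bsub>free_ring\<^esub> Poly_Mapping.single w 1)) ` h)"

subsection \<open>The action on the sphere\<close>

fun act_gen :: "u_gen \<Rightarrow> sphere_gen \<Rightarrow> sphere_gen free_algebra" where
  "act_gen U_k x = real_scalar (q powr sphere_index x) * free_gen x"
| "act_gen U_kinv x = real_scalar (q powr (- sphere_index x)) * free_gen x"
| "act_gen U_f X_minus = real_scalar (sqrt (qnum q 2)) * free_gen X_zero"
| "act_gen U_f X_zero = real_scalar (sqrt (qnum q 2)) * free_gen X_plus"
| "act_gen U_f X_plus = 0"
| "act_gen U_e X_minus = 0"
| "act_gen U_e X_zero = real_scalar (sqrt (qnum q 2)) * free_gen X_minus"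
| "act_gen U_e X_plus = real_scalar (sqrt (qnum q 2)) * free_gen X_zero"

text \<open>Extension to products by \<open>h \<triangleright> 1 = \<epsilon>(h) 1\<close> and
  \<open>h \<triangleright> (x y) = (h\<^sub>(\<^sub>1\<^sub>) \<triangleright> x) (h\<^sub>(\<^sub>2\<^sub>) \<triangleright> y)\<close>.\<close>
fun act_letters :: "u_gen \<Rightarrow> sphere_gen list \<Rightarrow> sphere_gen free_algebra" where
  "act_letters U_k [] = 1"
| "act_letters U_k (x # w) = act_gen U_k x * act_letters U_k w"
| "act_letters U_kinv [] = 1"
| "act_letters U_kinv (x # w) = act_gen U_kinv x * act_letters U_kinv w"
| "act_letters U_f [] = 0"
| "act_letters U_f (x # w) = act_gen U_f x * act_letters U_k w + act_gen U_kinv x * act_letters U_f w"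
| "act_letters U_e [] = 0"
| "act_letters U_e (x # w) = act_gen U_e x * act_letters U_k w + act_gen U_kinv x * act_letters U_e w"

definition act_free :: "u_gen \<Rightarrow> sphere_gen free_algebra \<Rightarrow> sphere_gen free_algebra" where
  "act_free g p = (\<Sum>w\<in>Poly_Mapping.keys p. scalar (Poly_Mapping.lookup p w) * act_letters g (letters w))"

definition sphere_act ::
  "u_gen free_algebra set \<Rightarrow> sphere_gen free_algebra set \<Rightarrow> sphere_gen free_algebra set" where
  "sphere_act h a = the_elem ((\<lambda>(p, x). sphere_ideal
      +>\<^bsub>free_ring\<^esub> free_action (\<lambda>c y. scalar c * y) act_free p x) ` (h \<times> a))"

end


section \<open>Spinors\<close>

text \<open>Labels \<open>(l, m, N)\<close>; the index \<open>\<plusminus>\<close> of \<open>v\<^sup>l\<^sub>m\<^sub>,\<^sub>\<plusminus>\<close> is encoded as \<open>N = \<plusminus>1/2\<close>.\<close>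
definition spin_labels :: "(real \<times> real \<times> real) set" where
  "spin_labels = {(l, m, N). (\<exists>n::nat. l = real n + 1/2) \<and> (\<exists>j::nat. m = - l + real j) \<and> m \<le> l
     \<and> N \<in> {1/2, - 1/2}}"

typedef spin_index = spin_labels
  by (rule exI[of _ "(1/2, - 1/2, 1/2)"]) (auto simp: spin_labels_def intro: exI[of _ 0])

type_synonym spinor = "spin_index ell2"

text \<open>Vectors which do not exist are \<open>0\<close>, as in the convention for \<open>\<pi>\<close>.\<close>
definition basis_vec :: "real \<Rightarrow> real \<Rightarrow> real \<Rightarrow> spinor" where
  "basis_vec l m N = (if (l, m, N) \<in> spin_labels then ket (Abs_spin_index (l, m, N)) else 0)"

definition algebraic_spinors :: "spinor set" where
  "algebraic_spinors = ell2.span {basis_vec l m N |l m N. (l, m, N) \<in> spin_labels}"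

text \<open>The linear map sending \<open>v\<^sup>l\<^sub>m\<^sub>,\<^sub>N\<close> to \<open>g l m N\<close>: on
  \<^const>\<open>algebraic_spinors\<close> the sum is finite, and if the map is bounded there, the infinite sum is
  its continuous extension.\<close>
definition on_basis :: "(real \<Rightarrow> real \<Rightarrow> real \<Rightarrow> spinor) \<Rightarrow> spinor \<Rightarrow> spinor" where
  "on_basis g x = (\<Sum>\<^sub>\<infinity>i. coeff x i *\<^sub>C (case Rep_spin_index i of (l, m, N) \<Rightarrow> g l m N))"

definition antilinear_on_basis :: "(real \<Rightarrow> real \<Rightarrow> real \<Rightarrow> spinor) \<Rightarrow> spinor \<Rightarrow> spinor" where
  "antilinear_on_basis g x =
     (\<Sum>\<^sub>\<infinity>i. cnj (coeff x i) *\<^sub>C (case Rep_spin_index i of (l, m, N) \<Rightarrow> g l m N))"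

context
  fixes q t :: real
begin

abbreviation qn :: "real \<Rightarrow> real" where "qn x \<equiv> qnum q x"
abbreviation sq :: "real \<Rightarrow> real" where "sq x \<equiv> sqrt (qnum q x)"

definition alpha_N :: "real \<Rightarrow> real \<Rightarrow> real" where
  "alpha_N N l = (sq 2 * sq (l + N) * sq (l - N) * sq (2*l)) / (sq (2*l + 1) * qn l)
     * sqrt (1 - t + q powr (- 2*N) * inverse ((qn (2*l))^2) * (qn l)^2 * (t - 1 + q powr (2*N))^2)"

definition beta_N :: "real \<Rightarrow> real \<Rightarrow> real" where
  "beta_N N l = (sgn N * qn (2 * \<bar>N\<bar>) * (inverse q + q - q powr (sgn N) * t)
      + t * (q - inverse q) * (qn \<bar>N\<bar> * qn (\<bar>N\<bar> + 1) - qn l * qn (l + 1))) / (q * qn (2*l + 2))"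

fun alpha_up :: "sphere_gen \<Rightarrow> real \<Rightarrow> real \<Rightarrow> real \<Rightarrow> real" where
  "alpha_up X_plus l m N = q powr (- l + m) * sq (l + m + 1) * sq (l + m + 2)
      / (sq (2*l + 1) * sq (2*l + 2)) * alpha_N N (l + 1)"
| "alpha_up X_zero l m N = q powr m * sq (l - m + 1) * sq (l + m + 1) * sq 2
      / (sq (2*l + 1) * sq (2*l + 2)) * alpha_N N (l + 1)"
| "alpha_up X_minus l m N = q powr (l + m) * sq (l - m + 1) * sq (l - m + 2)
      / (sq (2*l + 1) * sq (2*l + 2)) * alpha_N N (l + 1)"

fun alpha_mid :: "sphere_gen \<Rightarrow> real \<Rightarrow> real \<Rightarrow> real \<Rightarrow> real" where
  "alpha_mid X_plus l m N = - (q powr (m + 2) * sq (l - m) * sq (l + m + 1) * sq 2 / qn (2*l) * beta_N N l)"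
| "alpha_mid X_zero l m N =
     1 / qn (2*l) * (qn (l - m + 1) * qn (l + m) - q^2 * qn (l - m) * qn (l + m + 1)) * beta_N N l"
| "alpha_mid X_minus l m N = q powr m * sq (l - m + 1) * sq (l + m) * sq 2 / qn (2*l) * beta_N N l"

fun alpha_down :: "sphere_gen \<Rightarrow> real \<Rightarrow> real \<Rightarrow> real \<Rightarrow> real" where
  "alpha_down X_plus l m N = - (q powr (l + m + 1) * sq (l - m - 1) * sq (l - m)
      / (sq (2*l - 1) * sq (2*l)) * alpha_N N l)"
| "alpha_down X_zero l m N = q powr m * sq (l - m) * sq (l + m) * sq 2
      / (sq (2*l - 1) * sq (2*l)) * alpha_N N l"
| "alpha_down X_minus l m N = - (q powr (- l + m - 1) * sq (l + m - 1) * sq (l + m)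
      / (sq (2*l - 1) * sq (2*l)) * alpha_N N l)"

definition pi_gen :: "sphere_gen \<Rightarrow> spinor \<Rightarrow> spinor" where
  "pi_gen x = on_basis (\<lambda>l m N.
      alpha_down x l m N *\<^sub>R basis_vec (l - 1) (m + sphere_index x) N
    + alpha_mid x l m N *\<^sub>R basis_vec l (m + sphere_index x) N
    + alpha_up x l m N *\<^sub>R basis_vec (l + 1) (m + sphere_index x) N)"

definition spinor_rep :: "sphere_gen free_algebra set \<Rightarrow> spinor \<Rightarrow> spinor" where
  "spinor_rep a = the_elem (free_action scaleC_ell2 pi_gen ` a)"

fun spinor_act_gen :: "u_gen \<Rightarrow> spinor \<Rightarrow> spinor" where
  "spinor_act_gen U_k = on_basis (\<lambda>l m N. q powr m *\<^sub>R basis_vec l m N)"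
| "spinor_act_gen U_kinv = on_basis (\<lambda>l m N. q powr (- m) *\<^sub>R basis_vec l m N)"
| "spinor_act_gen U_f = on_basis (\<lambda>l m N. (sq (l - m) * sq (l + m + 1)) *\<^sub>R basis_vec l (m + 1) N)"
| "spinor_act_gen U_e = on_basis (\<lambda>l m N. (sq (l - m + 1) * sq (l + m)) *\<^sub>R basis_vec l (m - 1) N)"

text \<open>Only meaningful for \<open>\<xi> \<in> algebraic_spinors\<close>.\<close>
definition spinor_act :: "u_gen free_algebra set \<Rightarrow> spinor \<Rightarrow> spinor" where
  "spinor_act h \<xi> = the_elem ((\<lambda>p. free_action scaleC_ell2 spinor_act_gen p \<xi>) ` h)"

definition equivariant :: "(sphere_gen free_algebra set \<Rightarrow> spinor \<Rightarrow> spinor)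
    \<Rightarrow> spin_index graph \<Rightarrow> (spinor \<Rightarrow> spinor) \<Rightarrow> (spinor \<Rightarrow> spinor) \<Rightarrow> bool" where
  "equivariant \<pi> D J \<gamma> \<longleftrightarrow>
     (\<forall>a\<in>carrier (quantum_sphere q t). \<forall>\<xi>\<in>algebraic_spinors. \<pi> a \<xi> \<in> algebraic_spinors)
     \<and> (\<forall>h\<in>carrier (Uq_su2 q). \<forall>a\<in>carrier (quantum_sphere q t). \<forall>\<xi>\<in>algebraic_spinors.
          spinor_act h (\<pi> a \<xi>) = sweedler q h (\<lambda>h1 h2. \<pi> (sphere_act q t h1 a) (spinor_act h2 \<xi>)))
     \<and> (\<forall>\<xi>\<in>algebraic_spinors. \<exists>\<eta>\<in>algebraic_spinors. (\<xi>, \<eta>) \<in> D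
          \<and> (\<forall>h\<in>carrier (Uq_su2 q). (spinor_act h \<xi>, spinor_act h \<eta>) \<in> D))
     \<and> (\<forall>\<xi>\<in>algebraic_spinors. \<gamma> \<xi> \<in> algebraic_spinors
          \<and> (\<forall>h\<in>carrier (Uq_su2 q). \<gamma> (spinor_act h \<xi>) = spinor_act h (\<gamma> \<xi>)))
     \<and> (\<forall>\<xi>\<in>algebraic_spinors. J \<xi> \<in> algebraic_spinors)
     \<and> (\<exists>T. closed_antilinear T \<and> antiunitary_part T J
          \<and> (\<forall>\<xi>\<in>algebraic_spinors. \<exists>\<eta>\<in>algebraic_spinors. (\<xi>, \<eta>) \<in> T
               \<and> (\<forall>h\<in>carrier (Uq_su2 q).
                    (spinor_act h \<xi>, spinor_act (cstar (Uq_su2 q) (antipode q h)) \<eta>) \<in> T)))"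

text \<open>\<open>L\<^sub>q\<^sup>\<alpha>\<close>, the power of the positive diagonal operator \<open>L\<^sub>q\<close>.\<close>
definition L_pow :: "real \<Rightarrow> spinor \<Rightarrow> spinor" where
  "L_pow \<alpha> = on_basis (\<lambda>l m N. ((q powr l) powr \<alpha>) *\<^sub>R basis_vec l m N)"

end

definition grading :: "spinor \<Rightarrow> spinor" where
  "grading = on_basis (\<lambda>l m N. sgn N *\<^sub>R basis_vec l m N)"

text \<open>The self-adjoint operator is the closure of its restriction to \<^const>\<open>algebraic_spinors\<close>.\<close>
definition dirac :: "real \<Rightarrow> real \<Rightarrow> spin_index graph" where
  "dirac c1 c2 = closure ((\<lambda>x. (x,
     on_basis (\<lambda>l m N. (c1 * l + c2) *\<^sub>R basis_vec l m (- N)) x)) ` algebraic_spinors)"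

definition conjugation :: "spinor \<Rightarrow> spinor" where
  "conjugation = antilinear_on_basis (\<lambda>l m N. ((-1) powi \<lfloor>m + 1/2\<rfloor>) *\<^sub>R basis_vec l (- m) (- N))"

lemma coeff_basis_vec:
  "(l, m, N) \<in> spin_labels \<Longrightarrow>
    coeff (basis_vec l m N) i = (if i = Abs_spin_index (l, m, N) then 1 else 0)"
  by (simp add: basis_vec_def ket.rep_eq)

lemma on_basis_basis_vec:
  assumes "(l, m, N) \<in> spin_labels"
  shows "on_basis g (basis_vec l m N) = g l m N"
    and "antilinear_on_basis g (basis_vec l m N) = g l m N"
proof -
  define f where "f i = (case Rep_spin_index i of (l, m, N) \<Rightarrow> g l m N)" for i
  let ?i = "Abs_spin_index (l, m, N)"
  have f: "f ?i = g l m N" by (simp add: f_def Abs_spin_index_inverse assms)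
  have "(\<Sum>\<^sub>\<infinity>i. (if i = ?i then 1 else 0) *\<^sub>C f i) = (\<Sum>\<^sub>\<infinity>i\<in>{?i}. f i)"
    by (rule infsum_cong_neutral) auto
  then have 1: "(\<Sum>\<^sub>\<infinity>i. (if i = ?i then 1 else 0) *\<^sub>C f i) = g l m N" by (simp add: f)
  have 2: "cnj (if i = ?i then 1 else 0) = (if i = ?i then 1 else 0)" for i by simp
  show "on_basis g (basis_vec l m N) = g l m N"
    unfolding on_basis_def coeff_basis_vec[OF assms] f_def[symmetric] by (rule 1)
  show "antilinear_on_basis g (basis_vec l m N) = g l m N"
    unfolding antilinear_on_basis_def coeff_basis_vec[OF assms] f_def[symmetric] 2 by (rule 1)
qed

lemma grading_basis_vec:
  "(l, m, N) \<in> spin_labels \<Longrightarrow> grading (basis_vec l m N) = sgn N *\<^sub>R basis_vec l m N"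
  by (simp add: grading_def on_basis_basis_vec)

lemma conjugation_basis_vec:
  "(l, m, N) \<in> spin_labels \<Longrightarrow>
    conjugation (basis_vec l m N) = ((-1) powi \<lfloor>m + 1/2\<rfloor>) *\<^sub>R basis_vec l (- m) (- N)"
  by (simp add: conjugation_def on_basis_basis_vec)

lemma dirac_basis_vec:
  assumes "(l, m, N) \<in> spin_labels"
  shows "(basis_vec l m N, (c1 * l + c2) *\<^sub>R basis_vec l m (- N)) \<in> dirac c1 c2"
proof -
  have "basis_vec l m N \<in> algebraic_spinors"
    unfolding algebraic_spinors_def by (rule ell2.span_base) (use assms in blast)
  then show ?thesis
    unfolding dirac_def
    by (intro closure_subset[THEN subsetD] image_eqI[of _ _ "basis_vec l m N"])
      (simp_all add: on_basis_basis_vec assms)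
qed

end

theory Submission
  imports Defs "HOL-Real_Asymp.Real_Asymp"
begin

text \<open>
  In the coordinates \<open>a = l + m\<close>, \<open>b = l - m\<close> every \<open>\<pi>(x\<^sub>i)\<close> is a sum of three weighted shifts of the
  basis, whose coefficients are polynomial in \<open>q\<^sup>a\<close>, \<open>q\<^sup>b\<close>, \<open>(1 - q\<^sup>2\<^sup>k)\<^sup>1\<^sup>/\<^sup>2\<close> times a reduced matrix element
  \<open>E\<close> or \<open>B\<close> depending only on \<open>2l = a + b\<close> and the sign. The algebra relations amount to two
  recurrences and one constant of motion for \<open>E\<close> and \<open>B\<close>; equivariance is an identity between the
  coefficients. The representation is faithful because the leading terms of the monomials
  \<open>x\<^sub>\<plusminus>\<^sub>1\<^sup>n x\<^sub>0\<^sup>k\<close>, which span the algebra, raise \<open>l\<close> and \<open>m\<close> by different amounts; hence the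
  \<open>\<U>\<close>-action, defined on the free algebra, descends to the sphere.

  For reality, the weights of \<open>\<pi>(x)\<close> and of \<open>[D, \<pi>(x)]\<close> approach functions of \<open>a\<close> alone with error
  \<open>O(q\<^sup>\<alpha>\<^sup>l)\<close>, those of \<open>J \<pi>(y) J\<^sup>-\<^sup>1\<close> approach functions of \<open>b\<close> alone, and unless the shift fixes the
  variable in question the limit decays like \<open>q\<^sup>a\<close>, respectively \<open>q\<^sup>b\<close>. Since \<open>q\<^sup>a q\<^sup>b = q\<^sup>2\<^sup>l\<close>, the commutators
  are weighted shifts with weights \<open>O(q\<^sup>\<alpha>\<^sup>l)\<close>, that is, bounded multiples of \<open>L\<^sub>q\<^sup>\<alpha>\<close>. For \<open>t = 1\<close> the
  element \<open>E\<close> is only \<open>O(q\<^sup>l)\<close>, which halves the range of \<open>\<alpha>\<close>.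
\<close>

text \<open>After rescaling, square roots enter only through \<open>u n\<close> and
  \<open>E N n\<close>, whose squares are rational in q^n; so the algebra relations and the
  covariance laws become polynomial identities modulo a few squares and recurrences. As
  \<open>u 0 = 0\<close>, coefficients vanish by themselves at the boundary of the label range. The
  second relation follows from the first by taking adjoints. Faithfulness identifies the defining
  ideal with the kernel of the representation. On \<open>algebraic_spinors\<close> the action is h.x
  = h_(1) x S(h_(2)), so that its compatibility with both ideals is read off from operator
  identities. The operator required for equivariance of J is T = J k, whose absolute value is the
  closure of k. The ideal of L_q^\<alpha> is never described elementwise: it lies in every ideal
  containing its generator, in particular in the compact operators and in those that are O(\<rho>^n)
  off O(n^2) dimensions. The quadratic count is that of the labels with l at most n, and it yields
  singular values decaying like \<rho> to a multiple of sqrt k. A commutator with D costs a factor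
  l, harmless because the limits of the weights do not depend on the sign N and \<alpha> stays
  strictly below the critical exponent.\<close>

declare split_paired_All [simp del] split_paired_Ex [simp del]

section \<open>Square-summable families\<close>

lemma ell2_eqI: "(\<And>i. coeff x i = coeff y i) \<Longrightarrow> x = y"
  by (meson coeff_inject ext)

lemmas coeff_simps [simp] = zero_ell2.rep_eq plus_ell2.rep_eq minus_ell2.rep_eq uminus_ell2.rep_eq
  scaleC_ell2.rep_eq scaleR_ell2.rep_eq ket.rep_eq

lemma coeff_sum [simp]: "coeff (sum f A) i = (\<Sum>a\<in>A. coeff (f a) i)"
  by (induction A rule: infinite_finite_induct) auto

lemma Abs_ell2_coeff:
  "(\<lambda>i. (cmod (f i))\<^sup>2) summable_on UNIV \<Longrightarrow> coeff (Abs_ell2 f) = f"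
  by (rule Abs_ell2_inverse) simp

lemma cinner_add_left: "cinner (x + y) z = cinner x z + cinner y z"
  by (metis cinner_add_right cinner_commute complex_cnj_add)

lemma cinner_scale_left: "cinner (c *\<^sub>C x) y = cnj c * cinner x y"
  by (metis cinner_commute cinner_scale_right complex_cnj_mult)

lemma scaleC_minus1: "(-1) *\<^sub>C x = - (x :: 'i ell2)"
  by (rule ell2_eqI) simp

lemma cinner_minus_right: "cinner x (- y) = - cinner x y"
  using cinner_scale_right[of x "-1" y] by (simp add: scaleC_minus1)

lemma cinner_minus_left: "cinner (- x) y = - cinner x y"
  using cinner_scale_left[of "-1" x y] by (simp add: scaleC_minus1)

lemma cinner_diff_right: "cinner x (y - z) = cinner x y - cinner x z"
  using cinner_add_right[of x y "- z"] by (simp add: cinner_minus_right)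

lemma cinner_diff_left: "cinner (x - y) z = cinner x z - cinner y z"
  using cinner_add_left[of x "- y" z] by (simp add: cinner_minus_left)

lemma cinner_zero_right [simp]: "cinner x 0 = 0"
  using cinner_scale_right[of x 0 0] by simp

lemma cinner_zero_left [simp]: "cinner 0 x = 0"
  using cinner_scale_left[of 0 0 x] by simp

lemma cinner_sum_right: "cinner x (sum f A) = (\<Sum>a\<in>A. cinner x (f a))"
  by (induction A rule: infinite_finite_induct) (auto simp: cinner_add_right)

lemma cinner_sum_left: "cinner (sum f A) x = (\<Sum>a\<in>A. cinner (f a) x)"
  by (induction A rule: infinite_finite_induct) (auto simp: cinner_add_left)

lemma cinner_self_norm: "cinner x x = complex_of_real ((norm x)\<^sup>2)"
  by (simp add: cinner_self norm_ell2_sq)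

lemma norm_scaleC [simp]: "norm (c *\<^sub>C x) = cmod c * norm (x :: 'i ell2)"
proof -
  have "cinner (c *\<^sub>C x) (c *\<^sub>C x) = (c * cnj c) * cinner x x"
    by (simp add: cinner_scale_left cinner_scale_right)
  then have "(norm (c *\<^sub>C x))\<^sup>2 = (cmod c)\<^sup>2 * (norm x)\<^sup>2"
    unfolding cinner_self_norm complex_norm_square[symmetric]
    by (simp only: of_real_mult[symmetric] of_real_eq_iff)
  then show ?thesis by (simp add: power2_eq_iff_nonneg flip: power_mult_distrib)
qed

lemma norm_le_by_coeff:
  assumes "\<And>i. cmod (coeff x i) \<le> c * cmod (coeff y i)" "0 \<le> c"
  shows "norm x \<le> c * norm y"
proof -
  have "(norm x)\<^sup>2 \<le> (\<Sum>\<^sub>\<infinity>i. c\<^sup>2 * (cmod (coeff y i))\<^sup>2)"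
    unfolding norm_ell2_sq
  proof (rule infsum_mono)
    show "(\<lambda>i. c\<^sup>2 * (cmod (coeff y i))\<^sup>2) summable_on UNIV"
      by (intro summable_on_cmult_right summable_coeff)
    show "(cmod (coeff x i))\<^sup>2 \<le> c\<^sup>2 * (cmod (coeff y i))\<^sup>2" for i
      using power_mono[OF assms(1), of i 2] by (simp add: power_mult_distrib)
  qed (rule summable_coeff)
  also have "\<dots> = c\<^sup>2 * (norm y)\<^sup>2"
    unfolding norm_ell2_sq by (intro infsum_cmult_right summable_coeff)
  finally show ?thesis
    using assms(2) by (auto simp flip: power_mult_distrib intro: power2_le_imp_le)
qed

lemma cinner_ket_left [simp]: "cinner (ket i) x = coeff x i"
proof -
  have "(\<Sum>\<^sub>\<infinity>j. cnj (if j = i then 1 else 0) * coeff x j) = (\<Sum>\<^sub>\<infinity>j\<in>{i}. coeff x j)"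
    by (rule infsum_cong_neutral) auto
  then show ?thesis by (simp add: cinner.rep_eq)
qed

lemma cinner_ket_right [simp]: "cinner x (ket i) = cnj (coeff x i)"
  using cinner_commute[of x "ket i"] by simp

lemma norm_ket [simp]: "norm (ket i) = 1"
proof -
  have "cinner (ket i) (ket i) = 1" by simp
  then have "(norm (ket i))\<^sup>2 = 1" unfolding cinner_self_norm by (simp only: of_real_eq_1_iff)
  then show ?thesis using norm_ge_zero[of "ket i"] unfolding power2_eq_1_iff by linarith
qed

text \<open>The real inner product is \<open>Re (cinner x y)\<close>. A phase \<open>c\<close> on
  the second argument makes \<open>cinner\<close> real and nonnegative, so the real Cauchy--Schwarz
  inequality bounds the modulus.\<close>

lemma norm_cinner_le: "cmod (cinner x y) \<le> norm x * norm y"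
proof -
  obtain c where c: "cmod c = 1" "c * cinner x y = complex_of_real (cmod (cinner x y))"
  proof (cases "cinner x y = 0")
    case False
    show ?thesis
    proof (rule that[of "cnj (sgn (cinner x y))"])
      show "cmod (cnj (sgn (cinner x y))) = 1" using False by (simp add: norm_sgn)
      show "cnj (sgn (cinner x y)) * cinner x y = complex_of_real (cmod (cinner x y))"
        using False complex_norm_square[of "cinner x y"]
        by (simp add: sgn_eq power2_eq_square divide_simps mult_ac)
    qed
  qed (use that[of 1] in auto)
  have "cmod (cinner x y) = inner x (c *\<^sub>C y)"
    unfolding inner_ell2_def cinner_scale_right c(2) by simp
  also have "\<dots> \<le> norm x * norm (c *\<^sub>C y)" by (rule norm_cauchy_schwarz)
  finally show ?thesis by (simp add: c)
qed

lemma coeff_finite_combination: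
  "finite F \<Longrightarrow> coeff (\<Sum>i\<in>F. c i *\<^sub>C ket i) j = (if j \<in> F then c j else 0)"
  by (simp add: if_distrib[of "(*) _"] cong: if_cong)

lemma cinner_self_finite_combination:
  assumes "finite F"
  shows "cinner (\<Sum>i\<in>F. c i *\<^sub>C ket i) (\<Sum>i\<in>F. c i *\<^sub>C ket i) = of_real (\<Sum>i\<in>F. (cmod (c i))\<^sup>2)"
proof -
  define y where "y = (\<Sum>i\<in>F. c i *\<^sub>C ket i)"
  have "cinner y y = (\<Sum>i\<in>F. c i * cinner y (ket i))"
    by (subst (2) y_def) (simp add: cinner_sum_right cinner_scale_right)
  also have "\<dots> = (\<Sum>i\<in>F. of_real ((cmod (c i))\<^sup>2))"
    by (rule sum.cong[OF refl])
      (simp add: y_def coeff_finite_combination[OF assms] complex_norm_square del: of_real_power coeff_sum)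
  finally show ?thesis by (simp add: y_def)
qed

text \<open>By Pythagoras the squared distance from \<open>x\<close> to a finite partial sum is the
  squared norm minus the partial sum of the squared moduli, which tends to 0. Hence bounded
  operators are determined by their values on the \<open>ket i\<close>.\<close>

lemma has_sum_kets: "((\<lambda>i. coeff x i *\<^sub>C ket i) has_sum x) UNIV"
proof -
  let ?s = "\<lambda>F. \<Sum>i\<in>F. coeff x i *\<^sub>C ket i"
  have n2: "(norm (x - ?s F))\<^sup>2 = (norm x)\<^sup>2 - (\<Sum>i\<in>F. (cmod (coeff x i))\<^sup>2)" if "finite F" for F
  proof -
    have 1: "cinner x (?s F) = of_real (\<Sum>i\<in>F. (cmod (coeff x i))\<^sup>2)"
      by (simp add: cinner_sum_right cinner_scale_right complex_norm_square del: of_real_power)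
    have 2: "cinner (?s F) (?s F) = of_real (\<Sum>i\<in>F. (cmod (coeff x i))\<^sup>2)"
      by (rule cinner_self_finite_combination[OF that])
    have "complex_of_real ((norm (x - ?s F))\<^sup>2) =
        of_real ((norm x)\<^sup>2 - (\<Sum>i\<in>F. (cmod (coeff x i))\<^sup>2))"
      unfolding cinner_self_norm[symmetric] cinner_diff_left cinner_diff_right 1 2
      by (subst cinner_commute, subst 1) (simp add: cinner_self_norm)
    then show ?thesis by (simp only: of_real_eq_iff)
  qed
  have "((\<lambda>F. \<Sum>i\<in>F. (cmod (coeff x i))\<^sup>2) \<longlongrightarrow> (norm x)\<^sup>2) (finite_subsets_at_top UNIV)"
    using has_sum_infsum[OF summable_coeff[of x]] unfolding norm_ell2_sq has_sum_def by simp
  then have "((\<lambda>F. sqrt ((norm x)\<^sup>2 - (\<Sum>i\<in>F. (cmod (coeff x i))\<^sup>2))) \<longlongrightarrow> sqrt ((norm x)\<^sup>2 - (norm x)\<^sup>2))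
      (finite_subsets_at_top UNIV)"
    by (intro tendsto_intros)
  then have "((\<lambda>F. norm (x - ?s F)) \<longlongrightarrow> 0) (finite_subsets_at_top UNIV)"
  proof (rule Lim_transform_eventually[OF _ eventually_finite_subsets_at_top_weakI, THEN tendsto_eq_rhs])
    fix F :: "'a set" assume "finite F"
    then show "sqrt ((norm x)\<^sup>2 - (\<Sum>i\<in>F. (cmod (coeff x i))\<^sup>2)) = norm (x - ?s F)"
      using n2[of F] by (metis norm_ge_zero real_sqrt_unique)
  qed simp
  then have "((\<lambda>F. norm (?s F - x)) \<longlongrightarrow> 0) (finite_subsets_at_top UNIV)"
    by (simp add: norm_minus_commute)
  then have "(?s \<longlongrightarrow> x) (finite_subsets_at_top UNIV)"
    using LIM_zero_cancel tendsto_norm_zero_iff by blast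
  then show ?thesis by (simp add: has_sum_def)
qed

section \<open>Bounded linear operators and the existence of adjoints\<close>

lemma bounded_clinearI:
  assumes "\<And>x y. A (x + y) = A x + A y" "\<And>c x. A (c *\<^sub>C x) = c *\<^sub>C A x" "\<And>x. norm (A x) \<le> K * norm x"
  shows "bounded_clinear A"
  unfolding bounded_clinear_def
  using assms by (auto intro!: bounded_linear_intro[of A K] simp: scaleR_scaleC mult.commute)

lemma
  assumes "bounded_clinear A"
  shows bounded_clinear_add: "A (x + y) = A x + A y"
    and bounded_clinear_scale: "A (c *\<^sub>C x) = c *\<^sub>C A x"
    and bounded_clinear_zero [simp]: "A 0 = 0"
    and bounded_clinear_minus: "A (- x) = - A x"
    and bounded_clinear_diff: "A (x - y) = A x - A y"
    and bounded_clinear_sum: "A (sum f S) = (\<Sum>a\<in>S. A (f a))"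
    and bounded_clinear_bounded: "\<exists>K>0. \<forall>x. norm (A x) \<le> K * norm x"
proof -
  interpret bounded_linear A using assms by (simp add: bounded_clinear_def)
  show "A (x + y) = A x + A y" by (rule add)
  show "A (c *\<^sub>C x) = c *\<^sub>C A x" using assms by (simp add: bounded_clinear_def)
  show "A 0 = 0" by (rule zero)
  show "A (- x) = - A x" by (rule neg)
  show "A (x - y) = A x - A y" by (rule diff)
  show "A (sum f S) = (\<Sum>a\<in>S. A (f a))" by (rule sum)
  show "\<exists>K>0. \<forall>x. norm (A x) \<le> K * norm x"
    using pos_bounded by (metis mult.commute)
qed

lemma bounded_clinear_comp:
  "bounded_clinear A \<Longrightarrow> bounded_clinear B \<Longrightarrow> bounded_clinear (A \<circ> B)"
  unfolding bounded_clinear_def by (auto simp: o_def intro: bounded_linear_compose)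

lemma bounded_clinear_plus:
  "bounded_clinear A \<Longrightarrow> bounded_clinear B \<Longrightarrow> bounded_clinear (\<lambda>x. A x + B x)"
  unfolding bounded_clinear_def
  by (auto intro: bounded_linear_add simp: ell2.scale_right_distrib)

lemma bounded_clinear_scaleC: "bounded_clinear ((*\<^sub>C) c)"
  by (rule bounded_clinearI[where K = "cmod c"])
    (auto simp: ell2.scale_right_distrib mult.commute)

lemma bounded_clinear_cmult: "bounded_clinear A \<Longrightarrow> bounded_clinear (\<lambda>x. c *\<^sub>C A x)"
  using bounded_clinear_comp[OF bounded_clinear_scaleC] by (simp add: o_def)

lemma bounded_clinear_rmult: "bounded_clinear A \<Longrightarrow> bounded_clinear (\<lambda>x. r *\<^sub>R A x)"
  by (simp add: scaleR_scaleC bounded_clinear_cmult)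

lemma bounded_clinear_id: "bounded_clinear id"
  by (rule bounded_clinearI[where K = 1]) auto

lemma bounded_clinear_0: "bounded_clinear (\<lambda>_. 0)"
  by (rule bounded_clinearI[where K = 0]) auto

lemma bounded_clinear_uminus: "bounded_clinear uminus"
  by (rule bounded_clinearI[where K = 1]) auto

lemma bounded_clinear_minus':
  "bounded_clinear A \<Longrightarrow> bounded_clinear B \<Longrightarrow> bounded_clinear (\<lambda>x. A x - B x)"
  using bounded_clinear_plus[of A "\<lambda>x. - B x"] bounded_clinear_comp[OF bounded_clinear_uminus, of B]
  by (simp add: o_def)

lemma bounded_clinear_eqI:
  fixes A B :: "'a op"
  assumes "bounded_clinear A" "bounded_clinear B" "\<And>i. A (ket i) = B (ket i)"
  shows "A = B"
proof
  fix x :: "'a ell2"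
  have *: "((\<lambda>i. coeff x i *\<^sub>C C (ket i)) has_sum C x) UNIV" if "bounded_clinear C" for C
    using has_sum_bounded_linear[OF _ has_sum_kets[of x], of C] that
    by (simp add: bounded_clinear_def o_def)
  show "A x = B x"
    by (rule has_sum_unique[OF *[OF assms(1)]]) (simp add: * assms)
qed

lemma ell2_summable_by_bound:
  assumes "\<And>F. finite F \<Longrightarrow> (\<Sum>i\<in>F. (cmod (f i))\<^sup>2) \<le> b"
  shows "(\<lambda>i. (cmod (f i))\<^sup>2) summable_on UNIV"
  by (rule nonneg_bounded_partial_sums_imp_summable_on[where C = b])
    (use assms in \<open>auto intro!: eventually_finite_subsets_at_top_weakI\<close>)

text \<open>Riesz representation in coordinates: the \<open>i\<close>-th coefficient of the adjoint applied to \<open>y\<close>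
  must be \<open>\<langle>A e\<^sub>i, y\<rangle>\<close>, and Cauchy--Schwarz on finite truncations gives square summability.\<close>

lemma adjoint_exists:
  fixes A :: "'i op"
  assumes "bounded_clinear A"
  shows "\<exists>B. \<forall>x y. cinner (B x) y = cinner x (A y)"
proof -
  obtain K where K: "K > 0" "\<And>x. norm (A x) \<le> K * norm x"
    using bounded_clinear_bounded[OF assms] by blast
  define f where "f x i = cinner (A (ket i)) x" for x i
  have fin: "(\<Sum>i\<in>F. (cmod (f x i))\<^sup>2) \<le> (K * norm x)\<^sup>2" if "finite F" for x F
  proof -
    define s where "s = (\<Sum>i\<in>F. (cmod (f x i))\<^sup>2)"
    define y where "y = (\<Sum>i\<in>F. f x i *\<^sub>C ket i)"
    have s0: "s \<ge> 0" unfolding s_def by (simp add: sum_nonneg)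
    have "cinner y y = of_real s"
      unfolding y_def s_def by (rule cinner_self_finite_combination[OF that])
    then have "complex_of_real ((norm y)\<^sup>2) = of_real s" by (simp only: cinner_self_norm)
    then have ny: "(norm y)\<^sup>2 = s" by (simp only: of_real_eq_iff)
    have "cinner (A y) x = of_real s"
      unfolding y_def bounded_clinear_sum[OF assms] bounded_clinear_scale[OF assms]
        cinner_sum_left cinner_scale_left s_def
      by (simp add: f_def complex_norm_square mult.commute del: of_real_power)
    then have "s \<le> norm (A y) * norm x"
      using norm_cinner_le[of "A y" x] s0 by simp
    also have "\<dots> \<le> K * norm y * norm x"
      by (intro mult_right_mono K) auto
    finally have "s \<le> (K * norm x) * norm y" by (simp add: mult_ac)
    then have "norm y * norm y \<le> (K * norm x) * norm y" using ny by (simp add: power2_eq_square)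
    then have "norm y \<le> K * norm x"
      using K(1) by (cases "norm y = 0") (auto simp: mult_le_cancel_right)
    then have "(norm y)\<^sup>2 \<le> (K * norm x)\<^sup>2" by (intro power_mono) auto
    then show ?thesis using ny s_def by simp
  qed
  have cf: "coeff (Abs_ell2 (f x)) = f x" for x
    by (rule Abs_ell2_coeff) (rule ell2_summable_by_bound[OF fin])
  have "cinner (Abs_ell2 (f x)) y = cinner x (A y)" for x y
  proof -
    define z where "z = Abs_ell2 (f x)"
    have bl: "bounded_linear (cinner w)" for w :: "'b ell2"
      by (rule bounded_linear_intro[where K = "norm w"])
        (use norm_cinner_le[of w] in \<open>auto simp: cinner_add_right cinner_scale_right scaleR_scaleC
        scaleR_conv_of_real mult.commute\<close>)
    have "((\<lambda>i. cinner z (coeff y i *\<^sub>C ket i)) has_sum cinner z y) UNIV"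
      using has_sum_bounded_linear[OF bl has_sum_kets[of y]] by (simp add: o_def)
    then have 1: "((\<lambda>i. coeff y i * cinner x (A (ket i))) has_sum cinner z y) UNIV"
      by (simp add: cinner_scale_right z_def cf f_def cinner_commute[of "A _" x])
    have "bounded_linear (\<lambda>y. cinner x (A y))"
      using bounded_linear_compose[OF bl, of A x] assms by (simp add: bounded_clinear_def)
    from has_sum_bounded_linear[OF this has_sum_kets[of y]]
    have 2: "((\<lambda>i. coeff y i * cinner x (A (ket i))) has_sum cinner x (A y)) UNIV"
      by (simp add: o_def bounded_clinear_scale[OF assms] cinner_scale_right)
    show ?thesis using has_sum_unique[OF 1 2] by (simp add: z_def)
  qed
  then show ?thesis by (intro exI[of _ "\<lambda>x. Abs_ell2 (f x)"]) simp
qed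

lemma cinner_cadjoint:
  "bounded_clinear A \<Longrightarrow> cinner (cadjoint A x) y = cinner x (A y)"
  unfolding cadjoint_def using someI_ex[OF adjoint_exists] by blast

lemma cinner_cadjoint': "bounded_clinear A \<Longrightarrow> cinner x (cadjoint A y) = cinner (A x) y"
  by (metis cinner_cadjoint cinner_commute)

text \<open>Injectivity makes the images of the basis vectors orthogonal, so bounded weights give a
  bounded operator. Convergence of the unordered sum is recorded besides the coordinates because
  \<open>on_basis\<close> is defined by that sum.\<close>

lemma weighted_injection:
  fixes a :: "'i \<Rightarrow> complex" and \<sigma> :: "'i \<Rightarrow> 'i"
  assumes inj: "inj_on \<sigma> S" and a: "\<And>i. i \<in> S \<Longrightarrow> cmod (a i) \<le> C" and C: "C \<ge> 0"
  shows "\<exists>y. ((\<lambda>i. coeff x i *\<^sub>C (if i \<in> S then a i *\<^sub>C ket (\<sigma> i) else 0)) has_sum y) UNIV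
    \<and> norm y \<le> C * norm x
    \<and> (\<forall>i\<in>S. coeff y (\<sigma> i) = a i * coeff x i) \<and> (\<forall>j. j \<notin> \<sigma> ` S \<longrightarrow> coeff y j = 0)"
proof -
  define f where "f j = (if j \<in> \<sigma> ` S then a (inv_into S \<sigma> j) * coeff x (inv_into S \<sigma> j) else 0)" for j
  have f1: "f (\<sigma> i) = a i * coeff x i" if "i \<in> S" for i
    using that inj by (simp add: f_def)
  have bound: "(\<Sum>i\<in>F. (cmod (f i))\<^sup>2) \<le> (C * norm x)\<^sup>2" if "finite F" for F
  proof -
    let ?G = "inv_into S \<sigma> ` (F \<inter> \<sigma> ` S)"
    have G: "?G \<subseteq> S" by (auto simp: inv_into_into)
    have i2: "inj_on (inv_into S \<sigma>) (F \<inter> \<sigma> ` S)" by (rule inj_on_subset[OF inj_on_inv_into]) auto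
    have "(\<Sum>i\<in>F. (cmod (f i))\<^sup>2) = (\<Sum>i\<in>F \<inter> \<sigma> ` S. (cmod (f i))\<^sup>2)"
      using that by (intro sum.mono_neutral_right) (auto simp: f_def)
    also have "\<dots> = (\<Sum>i\<in>?G. (cmod (a i * coeff x i))\<^sup>2)"
      using i2 by (simp add: sum.reindex f_def)
    also have "\<dots> \<le> (\<Sum>i\<in>?G. C\<^sup>2 * (cmod (coeff x i))\<^sup>2)"
    proof (rule sum_mono)
      fix i assume "i \<in> ?G"
      then have "cmod (a i) \<le> C" using G a by blast
      then have "(cmod (a i))\<^sup>2 \<le> C\<^sup>2" by (intro power_mono) auto
      then show "(cmod (a i * coeff x i))\<^sup>2 \<le> C\<^sup>2 * (cmod (coeff x i))\<^sup>2"
        by (simp add: norm_mult power_mult_distrib mult_right_mono)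
    qed
    also have "\<dots> \<le> C\<^sup>2 * (norm x)\<^sup>2"
      unfolding sum_distrib_left[symmetric]
      using that by (intro mult_left_mono sum_coeff_le_norm) auto
    finally show ?thesis by (simp add: power_mult_distrib)
  qed
  define y where "y = Abs_ell2 f"
  have cy: "coeff y = f"
    unfolding y_def by (rule Abs_ell2_coeff) (rule ell2_summable_by_bound[OF bound])
  have "(norm y)\<^sup>2 \<le> (C * norm x)\<^sup>2"
    unfolding norm_ell2_sq[of y] cy
    by (rule infsum_le_finite_sums[OF ell2_summable_by_bound[OF bound] bound])
  then have ny: "norm y \<le> C * norm x"
    by (rule power2_le_imp_le) (simp add: C)
  have "((\<lambda>j. coeff y j *\<^sub>C ket j) has_sum y) (\<sigma> ` S)"
    by (rule has_sum_cong_neutral[THEN iffD1, OF _ _ _ has_sum_kets]) (auto simp: cy f_def)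
  then have "((\<lambda>i. coeff y (\<sigma> i) *\<^sub>C ket (\<sigma> i)) has_sum y) S"
    using has_sum_reindex[OF inj, of "\<lambda>j. coeff y j *\<^sub>C ket j" y] by (simp add: o_def)
  then have "((\<lambda>i. coeff x i *\<^sub>C (if i \<in> S then a i *\<^sub>C ket (\<sigma> i) else 0)) has_sum y) UNIV"
    by (rule has_sum_cong_neutral[THEN iffD1, rotated -1]) (auto simp: cy f1 mult_ac)
  then show ?thesis using ny f1 by (intro exI[of _ y]) (auto simp: cy f_def)
qed

section \<open>Compact operators and operator ideals\<close>

text \<open>The coefficients range over compact discs, and adding one basis vector at a time is a
  continuous image of a product of compact sets.\<close>

lemma compact_finitely_supported:
  assumes "finite F"
  shows "\<exists>K. compact K \<and> {x :: 'i ell2. (\<forall>i. i \<notin> F \<longrightarrow> coeff x i = 0) \<and> norm x \<le> r} \<subseteq> K"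
proof -
  have bl: "bounded_linear (\<lambda>c. c *\<^sub>C (y :: 'i ell2))" for y
    by (rule bounded_linear_intro[where K = "norm y"])
      (auto simp: ell2.scale_left_distrib scaleR_scaleC scaleR_conv_of_real)
  have "\<exists>K. compact K \<and> {\<Sum>i\<in>F. c i *\<^sub>C ket i |c. \<forall>i. cmod (c i) \<le> r} \<subseteq> (K :: 'i ell2 set)"
    using assms
  proof induction
    case empty
    show ?case by (rule exI[of _ "{0}"]) auto
  next
    case (insert j F)
    then obtain K where K: "compact K" "{\<Sum>i\<in>F. c i *\<^sub>C ket i |c. \<forall>i. cmod (c i) \<le> r} \<subseteq> K"
      by blast
    let ?f = "\<lambda>(c, y). c *\<^sub>C ket j + y :: 'i ell2"
    have "continuous_on (cball 0 r \<times> K) ?f"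
      unfolding case_prod_beta
      by (intro continuous_intros linear_continuous_on_compose[OF _ bounded_linear.linear[OF bl]]
        bounded_linear.continuous_on[OF bl])
    then have "compact (?f ` (cball 0 r \<times> K))"
      by (intro compact_continuous_image compact_Times K compact_cball)
    moreover have "{\<Sum>i\<in>insert j F. c i *\<^sub>C ket i |c. \<forall>i. cmod (c i) \<le> r} \<subseteq> ?f ` (cball 0 r \<times> K)"
    proof safe
      fix c :: "'i \<Rightarrow> complex" assume "\<forall>i. cmod (c i) \<le> r"
      then have "(c j, \<Sum>i\<in>F. c i *\<^sub>C ket i) \<in> cball 0 r \<times> K" using K(2) by auto
      then have "?f (c j, \<Sum>i\<in>F. c i *\<^sub>C ket i) \<in> ?f ` (cball 0 r \<times> K)" by (rule imageI)
      then show "(\<Sum>i\<in>insert j F. c i *\<^sub>C ket i) \<in> ?f ` (cball 0 r \<times> K)"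
        using insert.hyps by simp
    qed
    ultimately show ?case by blast
  qed
  then obtain K where K: "compact K" "{\<Sum>i\<in>F. c i *\<^sub>C ket i |c. \<forall>i. cmod (c i) \<le> r} \<subseteq> (K :: 'i ell2 set)"
    by blast
  have "x \<in> K" if "\<forall>i. i \<notin> F \<longrightarrow> coeff x i = 0" "norm x \<le> r" for x :: "'i ell2"
  proof -
    have x: "x = (\<Sum>i\<in>F. coeff x i *\<^sub>C ket i)"
    proof (rule ell2_eqI)
      fix i
      show "coeff x i = coeff (\<Sum>i\<in>F. coeff x i *\<^sub>C ket i) i"
        unfolding coeff_finite_combination[OF assms] using that(1) by simp
    qed
    have "cmod (coeff x i) \<le> r" for i using coeff_le_norm[of x i] that(2) by linarith
    then have "(\<Sum>i\<in>F. coeff x i *\<^sub>C ket i) \<in> K" using K(2) by blast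
    then show ?thesis using x by simp
  qed
  then show ?thesis using K(1) by blast
qed

lemma compact_closure_if_approximable:
  fixes S :: "'a :: banach set"
  assumes "\<And>e. e > 0 \<Longrightarrow> \<exists>K. compact K \<and> (\<forall>x\<in>S. \<exists>y\<in>K. dist x y \<le> e)"
  shows "compact (closure S)"
  unfolding compact_eq_totally_bounded
proof (intro conjI allI impI)
  show "complete (closure S)" by (simp add: complete_eq_closed)
  fix e :: real assume "e > 0"
  \<comment> \<open>Three errors of size \<open>e/4\<close> will add up: from the closure to
    \<open>S\<close>, from \<open>S\<close> to \<open>K\<close>, and from \<open>K\<close> to its
    finite net.\<close>
  then obtain K where K: "compact K" "\<forall>x\<in>S. \<exists>y\<in>K. dist x y \<le> e/4"
    using assms[of "e/4"] by auto
  then obtain k where k: "finite k" "K \<subseteq> (\<Union>x\<in>k. ball x (e/4))"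
    using \<open>e > 0\<close> unfolding compact_eq_totally_bounded by (metis zero_less_divide_iff zero_less_numeral)
  have "closure S \<subseteq> (\<Union>x\<in>k. ball x e)"
  proof
    fix x assume "x \<in> closure S"
    then obtain y where y: "y \<in> S" "dist y x < e/4"
      using \<open>e > 0\<close> unfolding closure_approachable by (metis zero_less_divide_iff zero_less_numeral)
    then obtain z where z: "z \<in> K" "dist y z \<le> e/4" using K(2) by blast
    then obtain w where w: "w \<in> k" "dist w z < e/4" using k(2) by auto
    have "dist w x \<le> dist w z + dist y z + dist y x"
      using dist_triangle[of w x z] dist_triangle[of z x y] by (simp add: dist_commute)
    then have "dist w x < e" using y z w \<open>e > 0\<close> by simp
    then show "x \<in> (\<Union>x\<in>k. ball x e)" using w(1) by auto
  qed
  then show "\<exists>k. finite k \<and> closure S \<subseteq> (\<Union>x\<in>k. ball x e)" using k(1) by blast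
qed

lemma compact_closure_subset:
  fixes S T :: "'a :: t2_space set"
  shows "compact T \<Longrightarrow> closure S \<subseteq> T \<Longrightarrow> compact (closure S)"
  using compact_Int_closed[of T "closure S"] by (simp add: inf.absorb2)

text \<open>Cutting a vector of the unit ball down to its coordinates in \<open>F\<close> changes
  its image by at most \<open>e\<close>, and the cut vectors lie in a compact set. So the image of
  the ball is approximated by compact sets to any precision.\<close>

lemma compact_operatorI:
  fixes A :: "'i op"
  assumes A: "bounded_clinear A"
    and small: "\<And>e. e > 0 \<Longrightarrow> \<exists>F. finite F \<and> (\<forall>x. (\<forall>i\<in>F. coeff x i = 0) \<longrightarrow> norm (A x) \<le> e * norm x)"
  shows "compact_operator A"
  unfolding compact_operator_def
proof (intro conjI A compact_closure_if_approximable)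
  fix e :: real assume "e > 0"
  then obtain F where F: "finite F" "\<And>x. \<forall>i\<in>F. coeff x i = 0 \<Longrightarrow> norm (A x) \<le> e * norm x"
    using small by blast
  obtain K where K: "compact K" "{x. (\<forall>i. i \<notin> F \<longrightarrow> coeff x i = 0) \<and> norm x \<le> 1} \<subseteq> (K :: 'i ell2 set)"
    using compact_finitely_supported[OF F(1)] by blast
  have "compact (A ` K)"
    using A K(1) by (intro compact_continuous_image)
      (auto simp: bounded_clinear_def linear_continuous_on)
  moreover have "\<exists>y\<in>A ` K. dist (A x) y \<le> e" if "norm x \<le> 1" for x
  proof -
    define y where "y = (\<Sum>i\<in>F. coeff x i *\<^sub>C ket i)"
    have y: "coeff y i = (if i \<in> F then coeff x i else 0)" for i
      unfolding y_def by (rule coeff_finite_combination[OF F(1)])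
    have "norm y \<le> 1 * norm x" by (rule norm_le_by_coeff) (auto simp: y)
    then have "y \<in> K" using K(2) that by (auto simp: y)
    moreover have "dist (A x) (A y) \<le> e"
    proof -
      have "dist (A x) (A y) = norm (A (x - y))"
        by (simp add: dist_norm bounded_clinear_diff[OF A])
      also have "\<dots> \<le> e * norm (x - y)" by (rule F) (simp add: y)
      also have "\<dots> \<le> e * 1"
      proof (intro mult_left_mono)
        have "norm (x - y) \<le> 1 * norm x" by (rule norm_le_by_coeff) (auto simp: y)
        then show "norm (x - y) \<le> 1" using that by simp
      qed (use \<open>e > 0\<close> in simp)
      finally show ?thesis by simp
    qed
    ultimately show ?thesis by blast
  qed
  ultimately show "\<exists>K. compact K \<and> (\<forall>x\<in>A ` cball 0 1. \<exists>y\<in>K. dist x y \<le> e)"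
    by (intro exI[of _ "A ` K"]) auto
qed

text \<open>Needed to bound the ideal generated by L_q^\<alpha> from above: a hull lies in every
  ideal that contains the generator.\<close>

lemma compact_operator_ideal: "operator_ideal (Collect (compact_operator :: 'i op \<Rightarrow> bool))"
  unfolding operator_ideal_def
proof (intro conjI ballI allI impI)
  show "Collect compact_operator \<subseteq> Collect bounded_clinear" by (auto simp: compact_operator_def)
  show "(\<lambda>_. 0) \<in> Collect (compact_operator :: 'i op \<Rightarrow> bool)"
    by (simp, rule compact_operatorI[OF bounded_clinear_0]) (auto intro: exI[of _ "{}"])
next
  fix A B :: "'i op" assume "A \<in> Collect compact_operator" "B \<in> Collect compact_operator"
  then have AB: "compact_operator A" "compact_operator B" by auto
  let ?K = "\<lambda>A :: 'i op. closure (A ` cball 0 1)"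
  have c: "compact ((\<lambda>(x, y). x + y) ` (?K A \<times> ?K B))"
    using AB unfolding compact_operator_def
    by (intro compact_continuous_image compact_Times) (auto simp: case_prod_beta intro!: continuous_intros)
  have "(\<lambda>x. A x + B x) ` cball 0 1 \<subseteq> (\<lambda>(x, y). x + y) ` (?K A \<times> ?K B)"
  proof
    fix y assume "y \<in> (\<lambda>x. A x + B x) ` cball 0 1"
    then obtain x where "y = A x + B x" "x \<in> cball 0 1" by blast
    then show "y \<in> (\<lambda>(x, y). x + y) ` (?K A \<times> ?K B)"
      using closure_subset[of "A ` cball 0 1"] closure_subset[of "B ` cball 0 1"]
      by (intro image_eqI[of _ _ "(A x, B x)"]) auto
  qed
  then have "closure ((\<lambda>x. A x + B x) ` cball 0 1) \<subseteq> (\<lambda>(x, y). x + y) ` (?K A \<times> ?K B)"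
    by (rule closure_minimal) (use c compact_imp_closed in blast)
  then have "compact (closure ((\<lambda>x. A x + B x) ` cball 0 1))"
    by (rule compact_closure_subset[OF c])
  then show "(\<lambda>x. A x + B x) \<in> Collect compact_operator"
    using AB by (auto simp: compact_operator_def intro: bounded_clinear_plus)
next
  fix A B :: "'i op" assume "A \<in> Collect compact_operator" and B: "bounded_clinear B"
  then have A: "bounded_clinear A" "compact (closure (A ` cball 0 1))"
    by (auto simp: compact_operator_def)
  obtain K where K: "K > 0" "\<And>x. norm (B x) \<le> K * norm x"
    using bounded_clinear_bounded[OF B] by blast
  have c: "compact ((*\<^sub>R) K ` closure (A ` cball 0 1))"
    using A(2) by (rule compact_scaling)
  have "(A \<circ> B) ` cball 0 1 \<subseteq> (*\<^sub>R) K ` closure (A ` cball 0 1)"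
  proof
    fix y assume "y \<in> (A \<circ> B) ` cball 0 1"
    then obtain x where x: "y = A (B x)" "norm x \<le> 1" by auto
    have "norm (inverse K *\<^sub>R B x) \<le> 1"
      using K(2)[of x] K(1) x(2) by (simp add: divide_simps mult_left_le order_trans)
    moreover have "y = K *\<^sub>R A (inverse K *\<^sub>R B x)"
      using K(1) by (simp add: x scaleR_scaleC bounded_clinear_scale[OF A(1)])
    ultimately show "y \<in> (*\<^sub>R) K ` closure (A ` cball 0 1)"
      using closure_subset[of "A ` cball 0 1"] by (intro image_eqI[of _ _ "A (inverse K *\<^sub>R B x)"]) auto
  qed
  then have "closure ((A \<circ> B) ` cball 0 1) \<subseteq> (*\<^sub>R) K ` closure (A ` cball 0 1)"
    by (rule closure_minimal) (use c compact_imp_closed in blast)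
  then have "compact (closure ((A \<circ> B) ` cball 0 1))"
    by (rule compact_closure_subset[OF c])
  then show "A \<circ> B \<in> Collect compact_operator"
    using A B by (simp add: compact_operator_def bounded_clinear_comp)
  have c: "compact (B ` closure (A ` cball 0 1))"
    using A B by (intro compact_continuous_image)
      (auto simp: bounded_clinear_def linear_continuous_on)
  have "(B \<circ> A) ` cball 0 1 \<subseteq> B ` closure (A ` cball 0 1)"
    using closure_subset[of "A ` cball 0 1"] by (auto simp: o_def)
  then have "closure ((B \<circ> A) ` cball 0 1) \<subseteq> B ` closure (A ` cball 0 1)"
    by (rule closure_minimal) (use c compact_imp_closed in blast)
  then have "compact (closure ((B \<circ> A) ` cball 0 1))"
    by (rule compact_closure_subset[OF c])
  then show "B \<circ> A \<in> Collect compact_operator"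
    using A B by (simp add: compact_operator_def bounded_clinear_comp)
qed

section \<open>Linear systems and an upper bound for singular values\<close>

lemma homogeneous_system_nontrivial:
  fixes M :: "'y \<Rightarrow> 'i \<Rightarrow> complex"
  assumes "finite Y" "finite I" "card Y < card I"
  shows "\<exists>c. (\<exists>i\<in>I. c i \<noteq> 0) \<and> (\<forall>y\<in>Y. (\<Sum>i\<in>I. c i * M y i) = 0)"
  using assms
proof (induction Y arbitrary: I M)
  case empty
  then have "I \<noteq> {}" by auto
  then show ?case by (intro exI[of _ "\<lambda>_. 1"]) auto
next
  case (insert y Y)
  show ?case
  proof (cases "\<forall>i\<in>I. M y i = 0")
    case True
    from insert.IH[of I M] insert.prems insert.hyps
    obtain c where "\<exists>i\<in>I. c i \<noteq> 0" "\<forall>z\<in>Y. (\<Sum>i\<in>I. c i * M z i) = 0" by auto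
    then show ?thesis using True by (intro exI[of _ c]) auto
  next
    case False
    then obtain j where j: "j \<in> I" "M y j \<noteq> 0" by blast
    \<comment> \<open>Gaussian elimination: the equation \<open>y\<close> with pivot
      \<open>M y j\<close> is used to remove the unknown \<open>j\<close> from the other
      equations.\<close>
    define M' where "M' z i = M z i - M z j / M y j * M y i" for z i
    have "card Y < card (I - {j})" using insert j by simp
    then obtain c where c: "\<exists>i\<in>I - {j}. c i \<noteq> 0" "\<forall>z\<in>Y. (\<Sum>i\<in>I - {j}. c i * M' z i) = 0"
      using insert.IH[of "I - {j}" M'] insert.prems by auto
    define S where "S = (\<Sum>i\<in>I - {j}. c i * M y i)"
    \<comment> \<open>Back substitution: the value at \<open>j\<close> is forced by the equation
      \<open>y\<close>.\<close>
    define d where "d = c(j := - S / M y j)"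
    have s: "(\<Sum>i\<in>I. d i * M z i) = - S / M y j * M z j + (\<Sum>i\<in>I - {j}. c i * M z i)" for z
      using j(1) insert.prems by (simp add: sum.remove[of I j] d_def)
    have "(\<Sum>i\<in>I. d i * M z i) = (\<Sum>i\<in>I - {j}. c i * M' z i)" for z
      unfolding s by (simp add: M'_def S_def algebra_simps sum_subtractf sum_distrib_left sum_divide_distrib)
    moreover have "(\<Sum>i\<in>I. d i * M y i) = 0" unfolding s using j(2) by (simp add: S_def)
    moreover have "\<exists>i\<in>I. d i \<noteq> 0" using c(1) by (auto simp: d_def)
    ultimately show ?thesis using c(2) by (intro exI[of _ d]) auto
  qed
qed

text \<open>One half of the min-max principle: \<open>k + 1\<close> orthonormal eigenvectors of \<open>A\<^sup>*A\<close> span a vector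
  orthogonal to the \<open>k\<close> given ones.\<close>

lemma singular_value_le:
  assumes A: "bounded_clinear A" and Y: "finite Y" "card Y \<le> k" and e: "e \<ge> 0"
    and small: "\<And>x. (\<And>y. y \<in> Y \<Longrightarrow> cinner y x = 0) \<Longrightarrow> norm (A x) \<le> e * norm x"
  shows "singular_value A k \<in> {0..e}"
proof -
  let ?S = "insert 0 {s k |s u.
     (\<forall>i\<le>k. \<forall>j\<le>k. cinner (u i) (u j) = (if i = j then 1 else 0)) \<and>
     (\<forall>i\<le>k. 0 \<le> s i \<and> cadjoint A (A (u i)) = complex_of_real ((s i)\<^sup>2) *\<^sub>C u i) \<and>
     (\<forall>i<k. s (Suc i) \<le> s i)}"
  have bound: "s k \<le> e"
    if on: "\<forall>i\<le>k. \<forall>j\<le>k. cinner (u i) (u j) = (if i = j then 1 else 0)"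
      and ev: "\<forall>i\<le>k. 0 \<le> s i \<and> cadjoint A (A (u i)) = complex_of_real ((s i)\<^sup>2) *\<^sub>C u i"
      and dec: "\<forall>i<k. s (Suc i) \<le> s i" for s :: "nat \<Rightarrow> real" and u
  proof -
    obtain c where c: "\<exists>i\<in>{..k}. c i \<noteq> 0" "\<forall>y\<in>Y. (\<Sum>i\<le>k. c i * cinner y (u i)) = 0"
      using homogeneous_system_nontrivial[of Y "{..k}" "\<lambda>y i. cinner y (u i)"] Y by auto
    define x where "x = (\<Sum>i\<le>k. c i *\<^sub>C u i)"
    have xu: "cinner x (u i) = cnj (c i)" if "i \<le> k" for i
    proof -
      have "cinner x (u i) = (\<Sum>j\<le>k. cnj (c j) * (if j = i then 1 else 0))"
        unfolding x_def cinner_sum_left cinner_scale_left using on that by (intro sum.cong) auto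
      also have "\<dots> = cnj (c i)" using that by (simp add: if_distrib[of "(*) _"] cong: if_cong)
      finally show ?thesis .
    qed
    have "cinner x x = (\<Sum>i\<le>k. c i * cinner x (u i))"
      by (subst (2) x_def) (simp add: cinner_sum_right cinner_scale_right)
    also have "\<dots> = of_real (\<Sum>i\<le>k. (cmod (c i))\<^sup>2)"
      unfolding of_real_sum by (rule sum.cong) (simp_all add: xu complex_norm_square del: of_real_power)
    finally have nx: "(norm x)\<^sup>2 = (\<Sum>i\<le>k. (cmod (c i))\<^sup>2)"
      unfolding cinner_self_norm by (simp only: of_real_eq_iff)
    have "A x = (\<Sum>i\<le>k. c i *\<^sub>C A (u i))"
      unfolding x_def by (simp add: bounded_clinear_sum[OF A] bounded_clinear_scale[OF A])
    then have "cinner (A x) (A x) = (\<Sum>i\<le>k. c i * cinner (A x) (A (u i)))"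
      by (metis (no_types, lifting) cinner_scale_right cinner_sum_right sum.cong)
    also have "\<dots> = (\<Sum>i\<le>k. c i * cinner x (cadjoint A (A (u i))))"
      by (simp add: cinner_cadjoint'[OF A])
    also have "\<dots> = of_real (\<Sum>i\<le>k. (s i)\<^sup>2 * (cmod (c i))\<^sup>2)"
      unfolding of_real_sum
      by (rule sum.cong) (use ev in \<open>simp_all add: cinner_scale_right xu complex_norm_square
        of_real_mult del: of_real_power\<close>)
    finally have nAx: "(norm (A x))\<^sup>2 = (\<Sum>i\<le>k. (s i)\<^sup>2 * (cmod (c i))\<^sup>2)"
      unfolding cinner_self_norm by (simp only: of_real_eq_iff)
    have sk: "s k \<le> s i" if "i \<le> k" for i
      using that by (induction rule: inc_induct) (use dec in \<open>auto intro: order_trans\<close>)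
    \<comment> \<open>All eigenvalues involved are at least \<open>(s k)\<^sup>2\<close>, so
      \<open>A\<close> stretches every vector of the span by at least \<open>s k\<close>.\<close>
    have "(s k * norm x)\<^sup>2 \<le> (norm (A x))\<^sup>2"
      unfolding power_mult_distrib nx nAx sum_distrib_left
      using ev sk by (intro sum_mono mult_right_mono power_mono) auto
    also have "\<dots> \<le> (e * norm x)\<^sup>2"
    proof (intro power_mono small)
      fix y assume "y \<in> Y"
      then show "cinner y x = 0" using c(2) by (simp add: x_def cinner_sum_right cinner_scale_right)
    qed auto
    finally have "s k * norm x \<le> e * norm x"
      by (rule power2_le_imp_le) (use e in auto)
    moreover have "norm x > 0"
    proof -
      have "(\<Sum>i\<le>k. (cmod (c i))\<^sup>2) \<noteq> 0" using c(1) by (subst sum_nonneg_eq_0_iff) auto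
      then show ?thesis using nx by auto
    qed
    ultimately show ?thesis by simp
  qed
  have le: "\<forall>x\<in>?S. x \<le> e" using bound e by blast
  then have bdd: "bdd_above ?S" unfolding bdd_above_def by (rule exI)
  have "Sup ?S \<le> e" by (rule cSup_least) (use le in blast)+
  moreover have "0 \<le> Sup ?S" by (rule cSup_upper[OF insertI1 bdd])
  ultimately show ?thesis by (simp add: singular_value_def)
qed

text \<open>Small norm on the orthogonal complement of few vectors is stable under sums and
  products, whereas singular values themselves are awkward to compose. The quadratic bound on the
  number of vectors matches the number of labels with l at most n.\<close>

definition exponentially_small :: "'i op \<Rightarrow> bool" where
  "exponentially_small A \<longleftrightarrow> bounded_clinear A \<and> (\<exists>C \<rho> K Y. 0 \<le> C \<and> 0 < \<rho> \<and> \<rho> < 1 \<and>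
     (\<forall>n. finite (Y n) \<and> card (Y n) \<le> K * (n + 1)\<^sup>2 \<and>
        (\<forall>x. (\<forall>y\<in>Y n. cinner y x = 0) \<longrightarrow> norm (A x) \<le> C * \<rho> ^ n * norm x)))"

lemma exponentially_smallI:
  assumes "bounded_clinear A" "0 \<le> C" "0 < \<rho>" "\<rho> < 1"
    "\<And>n. finite (Y n)" "\<And>n. card (Y n) \<le> K * (n + 1)\<^sup>2"
    "\<And>n x. \<forall>y\<in>Y n. cinner y x = 0 \<Longrightarrow> norm (A x) \<le> C * \<rho> ^ n * norm x"
  shows "exponentially_small A"
  unfolding exponentially_small_def using assms by metis

lemma exponentially_small_ideal: "operator_ideal (Collect (exponentially_small :: 'i op \<Rightarrow> bool))"
  unfolding operator_ideal_def
proof (intro conjI ballI allI impI)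
  show "Collect exponentially_small \<subseteq> Collect bounded_clinear" by (auto simp: exponentially_small_def)
  have "exponentially_small (\<lambda>_. 0 :: 'i ell2)"
    unfolding exponentially_small_def
    by (intro conjI bounded_clinear_0 exI[of _ 0] exI[of _ "1/2"] exI[of _ "\<lambda>_. {}"]) auto
  then show "(\<lambda>_. 0 :: 'i ell2) \<in> Collect exponentially_small" by simp
next
  fix A B :: "'i op" assume "A \<in> Collect exponentially_small" "B \<in> Collect exponentially_small"
  then obtain C \<rho> K Y C' \<rho>' K' Y' where A: "bounded_clinear A" "bounded_clinear B" "0 \<le> C" "0 < \<rho>" "\<rho> < 1"
     "\<And>n. finite (Y n)" "\<And>n. card (Y n) \<le> K * (n + 1)\<^sup>2"
     "\<And>n x. \<forall>y\<in>Y n. cinner y x = 0 \<Longrightarrow> norm (A x) \<le> C * \<rho> ^ n * norm x"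
     "0 \<le> C'" "0 < \<rho>'" "\<rho>' < 1"
     "\<And>n. finite (Y' n)" "\<And>n. card (Y' n) \<le> K' * (n + 1)\<^sup>2"
     "\<And>n x. \<forall>y\<in>Y' n. cinner y x = 0 \<Longrightarrow> norm (B x) \<le> C' * \<rho>' ^ n * norm x"
    unfolding exponentially_small_def mem_Collect_eq by metis
  show "(\<lambda>x. A x + B x) \<in> Collect exponentially_small"
  proof (intro CollectI exponentially_smallI[where C = "C + C'" and \<rho> = "max \<rho> \<rho>'"
        and K = "K + K'" and Y = "\<lambda>n. Y n \<union> Y' n"] bounded_clinear_plus A)
    show "0 \<le> C + C'" "0 < max \<rho> \<rho>'" "max \<rho> \<rho>' < 1" using A by auto
    fix n
    show "finite (Y n \<union> Y' n)" using A by simp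
    show "card (Y n \<union> Y' n) \<le> (K + K') * (n + 1)\<^sup>2"
      using card_Un_le[of "Y n" "Y' n"] A(7)[of n] A(13)[of n] by (simp add: algebra_simps)
    fix x assume "\<forall>y\<in>Y n \<union> Y' n. cinner y x = 0"
    then have "norm (A x) \<le> C * \<rho> ^ n * norm x" "norm (B x) \<le> C' * \<rho>' ^ n * norm x"
      using A by auto
    moreover have "C * \<rho> ^ n * norm x \<le> C * max \<rho> \<rho>' ^ n * norm x"
      using A by (intro mult_right_mono mult_left_mono power_mono) auto
    moreover have "C' * \<rho>' ^ n * norm x \<le> C' * max \<rho> \<rho>' ^ n * norm x"
      using A by (intro mult_right_mono mult_left_mono power_mono) auto
    ultimately show "norm (A x + B x) \<le> (C + C') * max \<rho> \<rho>' ^ n * norm x"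
      using norm_triangle_ineq[of "A x" "B x"] by (simp add: algebra_simps)
  qed
next
  fix A B :: "'i op" assume "A \<in> Collect exponentially_small" and B: "bounded_clinear B"
  then obtain C \<rho> K Y where A: "bounded_clinear A" "0 \<le> C" "0 < \<rho>" "\<rho> < 1"
     "\<And>n. finite (Y n)" "\<And>n. card (Y n) \<le> K * (n + 1)\<^sup>2"
     "\<And>n x. \<forall>y\<in>Y n. cinner y x = 0 \<Longrightarrow> norm (A x) \<le> C * \<rho> ^ n * norm x"
    unfolding exponentially_small_def mem_Collect_eq by metis
  obtain L where L: "L > 0" "\<And>x. norm (B x) \<le> L * norm x"
    using bounded_clinear_bounded[OF B] by blast
  show "A \<circ> B \<in> Collect exponentially_small"
  \<comment> \<open>\<open>B x\<close> is orthogonal to \<open>y\<close> exactly if \<open>x\<close>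
    is orthogonal to \<open>cadjoint B y\<close>; this determines the new exceptional
    vectors.\<close>
  proof (intro CollectI exponentially_smallI[where C = "C * L" and \<rho> = \<rho> and K = K
        and Y = "\<lambda>n. cadjoint B ` Y n"] bounded_clinear_comp A B)
    show "0 \<le> C * L" using A L by simp
    fix n
    show "finite (cadjoint B ` Y n)" using A by simp
    show "card (cadjoint B ` Y n) \<le> K * (n + 1)\<^sup>2"
      using card_image_le[of "Y n" "cadjoint B"] A(5,6)[of n] by simp
    fix x assume "\<forall>y\<in>cadjoint B ` Y n. cinner y x = 0"
    then have "norm (A (B x)) \<le> C * \<rho> ^ n * norm (B x)"
      by (intro A) (auto simp: cinner_cadjoint[OF B])
    also have "\<dots> \<le> C * \<rho> ^ n * (L * norm x)" using A L by (intro mult_left_mono) auto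
    finally show "norm ((A \<circ> B) x) \<le> C * L * \<rho> ^ n * norm x" by (simp add: mult_ac)
  qed
  show "B \<circ> A \<in> Collect exponentially_small"
  proof (intro CollectI exponentially_smallI[where C = "C * L" and \<rho> = \<rho> and K = K
        and Y = "Y"] bounded_clinear_comp A B)
    show "0 \<le> C * L" using A L by simp
    fix n
    fix x assume "\<forall>y\<in>Y n. cinner y x = 0"
    then have "L * norm (A x) \<le> L * (C * \<rho> ^ n * norm x)"
      using A(7)[of n x] L by (intro mult_left_mono) auto
    then show "norm ((B \<circ> A) x) \<le> C * L * \<rho> ^ n * norm x"
      using L(2)[of "A x"] by (simp add: mult_ac)
  qed
qed

text \<open>If K(n+1)^2 is at most k, the k-th singular value is at most C \<rho>^n. Taking n near
  sqrt(k/K) gives decay like the exponential of a negative multiple of sqrt k, which beats every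
  power of k.\<close>

lemma exponentially_small_infinitesimal:
  assumes "compact_operator A" "exponentially_small A"
  shows "infinitesimal_of_arbitrary_order A"
  unfolding infinitesimal_of_arbitrary_order_def
proof (intro conjI allI impI)
  fix p :: real assume "p > 0"
  obtain C \<rho> K0 Y where A: "bounded_clinear A" "0 \<le> C" "0 < \<rho>" "\<rho> < 1"
     "\<And>n. finite (Y n)" "\<And>n. card (Y n) \<le> K0 * (n + 1)\<^sup>2"
     "\<And>n x. \<forall>y\<in>Y n. cinner y x = 0 \<Longrightarrow> norm (A x) \<le> C * \<rho> ^ n * norm x"
    using assms(2) unfolding exponentially_small_def by metis
  \<comment> \<open>The successor keeps the constant positive, so that dividing by it is harmless
    when \<open>K0 = 0\<close>.\<close>
  define K where "K = Suc K0"
  have sv: "singular_value A k \<in> {0..C * \<rho> ^ n}" if "K * (n + 1)\<^sup>2 \<le> k" for k n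
  proof -
    have "card (Y n) \<le> k" using A(6)[of n] that by (simp add: K_def)
    then show ?thesis using A by (intro singular_value_le[of A "Y n"]) auto
  qed
  define a where "a = - ln \<rho>"
  have a: "a > 0" "\<rho> = exp (- a)" using A by (auto simp: a_def)
  have bound: "singular_value A k \<in> {0..C * exp (- a * (sqrt (real k / real K) - 2))}" if k: "k \<ge> K" for k
  proof -
    define r where "r = sqrt (real k / real K)"
    \<comment> \<open>The largest \<open>n\<close> with \<open>n + 1\<close> at most
      \<open>r\<close>; rounding costs at most 2 in the exponent.\<close>
    define n where "n = nat \<lfloor>r\<rfloor> - 1"
    have "r \<ge> 1" using k by (simp add: r_def K_def)
    then have n: "real n + 1 \<le> r" "r - 2 \<le> real n" unfolding n_def by linarith+
    have "(real n + 1)\<^sup>2 \<le> r\<^sup>2" using n by (intro power_mono) auto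
    also have "\<dots> = real k / real K" by (simp add: r_def)
    finally have "real K * (real n + 1)\<^sup>2 \<le> real k" by (simp add: K_def field_simps)
    then have "real (K * (n + 1)\<^sup>2) \<le> real k" by (simp add: add.commute)
    then have s: "singular_value A k \<in> {0..C * \<rho> ^ n}" by (intro sv) (simp only: of_nat_le_iff)
    have "\<rho> ^ n = exp (- a * real n)" unfolding a(2) by (simp add: exp_of_nat_mult[symmetric] mult.commute)
    also have "\<dots> \<le> exp (- a * (r - 2))" using a n by (simp add: mult_left_mono)
    finally have "C * \<rho> ^ n \<le> C * exp (- a * (r - 2))" using A by (intro mult_left_mono) auto
    then show ?thesis using s by (simp add: r_def)
  qed
  have Kpos: "real K > 0" by (simp add: K_def)
  have lim: "(\<lambda>k. real k powr p * (C * exp (- a * (sqrt (real k / real K) - 2)))) \<longlonglongrightarrow> 0"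
    using a(1) \<open>p > 0\<close> Kpos by real_asymp
  show "(\<lambda>k. real k powr p * singular_value A k) \<longlonglongrightarrow> 0"
  proof (rule tendsto_sandwich[OF _ _ tendsto_const lim])
    show "\<forall>\<^sub>F k in sequentially. 0 \<le> real k powr p * singular_value A k"
      unfolding eventually_sequentially using bound by (intro exI[of _ K]) auto
    show "\<forall>\<^sub>F k in sequentially. real k powr p * singular_value A k
        \<le> real k powr p * (C * exp (- a * (sqrt (real k / real K) - 2)))"
      unfolding eventually_sequentially using bound by (intro exI[of _ K]) (auto intro!: mult_left_mono)
  qed
qed (rule assms)

section \<open>Ideals generated by one operator\<close>

lemma operator_ideal_Inter: "\<T> \<noteq> {} \<Longrightarrow> (\<And>I. I \<in> \<T> \<Longrightarrow> operator_ideal I) \<Longrightarrow> operator_ideal (\<Inter>\<T>)"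
  unfolding operator_ideal_def by (intro conjI) blast+

lemma operator_ideal_hull:
  assumes "bounded_clinear L"
  shows "operator_ideal (operator_ideal hull {L})"
  unfolding hull_def
proof (rule operator_ideal_Inter)
  have "operator_ideal (Collect (bounded_clinear :: 'a op \<Rightarrow> bool))"
    unfolding operator_ideal_def
    by (auto intro: bounded_clinear_0 bounded_clinear_plus bounded_clinear_comp)
  then show "{t. operator_ideal t \<and> {L} \<subseteq> t} \<noteq> {}" using assms by blast
qed simp

lemma
  assumes "operator_ideal I"
  shows ideal_bounded: "A \<in> I \<Longrightarrow> bounded_clinear A"
    and ideal_zero: "(\<lambda>_. 0) \<in> I"
    and ideal_plus: "A \<in> I \<Longrightarrow> B \<in> I \<Longrightarrow> (\<lambda>x. A x + B x) \<in> I"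
    and ideal_right: "A \<in> I \<Longrightarrow> bounded_clinear B \<Longrightarrow> (\<lambda>x. A (B x)) \<in> I"
    and ideal_left: "A \<in> I \<Longrightarrow> bounded_clinear B \<Longrightarrow> (\<lambda>x. B (A x)) \<in> I"
  using assms unfolding operator_ideal_def o_def by blast+

lemma ideal_cmult: "operator_ideal I \<Longrightarrow> A \<in> I \<Longrightarrow> (\<lambda>x. c *\<^sub>C A x) \<in> I"
  using ideal_left[OF _ _ bounded_clinear_scaleC] by blast

section \<open>Weighted permutations of the spinor basis\<close>

type_synonym label = "real \<times> real \<times> real"

text \<open>Labels become a single argument, and the vector is 0 at triples that are not labels.
  Shifts can then act on all real triples, and missing vectors need no separate treatment.\<close>

definition bv :: "label \<Rightarrow> spinor" where
  "bv p = (if p \<in> spin_labels then ket (Abs_spin_index p) else 0)"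

definition cf :: "spinor \<Rightarrow> label \<Rightarrow> complex" where
  "cf x p = (if p \<in> spin_labels then coeff x (Abs_spin_index p) else 0)"

lemma basis_vec_eq: "basis_vec l m N = bv (l, m, N)"
  by (simp add: basis_vec_def bv_def)

lemma bv_outside: "p \<notin> spin_labels \<Longrightarrow> bv p = 0"
  by (simp add: bv_def)

lemma cf_outside: "p \<notin> spin_labels \<Longrightarrow> cf x p = 0"
  by (simp add: cf_def)

lemma cf_eqI: "(\<And>p. p \<in> spin_labels \<Longrightarrow> cf x p = cf y p) \<Longrightarrow> x = y"
  by (rule ell2_eqI) (metis Rep_spin_index Rep_spin_index_inverse cf_def)

lemma coeff_cf: "coeff x i = cf x (Rep_spin_index i)"
  by (simp add: cf_def Rep_spin_index Rep_spin_index_inverse)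

lemma cf_simps [simp]:
  "cf 0 p = 0" "cf (x + y) p = cf x p + cf y p" "cf (x - y) p = cf x p - cf y p"
  "cf (- x) p = - cf x p" "cf (c *\<^sub>C x) p = c * cf x p" "cf (r *\<^sub>R x) p = of_real r * cf x p"
  by (auto simp: cf_def)

lemma cf_sum: "cf (sum f S) p = (\<Sum>a\<in>S. cf (f a) p)"
  by (induction S rule: infinite_finite_induct) auto

lemma cf_bv: "p \<in> spin_labels \<Longrightarrow> cf (bv p) r = (if r = p then 1 else 0)"
  by (auto simp: cf_def bv_def Abs_spin_index_inject)

lemma cf_bv': "cf (bv p) r = (if r = p \<and> p \<in> spin_labels then 1 else 0)"
  by (cases "p \<in> spin_labels") (auto simp: cf_bv bv_outside)

lemma cinner_bv: "cinner (bv p) x = cf x p"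
  by (simp add: bv_def cf_def)

lemma cf_le_norm: "cmod (cf x p) \<le> norm x"
  by (simp add: cf_def coeff_le_norm)

lemma on_basis_eq: "on_basis g x = (\<Sum>\<^sub>\<infinity>i. coeff x i *\<^sub>C (\<lambda>(l, m, N). g l m N) (Rep_spin_index i))"
  by (simp add: on_basis_def)

subsection \<open>Finite combinations of the basis vectors\<close>

abbreviation "W \<equiv> algebraic_spinors"

lemma algebraic_spinors_eq: "W = ell2.span (bv ` spin_labels)"
  unfolding algebraic_spinors_def basis_vec_eq by (rule arg_cong[where f = ell2.span]) auto

lemma bv_in_W [simp]: "bv p \<in> W"
  by (cases "p \<in> spin_labels") (auto simp: algebraic_spinors_eq bv_outside ell2.span_base ell2.span_zero)

lemma W_closed [simp]:
  "0 \<in> W" "x \<in> W \<Longrightarrow> y \<in> W \<Longrightarrow> x + y \<in> W" "x \<in> W \<Longrightarrow> c *\<^sub>C x \<in> W" "x \<in> W \<Longrightarrow> r *\<^sub>R x \<in> W"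
  "x \<in> W \<Longrightarrow> y \<in> W \<Longrightarrow> x - y \<in> W" "x \<in> W \<Longrightarrow> - x \<in> W"
  unfolding algebraic_spinors_eq
  by (auto intro: ell2.span_zero ell2.span_add ell2.span_scale ell2.span_diff ell2.span_neg
      simp: scaleR_scaleC)

lemma W_sum: "(\<And>a. a \<in> S \<Longrightarrow> f a \<in> W) \<Longrightarrow> sum f S \<in> W"
  unfolding algebraic_spinors_eq by (rule ell2.span_sum)

lemma W_induct [consumes 1, case_names zero bv add scale]:
  assumes "x \<in> W" "P 0" "\<And>p. p \<in> spin_labels \<Longrightarrow> P (bv p)"
    "\<And>x y. x \<in> W \<Longrightarrow> y \<in> W \<Longrightarrow> P x \<Longrightarrow> P y \<Longrightarrow> P (x + y)" "\<And>c x. x \<in> W \<Longrightarrow> P x \<Longrightarrow> P (c *\<^sub>C x)"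
  shows "P x"
proof -
  have "x \<in> W \<and> P x"
    by (rule ell2.span_induct_alt[OF assms(1)[unfolded algebraic_spinors_eq]])
      (use assms in auto)
  then show ?thesis ..
qed

lemma W_finite_support: "x \<in> W \<Longrightarrow> finite {i. coeff x i \<noteq> 0}"
proof (induction rule: W_induct)
  case (bv p)
  have "{i. coeff (bv p) i \<noteq> 0} \<subseteq> {Abs_spin_index p}" by (auto simp: bv_def)
  then show ?case by (rule finite_subset) simp
next
  case (add x y)
  have "{i. coeff (x + y) i \<noteq> 0} \<subseteq> {i. coeff x i \<noteq> 0} \<union> {i. coeff y i \<noteq> 0}" by auto
  then show ?case using add by (meson finite_Un finite_subset)
next
  case (scale c x)
  have "{i. coeff (c *\<^sub>C x) i \<noteq> 0} \<subseteq> {i. coeff x i \<noteq> 0}" by auto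
  then show ?case using scale finite_subset by blast
qed simp

lemma on_basis_finite:
  assumes "finite F" "\<And>i. i \<notin> F \<Longrightarrow> coeff x i = 0"
  shows "on_basis g x = (\<Sum>i\<in>F. coeff x i *\<^sub>C (\<lambda>(l, m, N). g l m N) (Rep_spin_index i))"
proof -
  have "on_basis g x = (\<Sum>\<^sub>\<infinity>i\<in>F. coeff x i *\<^sub>C (\<lambda>(l, m, N). g l m N) (Rep_spin_index i))"
    unfolding on_basis_eq by (rule infsum_cong_neutral) (use assms in auto)
  then show ?thesis using assms(1) by simp
qed

text \<open>On \<open>W\<close> the defining sum is finite. For other vectors it may fail to
  converge, because the images of the basis vectors can be unbounded; hence the restriction.\<close>

lemma on_basis_add:
  assumes "x \<in> W" "y \<in> W"
  shows "on_basis g (x + y) = on_basis g x + on_basis g y"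
proof -
  let ?F = "{i. coeff x i \<noteq> 0} \<union> {i. coeff y i \<noteq> 0}"
  have F: "finite ?F" using assms by (simp add: W_finite_support)
  show ?thesis
    by (subst (1 2 3) on_basis_finite[OF F])
      (simp_all add: ell2.scale_left_distrib sum.distrib)
qed

lemma on_basis_scale:
  assumes "x \<in> W"
  shows "on_basis g (c *\<^sub>C x) = c *\<^sub>C on_basis g x"
proof -
  have F: "finite {i. coeff x i \<noteq> 0}" using assms by (rule W_finite_support)
  show ?thesis
    by (subst (1 2) on_basis_finite[OF F]) (simp_all add: ell2.scale_sum_right)
qed

lemma on_basis_zero [simp]: "on_basis g 0 = 0"
  using on_basis_finite[of "{}" 0 g] by simp

lemma on_basis_bv: "(l, m, N) \<in> spin_labels \<Longrightarrow> on_basis g (bv (l, m, N)) = g l m N"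
  using on_basis_basis_vec(1) by (simp add: basis_vec_eq)

lemma on_basis_in_W:
  assumes "x \<in> W" "\<And>l m N. (l, m, N) \<in> spin_labels \<Longrightarrow> g l m N \<in> W"
  shows "on_basis g x \<in> W"
  using assms(1)
proof (induction rule: W_induct)
  case (bv p)
  obtain l m N where "p = (l, m, N)" by (cases p)
  with bv show ?case by (simp add: on_basis_bv assms(2))
qed (auto simp: on_basis_add on_basis_scale)

definition truncate :: "label set \<Rightarrow> spinor \<Rightarrow> spinor" where
  "truncate F x = (\<Sum>p\<in>F. cf x p *\<^sub>C bv p)"

lemma truncate_in_W: "truncate F x \<in> W"
  unfolding truncate_def by (intro W_sum W_closed bv_in_W)

lemma cf_truncate: "finite F \<Longrightarrow> cf (truncate F x) p = (if p \<in> F then cf x p else 0)"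
proof -
  assume F: "finite F"
  have "cf (truncate F x) p = (\<Sum>r\<in>F. if r = p then cf x p else 0)"
    unfolding truncate_def cf_sum
    by (rule sum.cong[OF refl]) (auto simp: cf_bv' cf_outside)
  then show ?thesis using F by simp
qed

text \<open>Closeness is claimed for all finite supersets of \<open>F\<close>, so that one set can
  be chosen for two vectors at once and enlarged to be invariant under an involution.\<close>

lemma truncate_tendsto:
  fixes x y :: spinor
  assumes "e > 0"
  shows "\<exists>F. finite F \<and> (\<forall>G. finite G \<longrightarrow> F \<subseteq> G \<longrightarrow> dist (truncate G x) x < e)"
proof -
  obtain I where I: "finite I"
    "\<And>J. finite J \<Longrightarrow> I \<subseteq> J \<Longrightarrow> dist (\<Sum>i\<in>J. coeff x i *\<^sub>C ket i) x < e"
  proof -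
    have "\<forall>\<^sub>F J in finite_subsets_at_top UNIV. dist (\<Sum>i\<in>J. coeff x i *\<^sub>C ket i) x < e"
      using has_sum_kets[of x] assms unfolding has_sum_def tendsto_iff by blast
    then show ?thesis using that unfolding eventually_finite_subsets_at_top by auto
  qed
  have "dist (truncate G x) x < e" if G: "finite G" "Rep_spin_index ` I \<subseteq> G" for G
  proof -
    have "truncate G x = truncate (G \<inter> spin_labels) x"
      by (rule cf_eqI) (use G in \<open>auto simp: cf_truncate\<close>)
    also have "\<dots> = (\<Sum>i\<in>Abs_spin_index ` (G \<inter> spin_labels). coeff x i *\<^sub>C ket i)"
    proof (rule ell2_eqI)
      fix i
      have fin: "finite (Abs_spin_index ` (G \<inter> spin_labels))" using G by simp
      have "i \<in> Abs_spin_index ` (G \<inter> spin_labels) \<longleftrightarrow> Rep_spin_index i \<in> G"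
        by (metis (no_types, lifting) Abs_spin_index_inverse IntE IntI Rep_spin_index
        Rep_spin_index_inverse image_iff)
      then show "coeff (truncate (G \<inter> spin_labels) x) i
        = coeff (\<Sum>i\<in>Abs_spin_index ` (G \<inter> spin_labels). coeff x i *\<^sub>C ket i) i"
        unfolding coeff_finite_combination[OF fin]
        using G by (simp add: coeff_cf cf_truncate Rep_spin_index)
    qed
    finally have eq: "truncate G x = (\<Sum>i\<in>Abs_spin_index ` (G \<inter> spin_labels). coeff x i *\<^sub>C ket i)" .
    have "I \<subseteq> Abs_spin_index ` (G \<inter> spin_labels)"
    proof
      fix i assume "i \<in> I"
      then have "Rep_spin_index i \<in> G \<inter> spin_labels" using G Rep_spin_index by auto
      then show "i \<in> Abs_spin_index ` (G \<inter> spin_labels)"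
        by (rule rev_image_eqI) (simp add: Rep_spin_index_inverse)
    qed
    then show ?thesis unfolding eq using G by (intro I) auto
  qed
  then show ?thesis using I(1) by (intro exI[of _ "Rep_spin_index ` I"]) auto
qed

lemma W_dense: "closure W = UNIV"
proof -
  have "x \<in> closure W" for x
    unfolding closure_approachable using truncate_tendsto[of _ x] truncate_in_W by blast
  then show ?thesis by blast
qed

lemma bounded_clinear_eq_on_W:
  assumes "bounded_clinear A" "bounded_clinear B" "\<And>p. p \<in> spin_labels \<Longrightarrow> A (bv p) = B (bv p)"
  shows "A = B"
proof (rule bounded_clinear_eqI[OF assms(1,2)])
  fix i
  show "A (ket i) = B (ket i)"
    using assms(3)[of "Rep_spin_index i"] by (simp add: bv_def Rep_spin_index Rep_spin_index_inverse)
qed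

subsection \<open>Weighted permutations\<close>

text \<open>Invertibility is required on the whole type, not on the labels only: a shift is
  bijective on real triples, while leaving the range of labels is accounted for by \<open>bv\<close>
  being 0 there.\<close>

definition inverse_maps :: "('a \<Rightarrow> 'a) \<Rightarrow> ('a \<Rightarrow> 'a) \<Rightarrow> bool" where
  "inverse_maps \<sigma> \<tau> \<longleftrightarrow> (\<forall>p. \<tau> (\<sigma> p) = p) \<and> (\<forall>p. \<sigma> (\<tau> p) = p)"

definition wmap :: "(label \<Rightarrow> real) \<Rightarrow> (label \<Rightarrow> label) \<Rightarrow> spinor \<Rightarrow> spinor" where
  "wmap c \<sigma> = on_basis (\<lambda>l m N. c (l, m, N) *\<^sub>R bv (\<sigma> (l, m, N)))"

text \<open>Weights are compared only between existing labels; elsewhere they multiply the zero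
  vector and may be arbitrary.\<close>

definition weight_bounded :: "(label \<Rightarrow> real) \<Rightarrow> (label \<Rightarrow> label) \<Rightarrow> real \<Rightarrow> bool" where
  "weight_bounded c \<sigma> C \<longleftrightarrow> 0 \<le> C \<and> (\<forall>p\<in>spin_labels. \<sigma> p \<in> spin_labels \<longrightarrow> \<bar>c p\<bar> \<le> C)"

lemma wmap_bv: "p \<in> spin_labels \<Longrightarrow> wmap c \<sigma> (bv p) = c p *\<^sub>R bv (\<sigma> p)"
  by (cases p) (simp add: wmap_def on_basis_bv)

text \<open>An instance of \<open>weighted_injection\<close> on the set \<open>S\<close> of indices
  whose image label exists. Outside \<open>S\<close> the summand is 0 because \<open>bv\<close>
  is.\<close>

lemma
  assumes inv: "inverse_maps \<sigma> \<tau>" and c: "weight_bounded c \<sigma> C"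
  shows wmap_has_sum: "((\<lambda>i. coeff x i *\<^sub>C (\<lambda>p. c p *\<^sub>R bv (\<sigma> p)) (Rep_spin_index i)) has_sum wmap c \<sigma> x) UNIV"
    and norm_wmap: "norm (wmap c \<sigma> x) \<le> C * norm x"
    and cf_wmap: "p \<in> spin_labels \<Longrightarrow> cf (wmap c \<sigma> x) p = of_real (c (\<tau> p)) * cf x (\<tau> p)"
proof -
  define S where "S = {i. \<sigma> (Rep_spin_index i) \<in> spin_labels}"
  define s where "s i = Abs_spin_index (\<sigma> (Rep_spin_index i))" for i
  have inj: "inj_on s S"
  proof (rule inj_onI)
    fix i j assume "i \<in> S" "j \<in> S" "s i = s j"
    then have "\<sigma> (Rep_spin_index i) = \<sigma> (Rep_spin_index j)" by (simp add: S_def s_def Abs_spin_index_inject)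
    then have "Rep_spin_index i = Rep_spin_index j" using inv by (metis inverse_maps_def)
    then show "i = j" by (simp add: Rep_spin_index_inject)
  qed
  have "\<exists>y. ((\<lambda>i. coeff x i *\<^sub>C (if i \<in> S then complex_of_real (c (Rep_spin_index i)) *\<^sub>C ket (s i) else 0)) has_sum y) UNIV
    \<and> norm y \<le> C * norm x
    \<and> (\<forall>i\<in>S. coeff y (s i) = complex_of_real (c (Rep_spin_index i)) * coeff x i) \<and> (\<forall>j. j \<notin> s ` S \<longrightarrow> coeff y j = 0)"
    by (rule weighted_injection[OF inj])
      (use c in \<open>auto simp: weight_bounded_def S_def Rep_spin_index\<close>)
  then obtain y where y: "((\<lambda>i. coeff x i *\<^sub>C (if i \<in> S then complex_of_real (c (Rep_spin_index i)) *\<^sub>C ket (s i) else 0)) has_sum y) UNIV"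
    "norm y \<le> C * norm x"
    "\<And>i. i \<in> S \<Longrightarrow> coeff y (s i) = complex_of_real (c (Rep_spin_index i)) * coeff x i"
    "\<And>j. j \<notin> s ` S \<Longrightarrow> coeff y j = 0"
    by blast
  have "(if i \<in> S then complex_of_real (c (Rep_spin_index i)) *\<^sub>C ket (s i) else 0)
      = (\<lambda>p. c p *\<^sub>R bv (\<sigma> p)) (Rep_spin_index i)" for i
    by (simp add: S_def bv_def s_def scaleR_scaleC)
  with y(1) have hs: "((\<lambda>i. coeff x i *\<^sub>C (\<lambda>p. c p *\<^sub>R bv (\<sigma> p)) (Rep_spin_index i)) has_sum y) UNIV"
    by simp
  then have w: "wmap c \<sigma> x = y"
    unfolding wmap_def on_basis_eq by (simp add: infsumI case_prod_unfold)
  show "((\<lambda>i. coeff x i *\<^sub>C (\<lambda>p. c p *\<^sub>R bv (\<sigma> p)) (Rep_spin_index i)) has_sum wmap c \<sigma> x) UNIV"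
    unfolding w by (rule hs)
  show "norm (wmap c \<sigma> x) \<le> C * norm x" unfolding w by (rule y)
  assume p: "p \<in> spin_labels"
  have \<sigma>: "\<sigma> (\<tau> r) = r" "\<tau> (\<sigma> r) = r" for r using inv unfolding inverse_maps_def by blast+
  show "cf (wmap c \<sigma> x) p = of_real (c (\<tau> p)) * cf x (\<tau> p)"
  proof (cases "\<tau> p \<in> spin_labels")
    case True
    let ?i = "Abs_spin_index (\<tau> p)"
    have "?i \<in> S" "s ?i = Abs_spin_index p"
      using True p \<sigma> by (simp_all add: S_def s_def Abs_spin_index_inverse)
    then show ?thesis using y(3)[of ?i] True p by (simp add: w cf_def Abs_spin_index_inverse)
  next
    case False
    have "Abs_spin_index p \<notin> s ` S"
    proof
      assume "Abs_spin_index p \<in> s ` S"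
      then obtain i where "i \<in> S" "Abs_spin_index p = s i" by blast
      then have "p = \<sigma> (Rep_spin_index i)" using p by (simp add: S_def s_def Abs_spin_index_inject)
      then show False using False \<sigma> Rep_spin_index by simp
    qed
    then show ?thesis using y(4) p False by (simp add: w cf_def)
  qed
qed

lemma bounded_clinear_wmap:
  assumes "inverse_maps \<sigma> \<tau>" "weight_bounded c \<sigma> C"
  shows "bounded_clinear (wmap c \<sigma>)"
proof (rule bounded_clinearI)
  show "norm (wmap c \<sigma> x) \<le> C * norm x" for x by (rule norm_wmap[OF assms])
  show "wmap c \<sigma> (x + y) = wmap c \<sigma> x + wmap c \<sigma> y" for x y
    by (rule cf_eqI) (simp add: cf_wmap[OF assms] algebra_simps)
  show "wmap c \<sigma> (r *\<^sub>C x) = r *\<^sub>C wmap c \<sigma> x" for r x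
    by (rule cf_eqI) (simp add: cf_wmap[OF assms])
qed

definition shift :: "real \<Rightarrow> real \<Rightarrow> real \<Rightarrow> label \<Rightarrow> label" where
  "shift j i s = (\<lambda>(l, m, N). (l + j, m + i, s * N))"

lemma inverse_maps_shift: "s * s = 1 \<Longrightarrow> inverse_maps (shift j i s) (shift (- j) (- i) s)"
  by (auto simp: inverse_maps_def shift_def simp flip: mult.assoc)

lemma inverse_maps_id: "inverse_maps id id"
  by (simp add: inverse_maps_def)

definition conj_spinor :: "spinor \<Rightarrow> spinor" where
  "conj_spinor x = Abs_ell2 (\<lambda>i. cnj (coeff x i))"

lemma coeff_conj_spinor: "coeff (conj_spinor x) i = cnj (coeff x i)"
  unfolding conj_spinor_def by (subst Abs_ell2_coeff) (simp_all add: summable_coeff)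

lemma cf_conj_spinor [simp]: "cf (conj_spinor x) p = cnj (cf x p)"
  by (simp add: cf_def coeff_conj_spinor)

lemma antilinear_on_basis_eq: "antilinear_on_basis g x = on_basis g (conj_spinor x)"
  by (simp add: antilinear_on_basis_def on_basis_def coeff_conj_spinor)

text \<open>There are at most n + 1 values of l, at most 2n + 2 values of m for each, and two
  signs.\<close>

lemma finite_labels_le:
  "finite {p \<in> spin_labels. fst p \<le> real n}" "card {p \<in> spin_labels. fst p \<le> real n} \<le> 4 * (n + 1)\<^sup>2"
proof -
  let ?f = "\<lambda>(k :: nat, j :: nat, b :: bool). (real k + 1/2, - (real k + 1/2) + real j, if b then 1/2 else - (1/2) :: real)"
  let ?S = "{..n} \<times> {..2 * n + 1} \<times> (UNIV :: bool set)"
  have sub: "{p \<in> spin_labels. fst p \<le> real n} \<subseteq> ?f ` ?S"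
  proof
    fix p assume "p \<in> {p \<in> spin_labels. fst p \<le> real n}"
    then obtain l m N k j where p: "p = (l, m, N)" "l = real k + 1/2" "m = - l + real j" "m \<le> l"
      "N = 1/2 \<or> N = - (1/2)" "l \<le> real n" by (auto simp: spin_labels_def)
    then have "real j \<le> 2 * real n" "real k \<le> real n" by linarith+
    then have "j \<le> 2 * n" "k \<le> n" by linarith+
    then have "(k, j, N = 1/2) \<in> ?S" by simp
    moreover have "p = ?f (k, j, N = 1/2)" using p by auto
    ultimately show "p \<in> ?f ` ?S" by blast
  qed
  then show "finite {p \<in> spin_labels. fst p \<le> real n}" by (rule finite_subset) simp
  have "card {p \<in> spin_labels. fst p \<le> real n} \<le> card ?S"
    by (rule order_trans[OF card_mono[OF _ sub] card_image_le]) auto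
  then show "card {p \<in> spin_labels. fst p \<le> real n} \<le> 4 * (n + 1)\<^sup>2"
    by (simp add: card_cartesian_product power2_eq_square)
qed

text \<open>Weights at labels where \<open>x\<close> has no component may be replaced by 0, which
  leaves a weight function bounded by \<open>e\<close>.\<close>

lemma norm_wmap_outside:
  assumes "inverse_maps \<sigma> \<tau>" "weight_bounded c \<sigma> C" "0 \<le> e"
    and "\<And>p. p \<in> spin_labels \<Longrightarrow> cf x p \<noteq> 0 \<Longrightarrow> \<bar>c p\<bar> \<le> e"
  shows "norm (wmap c \<sigma> x) \<le> e * norm x"
proof -
  let ?d = "\<lambda>p. if cf x p = 0 then 0 else c p"
  have d: "weight_bounded ?d \<sigma> e" using assms by (auto simp: weight_bounded_def)
  have "wmap c \<sigma> x = wmap ?d \<sigma> x"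
    by (rule cf_eqI) (simp add: cf_wmap[OF assms(1,2)] cf_wmap[OF assms(1) d])
  then show ?thesis using norm_wmap[OF assms(1) d] by simp
qed

lemma compact_wmap:
  assumes "inverse_maps \<sigma> \<tau>" "weight_bounded c \<sigma> C"
    and small: "\<And>e. e > 0 \<Longrightarrow> \<exists>n :: nat. \<forall>p\<in>spin_labels. fst p > real n \<longrightarrow> \<bar>c p\<bar> \<le> e"
  shows "compact_operator (wmap c \<sigma>)"
proof (rule compact_operatorI[OF bounded_clinear_wmap[OF assms(1,2)]])
  fix e :: real assume "e > 0"
  then obtain n :: nat where n: "\<And>p. p \<in> spin_labels \<Longrightarrow> fst p > real n \<Longrightarrow> \<bar>c p\<bar> \<le> e"
    using small by blast
  let ?F = "Abs_spin_index ` {p \<in> spin_labels. fst p \<le> real n}"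
  have "norm (wmap c \<sigma> x) \<le> e * norm x" if "\<forall>i\<in>?F. coeff x i = 0" for x
  proof (rule norm_wmap_outside[OF assms(1,2)])
    show "0 \<le> e" using \<open>e > 0\<close> by simp
    fix p assume "p \<in> spin_labels" "cf x p \<noteq> 0"
    then have "\<not> fst p \<le> real n" using that by (auto simp: cf_def)
    then have "fst p > real n" by simp
    then show "\<bar>c p\<bar> \<le> e" using n \<open>p \<in> spin_labels\<close> by blast
  qed
  then show "\<exists>F. finite F \<and> (\<forall>x. (\<forall>i\<in>F. coeff x i = 0) \<longrightarrow> norm (wmap c \<sigma> x) \<le> e * norm x)"
    using finite_labels_le(1) by (intro exI[of _ ?F]) auto
qed

subsection \<open>The ideal generated by a power of the length operator\<close>

context
  fixes q \<alpha> :: real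
  assumes q: "0 < q" "q < 1" and \<alpha>: "0 < \<alpha>"
begin

abbreviation L_weight :: "label \<Rightarrow> real" where
  "L_weight \<equiv> \<lambda>p. (q powr fst p) powr \<alpha>"

lemma L_pow_eq: "L_pow q \<alpha> = wmap L_weight id"
  by (simp add: L_pow_def wmap_def basis_vec_eq)

lemma spin_labels_pos: "p \<in> spin_labels \<Longrightarrow> 1/2 \<le> fst p"
  by (auto simp: spin_labels_def)

lemma L_weight_antimono: "l \<le> fst p \<Longrightarrow> L_weight p \<le> (q powr l) powr \<alpha>"
  using q \<alpha> by (intro powr_mono2) (auto simp: powr_mono')

lemma L_weight_bounded: "weight_bounded L_weight id 1"
proof -
  have "\<bar>L_weight p\<bar> \<le> 1" if "p \<in> spin_labels" for p
    using L_weight_antimono[of 0 p] spin_labels_pos[OF that] q by simp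
  then show ?thesis by (simp add: weight_bounded_def)
qed

lemma L_power: "(q powr real n) powr \<alpha> = (q powr \<alpha>) ^ n"
  using q by (simp add: powr_powr mult.commute flip: powr_realpow)

lemma q_powr_\<alpha>: "0 < q powr \<alpha>" "q powr \<alpha> < 1"
  using q \<alpha> powr_less_mono'[of q 0 \<alpha>] by auto

lemma L_pow_bounded: "bounded_clinear (L_pow q \<alpha>)"
  unfolding L_pow_eq by (rule bounded_clinear_wmap[OF inverse_maps_id L_weight_bounded])

lemma L_pow_compact: "compact_operator (L_pow q \<alpha>)"
  unfolding L_pow_eq
proof (rule compact_wmap[OF inverse_maps_id L_weight_bounded])
  fix e :: real assume "e > 0"
  then obtain n where "(q powr \<alpha>) ^ n < e" using real_arch_pow_inv[OF _ q_powr_\<alpha>(2)] by blast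
  then have "\<bar>L_weight p\<bar> \<le> e" if "fst p > real n" for p
    using L_weight_antimono[of "real n" p] that by (simp add: L_power)
  then show "\<exists>n :: nat. \<forall>p\<in>spin_labels. fst p > real n \<longrightarrow> \<bar>L_weight p\<bar> \<le> e" by blast
qed

text \<open>Orthogonality to the basis vectors with l at most n leaves only eigenvalues q^(\<alpha>
  l) below (q^\<alpha>)^n.\<close>

lemma L_pow_exponentially_small: "exponentially_small (L_pow q \<alpha>)"
proof (rule exponentially_smallI[where C = 1 and \<rho> = "q powr \<alpha>" and K = 4
      and Y = "\<lambda>n. bv ` {p \<in> spin_labels. fst p \<le> real n}"])
  show "bounded_clinear (L_pow q \<alpha>)" by (rule L_pow_bounded)
  fix n
  show "finite (bv ` {p \<in> spin_labels. fst p \<le> real n})" using finite_labels_le(1) by simp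
  show "card (bv ` {p \<in> spin_labels. fst p \<le> real n}) \<le> 4 * (n + 1)\<^sup>2"
    using finite_labels_le card_image_le order_trans by blast
  fix x assume x: "\<forall>y\<in>bv ` {p \<in> spin_labels. fst p \<le> real n}. cinner y x = 0"
  show "norm (L_pow q \<alpha> x) \<le> 1 * (q powr \<alpha>) ^ n * norm x"
    unfolding L_pow_eq mult_1
  proof (rule norm_wmap_outside[OF inverse_maps_id L_weight_bounded])
    fix p assume "p \<in> spin_labels" "cf x p \<noteq> 0"
    then have "\<not> fst p \<le> real n" using x by (auto simp: cinner_bv)
    then have "real n \<le> fst p" by simp
    then show "\<bar>L_weight p\<bar> \<le> (q powr \<alpha>) ^ n" using L_weight_antimono[of "real n" p] by (simp add: L_power)
  qed simp
qed (use q_powr_\<alpha> in auto)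

abbreviation "L_ideal \<equiv> operator_ideal hull {L_pow q \<alpha>}"

lemma L_ideal: "operator_ideal L_ideal"
  by (rule operator_ideal_hull[OF L_pow_bounded])

text \<open>Compactness and exponential smallness each define an ideal containing the generator, so
  both properties pass to the hull without a description of its elements.\<close>

lemma L_ideal_infinitesimal: "T \<in> L_ideal \<Longrightarrow> infinitesimal_of_arbitrary_order T"
proof (rule exponentially_small_infinitesimal)
  assume T: "T \<in> L_ideal"
  have "L_ideal \<subseteq> Collect compact_operator"
    by (rule hull_minimal) (simp_all add: compact_operator_ideal L_pow_compact)
  then show "compact_operator T" using T by blast
  have "L_ideal \<subseteq> Collect exponentially_small"
    by (rule hull_minimal) (simp_all add: exponentially_small_ideal L_pow_exponentially_small)
  then show "exponentially_small T" using T by blast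
qed

text \<open>Dividing the weights by those of the generator leaves a bounded weighted permutation, so
  the operator factors through \<open>L_pow q \<alpha>\<close>. All memberships in the ideal are
  eventually obtained in this way.\<close>

lemma wmap_in_L_ideal:
  assumes inv: "inverse_maps \<sigma> \<tau>" and c: "\<And>p. p \<in> spin_labels \<Longrightarrow> \<sigma> p \<in> spin_labels \<Longrightarrow> \<bar>c p\<bar> \<le> C * L_weight p"
    and C: "0 \<le> C"
  shows "wmap c \<sigma> \<in> L_ideal"
proof -
  let ?d = "\<lambda>p. c p / L_weight p"
  have pos: "L_weight p > 0" for p using q by simp
  have d: "weight_bounded ?d \<sigma> C"
    unfolding weight_bounded_def
  proof (intro conjI ballI impI)
    fix p assume "p \<in> spin_labels" "\<sigma> p \<in> spin_labels"
    then have "\<bar>c p\<bar> \<le> C * L_weight p" by (rule c)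
    then show "\<bar>?d p\<bar> \<le> C" using pos[of p] by (simp add: abs_divide divide_le_eq)
  qed (rule C)
  have L: "L_weight p \<le> 1" if "p \<in> spin_labels" for p
    using L_weight_bounded that by (auto simp: weight_bounded_def)
  have c': "weight_bounded c \<sigma> C"
    unfolding weight_bounded_def
  proof (intro conjI ballI impI)
    fix p assume p: "p \<in> spin_labels" "\<sigma> p \<in> spin_labels"
    have "C * L_weight p \<le> C * 1" using L[OF p(1)] C by (intro mult_left_mono)
    then show "\<bar>c p\<bar> \<le> C" using c[OF p] by simp
  qed (rule C)
  have "wmap c \<sigma> = (\<lambda>x. wmap ?d \<sigma> (L_pow q \<alpha> x))"
  proof (rule ext, rule cf_eqI)
    fix x p assume p: "p \<in> spin_labels"
    show "cf (wmap c \<sigma> x) p = cf (wmap ?d \<sigma> (L_pow q \<alpha> x)) p"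
    proof (cases "\<tau> p \<in> spin_labels")
      case True
      have "c r = ?d r * L_weight r" for r using pos[of r] by simp
      then have "complex_of_real (c (\<tau> p)) = of_real (?d (\<tau> p)) * of_real (L_weight (\<tau> p))"
        unfolding of_real_mult[symmetric] by (simp only:)
      then show ?thesis unfolding L_pow_eq cf_wmap[OF inv c' p] cf_wmap[OF inv d p]
        cf_wmap[OF inverse_maps_id L_weight_bounded True] by (simp only: mult.assoc id_apply)
    next
      case False
      then show ?thesis unfolding cf_wmap[OF inv c' p] cf_wmap[OF inv d p] by (simp add: cf_outside)
    qed
  qed
  then show ?thesis
    using ideal_left[OF L_ideal hull_inc[of "L_pow q \<alpha>"] bounded_clinear_wmap[OF inv d]] by simp
qed

end

section \<open>The Dirac operator, the grading and the conjugation\<close>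

definition label_involution :: "(label \<Rightarrow> label) \<Rightarrow> bool" where
  "label_involution \<sigma> \<longleftrightarrow> inverse_maps \<sigma> \<sigma> \<and> (\<forall>p. \<sigma> p \<in> spin_labels \<longleftrightarrow> p \<in> spin_labels)"

lemma
  assumes "label_involution \<sigma>"
  shows label_involution_inv: "inverse_maps \<sigma> \<sigma>"
    and label_involution_twice: "\<sigma> (\<sigma> p) = p"
    and label_involution_iff: "\<sigma> p \<in> spin_labels \<longleftrightarrow> p \<in> spin_labels"
  using assms unfolding label_involution_def inverse_maps_def by blast+

definition flip :: "label \<Rightarrow> label" where "flip = (\<lambda>(l, m, N). (l, m, - N))"

definition reflect :: "label \<Rightarrow> label" where "reflect = (\<lambda>(l, m, N). (l, - m, - N))"

lemma spin_labels_flip: "(l, m, - N) \<in> spin_labels \<longleftrightarrow> (l, m, N) \<in> spin_labels"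
proof -
  have "- N \<in> {1/2, - 1/2} \<longleftrightarrow> N \<in> {1/2, - 1/2 :: real}" by (simp add: minus_equation_iff[of N]) linarith
  then show ?thesis unfolding spin_labels_def by simp
qed

lemma spin_labels_reflect: "(l, - m, N) \<in> spin_labels \<longleftrightarrow> (l, m, N) \<in> spin_labels"
proof -
  have "(l, - m, N) \<in> spin_labels" if lab: "(l, m, N) \<in> spin_labels" for m
  proof -
    from lab obtain n j :: nat where *: "l = real n + 1/2" "m = - l + real j" "m \<le> l"
      and N: "N \<in> {1/2, - 1/2}" unfolding spin_labels_def by blast
    then have "real j \<le> real (2 * n + 1)" by simp
    then have "j \<le> 2 * n + 1" by (simp only: of_nat_le_iff)
    then have "- m = - l + real (2 * n + 1 - j)" using * by (simp add: of_nat_diff)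
    then have "\<exists>j::nat. - m = - l + real j" by blast
    moreover have "- m \<le> l" using * by simp
    ultimately show ?thesis using * N unfolding spin_labels_def by blast
  qed
  from this[of m] this[of "- m"] show ?thesis by auto
qed

lemma label_involution_flip: "label_involution flip"
  by (auto simp: label_involution_def inverse_maps_def flip_def spin_labels_flip)

lemma label_involution_reflect: "label_involution reflect"
  by (auto simp: label_involution_def inverse_maps_def reflect_def spin_labels_flip spin_labels_reflect)

lemma label_involution_id: "label_involution id"
  by (auto simp: label_involution_def inverse_maps_def)

lemma infsum_label_involution:
  assumes "label_involution \<sigma>"
  shows "(\<Sum>\<^sub>\<infinity>i. f (\<sigma> (Rep_spin_index i))) = (\<Sum>\<^sub>\<infinity>i. f (Rep_spin_index i))"
proof -
  let ?s = "\<lambda>i. Abs_spin_index (\<sigma> (Rep_spin_index i))"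
  have R: "Rep_spin_index (?s i) = \<sigma> (Rep_spin_index i)" for i
    by (rule Abs_spin_index_inverse) (simp add: label_involution_iff[OF assms] Rep_spin_index)
  have "?s (?s i) = i" for i by (simp add: R label_involution_twice[OF assms] Rep_spin_index_inverse)
  then have "bij ?s" by (intro o_bij[of ?s]) (simp_all add: fun_eq_iff)
  from infsum_reindex_bij_betw[OF this, of "\<lambda>i. f (Rep_spin_index i)"] show ?thesis by (simp only: R)
qed

section \<open>Unbounded operators given by an involution of the labels\<close>

lemma cinner_cf: "cinner x y = (\<Sum>\<^sub>\<infinity>i. (\<lambda>p. cnj (cf x p) * cf y p) (Rep_spin_index i))"
  by (simp add: cinner.rep_eq coeff_cf)

lemma cf_wmap_W:
  assumes "inverse_maps \<sigma> \<tau>" "x \<in> W" "p \<in> spin_labels"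
  shows "cf (wmap c \<sigma> x) p = of_real (c (\<tau> p)) * cf x (\<tau> p)"
  using assms(2)
proof (induction rule: W_induct)
  case (bv r)
  have "p = \<sigma> r \<longleftrightarrow> \<tau> p = r" using assms(1) unfolding inverse_maps_def by metis
  then show ?case using bv assms(3) by (auto simp: wmap_bv cf_bv')
qed (auto simp: wmap_def on_basis_add on_basis_scale algebra_simps)

text \<open>The maximal operator: a pair belongs to the graph as soon as the prescribed coefficients
  form a vector of the space. For an involution that preserves \<open>c\<close> it turns out to be
  the closure of its restriction to \<open>W\<close> and self-adjoint.\<close>

definition permutation_graph :: "(label \<Rightarrow> real) \<Rightarrow> (label \<Rightarrow> label) \<Rightarrow> spin_index graph" where
  "permutation_graph c \<sigma> = {(x, y). \<forall>p\<in>spin_labels. cf y p = of_real (c p) * cf x (\<sigma> p)}"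

lemma permutation_graphD:
  assumes "(x, y) \<in> permutation_graph c \<sigma>" "label_involution \<sigma>"
  shows "cf y p = of_real (c p) * cf x (\<sigma> p)"
proof (cases "p \<in> spin_labels")
  case True
  then show ?thesis using assms(1) by (simp add: permutation_graph_def)
next
  case False
  then show ?thesis using label_involution_iff[OF assms(2)] by (simp add: cf_outside)
qed

lemma permutation_graphI:
  "(\<And>p. p \<in> spin_labels \<Longrightarrow> cf y p = of_real (c p) * cf x (\<sigma> p)) \<Longrightarrow> (x, y) \<in> permutation_graph c \<sigma>"
  by (simp add: permutation_graph_def)

lemma bounded_linear_cf: "bounded_linear (\<lambda>x. cf x p)"
  by (rule bounded_linear_intro[where K = 1]) (auto simp: scaleR_conv_of_real cf_le_norm)

lemma closed_permutation_graph: "closed (permutation_graph c \<sigma>)"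
proof -
  have eq: "permutation_graph c \<sigma>
      = (\<Inter>p\<in>spin_labels. {z. cf (snd z) p = of_real (c p) * cf (fst z) (\<sigma> p)})"
    by (auto simp: permutation_graph_def)
  show ?thesis unfolding eq
    by (intro closed_INT ballI closed_Collect_eq continuous_intros
        bounded_linear.continuous_on[OF bounded_linear_cf])
qed

context
  fixes c :: "label \<Rightarrow> real" and \<sigma> :: "label \<Rightarrow> label"
  assumes \<sigma>: "label_involution \<sigma>" and c: "\<And>p. c (\<sigma> p) = c p"
begin

lemma wmap_in_permutation_graph: "x \<in> W \<Longrightarrow> (x, wmap c \<sigma> x) \<in> permutation_graph c \<sigma>"
  by (rule permutation_graphI) (simp add: cf_wmap_W[OF label_involution_inv[OF \<sigma>]] c)

lemma permutation_graph_unique: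
  "(x, y) \<in> permutation_graph c \<sigma> \<Longrightarrow> (x, z) \<in> permutation_graph c \<sigma> \<Longrightarrow> y = z"
  by (rule cf_eqI) (simp add: permutation_graphD[OF _ \<sigma>])

text \<open>Truncation to a finite set of labels invariant under \<open>\<sigma>\<close> commutes
  with the operator, so each pair in the graph is a limit of truncated pairs.\<close>

lemma closure_permutation_graph: "closure ((\<lambda>x. (x, wmap c \<sigma> x)) ` W) = permutation_graph c \<sigma>"
proof
  show "closure ((\<lambda>x. (x, wmap c \<sigma> x)) ` W) \<subseteq> permutation_graph c \<sigma>"
    by (rule closure_minimal[OF _ closed_permutation_graph]) (auto simp: wmap_in_permutation_graph)
  show "permutation_graph c \<sigma> \<subseteq> closure ((\<lambda>x. (x, wmap c \<sigma> x)) ` W)"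
  proof
    fix z assume "z \<in> permutation_graph c \<sigma>"
    then obtain x y where z: "z = (x, y)" "(x, y) \<in> permutation_graph c \<sigma>" by (cases z) auto
    show "z \<in> closure ((\<lambda>x. (x, wmap c \<sigma> x)) ` W)"
      unfolding closure_approachable
    proof (intro allI impI)
      fix e :: real assume "e > 0"
      then obtain F F' where F: "finite F" "\<And>G. finite G \<Longrightarrow> F \<subseteq> G \<Longrightarrow> dist (truncate G x) x < e/2"
        "finite F'" "\<And>G. finite G \<Longrightarrow> F' \<subseteq> G \<Longrightarrow> dist (truncate G y) y < e/2"
        using truncate_tendsto[of "e/2" x] truncate_tendsto[of "e/2" y] by (metis half_gt_zero)
      \<comment> \<open>Adding the images under \<open>\<sigma>\<close> makes the set invariant,
        which is what lets truncation commute with \<open>wmap c \<sigma>\<close>.\<close>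
      define G where "G = F \<union> F' \<union> \<sigma> ` (F \<union> F')"
      have G: "finite G" "F \<subseteq> G" "F' \<subseteq> G" using F by (auto simp: G_def)
      have \<sigma>G: "\<sigma> p \<in> G \<longleftrightarrow> p \<in> G" for p
      proof -
        have "\<sigma> r \<in> G" if "r \<in> G" for r
        using that label_involution_twice[OF \<sigma>] unfolding G_def by (metis Un_iff imageE imageI)
        then show ?thesis using label_involution_twice[OF \<sigma>] by metis
      qed
      have "wmap c \<sigma> (truncate G x) = truncate G y"
      proof (rule cf_eqI)
        fix p assume "p \<in> spin_labels"
        then show "cf (wmap c \<sigma> (truncate G x)) p = cf (truncate G y) p"
        by (simp add: cf_wmap_W[OF label_involution_inv[OF \<sigma>] truncate_in_W] cf_truncate G(1) \<sigma>G c
        permutation_graphD[OF z(2) \<sigma>])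
      qed
      moreover have "dist (truncate G x, truncate G y) (x, y) \<le> dist (truncate G x) x + dist (truncate G y) y"
        unfolding dist_prod_def by (simp add: sqrt_sum_squares_le_sum)
      moreover have "dist (truncate G x) x < e/2" "dist (truncate G y) y < e/2"
        using F G by auto
      ultimately have "dist (truncate G x, wmap c \<sigma> (truncate G x)) z < e" using z(1) by simp
      then show "\<exists>u\<in>(\<lambda>x. (x, wmap c \<sigma> x)) ` W. dist u z < e" using truncate_in_W by blast
    qed
  qed
qed

text \<open>Testing the adjoint condition on basis vectors already forces the coefficient formula.
  The converse is a reindexing of the inner product by the involution.\<close>

lemma selfadjoint_permutation_graph: "selfadjoint (permutation_graph c \<sigma>)"
  unfolding selfadjoint_def
proof
  have "W \<subseteq> Domain (permutation_graph c \<sigma>)" using wmap_in_permutation_graph by blast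
  then show "closure (Domain (permutation_graph c \<sigma>)) = UNIV"
    using W_dense closure_mono by blast
  show "adjoint_graph (permutation_graph c \<sigma>) = permutation_graph c \<sigma>"
  proof (intro equalityI subrelI)
    fix y z assume "(y, z) \<in> adjoint_graph (permutation_graph c \<sigma>)"
    then have adj: "cinner z x = cinner y w" if "(x, w) \<in> permutation_graph c \<sigma>" for x w
      using that by (auto simp: adjoint_graph_def)
    show "(y, z) \<in> permutation_graph c \<sigma>"
    proof (rule permutation_graphI)
      fix p assume p: "p \<in> spin_labels"
      have "cinner z (bv p) = cinner y (c p *\<^sub>R bv (\<sigma> p))"
        using adj[OF wmap_in_permutation_graph[OF bv_in_W[of p]]] by (simp add: wmap_bv p)
      then have "cnj (cinner (bv p) z) = cnj (of_real (c p) * cinner (bv (\<sigma> p)) y)"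
        unfolding cinner_commute[of z] cinner_commute[of y] by (simp add: scaleR_scaleC cinner_scale_left)
      then show "cf z p = of_real (c p) * cf y (\<sigma> p)"
        by (simp only: complex_cnj_cancel_iff cinner_bv)
    qed
  next
    fix y z assume yz: "(y, z) \<in> permutation_graph c \<sigma>"
    have "cinner z x = cinner y w" if xw: "(x, w) \<in> permutation_graph c \<sigma>" for x w
    proof -
      let ?f = "\<lambda>p. cnj (cf y p) * cf w p"
      have "cinner z x = (\<Sum>\<^sub>\<infinity>i. ?f (\<sigma> (Rep_spin_index i)))"
        unfolding cinner_cf
        by (simp add: permutation_graphD[OF yz \<sigma>] permutation_graphD[OF xw \<sigma>] label_involution_twice[OF \<sigma>] c mult_ac)
      also have "\<dots> = cinner y w" unfolding cinner_cf by (rule infsum_label_involution[OF \<sigma>])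
      finally show ?thesis .
    qed
    then show "(y, z) \<in> adjoint_graph (permutation_graph c \<sigma>)" by (auto simp: adjoint_graph_def)
  qed
qed

text \<open>\<open>(D + \<i>)\<^sup>-\<^sup>1 = (D - \<i>) (D\<^sup>2 + 1)\<^sup>-\<^sup>1\<close>, where \<open>D\<^sup>2\<close> is diagonal.\<close>

lemma compact_resolvent_permutation_graph:
  assumes large: "\<And>B :: real. \<exists>n :: nat. \<forall>p\<in>spin_labels. fst p > real n \<longrightarrow> B \<le> \<bar>c p\<bar>"
  shows "compact_resolvent (permutation_graph c \<sigma>)"
proof -
  note inv = label_involution_inv[OF \<sigma>]
  let ?a = "\<lambda>p. c p / ((c p)\<^sup>2 + 1)" and ?b = "\<lambda>p. 1 / ((c p)\<^sup>2 + 1)"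
  have pos: "x\<^sup>2 + 1 > 0" for x :: real by (simp add: add_nonneg_pos)
  have b_le: "?b p \<le> 1" for p using pos[of "c p"] by (simp add: divide_simps)
  have a_le: "\<bar>?a p\<bar> \<le> 1" for p
  proof -
    have "2 * \<bar>c p\<bar> \<le> (c p)\<^sup>2 + 1"
      using zero_le_power2[of "\<bar>c p\<bar> - 1"] by (simp add: power2_eq_square algebra_simps)
    then show ?thesis using pos[of "c p"] by (simp add: abs_divide divide_le_eq abs_of_pos)
  qed
  have a: "weight_bounded ?a \<sigma> 1" and b: "weight_bounded ?b id 1"
    using a_le b_le pos by (auto simp: weight_bounded_def abs_of_pos)
  define K where "K x = wmap ?a \<sigma> x - \<i> *\<^sub>C wmap ?b id x" for x
  have cfK: "cf (K x) p = of_real (?a p) * cf x (\<sigma> p) - \<i> * of_real (?b p) * cf x p"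
    if "p \<in> spin_labels" for x p
    unfolding K_def using that by (simp add: cf_wmap[OF inv a] cf_wmap[OF inverse_maps_id b] c mult.assoc)
  have small: "\<exists>n :: nat. \<forall>p\<in>spin_labels. fst p > real n \<longrightarrow> \<bar>?a p\<bar> \<le> e \<and> \<bar>?b p\<bar> \<le> e" if "e > 0" for e
  proof -
    \<comment> \<open>The summand 1/e controls the first weight; the additional 1 gives
      \<open>1 \<le> \<bar>c p\<bar>\<close>, from which the bound for the second weight
      follows.\<close>
    obtain n :: nat where n: "\<And>p. p \<in> spin_labels \<Longrightarrow> fst p > real n \<Longrightarrow> 1 / e + 1 \<le> \<bar>c p\<bar>"
      using large by metis
    have "\<bar>?a p\<bar> \<le> e \<and> \<bar>?b p\<bar> \<le> e" if "p \<in> spin_labels" "fst p > real n" for p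
    proof -
      have cp: "1 / e + 1 \<le> \<bar>c p\<bar>" by (rule n[OF that])
      have "0 < 1 / e" using \<open>e > 0\<close> by simp
      then have 0: "1 \<le> \<bar>c p\<bar>" using cp by linarith
      have 1: "1 \<le> e * \<bar>c p\<bar>"
        using \<open>e > 0\<close> mult_left_mono[OF cp, of e] by (simp add: distrib_left)
      have 2: "\<bar>c p\<bar> \<le> e * (c p)\<^sup>2"
        using mult_right_mono[OF 1(1), of "\<bar>c p\<bar>"] by (simp add: power2_eq_square mult.assoc)
      have "\<bar>c p\<bar> \<le> e * ((c p)\<^sup>2 + 1)" "1 \<le> e * ((c p)\<^sup>2 + 1)"
        using 0 1 2 \<open>e > 0\<close> by (simp_all add: distrib_left)
      then show ?thesis using pos[of "c p"] by (simp add: abs_divide divide_le_eq abs_of_pos)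
    qed
    then show ?thesis by blast
  qed
  have "compact_operator (wmap ?a \<sigma>)" "compact_operator (wmap ?b id)"
    by (rule compact_wmap[OF inv a] compact_wmap[OF inverse_maps_id b], use small in blast)+
  then have "compact_operator (\<lambda>x. wmap ?a \<sigma> x + (- \<i>) *\<^sub>C wmap ?b id x)"
    by (rule CollectD[OF ideal_plus[OF compact_operator_ideal CollectI
        ideal_cmult[OF compact_operator_ideal CollectI]]])
  moreover have "K = (\<lambda>x. wmap ?a \<sigma> x + (- \<i>) *\<^sub>C wmap ?b id x)"
    by (rule ext) (simp add: K_def ell2.scale_minus_left)
  ultimately have "compact_operator K" by simp
  moreover have "{(y + \<i> *\<^sub>C x, x) |x y. (x, y) \<in> permutation_graph c \<sigma>} = op_graph K"
  proof (rule Set.set_eqI, rule iffI)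
    fix z assume "z \<in> {(y + \<i> *\<^sub>C x, x) |x y. (x, y) \<in> permutation_graph c \<sigma>}"
    then obtain x y where z: "z = (y + \<i> *\<^sub>C x, x)" and xy: "(x, y) \<in> permutation_graph c \<sigma>" by blast
    have "K (y + \<i> *\<^sub>C x) = x"
    proof (rule cf_eqI)
      fix p assume p: "p \<in> spin_labels"
      have ne: "(complex_of_real (c p))\<^sup>2 + 1 \<noteq> 0"
        using pos[of "c p"] by (metis of_real_1 of_real_add of_real_eq_0_iff of_real_power less_irrefl)
      have "cf (K (y + \<i> *\<^sub>C x)) p = ((of_real (c p))\<^sup>2 + 1) * cf x p / ((of_real (c p))\<^sup>2 + 1)"
        unfolding cfK[OF p] cf_simps permutation_graphD[OF xy \<sigma>]
        using ne by (simp add: label_involution_twice[OF \<sigma>] c divide_simps) (simp add: algebra_simps power2_eq_square)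
      then show "cf (K (y + \<i> *\<^sub>C x)) p = cf x p" using ne by simp
    qed
    then show "z \<in> op_graph K" unfolding z op_graph_def by auto
  next
    fix z assume "z \<in> op_graph K"
    then obtain w where z: "z = (w, K w)" by (auto simp: op_graph_def)
    have "(K w, w - \<i> *\<^sub>C K w) \<in> permutation_graph c \<sigma>"
    proof (rule permutation_graphI)
      fix p assume p: "p \<in> spin_labels"
      have ne: "(complex_of_real (c p))\<^sup>2 + 1 \<noteq> 0"
        using pos[of "c p"] by (metis of_real_1 of_real_add of_real_eq_0_iff of_real_power less_irrefl)
      have p': "\<sigma> p \<in> spin_labels" using p label_involution_iff[OF \<sigma>] by simp
      show "cf (w - \<i> *\<^sub>C K w) p = of_real (c p) * cf (K w) (\<sigma> p)"
        unfolding cf_simps cfK[OF p] cfK[OF p'] using ne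
        by (simp add: label_involution_twice[OF \<sigma>] c divide_simps) (simp add: algebra_simps power2_eq_square)
    qed
    then show "z \<in> {(y + \<i> *\<^sub>C x, x) |x y. (x, y) \<in> permutation_graph c \<sigma>}"
      unfolding z by (intro CollectI exI[of _ "K w"] exI[of _ "w - \<i> *\<^sub>C K w"]) auto
  qed
  ultimately show ?thesis unfolding compact_resolvent_def by blast
qed

end

lemma permutation_graph_closed_add:
  "(x, y) \<in> permutation_graph c \<sigma> \<Longrightarrow> (x', y') \<in> permutation_graph c \<sigma>
    \<Longrightarrow> (x + x', y + y') \<in> permutation_graph c \<sigma>"
  by (auto simp: permutation_graph_def algebra_simps)

lemma permutation_graph_closed_scale:
  "(x, y) \<in> permutation_graph c \<sigma> \<Longrightarrow> (r *\<^sub>C x, r *\<^sub>C y) \<in> permutation_graph c \<sigma>"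
  by (auto simp: permutation_graph_def)

section \<open>The Dirac operator\<close>

abbreviation dirac_weight :: "real \<Rightarrow> real \<Rightarrow> label \<Rightarrow> real" where
  "dirac_weight c1 c2 \<equiv> \<lambda>(l, m, N). c1 * l + c2"

lemma dirac_eq: "dirac c1 c2 = permutation_graph (dirac_weight c1 c2) flip"
proof -
  have "on_basis (\<lambda>l m N. (c1 * l + c2) *\<^sub>R basis_vec l m (- N)) = wmap (dirac_weight c1 c2) flip"
    by (simp add: wmap_def flip_def basis_vec_eq)
  moreover have "dirac_weight c1 c2 (flip p) = dirac_weight c1 c2 p" for p
    by (simp add: flip_def case_prod_beta)
  ultimately show ?thesis
    using closure_permutation_graph[OF label_involution_flip, of "dirac_weight c1 c2"]
    by (simp add: dirac_def)
qed

lemma dirac_weight_flip: "dirac_weight c1 c2 (flip p) = dirac_weight c1 c2 p"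
  by (simp add: flip_def case_prod_beta)

lemma dirac_selfadjoint: "selfadjoint (dirac c1 c2)"
  unfolding dirac_eq by (rule selfadjoint_permutation_graph[OF label_involution_flip]) (rule dirac_weight_flip)

text \<open>Since \<open>c1\<close> is nonzero, the weights tend to infinity with l, and only
  finitely many labels lie below any bound on l.\<close>

lemma dirac_compact_resolvent:
  assumes "c1 \<noteq> 0"
  shows "compact_resolvent (dirac c1 c2)"
  unfolding dirac_eq
proof (rule compact_resolvent_permutation_graph[OF label_involution_flip])
  fix B :: real
  obtain n :: nat where n: "(\<bar>B\<bar> + \<bar>c2\<bar>) / \<bar>c1\<bar> < real n" using reals_Archimedean2 by blast
  have "B \<le> \<bar>c1 * l + c2\<bar>" if "l > real n" for l
  proof -
    have "\<bar>B\<bar> + \<bar>c2\<bar> \<le> \<bar>c1\<bar> * \<bar>l\<bar>"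
    proof -
      have "\<bar>B\<bar> + \<bar>c2\<bar> \<le> \<bar>c1\<bar> * real n" using n assms by (simp add: divide_less_eq mult.commute)
      also have "\<dots> \<le> \<bar>c1\<bar> * \<bar>l\<bar>" using that by (intro mult_left_mono) auto
      finally show ?thesis .
    qed
    then have "\<bar>B\<bar> + \<bar>c2\<bar> \<le> \<bar>c1 * l\<bar>" by (simp add: abs_mult)
    then show ?thesis by linarith
  qed
  then show "\<exists>n :: nat. \<forall>p\<in>spin_labels. fst p > real n \<longrightarrow> B \<le> \<bar>dirac_weight c1 c2 p\<bar>"
    by (intro exI[of _ n]) (auto simp: case_prod_beta)
qed (rule dirac_weight_flip)

subsection \<open>The grading\<close>

abbreviation grading_weight :: "label \<Rightarrow> real" where
  "grading_weight \<equiv> \<lambda>(l, m, N). sgn N"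

lemma grading_eq: "grading = wmap grading_weight id"
  by (simp add: grading_def wmap_def basis_vec_eq)

lemma grading_weight_bounded: "weight_bounded grading_weight id 1"
  by (auto simp: weight_bounded_def spin_labels_def)

lemma bounded_clinear_grading: "bounded_clinear grading"
  unfolding grading_eq by (rule bounded_clinear_wmap[OF inverse_maps_id grading_weight_bounded])

lemma cf_grading: "cf (grading x) p = of_real (grading_weight p) * cf x p"
proof (cases "p \<in> spin_labels")
  case True
  then show ?thesis using cf_wmap[OF inverse_maps_id grading_weight_bounded] by (simp add: grading_eq)
qed (simp add: cf_outside)

lemma grading_weight_square: "p \<in> spin_labels \<Longrightarrow> grading_weight p * grading_weight p = 1"
  by (auto simp: spin_labels_def)

lemma grading_weight_flip: "grading_weight (flip p) = - grading_weight p"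
  by (simp add: flip_def case_prod_beta sgn_minus)

lemma grading_square: "grading (grading x) = x"
proof (rule cf_eqI)
  fix p assume "p \<in> spin_labels"
  then have "of_real (grading_weight p) * of_real (grading_weight p) = (1 :: complex)"
    unfolding of_real_mult[symmetric] by (simp only: grading_weight_square of_real_1)
  then show "cf (grading (grading x)) p = cf x p"
    unfolding cf_grading by (simp only: mult.assoc[symmetric] mult_1)
qed

lemma cinner_grading: "cinner (grading x) y = cinner x (grading y)"
  unfolding cinner_cf by (simp add: cf_grading mult_ac case_prod_beta)

lemma dirac_grading:
  assumes "(x, y) \<in> dirac c1 c2"
  shows "(grading x, - grading y) \<in> dirac c1 c2"
  unfolding dirac_eq
proof (rule permutation_graphI)
  fix p
  show "cf (- grading y) p = of_real (dirac_weight c1 c2 p) * cf (grading x) (flip p)"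
    unfolding cf_simps cf_grading grading_weight_flip
      permutation_graphD[OF assms[unfolded dirac_eq] label_involution_flip] by simp
qed

lemma dirac_anticommutes_grading:
  "dirac c1 c2 O op_graph grading = op_graph grading O dirac c1 c2 O op_graph uminus"
proof (intro equalityI subrelI)
  fix x z assume "(x, z) \<in> dirac c1 c2 O op_graph grading"
  then obtain y where "(x, y) \<in> dirac c1 c2" "z = grading y" by (auto simp: op_graph_def)
  then show "(x, z) \<in> op_graph grading O dirac c1 c2 O op_graph uminus"
    using dirac_grading by (force simp: op_graph_def)
next
  fix x y
  assume "(x, y) \<in> op_graph grading O dirac c1 c2 O op_graph uminus"
  then obtain z where "(grading x, z) \<in> dirac c1 c2" "y = - z" by (auto simp: op_graph_def)
  then have "(grading (grading x), - grading z) \<in> dirac c1 c2" "y = grading (- grading z)"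
    using dirac_grading[of "grading x" z c1 c2]
    by (simp_all add: bounded_clinear_minus[OF bounded_clinear_grading] grading_square)
  then show "(x, y) \<in> dirac c1 c2 O op_graph grading"
    by (auto simp: op_graph_def grading_square)
qed

subsection \<open>The conjugation\<close>

abbreviation phase :: "label \<Rightarrow> real" where
  "phase \<equiv> \<lambda>(l, m, N). (-1) powi \<lfloor>m + 1/2\<rfloor>"

lemma conjugation_eq: "conjugation x = wmap phase reflect (conj_spinor x)"
  by (simp add: conjugation_def wmap_def basis_vec_eq antilinear_on_basis_eq reflect_def)

lemma minus_one_powi_square: "((-1) powi k) * ((-1) powi k) = (1 :: real)"
  by (simp flip: power_int_mult_distrib)

lemma phase_square: "phase p * phase p = 1"
  by (simp add: case_prod_beta minus_one_powi_square)

lemma abs_phase: "\<bar>phase p\<bar> = 1"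
  using phase_square[of p] abs_square_eq_1[of "phase p"] unfolding power2_eq_square by blast

lemma label_int: "(l, m, N) \<in> spin_labels \<Longrightarrow> \<exists>k :: int. m = of_int k - 1/2"
proof -
  assume "(l, m, N) \<in> spin_labels"
  then obtain n j :: nat where "l = real n + 1/2" "m = - l + real j" by (auto simp: spin_labels_def)
  then show ?thesis by (intro exI[of _ "int j - int n"]) simp
qed

text \<open>As m is a half-odd number, m + 1/2 and -m + 1/2 are integers with sum 1, so one of them
  is even and the other odd. This is the origin of J^2 = -1.\<close>

lemma phase_reflect: "p \<in> spin_labels \<Longrightarrow> phase (reflect p) = - phase p"
proof -
  assume "p \<in> spin_labels"
  then obtain l m N and k :: int where p: "p = (l, m, N)" "m = of_int k - 1/2"
    using label_int by (metis prod_cases3)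
  have "phase p * phase (reflect p) = (-1) powi k * (-1) powi (1 - k)"
    by (simp add: p reflect_def)
  also have "\<dots> = -1" by (simp flip: power_int_add)
  finally have *: "phase p * phase (reflect p) = -1" .
  have "phase (reflect p) = (phase p * phase p) * phase (reflect p)" unfolding phase_square by simp
  also have "\<dots> = phase p * (phase p * phase (reflect p))" by (simp only: mult.assoc)
  finally show ?thesis unfolding * by simp
qed

lemma phase_weight_bounded: "weight_bounded phase \<sigma> 1"
  by (simp only: weight_bounded_def abs_phase) auto

text \<open>The definition puts the phase at the source label; expressing it at the target
  \<open>p\<close> produces the minus sign.\<close>

lemma cf_conjugation: "cf (conjugation x) p = - of_real (phase p) * cnj (cf x (reflect p))"
proof (cases "p \<in> spin_labels")
  case True
  then show ?thesis
    using cf_wmap[OF label_involution_inv[OF label_involution_reflect] phase_weight_bounded True]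
    by (simp only: conjugation_eq phase_reflect cf_conj_spinor of_real_minus)
next
  case False
  then show ?thesis using label_involution_iff[OF label_involution_reflect] by (simp add: cf_outside)
qed

lemma conjugation_bv: "p \<in> spin_labels \<Longrightarrow> conjugation (bv p) = phase p *\<^sub>R bv (reflect p)"
proof -
  assume p: "p \<in> spin_labels"
  have "conj_spinor (bv p) = bv p" by (rule cf_eqI) (simp add: cf_bv')
  then show ?thesis by (simp only: conjugation_eq wmap_bv[OF p])
qed

lemma conjugation_square: "conjugation (conjugation x) = - x"
proof (rule cf_eqI)
  fix p assume p: "p \<in> spin_labels"
  have *: "of_real (phase p) * of_real (phase p) = (1 :: complex)"
    unfolding of_real_mult[symmetric] phase_square by simp
  have "cf (conjugation (conjugation x)) p = - (of_real (phase p) * of_real (phase p)) * cf x p"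
    unfolding cf_conjugation phase_reflect[OF p] label_involution_twice[OF label_involution_reflect] by simp
  then show "cf (conjugation (conjugation x)) p = cf (- x) p" unfolding * by simp
qed

lemma
  shows conjugation_add: "conjugation (x + y) = conjugation x + conjugation y"
    and conjugation_scale: "conjugation (r *\<^sub>C x) = cnj r *\<^sub>C conjugation x"
    and conjugation_minus: "conjugation (- x) = - conjugation x"
    and conjugation_zero [simp]: "conjugation 0 = 0"
  by (rule cf_eqI, simp only: cf_conjugation cf_simps complex_cnj_add complex_cnj_mult complex_cnj_minus
      complex_cnj_zero, simp add: algebra_simps)+

lemma cinner_conjugation: "cinner (conjugation x) (conjugation y) = cnj (cinner x y)"
proof -
  have *: "of_real (phase p) * of_real (phase p) = (1 :: complex)" for p
    unfolding of_real_mult[symmetric] phase_square by simp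
  have "cnj (cf (conjugation x) p) * cf (conjugation y) p
      = (of_real (phase p) * of_real (phase p)) * (cf x (reflect p) * cnj (cf y (reflect p)))" for p
    unfolding cf_conjugation by simp
  then have "cinner (conjugation x) (conjugation y)
      = (\<Sum>\<^sub>\<infinity>i. (\<lambda>p. cf x p * cnj (cf y p)) (reflect (Rep_spin_index i)))"
    unfolding cinner_cf * by simp
  also have "\<dots> = (\<Sum>\<^sub>\<infinity>i. (\<lambda>p. cf x p * cnj (cf y p)) (Rep_spin_index i))"
    by (rule infsum_label_involution[OF label_involution_reflect])
  also have "\<dots> = cnj (cinner x y)" unfolding cinner_cf by (simp flip: infsum_cnj)
  finally show ?thesis .
qed

lemma inv_conjugation: "inv_into UNIV conjugation = (\<lambda>x. - conjugation x)"
proof (rule inv_equality)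
  show "- conjugation (conjugation x) = x" for x by (simp add: conjugation_square)
  show "conjugation (- conjugation x) = x" for x by (simp add: conjugation_minus conjugation_square)
qed

lemma antiunitary_conjugation: "antiunitary conjugation"
  unfolding antiunitary_def
proof (intro conjI allI)
  show "surj conjugation"
    by (rule surjI[of _ "\<lambda>x. - conjugation x"]) (simp add: conjugation_minus conjugation_square)
qed (auto simp: conjugation_add conjugation_scale cinner_conjugation)

lemma norm_conjugation: "norm (conjugation x) = norm x"
proof -
  have "cinner (conjugation x) (conjugation x) = cnj (cinner x x)" by (rule cinner_conjugation)
  then have "complex_of_real ((norm (conjugation x))\<^sup>2) = of_real ((norm x)\<^sup>2)"
    unfolding cinner_self_norm by (simp only: complex_cnj_complex_of_real)
  then have "(norm (conjugation x))\<^sup>2 = (norm x)\<^sup>2" by (simp only: of_real_eq_iff)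
  then show ?thesis by (simp add: power2_eq_iff_nonneg)
qed

lemma continuous_conjugation: "continuous_on S conjugation"
proof -
  have "dist (conjugation x) (conjugation y) = dist x y" for x y
  proof -
    have "conjugation x - conjugation y = conjugation (x - y)"
      using conjugation_add[of x "- y"] by (simp add: conjugation_minus)
    then show ?thesis by (simp only: dist_norm norm_conjugation)
  qed
  then show ?thesis unfolding continuous_on_iff by metis
qed

lemma conjugation_in_W: "x \<in> W \<Longrightarrow> conjugation x \<in> W"
  by (induction rule: W_induct) (auto simp: conjugation_bv conjugation_add conjugation_scale)

lemma conjugation_anticommutes_grading: "conjugation (grading x) = - grading (conjugation x)"
proof (rule cf_eqI)
  fix p assume "p \<in> spin_labels"
  have "grading_weight (reflect p) = - grading_weight p"
    by (simp add: reflect_def case_prod_beta sgn_minus)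
  then show "cf (conjugation (grading x)) p = cf (- grading (conjugation x)) p"
    unfolding cf_simps cf_grading cf_conjugation by simp
qed

lemma dirac_conjugation:
  assumes "(x, y) \<in> dirac c1 c2"
  shows "(conjugation x, conjugation y) \<in> dirac c1 c2"
  unfolding dirac_eq
proof (rule permutation_graphI)
  fix p
  have *: "phase (flip p) = phase p" "reflect (flip p) = flip (reflect p)"
    "dirac_weight c1 c2 (reflect p) = dirac_weight c1 c2 p"
    by (simp_all add: reflect_def flip_def case_prod_beta)
  show "cf (conjugation y) p = of_real (dirac_weight c1 c2 p) * cf (conjugation x) (flip p)"
    unfolding cf_conjugation * permutation_graphD[OF assms[unfolded dirac_eq] label_involution_flip]
    by simp
qed

lemma dirac_commutes_conjugation:
  "dirac c1 c2 O op_graph conjugation = op_graph conjugation O dirac c1 c2"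
proof (intro equalityI subrelI)
  fix x z assume "(x, z) \<in> dirac c1 c2 O op_graph conjugation"
  then show "(x, z) \<in> op_graph conjugation O dirac c1 c2"
    using dirac_conjugation by (auto simp: op_graph_def)
next
  fix x z assume "(x, z) \<in> op_graph conjugation O dirac c1 c2"
  then have *: "(conjugation (conjugation x), conjugation z) \<in> dirac c1 c2"
    using dirac_conjugation by (auto simp: op_graph_def)
  have "((-1) *\<^sub>C conjugation (conjugation x), (-1) *\<^sub>C conjugation z) \<in> dirac c1 c2"
    using * unfolding dirac_eq by (rule permutation_graph_closed_scale)
  then have "(x, - conjugation z) \<in> dirac c1 c2"
    by (simp add: scaleC_minus1 conjugation_square)
  moreover have "z = conjugation (- conjugation z)" by (simp add: conjugation_minus conjugation_square)
  ultimately show "(x, z) \<in> dirac c1 c2 O op_graph conjugation" unfolding op_graph_def by blast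
qed

lemma even_structure_dirac:
  assumes "\<And>a. a \<in> carrier A \<Longrightarrow> grading \<circ> \<pi> a = \<pi> a \<circ> grading"
  shows "even_structure A \<pi> (dirac c1 c2) grading"
  unfolding even_structure_def
  using assms by (auto simp: bounded_clinear_grading cinner_grading dirac_anticommutes_grading
      grading_square o_def)

subsection \<open>The modular operator and its antilinear companion\<close>

context
  fixes q :: real
  assumes q: "0 < q"
begin

abbreviation m_weight :: "label \<Rightarrow> real" where
  "m_weight \<equiv> \<lambda>(l, m, N). q powr m"

abbreviation "modular_graph \<equiv> permutation_graph m_weight id"

text \<open>This is T = J k, with k replaced by its self-adjoint closure
  \<open>modular_graph\<close>. The choice is dictated by T h = S(h)^* T, since k implements the
  square of the antipode and J interchanges e and f up to sign.\<close>

abbreviation "T_graph \<equiv> modular_graph O op_graph conjugation"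

lemma T_graph_iff: "(x, y) \<in> T_graph \<longleftrightarrow> (x, - conjugation y) \<in> modular_graph"
proof
  assume "(x, y) \<in> T_graph"
  then obtain z where "(x, z) \<in> modular_graph" "y = conjugation z" by (auto simp: op_graph_def)
  then show "(x, - conjugation y) \<in> modular_graph" by (simp add: conjugation_square)
next
  assume "(x, - conjugation y) \<in> modular_graph"
  moreover have "y = conjugation (- conjugation y)" by (simp add: conjugation_minus conjugation_square)
  ultimately show "(x, y) \<in> T_graph" unfolding op_graph_def by blast
qed

lemma selfadjoint_modular: "selfadjoint modular_graph"
  by (rule selfadjoint_permutation_graph[OF label_involution_id]) simp

lemma closed_antilinear_T: "closed_antilinear T_graph"
  unfolding closed_antilinear_def
proof (intro conjI allI)
  have "T_graph = (\<lambda>z. (fst z, - conjugation (snd z))) -` modular_graph"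
    by (intro equalityI subrelI subsetI) (auto simp only: T_graph_iff vimage_def mem_Collect_eq fst_conv snd_conv split_paired_all)
  moreover have "continuous_on UNIV (\<lambda>z :: spinor \<times> spinor. (fst z, - conjugation (snd z)))"
    by (intro continuous_intros continuous_on_compose2[OF continuous_conjugation[of UNIV]]) auto
  then have "closed ((\<lambda>z. (fst z, - conjugation (snd z))) -` modular_graph)"
    by (rule closed_vimage[OF closed_permutation_graph])
  ultimately show "closed T_graph" by simp
  show "single_valued T_graph"
    unfolding single_valued_def T_graph_iff
  proof (intro allI impI)
    fix x y z assume "(x, - conjugation y) \<in> modular_graph" "(x, - conjugation z) \<in> modular_graph"
    then have "- conjugation y = - conjugation z"
      by (rule permutation_graph_unique[OF label_involution_id, rotated]) simp
    then have "conjugation (conjugation y) = conjugation (conjugation z)" by simp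
    then show "y = z" by (simp add: conjugation_square)
  qed
  have "Domain modular_graph \<subseteq> Domain T_graph" by (auto simp: op_graph_def)
  then show "closure (Domain T_graph) = UNIV"
    using selfadjoint_modular closure_mono unfolding selfadjoint_def by blast
  show "\<forall>(x, y)\<in>T_graph. \<forall>(x', y')\<in>T_graph. (x + x', y + y') \<in> T_graph"
  proof -
    have "(x + x', y + y') \<in> T_graph" if "(x, y) \<in> T_graph" "(x', y') \<in> T_graph" for x y x' y'
      using that permutation_graph_closed_add[of x "- conjugation y" m_weight id x' "- conjugation y'"]
      unfolding T_graph_iff by (simp add: conjugation_add)
    then show ?thesis by blast
  qed
  fix r
  show "\<forall>(x, y)\<in>T_graph. (r *\<^sub>C x, cnj r *\<^sub>C y) \<in> T_graph"
  proof (intro ballI, unfold split_paired_all prod.case)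
    fix x y assume "(x, y) \<in> T_graph"
    then have "(r *\<^sub>C x, r *\<^sub>C (- conjugation y)) \<in> modular_graph"
      unfolding T_graph_iff by (rule permutation_graph_closed_scale)
    then show "(r *\<^sub>C x, cnj r *\<^sub>C y) \<in> T_graph"
      unfolding T_graph_iff by (simp add: conjugation_scale)
  qed
qed

lemma infsum_of_real_spin: "(\<Sum>\<^sub>\<infinity>i\<in>A. complex_of_real (f i)) = of_real (\<Sum>\<^sub>\<infinity>i\<in>A. f i)"
proof (cases "(\<lambda>i. complex_of_real (f i)) summable_on A")
  case True
  then obtain s where s: "((\<lambda>i. complex_of_real (f i)) has_sum s) A" by (auto simp: summable_on_def)
  then have f: "(f has_sum Re s) A" using has_sum_bounded_linear[OF bounded_linear_Re s] by (simp add: o_def)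
  then show ?thesis using infsumI[OF has_sum_of_real_iff[THEN iffD2, OF f]] by (simp add: infsumI)
next
  case False
  then have "\<not> f summable_on A" unfolding summable_on_def by (metis has_sum_of_real_iff)
  then show ?thesis using False by (simp add: infsum_not_exists)
qed

lemma positive_modular: "positive_graph modular_graph"
  unfolding positive_graph_def
proof clarify
  fix x y assume xy: "(x, y) \<in> modular_graph"
  have "cinner x y = (\<Sum>\<^sub>\<infinity>i. of_real ((\<lambda>p. m_weight p * (cmod (cf x p))\<^sup>2) (Rep_spin_index i)))"
    unfolding cinner_cf
    by (rule infsum_cong) (simp add: permutation_graphD[OF xy label_involution_id] complex_norm_square
        mult_ac del: of_real_power)
  also have "\<dots> = of_real (\<Sum>\<^sub>\<infinity>i. (\<lambda>p. m_weight p * (cmod (cf x p))\<^sup>2) (Rep_spin_index i))"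
    by (rule infsum_of_real_spin)
  finally have "cinner x y = of_real (\<Sum>\<^sub>\<infinity>i. (\<lambda>p. m_weight p * (cmod (cf x p))\<^sup>2) (Rep_spin_index i))" .
  moreover have "0 \<le> (\<Sum>\<^sub>\<infinity>i. (\<lambda>p. m_weight p * (cmod (cf x p))\<^sup>2) (Rep_spin_index i))"
    by (rule infsum_nonneg) (simp add: case_prod_beta)
  ultimately show "cinner x y \<in> \<real> \<and> 0 \<le> Re (cinner x y)" by simp
qed

text \<open>For T = J P with P self-adjoint the antilinear adjoint is P J^{-1}, and J^{-1} =
  -J.\<close>

lemma antilinear_adjoint_T:
  "antilinear_adjoint_graph T_graph = {(y, z). (- conjugation y, z) \<in> modular_graph}"
proof -
  have J: "cinner (conjugation v) y = cinner (- conjugation y) v" for v y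
  proof -
    have "cinner (- conjugation y) v = - cinner (conjugation y) (- conjugation (conjugation v))"
      by (simp add: cinner_minus_left conjugation_square)
    also have "\<dots> = cnj (cinner y (conjugation v))"
      by (simp add: cinner_minus_right cinner_conjugation)
    also have "\<dots> = cinner (conjugation v) y" by (simp flip: cinner_commute)
    finally show ?thesis by simp
  qed
  have "(y, z) \<in> antilinear_adjoint_graph T_graph \<longleftrightarrow>
      (\<forall>(x, v)\<in>modular_graph. cinner z x = cinner (conjugation v) y)" for y z
    unfolding antilinear_adjoint_graph_def op_graph_def by (auto simp: relcomp_unfold)
  also have "\<dots> y z \<longleftrightarrow> (- conjugation y, z) \<in> adjoint_graph modular_graph" for y z
    unfolding adjoint_graph_def J by auto
  finally show ?thesis using selfadjoint_modular unfolding selfadjoint_def by auto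
qed

text \<open>With the adjoint P J^{-1} the product T^* T collapses to P^2, and P has trivial kernel
  because all its eigenvalues q^m are positive.\<close>

lemma antiunitary_part_T: "antiunitary_part T_graph conjugation"
  unfolding antiunitary_part_def
proof (intro conjI antiunitary_conjugation exI[of _ modular_graph] selfadjoint_modular positive_modular refl)
  show "modular_graph O modular_graph = T_graph O antilinear_adjoint_graph T_graph"
    unfolding antilinear_adjoint_T
  proof (intro equalityI subrelI)
    fix x z assume "(x, z) \<in> modular_graph O modular_graph"
    then obtain y where y: "(x, y) \<in> modular_graph" "(y, z) \<in> modular_graph" by blast
    have "(x, conjugation y) \<in> T_graph"
      unfolding T_graph_iff using y(1) by (simp add: conjugation_square)
    moreover have "(conjugation y, z) \<in> {(y, z). (- conjugation y, z) \<in> modular_graph}"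
      using y(2) by (simp add: conjugation_square)
    ultimately show "(x, z) \<in> T_graph O {(y, z). (- conjugation y, z) \<in> modular_graph}" by blast
  next
    fix x z assume "(x, z) \<in> T_graph O {(y, z). (- conjugation y, z) \<in> modular_graph}"
    then obtain y where "(x, y) \<in> T_graph" "(- conjugation y, z) \<in> modular_graph" by blast
    then show "(x, z) \<in> modular_graph O modular_graph" unfolding T_graph_iff by blast
  qed
  show "{x. (x, 0) \<in> modular_graph} = {0}"
  proof (rule Set.set_eqI, rule iffI)
    fix x assume "x \<in> {x. (x, 0) \<in> modular_graph}"
    then have x: "(x, 0) \<in> modular_graph" by simp
    have "x = 0"
    proof (rule cf_eqI)
      fix p :: label
      have "m_weight p \<noteq> 0" using q by (simp add: case_prod_beta)
      then show "cf x p = cf 0 p" using permutation_graphD[OF x label_involution_id, of p] by simp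
    qed
    then show "x \<in> {0}" by simp
  next
    fix x :: spinor assume "x \<in> {0}"
    moreover have "(0, 0) \<in> modular_graph" by (rule permutation_graphI) simp
    ultimately show "x \<in> {x. (x, 0) \<in> modular_graph}" by simp
  qed
qed

lemma T_graph_W: "x \<in> W \<Longrightarrow> (x, conjugation (wmap m_weight id x)) \<in> T_graph"
  using wmap_in_permutation_graph[OF label_involution_id, of m_weight x]
  by (auto simp: op_graph_def)

end

section \<open>Free algebras and their quotients\<close>

text \<open>The coefficient is passed to \<open>F\<close> instead of multiplying its value, so that
  linear and antilinear extensions are both instances.\<close>

definition lin_sum :: "('w \<Rightarrow> complex \<Rightarrow> 'v::comm_monoid_add) \<Rightarrow> ('w \<Rightarrow>\<^sub>0 complex) \<Rightarrow> 'v" where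
  "lin_sum F p = (\<Sum>w\<in>Poly_Mapping.keys p. F w (Poly_Mapping.lookup p w))"

lemma lin_sum_superset:
  assumes "finite S" "Poly_Mapping.keys p \<subseteq> S" "\<And>w. F w 0 = 0"
  shows "lin_sum F p = (\<Sum>w\<in>S. F w (Poly_Mapping.lookup p w))"
  unfolding lin_sum_def using assms
  by (intro sum.mono_neutral_left) (auto simp: in_keys_iff)

lemma lin_sum_add:
  assumes "\<And>w. F w 0 = 0" "\<And>w a b. F w (a + b) = F w a + F w b"
  shows "lin_sum F (p + r) = lin_sum F p + lin_sum F r"
proof -
  let ?S = "Poly_Mapping.keys p \<union> Poly_Mapping.keys r"
  have sub: "Poly_Mapping.keys (p + r) \<subseteq> ?S" by (rule keys_add)
  show ?thesis
    using lin_sum_superset[OF _ sub, of F] lin_sum_superset[of ?S p F] lin_sum_superset[of ?S r F]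
    by (simp add: assms lookup_add sum.distrib)
qed

lemma lin_sum_single: "F w 0 = 0 \<Longrightarrow> lin_sum F (Poly_Mapping.single w c) = F w c"
  by (simp add: lin_sum_def)

lemma lin_sum_zero [simp]: "lin_sum F 0 = 0"
  by (simp add: lin_sum_def)

lemma sum_of_singles: "p = (\<Sum>w\<in>Poly_Mapping.keys p. Poly_Mapping.single w (Poly_Mapping.lookup p w))"
proof (rule poly_mapping_eqI)
  fix v
  have "(\<Sum>w\<in>Poly_Mapping.keys p. Poly_Mapping.lookup (Poly_Mapping.single w (Poly_Mapping.lookup p w)) v)
      = (\<Sum>w\<in>Poly_Mapping.keys p. if w = v then Poly_Mapping.lookup p v else 0)"
    by (rule sum.cong) (auto simp: lookup_single when_def)
  then show "Poly_Mapping.lookup p v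
      = Poly_Mapping.lookup (\<Sum>w\<in>Poly_Mapping.keys p. Poly_Mapping.single w (Poly_Mapping.lookup p w)) v"
    by (simp add: lookup_sum in_keys_iff)
qed

lemma poly_mapping_induct_single [case_names single add]:
  assumes s: "\<And>w c. P (Poly_Mapping.single w c)" and a: "\<And>p r. P p \<Longrightarrow> P r \<Longrightarrow> P (p + r)"
  shows "P (p :: 'w \<Rightarrow>\<^sub>0 complex)"
proof -
  have 0: "P 0" using s[of undefined 0] by simp
  have "P (\<Sum>w\<in>S. Poly_Mapping.single w (Poly_Mapping.lookup p w))" if "finite S" for S
    using that by induction (auto intro: s a 0)
  from this[of "Poly_Mapping.keys p"] show ?thesis using sum_of_singles[of p] by simp
qed

lemma scalar_mult_single: "scalar c * Poly_Mapping.single w d = Poly_Mapping.single w (c * d)"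
  by (simp add: scalar_def mult_single)

lemma single_mult_scalar: "Poly_Mapping.single w d * scalar c = Poly_Mapping.single w (c * d)"
  by (simp add: scalar_def mult_single mult.commute)

lemma scalar_central: "scalar c * p = p * scalar c" for p :: "'w::monoid_add \<Rightarrow>\<^sub>0 complex"
  by (induction p rule: poly_mapping_induct_single)
    (simp_all add: scalar_mult_single single_mult_scalar algebra_simps)

lemma scalar_mid: "p * (scalar c * r) = scalar c * (p * r)" for p :: "'w::monoid_add \<Rightarrow>\<^sub>0 complex"
  by (metis mult.assoc scalar_central)

lemma scalar_simps [simp]:
  "scalar 0 = 0" "scalar 1 = 1" "scalar a * scalar b = scalar (a * b)"
  by (simp_all add: scalar_def mult_single)

lemma scalar_add: "scalar (a + b) = scalar a + scalar b"
  by (simp add: scalar_def single_add)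

lemma scalar_uminus: "scalar (- a) = - scalar a"
  by (simp add: scalar_def single_uminus)

lemma scalar_scalar_mult: "scalar a * (scalar b * p) = scalar (a * b) * p"
  by (simp flip: mult.assoc)

lemma word_single: "Poly_Mapping.single (Word ws) 1 = prod_list (map free_gen ws)"
proof (induction ws)
  case Nil
  show ?case by (simp flip: zero_word_def)
next
  case (Cons g ws)
  have "Poly_Mapping.single (Word [g]) 1 * Poly_Mapping.single (Word ws) (1 :: complex)
      = Poly_Mapping.single (Word (g # ws)) 1"
    by (simp add: mult_single plus_word_def)
  then show ?case using Cons by (simp add: free_gen_def)
qed

lemma free_algebra_induct [case_names scalar gen add mult]:
  assumes "\<And>c. P (scalar c)" "\<And>g. P (free_gen g)"
    "\<And>p r. P p \<Longrightarrow> P r \<Longrightarrow> P (p + r)" "\<And>p r. P p \<Longrightarrow> P r \<Longrightarrow> P (p * r)"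
  shows "P (p :: 'g free_algebra)"
proof (induction p rule: poly_mapping_induct_single)
  case (single w c)
  obtain ws where w: "w = Word ws" by (cases w)
  have "P (prod_list (map free_gen ws))"
    by (induction ws) (use assms(1)[of 1] assms in auto)
  moreover have "Poly_Mapping.single w c = scalar c * prod_list (map free_gen ws)"
    unfolding w word_single[symmetric] by (simp add: scalar_mult_single)
  ultimately show ?case using assms by simp
qed (rule assms)

subsection \<open>Two-sided ideals\<close>

lemma ring_free_ring: "ring (free_ring :: 'g free_algebra ring)"
proof (rule ringI)
  show "abelian_group (free_ring :: 'g free_algebra ring)"
  proof (rule abelian_groupI)
    fix x :: "'g free_algebra" assume "x \<in> carrier free_ring"
    show "\<exists>y\<in>carrier free_ring. y \<oplus>\<^bsub>free_ring\<^esub> x = \<zero>\<^bsub>free_ring\<^esub>"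
      by (intro bexI[of _ "- x"]) (auto simp: free_ring_def)
  qed (auto simp: free_ring_def ac_simps)
  show "Group.monoid (free_ring :: 'g free_algebra ring)"
    by (rule monoidI) (auto simp: free_ring_def mult.assoc)
qed (auto simp: free_ring_def algebra_simps)

lemma free_ring_simps [simp]:
  "carrier free_ring = UNIV" "\<one>\<^bsub>free_ring\<^esub> = 1" "\<zero>\<^bsub>free_ring\<^esub> = 0"
  "x \<otimes>\<^bsub>free_ring\<^esub> y = x * y" "x \<oplus>\<^bsub>free_ring\<^esub> y = x + y"
  by (auto simp: free_ring_def)

definition two_sided :: "'g free_algebra set \<Rightarrow> bool" where
  "two_sided I \<longleftrightarrow> 0 \<in> I \<and> (\<forall>x\<in>I. \<forall>y\<in>I. x + y \<in> I) \<and> (\<forall>x\<in>I. \<forall>a. a * x \<in> I \<and> x * a \<in> I)"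

lemma
  assumes "two_sided I"
  shows two_sided_zero: "0 \<in> I"
    and two_sided_add: "x \<in> I \<Longrightarrow> y \<in> I \<Longrightarrow> x + y \<in> I"
    and two_sided_left: "x \<in> I \<Longrightarrow> a * x \<in> I"
    and two_sided_right: "x \<in> I \<Longrightarrow> x * a \<in> I"
    and two_sided_uminus: "x \<in> I \<Longrightarrow> - x \<in> I"
    and two_sided_diff: "x \<in> I \<Longrightarrow> y \<in> I \<Longrightarrow> x - y \<in> I"
proof -
  show 1: "0 \<in> I" "x \<in> I \<Longrightarrow> y \<in> I \<Longrightarrow> x + y \<in> I" "x \<in> I \<Longrightarrow> a * x \<in> I" "x \<in> I \<Longrightarrow> x * a \<in> I" for x y a
    using assms unfolding two_sided_def by blast+
  show 2: "x \<in> I \<Longrightarrow> - x \<in> I" for x using 1(3)[of x "- 1"] by simp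
  show "x \<in> I \<Longrightarrow> y \<in> I \<Longrightarrow> x - y \<in> I" using 1(2)[of x "- y"] 2 by simp
qed

lemma ideal_iff_two_sided: "ideal I (free_ring :: 'g free_algebra ring) \<longleftrightarrow> two_sided I"
proof
  assume "ideal I (free_ring :: 'g free_algebra ring)"
  then interpret ideal I "free_ring :: 'g free_algebra ring" .
  show "two_sided I"
    unfolding two_sided_def using additive_subgroup.zero_closed[OF is_additive_subgroup]
      additive_subgroup.a_closed[OF is_additive_subgroup] I_l_closed I_r_closed by auto
next
  assume I: "two_sided I"
  interpret ring "free_ring :: 'g free_algebra ring" by (rule ring_free_ring)
  show "ideal I (free_ring :: 'g free_algebra ring)"
  proof (rule idealI[OF ring_free_ring])
    show "subgroup I (add_monoid (free_ring :: 'g free_algebra ring))"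
    proof (rule group.subgroupI[OF a_group])
      show "I \<noteq> {}" using two_sided_zero[OF I] by blast
      fix x y assume x: "x \<in> I"
      have "x \<oplus>\<^bsub>free_ring\<^esub> - x = \<zero>\<^bsub>free_ring\<^esub>" by simp
      then have "inv\<^bsub>add_monoid free_ring\<^esub> x = - x"
        using minus_equality[of "- x" x] by (simp add: a_inv_def)
      then show "inv\<^bsub>add_monoid free_ring\<^esub> x \<in> I" using two_sided_uminus[OF I x] by simp
      assume "y \<in> I"
      then show "x \<otimes>\<^bsub>add_monoid free_ring\<^esub> y \<in> I" using two_sided_add[OF I x] by simp
    qed auto
  qed (use two_sided_left[OF I] two_sided_right[OF I] in auto)
qed

lemma
  shows two_sided_genideal: "two_sided (genideal free_ring R)"
    and genideal_generators: "R \<subseteq> genideal free_ring R"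
    and genideal_subset: "two_sided I \<Longrightarrow> R \<subseteq> I \<Longrightarrow> genideal free_ring R \<subseteq> I"
proof -
  interpret ring "free_ring :: 'a free_algebra ring" by (rule ring_free_ring)
  show "two_sided (genideal free_ring R)"
    using genideal_ideal[of R] by (simp add: ideal_iff_two_sided)
  show "R \<subseteq> genideal free_ring R" by (rule genideal_self) simp
  show "two_sided I \<Longrightarrow> R \<subseteq> I \<Longrightarrow> genideal free_ring R \<subseteq> I"
    by (rule genideal_minimal) (simp add: ideal_iff_two_sided)
qed

text \<open>The preimage of a two-sided ideal under an additive antimultiplicative map is again
  two-sided, so only generators need checking. This serves the involutions and the antipode.\<close>

lemma genideal_mapsto:
  fixes \<phi> :: "'g free_algebra \<Rightarrow> 'g free_algebra"
  assumes "two_sided I" "\<And>x y. \<phi> (x + y) = \<phi> x + \<phi> y" "\<And>x y. \<phi> (x * y) = \<phi> y * \<phi> x"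
    and "\<And>r. r \<in> R \<Longrightarrow> \<phi> r \<in> I" and "x \<in> genideal free_ring R"
  shows "\<phi> x \<in> I"
proof -
  have "\<phi> 0 = 0" using assms(2)[of 0 0] by simp
  then have "two_sided {x. \<phi> x \<in> I}"
    using assms(1) by (auto simp: two_sided_def assms(2,3))
  then have "genideal free_ring R \<subseteq> {x. \<phi> x \<in> I}"
    by (rule genideal_subset) (use assms(4) in auto)
  then show ?thesis using assms(5) by blast
qed

definition cls :: "'g free_algebra set \<Rightarrow> 'g free_algebra \<Rightarrow> 'g free_algebra set" where
  "cls I p = I +>\<^bsub>free_ring\<^esub> p"

lemma cls_eq: "cls I p = {i + p |i. i \<in> I}"
  by (auto simp: cls_def a_r_coset_def r_coset_def)

lemma cls_self: "two_sided I \<Longrightarrow> p \<in> cls I p"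
  unfolding cls_eq using two_sided_zero by force

lemma cls_mem: "r \<in> cls I p \<longleftrightarrow> r - p \<in> I"
proof
  assume "r - p \<in> I"
  then show "r \<in> cls I p" unfolding cls_eq by (intro CollectI exI[of _ "r - p"]) simp
qed (auto simp: cls_eq)

lemma cls_eq_iff: "two_sided I \<Longrightarrow> cls I p = cls I r \<longleftrightarrow> p - r \<in> I"
proof
  assume I: "two_sided I" and "cls I p = cls I r"
  then show "p - r \<in> I" using cls_self[OF I, of p] by (simp add: cls_mem)
next
  assume I: "two_sided I" and *: "p - r \<in> I"
  have "x - p \<in> I \<longleftrightarrow> x - r \<in> I" for x
    using two_sided_add[OF I, of "x - p" "p - r"] two_sided_diff[OF I, of "x - r" "p - r"] * by auto
  then show "cls I p = cls I r" by (auto simp: cls_mem)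
qed

text \<open>Maps on quotients are defined by \<open>the_elem\<close> of the values on all
  representatives; constancy on the class is exactly well-definedness.\<close>

lemma the_elem_image: "x \<in> X \<Longrightarrow> (\<And>y. y \<in> X \<Longrightarrow> f y = f x) \<Longrightarrow> the_elem (f ` X) = f x"
proof -
  assume *: "x \<in> X" "\<And>y. y \<in> X \<Longrightarrow> f y = f x"
  then have "f ` X = {f x}" by blast
  then show ?thesis by simp
qed

lemma coset_map_cls:
  assumes I: "two_sided I" and "\<And>x y. f (x + y) = f x + f y" "\<And>x. x \<in> I \<Longrightarrow> f x \<in> I"
  shows "coset_map I f (cls I p) = cls I (f p)"
  unfolding coset_map_def cls_def[symmetric]
proof (rule the_elem_image[OF cls_self[OF I]])
  fix r assume "r \<in> cls I p"
  then have "f (r - p) \<in> I" using assms(3) by (simp add: cls_mem)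
  moreover have "f r = f (r - p) + f p" using assms(2)[of "r - p" p] by simp
  ultimately show "cls I (f r) = cls I (f p)" by (simp add: cls_eq_iff[OF I])
qed

lemma quotient_simps:
  assumes I: "two_sided I"
  shows "carrier (free_ring Quot I) = range (cls I)"
    and "\<one>\<^bsub>free_ring Quot I\<^esub> = cls I 1" and "\<zero>\<^bsub>free_ring Quot I\<^esub> = cls I 0"
    and "cls I p \<otimes>\<^bsub>free_ring Quot I\<^esub> cls I r = cls I (p * r)"
    and "cls I p \<oplus>\<^bsub>free_ring Quot I\<^esub> cls I r = cls I (p + r)"
proof -
  interpret ideal I "free_ring :: 'a free_algebra ring" using I by (simp add: ideal_iff_two_sided)
  show "carrier (free_ring Quot I) = range (cls I)"
    by (auto simp: FactRing_def A_RCOSETS_def RCOSETS_def cls_def a_r_coset_def)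
  show "\<one>\<^bsub>free_ring Quot I\<^esub> = cls I 1" by (simp add: FactRing_def cls_def)
  show "\<zero>\<^bsub>free_ring Quot I\<^esub> = cls I 0" by (simp add: FactRing_def cls_eq)
  show "cls I p \<otimes>\<^bsub>free_ring Quot I\<^esub> cls I r = cls I (p * r)"
    using rcoset_mult_add[of p r] by (simp add: FactRing_def cls_def)
  show "cls I p \<oplus>\<^bsub>free_ring Quot I\<^esub> cls I r = cls I (p + r)"
    using a_rcos_sum[of p r] by (simp add: FactRing_def cls_def)
qed

subsection \<open>Antimultiplicative extensions\<close>

context
  fixes \<kappa> :: "complex \<Rightarrow> complex" and s :: "'g \<Rightarrow> 'g free_algebra"
  assumes \<kappa>: "\<And>a b. \<kappa> (a + b) = \<kappa> a + \<kappa> b" "\<And>a b. \<kappa> (a * b) = \<kappa> a * \<kappa> b" "\<kappa> 1 = 1"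
begin

lemma anti_extension_eq: "anti_extension \<kappa> s = lin_sum (\<lambda>w c. scalar (\<kappa> c) * prod_list (map s (rev (letters w))))"
  by (rule ext) (simp add: anti_extension_def lin_sum_def)

lemma \<kappa>0: "\<kappa> 0 = 0" using \<kappa>(1)[of 0 0] by simp

lemma anti_extension_add: "anti_extension \<kappa> s (p + r) = anti_extension \<kappa> s p + anti_extension \<kappa> s r"
  unfolding anti_extension_eq by (rule lin_sum_add) (simp_all add: \<kappa>0 \<kappa>(1) scalar_add algebra_simps)

lemma anti_extension_single:
  "anti_extension \<kappa> s (Poly_Mapping.single w c) = scalar (\<kappa> c) * prod_list (map s (rev (letters w)))"
  unfolding anti_extension_eq by (rule lin_sum_single) (simp add: \<kappa>0)

lemma anti_extension_scalar: "anti_extension \<kappa> s (scalar c) = scalar (\<kappa> c)"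
  by (simp add: scalar_def anti_extension_single zero_word_def)

lemma anti_extension_gen: "anti_extension \<kappa> s (free_gen g) = s g"
  by (simp add: free_gen_def anti_extension_single \<kappa>)

lemma anti_extension_mult: "anti_extension \<kappa> s (p * r) = anti_extension \<kappa> s r * anti_extension \<kappa> s p"
proof (induction p rule: poly_mapping_induct_single)
  case p: (single w c)
  show ?case
  proof (induction r rule: poly_mapping_induct_single)
    case (single v d)
    let ?A = "prod_list (map s (rev (letters w)))" and ?B = "prod_list (map s (rev (letters v)))"
    have "anti_extension \<kappa> s (Poly_Mapping.single w c * Poly_Mapping.single v d)
        = scalar (\<kappa> c * \<kappa> d) * (?B * ?A)"
      by (simp add: mult_single anti_extension_single \<kappa> plus_word_def)
    also have "\<dots> = scalar (\<kappa> d) * (scalar (\<kappa> c) * ?B) * ?A"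
      by (simp add: mult.commute scalar_scalar_mult flip: mult.assoc)
    also have "scalar (\<kappa> c) * ?B = ?B * scalar (\<kappa> c)" by (rule scalar_central)
    finally show ?case by (simp add: anti_extension_single mult.assoc)
  qed (simp add: anti_extension_add algebra_simps)
qed (simp add: anti_extension_add algebra_simps)

lemma anti_extension_uminus: "anti_extension \<kappa> s (- p) = - anti_extension \<kappa> s p"
  using anti_extension_add[of p "- p"] anti_extension_scalar[of 0]
  by (simp add: \<kappa>0 add_eq_0_iff)

lemma anti_extension_diff: "anti_extension \<kappa> s (p - r) = anti_extension \<kappa> s p - anti_extension \<kappa> s r"
  using anti_extension_add[of p "- r"] by (simp add: anti_extension_uminus)

lemmas anti_extension_simps = anti_extension_add anti_extension_diff anti_extension_uminus
  anti_extension_mult anti_extension_gen anti_extension_scalar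

end

lemmas star_extension_simps =
  anti_extension_simps[where \<kappa> = cnj, OF complex_cnj_add complex_cnj_mult complex_cnj_one]

lemmas id_extension_simps = anti_extension_simps[where \<kappa> = id, simplified]

lemma coset_map_star:
  assumes "two_sided I" "\<And>r. r \<in> I \<Longrightarrow> anti_extension cnj s r \<in> I"
  shows "coset_map I (anti_extension cnj s) (cls I p) = cls I (anti_extension cnj s p)"
  by (rule coset_map_cls[OF assms(1)]) (simp_all add: star_extension_simps assms)

subsection \<open>Presented star algebras\<close>

context
  fixes s :: "'g \<Rightarrow> 'g free_algebra" and R :: "'g free_algebra set"
  assumes star_rels: "\<And>r. r \<in> R \<Longrightarrow> anti_extension cnj s r \<in> genideal free_ring R"
begin

abbreviation "pres_ideal \<equiv> genideal free_ring R"
abbreviation "pres_alg \<equiv> presented_star_algebra s R"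

lemma pres_star_ideal: "p \<in> pres_ideal \<Longrightarrow> anti_extension cnj s p \<in> pres_ideal"
  by (rule genideal_mapsto[OF two_sided_genideal _ _ star_rels]) (simp_all add: star_extension_simps)

lemma pres_simps:
  "carrier pres_alg = range (cls pres_ideal)"
  "\<one>\<^bsub>pres_alg\<^esub> = cls pres_ideal 1" "\<zero>\<^bsub>pres_alg\<^esub> = cls pres_ideal 0"
  "cls pres_ideal p \<otimes>\<^bsub>pres_alg\<^esub> cls pres_ideal r = cls pres_ideal (p * r)"
  "cls pres_ideal p \<oplus>\<^bsub>pres_alg\<^esub> cls pres_ideal r = cls pres_ideal (p + r)"
  "cscale pres_alg c (cls pres_ideal p) = cls pres_ideal (scalar c * p)"
  "cstar pres_alg (cls pres_ideal p) = cls pres_ideal (anti_extension cnj s p)"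
proof -
  note q = quotient_simps[OF two_sided_genideal[of R]]
  show "carrier pres_alg = range (cls pres_ideal)" "\<one>\<^bsub>pres_alg\<^esub> = cls pres_ideal 1"
    "\<zero>\<^bsub>pres_alg\<^esub> = cls pres_ideal 0"
    "cls pres_ideal p \<otimes>\<^bsub>pres_alg\<^esub> cls pres_ideal r = cls pres_ideal (p * r)"
    "cls pres_ideal p \<oplus>\<^bsub>pres_alg\<^esub> cls pres_ideal r = cls pres_ideal (p + r)"
    unfolding presented_star_algebra_def Let_def using q by simp_all
  show "cscale pres_alg c (cls pres_ideal p) = cls pres_ideal (scalar c * p)"
    unfolding presented_star_algebra_def Let_def
    using coset_map_cls[OF two_sided_genideal, of "\<lambda>p. scalar c * p" R p]
    by (simp add: algebra_simps two_sided_left[OF two_sided_genideal])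
  show "cstar pres_alg (cls pres_ideal p) = cls pres_ideal (anti_extension cnj s p)"
    unfolding presented_star_algebra_def Let_def
    using coset_map_star[OF two_sided_genideal pres_star_ideal] by simp
qed

lemma star_twice:
  assumes "\<And>g. anti_extension cnj s (s g) = free_gen g"
  shows "anti_extension cnj s (anti_extension cnj s p) = p"
  by (induction p rule: free_algebra_induct) (simp_all add: star_extension_simps assms)

lemma complex_star_algebra_presented:
  assumes "\<And>g. anti_extension cnj s (s g) = free_gen g"
  shows "complex_star_algebra pres_alg"
proof -
  have c: "x \<in> carrier pres_alg \<longleftrightarrow> (\<exists>p. x = cls pres_ideal p)" for x
    by (auto simp: pres_simps)
  have r: "ring pres_alg"
  proof (rule ringI)
    show "abelian_group pres_alg"
    proof (rule abelian_groupI)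
      fix x assume "x \<in> carrier pres_alg"
      then obtain p where "x = cls pres_ideal p" using c by blast
      then show "\<exists>y\<in>carrier pres_alg. y \<oplus>\<^bsub>pres_alg\<^esub> x = \<zero>\<^bsub>pres_alg\<^esub>"
        by (intro bexI[of _ "cls pres_ideal (- p)"]) (auto simp: pres_simps)
    qed (auto simp: c pres_simps ac_simps)
    show "Group.monoid pres_alg"
      by (rule monoidI) (auto simp: c pres_simps mult.assoc)
  qed (auto simp: c pres_simps algebra_simps)
  show ?thesis
    unfolding complex_star_algebra_def
  proof (intro conjI r allI ballI)
    fix a x y assume "x \<in> carrier pres_alg" "y \<in> carrier pres_alg"
    then obtain p r where *: "x = cls pres_ideal p" "y = cls pres_ideal r" unfolding c by blast
    have "cls pres_ideal (scalar a * (p * r)) = cls pres_ideal (p * (scalar a * r))"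
      by (rule arg_cong[OF scalar_mid[symmetric]])
    then show "cscale pres_alg a (x \<otimes>\<^bsub>pres_alg\<^esub> y) = x \<otimes>\<^bsub>pres_alg\<^esub> cscale pres_alg a y"
      unfolding * pres_simps .
  next
    fix a x assume "x \<in> carrier pres_alg"
    then obtain p where *: "x = cls pres_ideal p" using c by blast
    have "cls pres_ideal (anti_extension cnj s p * scalar (cnj a))
        = cls pres_ideal (scalar (cnj a) * anti_extension cnj s p)"
      by (rule arg_cong[OF scalar_central[symmetric]])
    then show "cstar pres_alg (cscale pres_alg a x) = cscale pres_alg (cnj a) (cstar pres_alg x)"
      unfolding * pres_simps star_extension_simps .
  qed (auto simp: c pres_simps star_extension_simps star_twice[OF assms] scalar_scalar_mult
      scalar_add distrib_left distrib_right mult.assoc)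
qed

end

subsection \<open>Representations of free algebras\<close>

text \<open>The generators need to be linear only on the invariant set \<open>V\<close>. This covers
  the bounded operators of the sphere on the whole space, the unbounded generators of the quantum
  group on \<open>W\<close>, and the latter's action on the free algebra of the sphere.\<close>

locale free_rep =
  fixes sc :: "complex \<Rightarrow> 'v::ab_group_add \<Rightarrow> 'v" and V :: "'v set" and \<rho> :: "'g \<Rightarrow> 'v \<Rightarrow> 'v"
  assumes sc: "sc c (x + y) = sc c x + sc c y" "sc (a + b) x = sc a x + sc b x"
      "sc a (sc b x) = sc (a * b) x" "sc 1 x = x"
    and V0: "0 \<in> V" and Vadd: "x \<in> V \<Longrightarrow> y \<in> V \<Longrightarrow> x + y \<in> V" and Vsc: "x \<in> V \<Longrightarrow> sc c x \<in> V"
    and \<rho>V: "x \<in> V \<Longrightarrow> \<rho> g x \<in> V"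
    and \<rho>add: "x \<in> V \<Longrightarrow> y \<in> V \<Longrightarrow> \<rho> g (x + y) = \<rho> g x + \<rho> g y"
    and \<rho>sc: "x \<in> V \<Longrightarrow> \<rho> g (sc c x) = sc c (\<rho> g x)"
begin

abbreviation "act \<equiv> free_action sc \<rho>"

lemma sc_zero [simp]: "sc 0 x = 0" "sc c 0 = 0"
  using sc(2)[of 0 0 x] sc(1)[of c 0 0] by simp_all

lemma act_eq: "act p x = lin_sum (\<lambda>w c. sc c (foldr \<rho> (letters w) x)) p"
  by (simp add: free_action_def lin_sum_def)

lemma foldr_V: "x \<in> V \<Longrightarrow> foldr \<rho> ws x \<in> V"
  by (induction ws) (auto intro: \<rho>V)

lemma foldr_add: "x \<in> V \<Longrightarrow> y \<in> V \<Longrightarrow> foldr \<rho> ws (x + y) = foldr \<rho> ws x + foldr \<rho> ws y"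
  by (induction ws) (auto simp: \<rho>add foldr_V)

lemma foldr_sc: "x \<in> V \<Longrightarrow> foldr \<rho> ws (sc c x) = sc c (foldr \<rho> ws x)"
  by (induction ws) (auto simp: \<rho>sc foldr_V)

lemma act_add: "act (p + r) x = act p x + act r x"
  unfolding act_eq by (rule lin_sum_add) (simp_all add: sc)

lemma act_single: "act (Poly_Mapping.single w c) x = sc c (foldr \<rho> (letters w) x)"
  unfolding act_eq by (rule lin_sum_single) simp

lemma act_V: "x \<in> V \<Longrightarrow> act p x \<in> V"
  by (induction p rule: poly_mapping_induct_single) (auto simp: act_add act_single Vadd Vsc foldr_V)

lemma act_zero [simp]: "act 0 x = 0"
  by (simp add: act_eq)

lemma act_add_right: "x \<in> V \<Longrightarrow> y \<in> V \<Longrightarrow> act p (x + y) = act p x + act p y"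
  by (induction p rule: poly_mapping_induct_single)
    (auto simp: act_add act_single foldr_add sc algebra_simps)

lemma act_sc: "x \<in> V \<Longrightarrow> act p (sc c x) = sc c (act p x)"
  by (induction p rule: poly_mapping_induct_single)
    (auto simp: act_add act_single foldr_sc sc algebra_simps)

lemma act_zero_right [simp]: "act p 0 = 0"
  using act_sc[OF V0, of p 0] by simp

lemma act_mult: "x \<in> V \<Longrightarrow> act (p * r) x = act p (act r x)"
proof (induction p rule: poly_mapping_induct_single)
  case p: (single w c)
  show ?case
  proof (induction r rule: poly_mapping_induct_single)
    case (single v d)
    then show ?case using p by (simp add: mult_single act_single plus_word_def foldr_sc foldr_V sc)
  next
    case (add r r')
    then show ?case using p by (simp add: distrib_left act_add act_add_right act_V)
  qed
qed (simp add: distrib_right act_add)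

lemma act_scalar: "act (scalar c) x = sc c x"
  by (simp add: scalar_def act_single zero_word_def)

lemma act_one: "act 1 x = x"
  using act_scalar[of 1] by (simp add: sc)

lemma act_gen: "act (free_gen g) x = \<rho> g x"
  by (simp add: free_gen_def act_single sc)

lemma act_uminus: "act (- p) x = - act p x"
  using act_add[of p "- p" x] by (simp add: add_eq_0_iff)

lemma act_diff: "act (p - r) x = act p x - act r x"
  using act_add[of p "- r" x] by (simp add: act_uminus)

lemmas act_simps = act_add act_diff act_uminus act_mult act_scalar act_one act_gen

text \<open>With \<open>J = {0}\<close> this says that a representation descends to the quotient.
  With \<open>J\<close> the ideal of the sphere it makes the quantum group act on the quotient
  algebra.\<close>

lemma act_genideal:
  assumes J: "0 \<in> J" "\<And>x y. x \<in> J \<Longrightarrow> y \<in> J \<Longrightarrow> x + y \<in> J" "\<And>c x. x \<in> J \<Longrightarrow> sc c x \<in> J" "J \<subseteq> V"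
      "\<And>g x. x \<in> J \<Longrightarrow> \<rho> g x \<in> J"
    and R: "\<And>r x. r \<in> R \<Longrightarrow> x \<in> V \<Longrightarrow> act r x \<in> J"
    and p: "p \<in> genideal free_ring R" and x: "x \<in> V"
  shows "act p x \<in> J"
proof -
  have JJ: "act a y \<in> J" if "y \<in> J" for a y
  proof (induction a rule: poly_mapping_induct_single)
    case (single w c)
    have "foldr \<rho> ws y \<in> J" for ws by (induction ws) (use that J in auto)
    then show ?case by (simp add: act_single J)
  qed (simp add: act_add J)
  let ?I = "{p. \<forall>x\<in>V. act p x \<in> J}"
  have "two_sided ?I"
    unfolding two_sided_def using J by (auto simp: act_add act_mult act_V JJ)
  then have "genideal free_ring R \<subseteq> ?I" by (rule genideal_subset) (use R in auto)
  then show ?thesis using p x by blast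
qed

end

section \<open>Normal forms of the matrix elements\<close>

lemma diff_inverse_divide:
  "P \<noteq> 0 \<Longrightarrow> d \<noteq> 0 \<Longrightarrow> (inverse P - P) / d = (1 - P * P) / (P * d)" for P d :: real
  by (simp add: field_simps)

lemma square_less_1: "0 < z \<Longrightarrow> z < 1 \<Longrightarrow> z * z < 1" for z :: real
  using mult_strict_mono[of z 1 z 1] by simp

lemma inverse_square_quotient: "Z \<noteq> 0 \<Longrightarrow> z \<noteq> 0 \<Longrightarrow> d \<noteq> 0 \<Longrightarrow> 1 - z * z \<noteq> 0 \<Longrightarrow>
  inverse (((1 - z * z) / (z * d))\<^sup>2) * ((1 - z) / (Z * d))\<^sup>2
    = ((1 - z) / (1 - z * z))\<^sup>2 * (z * z / (Z * Z))" for z Z d :: real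
  by (simp add: power2_eq_square mult_ac)

lemma quotient_eqD: "e = x / (a * b) / (c * c) \<Longrightarrow> a \<noteq> 0 \<Longrightarrow> b \<noteq> 0 \<Longrightarrow> c \<noteq> 0 \<Longrightarrow> e * (c * c) * (a * b) = x" for e :: real
  by simp

lemma diff_quotients: "x = a / (b * d * d) \<Longrightarrow> y = c / (e * d * d) \<Longrightarrow> d \<noteq> 0 \<Longrightarrow>
  - d * (y - x) = a / (b * d) - c / (e * d)" for d :: real
  by (simp add: right_diff_distrib)

lemma product_quotient_cancel: "Z \<noteq> 0 \<Longrightarrow> z \<noteq> 0 \<Longrightarrow> d \<noteq> 0 \<Longrightarrow> s \<noteq> 0 \<Longrightarrow> p \<noteq> 0 \<Longrightarrow> f \<noteq> 0 \<Longrightarrow> g \<noteq> 0 \<Longrightarrow>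
  c * (a / (Z * s * d) * (b / (Z / s * d))) * (e / (z * d)) / (f / (z * p * d) * (g / (Z * d))\<^sup>2)
    = c * p * (a * b * e / (f * (g * g)))" for z Z d :: real
  by (simp add: power2_eq_square)

lemma quotient_regroup: "s \<noteq> 0 \<Longrightarrow> k * (b * s / (a * g)) * x = k * b / (a * (g * s)) * (x * (s * s))" for s :: real
  by simp

locale podles =
  fixes q t :: real
  assumes q0: "0 < q" and q1: "q < 1" and t0: "0 \<le> t" and t1: "t \<le> 1"
begin

definition r :: real where "r = sqrt q"
text \<open>The essential part of the square root of [n], see \<open>sqrt_qnum_int\<close>. For
  nonnegative n its square is polynomial in q^n, and the value 0 at n = 0 encodes the boundary of
  the label range.\<close>

definition u :: "int \<Rightarrow> real" where "u n = sqrt (1 - q powi (2 * n))"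
definition s2 :: real where "s2 = sqrt (qnum q 2)"
definition D :: real where "D = inverse q - q"

lemma r_pos: "0 < r" and r_square: "r * r = q" and r_less_1: "r < 1"
  using q0 q1 by (auto simp: r_def)

lemma D_pos: "0 < D"
  using q0 q1 by (simp add: D_def) (metis less_trans one_less_inverse)

lemma q_powr_half: "q powr (of_int k / 2) = r powi k"
  using q0 by (simp add: r_def powr_half_sqrt[symmetric] powr_powr flip: powr_real_of_int')

lemma q_powr_int: "q powr of_int k = q powi k"
  by (rule powr_real_of_int') (use q0 in auto)

lemma r_powi_double: "r powi k * r powi k = q powi k"
  using r_square by (metis power_int_mult_distrib)

lemma qnum_half: "qnum q (of_int k / 2) = (1 - q powi k) / (r powi k * D)"
proof -
  have pos: "0 < r powi k" using r_pos by (rule zero_less_power_int)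
  have "- (of_int k / 2) = of_int (- k) / (2 :: real)" by simp
  then have "qnum q (of_int k / 2) = (r powi k - inverse (r powi k)) / (q - inverse q)"
    unfolding qnum_def by (simp only: q_powr_half power_int_minus)
  also have "\<dots> = (inverse (r powi k) - r powi k) / D"
    unfolding D_def using nonzero_minus_divide_divide[of "q - inverse q" "r powi k - inverse (r powi k)"]
    by (metis (no_types) minus_diff_eq minus_divide_divide)
  also have "\<dots> = (1 - r powi k * r powi k) / (r powi k * D)"
    by (metis diff_inverse_divide less_irrefl pos D_pos)
  finally show ?thesis by (simp only: r_powi_double)
qed

lemma qnum_int: "qnum q (of_int k) = (1 - q powi (2 * k)) / (q powi k * D)"
proof -
  have e: "(of_int k :: real) = of_int (2 * k) / 2" by simp
  have "r powi (k + k) = r powi k * r powi k" using r_pos by (intro power_int_add) simp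
  then have "r powi (2 * k) = q powi k" unfolding r_powi_double by simp
  then show ?thesis unfolding e qnum_half by simp
qed

lemma q_powi_pos: "0 < q powi k"
  using q0 by (rule zero_less_power_int)

lemma q_powi_le_1: "0 \<le> k \<Longrightarrow> q powi k \<le> 1"
  using q0 q1 by (simp add: power_int_le_one)

lemma q_powi_less_1: "0 < k \<Longrightarrow> q powi k < 1"
proof -
  assume "0 < k"
  then obtain n where n: "k = int n" "0 < n" using zero_less_imp_eq_int by blast
  have "q ^ n < q ^ 0" using q0 q1 n(2) by (intro power_strict_decreasing) auto
  then show ?thesis by (simp add: n(1) power_int_of_nat)
qed

lemma q_powi_double: "q powi (2 * k) = q powi k * q powi k"
  by (metis less_irrefl mult_2 power_int_add q0)

lemma u_square: "0 \<le> n \<Longrightarrow> u n * u n = 1 - q powi n * q powi n"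
  using q_powi_le_1[of "2 * n"] by (simp add: u_def q_powi_double)

lemma u_nonneg: "0 \<le> n \<Longrightarrow> 0 \<le> u n" and u_pos: "0 < n \<Longrightarrow> 0 < u n" and u_0 [simp]: "u 0 = 0"
  using q_powi_le_1[of "2 * n"] q_powi_less_1[of "2 * n"] by (auto simp: u_def)

lemma sqrt_qnum_int: "sqrt (qnum q (of_int k)) = u k / (r powi k * sqrt D)"
proof -
  have "sqrt (q powi k) = r powi k"
    unfolding r_powi_double[of k, symmetric] using r_pos by (simp add: zero_le_power_int less_imp_le)
  then show ?thesis unfolding qnum_int u_def by (simp add: real_sqrt_divide real_sqrt_mult)
qed

lemma qnum_2: "qnum q 2 = q + inverse q"
proof -
  have "qnum q 2 = (1 - q powi 4) / (q powi 2 * D)" using qnum_int[of 2] by simp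
  also have "\<dots> = (1 - q ^ 4) / (q\<^sup>2 * D)" by (simp add: power_int_def)
  also have "1 - q ^ 4 = (q + inverse q) * (q\<^sup>2 * D)"
    using q0 unfolding D_def by (simp add: field_simps power2_eq_square power4_eq_xxxx)
  finally show ?thesis using q0 D_pos by simp
qed

lemma s2_square: "s2 * s2 = q + inverse q"
  using q0 by (simp add: s2_def qnum_2)

lemma s2_pos: "0 < s2"
  using q0 by (simp add: s2_def qnum_2 add_pos_pos)

text \<open>\<open>E\<close> and \<open>B\<close> are \<open>alpha_N\<close> and
  \<open>beta_N\<close> at l = n/2, freed from the factors \<open>u (n - 1) * u n\<close> and 1 -
  q^(2n), which cancel against the denominators of the matrix elements. The auxiliary
  \<open>p\<close> equals q or 1/q.\<close>

definition E :: "real \<Rightarrow> int \<Rightarrow> real" where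
  "E N n = (let z = q powi n; p = q powr (2 * N) in
     sqrt ((1 + q * q) * (1 - t + p * z) * (1 + (1 - t) * z / p) / ((1 + q * z) * (1 + z / q))) / (1 - z * z))"

definition B :: "real \<Rightarrow> int \<Rightarrow> real" where
  "B N n = (let z = q powi n; p = q powr (2 * N) in
     (t + (1 + q * q) * (1 / p - p - t / p) * z + t * q * q * z * z) / ((1 - q ^ 4 * z * z) * (1 - z * z)))"

lemma p_cases: "N \<in> {1/2, - 1/2} \<Longrightarrow> q powr (2 * N) = q \<or> q powr (2 * N) = 1 / q"
proof -
  assume "N \<in> {1/2, - 1/2}"
  then consider "2 * N = 1" | "2 * N = - 1" by force
  then show ?thesis using q0 by cases (simp_all only: powr_one powr_minus_divide less_imp_le simp_thms)
qed

lemma E_square: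
  assumes "0 < n"
  shows "E N n * E N n * ((1 - q powi n * q powi n) * (1 - q powi n * q powi n)) *
      ((1 + q * q powi n) * (1 + q powi n / q))
    = (1 + q * q) * (1 - t + q powr (2 * N) * q powi n) * (1 + (1 - t) * q powi n / q powr (2 * N))"
proof -
  define z where "z = q powi n"
  define p where "p = q powr (2 * N)"
  have z: "0 < z" "z < 1" using q_powi_pos q_powi_less_1[OF assms] by (auto simp: z_def)
  have p: "0 < p" using q0 by (simp add: p_def)
  have zz: "1 - z * z > 0" using square_less_1[OF z] by simp
  have w: "0 < 1 + q * z" "0 < 1 + z / q" using q0 z by (simp_all add: add_pos_pos)
  let ?X = "(1 + q * q) * (1 - t + p * z) * (1 + (1 - t) * z / p)"
  have "?X \<ge> 0" using q0 z p t1 by (intro mult_nonneg_nonneg add_nonneg_nonneg) auto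
  then have "sqrt (?X / ((1 + q * z) * (1 + z / q))) * sqrt (?X / ((1 + q * z) * (1 + z / q)))
      = ?X / ((1 + q * z) * (1 + z / q))" using w by (intro real_sqrt_mult_self[THEN trans] abs_of_nonneg divide_nonneg_nonneg mult_nonneg_nonneg[of "1 + q * z"]) auto
  then have "E N n * E N n = ?X / ((1 + q * z) * (1 + z / q)) / ((1 - z * z) * (1 - z * z))"
    unfolding E_def Let_def z_def[symmetric] p_def[symmetric] by simp
  then show ?thesis unfolding z_def[symmetric] p_def[symmetric] using w zz
    by (intro quotient_eqD) auto
qed

lemma E_nonneg: "0 < n \<Longrightarrow> 0 \<le> E N n"
proof -
  assume n: "0 < n"
  define z where "z = q powi n"
  have z: "0 < z" "z < 1" using q_powi_pos q_powi_less_1[OF n] by (auto simp: z_def)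
  have "z * z < 1" using z mult_strict_mono[of z 1 z 1] by simp
  moreover have "0 \<le> (1 + q * q) * (1 - t + q powr (2 * N) * z) * (1 + (1 - t) * z / q powr (2 * N))
      / ((1 + q * z) * (1 + z / q))"
    using q0 z t1 by (intro divide_nonneg_nonneg mult_nonneg_nonneg add_nonneg_nonneg) auto
  ultimately show ?thesis unfolding E_def Let_def z_def[symmetric] by simp
qed

lemma E_pos: "0 < n \<Longrightarrow> 0 < E N n"
proof -
  assume n: "0 < n"
  define z where "z = q powi n"
  have z: "0 < z" "z < 1" using q_powi_pos q_powi_less_1[OF n] by (auto simp: z_def)
  have "z * z < 1" using z mult_strict_mono[of z 1 z 1] by simp
  moreover have "0 < (1 + q * q) * (1 - t + q powr (2 * N) * z) * (1 + (1 - t) * z / q powr (2 * N))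
      / ((1 + q * z) * (1 + z / q))"
    using q0 z t1 by (intro divide_pos_pos mult_pos_pos add_nonneg_pos add_pos_nonneg) auto
  ultimately show ?thesis unfolding E_def Let_def z_def[symmetric] by simp
qed

text \<open>Both sides are nonnegative square roots, so their squares are compared. The decisive
  point is that the last radicand in \<open>alpha_N\<close>, times (1 + z)^2 with z = q^n, factors
  as (1 - t + p z)(1 + (1 - t) z / p).\<close>

lemma alpha_N_eq:
  assumes n: "0 < n" and N: "N \<in> {1/2, - 1/2}"
  shows "alpha_N q t N (of_int n / 2) = E N n * (u (n - 1) * u n)"
proof -
  define l where "l = (of_int n :: real) / 2"
  define z where "z = q powi n"
  define Z where "Z = r powi n"
  define p where "p = q powr (2 * N)"
  have z: "0 < z" "z < 1" using q_powi_pos q_powi_less_1[OF n] by (auto simp: z_def)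
  have Z: "0 < Z" "Z * Z = z" using r_pos by (simp_all add: Z_def z_def zero_less_power_int r_powi_double)
  have p: "0 < p" using q0 by (simp add: p_def)
  have zz: "z * z < 1" using z mult_strict_mono[of z 1 z 1] by simp
  have qq: "q * q < 1" using q0 q1 mult_strict_mono[of q 1 q 1] by simp
  have zzq: "z * z * (q * q) < 1" using zz qq q0 z mult_strict_mono[of "z * z" 1 "q * q" 1] by simp
  have zq: "z / q \<le> 1"
  proof -
    have "q powi (n - 1) \<le> 1" using n by (intro q_powi_le_1) simp
    then show ?thesis using q0 by (simp add: z_def power_int_diff)
  qed
  have qp: "q powi (2 * n) = z * z" "q powi (n + 1) = z * q" "q powi (n - 1) = z / q"
    "r powi (n + 1) = Z * r" "r powi (n - 1) = Z / r" "q powi (2 * (n - 1)) = z * z / (q * q)"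
    "q powi (2 * (n + 1)) = z * z * (q * q)"
    using q0 r_pos by (simp_all add: z_def Z_def power_int_add power_int_diff q_powi_double power2_eq_square)
  have e1: "l + 1/2 = of_int (n + 1) / 2" "l - 1/2 = of_int (n - 1) / 2" "2 * l = of_int n"
    "2 * l + 1 = of_int (n + 1)" by (simp_all add: l_def add_divide_distrib diff_divide_distrib)
  have l1: "qnum q l = (1 - z) / (Z * D)" unfolding l_def qnum_half by (simp add: z_def Z_def)
  have l2: "qnum q (2 * l) = (1 - z * z) / (z * D)" unfolding e1 qnum_int qp by (simp add: z_def)
  have l3: "qnum q (2 * l + 1) = (1 - z * z * (q * q)) / (z * q * D)"
    unfolding e1(4) qnum_int qp by simp
  have l4: "qnum q (l + 1/2) = (1 - z * q) / (Z * r * D)" unfolding e1 qnum_half qp by simp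
  have l5: "qnum q (l - 1/2) = (1 - z / q) / (Z / r * D)" unfolding e1 qnum_half qp by simp
  have zq': "z * q < 1" using z q0 q1 mult_strict_mono[of z 1 q 1] by simp
  have nn: "0 \<le> qnum q (l + 1/2)" "0 \<le> qnum q (l - 1/2)" "0 < qnum q l" "0 < qnum q (2 * l)" "0 < qnum q (2 * l + 1)"
    unfolding l1 l2 l3 l4 l5 using z Z zz zzq zq zq' D_pos q0 r_pos
    by (auto intro!: divide_nonneg_pos divide_pos_pos mult_pos_pos)
  \<comment> \<open>The product over l + N and l - N does not see the sign of N, so both signs
    reduce to one formula; the sign survives only in \<open>p\<close>.\<close>
  have swap: "sqrt (qnum q (l + N)) * sqrt (qnum q (l - N)) = sqrt (qnum q (l + 1/2) * qnum q (l - 1/2))"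
  proof -
    consider "N = 1/2" | "N = - (1/2)" using N by force
    then show ?thesis
    proof cases
      case 2
      have "l + - (1/2) = l - 1/2" "l - - (1/2) = l + 1/2" by simp_all
      then show ?thesis unfolding 2 by (simp only: real_sqrt_mult mult.commute)
    qed (simp only: real_sqrt_mult)
  qed
  let ?R = "1 - t + inverse p * inverse ((qnum q (2*l))^2) * (qnum q l)^2 * (t - 1 + p)^2"
  have R0: "?R \<ge> 0" using t1 p by (intro add_nonneg_nonneg mult_nonneg_nonneg) auto
  have pm: "q powr (- 2 * N) = inverse p" unfolding p_def by (simp add: powr_minus)
  let ?X = "qnum q 2 * (qnum q (l + 1/2) * qnum q (l - 1/2)) * qnum q (2*l) / (qnum q (2*l+1) * (qnum q l)^2) * ?R"
  have sq_l: "sqrt ((qnum q l)\<^sup>2) = qnum q l" using nn by simp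
  have "alpha_N q t N l = sqrt (qnum q 2) * (sqrt (qnum q (l + N)) * sqrt (qnum q (l - N))) * sqrt (qnum q (2*l))
      / (sqrt (qnum q (2*l+1)) * qnum q l) * sqrt ?R"
    unfolding alpha_N_def pm p_def[symmetric] by (simp only: mult.assoc)
  also have "\<dots> = sqrt ?X"
    unfolding swap by (simp only: real_sqrt_mult real_sqrt_divide sq_l)
  finally have a: "alpha_N q t N l = sqrt ?X" .
  have q2: "qnum q 2 * q = 1 + q * q" using q0 by (simp add: qnum_2 distrib_right)
  have R1: "?R * ((1 + z) * (1 + z)) = (1 - t + p * z) * (1 + (1 - t) * z / p)"
  proof -
    have "inverse ((qnum q (2*l))^2) * (qnum q l)^2 = ((1 - z) / (1 - z * z))\<^sup>2 * (z * z / (Z * Z))"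
      unfolding l1 l2 by (rule inverse_square_quotient) (use Z(1) z zz D_pos in auto)
    also have "1 - z * z = (1 - z) * (1 + z)" by (simp add: algebra_simps)
    also have "((1 - z) / ((1 - z) * (1 + z)))\<^sup>2 * (z * z / (Z * Z)) = z / ((1 + z) * (1 + z))"
      unfolding Z using z by (simp add: power2_eq_square)
    finally have "?R = 1 - t + z / ((1 + z) * (1 + z)) * ((t - 1 + p)\<^sup>2 / p)"
      by (simp add: divide_inverse mult_ac)
    then have "?R * ((1 + z) * (1 + z)) = (1 - t) * ((1 + z) * (1 + z)) + z * ((t - 1 + p)\<^sup>2 / p)"
      unfolding distrib_right[of "1 - t"] using z by simp
    also have "\<dots> = (1 - t + p * z) * (1 + (1 - t) * z / p)"
      using p by (simp add: field_simps power2_eq_square)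
    finally show ?thesis .
  qed
  define R' where "R' = ?R"
  have X: "?X = qnum q 2 * (qnum q (l + 1/2) * qnum q (l - 1/2)) * qnum q (2*l) / (qnum q (2*l+1) * (qnum q l)^2) * R'"
    by (simp only: R'_def)
  have "qnum q 2 * (qnum q (l + 1/2) * qnum q (l - 1/2)) * qnum q (2*l) / (qnum q (2*l+1) * (qnum q l)^2) * R' = qnum q 2 * q * ((1 - z * q) * (1 - z / q) * (1 - z * z) / ((1 - z * z * (q * q)) * ((1 - z) * (1 - z)))) * R'"
    unfolding l4 l5 l3
    unfolding l1 l2 by (subst product_quotient_cancel) (use Z(1) z zz zzq D_pos q0 r_pos in \<open>auto simp: mult.assoc\<close>)
  also have "(1 - z * q) * (1 - z / q) * (1 - z * z) / ((1 - z * z * (q * q)) * ((1 - z) * (1 - z)))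
     = (1 - z / q) * (1 + z) / ((1 + z * q) * (1 - z))"
  proof -
    have "1 - z * z * (q * q) = (1 - z * q) * (1 + z * q)" "1 - z * z = (1 - z) * (1 + z)" by (simp_all add: algebra_simps)
    then show ?thesis using z zq' by simp
  qed
  also have "qnum q 2 * q * ((1 - z / q) * (1 + z) / ((1 + z * q) * (1 - z))) * R'
     = (1 + q * q) * (1 - z / q) / ((1 + z * q) * ((1 - z) * (1 + z))) * (R' * ((1 + z) * (1 + z)))"
    unfolding q2 by (rule quotient_regroup) (use z in auto)
  also have "\<dots> = (1 + q * q) * (1 - z / q) / ((1 + z * q) * (1 - z * z)) * ((1 - t + p * z) * (1 + (1 - t) * z / p))"
    unfolding R1[folded R'_def] by (simp add: algebra_simps)
  also have "\<dots> = (E N n * (u (n - 1) * u n))\<^sup>2"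
  proof -
    have un: "u n * u n = 1 - z * z" "u (n - 1) * u (n - 1) = (1 - z / q) * (1 + z / q)"
      using n u_square[of n] u_square[of "n - 1"] by (simp_all add: z_def qp[unfolded z_def] algebra_simps)
    let ?Y = "(1 - t + p * z) * (1 + (1 - t) * z / p)"
    have e: "E N n * E N n * ((1 - z * z) * (1 - z * z)) * ((1 + q * z) * (1 + z / q)) = (1 + q * q) * ?Y"
      using E_square[OF n, of N] unfolding z_def[symmetric] p_def[symmetric] by (simp only: mult.assoc)
    have pos: "1 + z * q > 0" "1 - z * z > 0" using z zz q0 by (simp_all add: add_pos_pos)
    have "(E N n * (u (n - 1) * u n))\<^sup>2 = E N n * E N n * ((u n * u n) * (u (n - 1) * u (n - 1)))"
      by (simp add: power2_eq_square mult_ac)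
    also have "\<dots> = (E N n * E N n * ((1 - z * z) * (1 - z * z)) * ((1 + q * z) * (1 + z / q))) * (1 - z / q)
        / ((1 + z * q) * (1 - z * z))"
      unfolding un using pos by (simp add: mult_ac)
    also have "\<dots> = (1 + q * q) * (1 - z / q) / ((1 + z * q) * (1 - z * z)) * ?Y"
      unfolding e by (simp add: mult_ac)
    finally show ?thesis by simp
  qed
  finally have XX: "?X = (E N n * (u (n - 1) * u n))\<^sup>2" unfolding X .
  have "0 \<le> E N n * (u (n - 1) * u n)" using E_nonneg[OF n, of N] u_nonneg[of n] u_nonneg[of "n - 1"] n by simp
  then have "alpha_N q t N l = E N n * (u (n - 1) * u n)"
    unfolding a XX by (simp only: real_sqrt_abs abs_of_nonneg)
  then show ?thesis by (simp only: l_def)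
qed

text \<open>After clearing denominators both sides are quadratic polynomials in z = q^n. The two
  signs are compared separately, as N = 1/2 and N = -1/2 correspond to p = q and p = 1/q.\<close>

lemma beta_N_eq:
  assumes n: "0 < n" and N: "N \<in> {1/2, - 1/2}"
  shows "beta_N q t N (of_int n / 2) = B N n * (1 - q powi n * q powi n)"
proof -
  define l where "l = (of_int n :: real) / 2"
  define z where "z = q powi n"
  define p where "p = q powr (2 * N)"
  have z: "0 < z" "z < 1" using q_powi_pos q_powi_less_1[OF n] by (auto simp: z_def)
  have zz: "z * z < 1" using z mult_strict_mono[of z 1 z 1] by simp
  have q4: "q ^ 4 < 1" using q0 q1 by (simp add: power_less_one_iff)
  have zq4: "q ^ 4 * z * z < 1" using zz q4 q0 z mult_strict_mono[of "q ^ 4" 1 "z * z" 1] by (simp add: mult.assoc)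
  define Z where "Z = r powi n"
  have Z: "0 < Z" "Z * Z = z" using r_pos by (simp_all add: Z_def z_def zero_less_power_int r_powi_double)
  have qp: "q powi (n + 2) = z * (q * q)" "r powi (n + 2) = Z * q" "q powi (2 * (n + 2)) = z * z * q ^ 4"
  proof -
    have "r\<^sup>2 = q" by (simp add: power2_eq_square r_square)
    then show "q powi (n + 2) = z * (q * q)" "r powi (n + 2) = Z * q" "q powi (2 * (n + 2)) = z * z * q ^ 4"
      using q0 r_pos
      by (simp_all add: z_def Z_def power_int_add q_powi_double power2_eq_square power4_eq_xxxx)
  qed
  have e: "l + 1 = of_int (n + 2) / 2" "2 * l + 2 = of_int (n + 2)" by (simp_all add: l_def add_divide_distrib)
  have a: "qnum q l = (1 - z) / (Z * D)" "qnum q (l + 1) = (1 - z * (q * q)) / (Z * q * D)"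
      "qnum q (2 * l + 2) = (1 - z * z * q ^ 4) / (z * (q * q) * D)"
    unfolding e qnum_int qp unfolding l_def qnum_half by (simp_all add: qp z_def Z_def)
  have b: "qnum q (1/2) = (1 - q) / (r * D)" "qnum q (1/2 + 1) = (1 - q ^ 3) / (r * q * D)"
    "qnum q 1 = 1"
  proof -
    show "qnum q (1/2) = (1 - q) / (r * D)" using qnum_half[of 1] by simp
    have "r powi 3 = r * q" by (simp add: power_int_def power3_eq_cube r_square mult.assoc)
    then show "qnum q (1/2 + 1) = (1 - q ^ 3) / (r * q * D)" using qnum_half[of 3] by (simp add: power_int_def)
    show "qnum q 1 = 1" using qnum_int[of 1] D_pos q0 by (simp add: D_def power_int_def field_simps power2_eq_square)
  qed
  have N': "sgn N * sgn N = 1" "\<bar>N\<bar> = 1/2" "2 * \<bar>N\<bar> = 1" using N by auto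
  have qD: "q - inverse q = - D" "q * D = 1 - q * q" using q0 by (simp_all add: D_def algebra_simps)
  have "qnum q l * qnum q (l + 1) = (1 - z) * (1 - z * (q * q)) / (z * q * D * D)"
    unfolding a using Z by (simp add: mult_ac)
  moreover have "qnum q (1/2) * qnum q (1/2 + 1) = (1 - q) * (1 - q ^ 3) / (q * q * D * D)"
    unfolding b using r_square by (simp add: mult_ac)
  ultimately have num: "(q - inverse q) * (qnum q \<bar>N\<bar> * qnum q (\<bar>N\<bar> + 1) - qnum q l * qnum q (l + 1))
     = (1 - z) * (1 - z * (q * q)) / (z * q * D) - (1 - q) * (1 - q ^ 3) / (q * q * D)"
    unfolding N' qD(1) by (rule diff_quotients) (use D_pos in auto)
  define S where "S = sgn N * (inverse q + q - q powr sgn N * t)"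
  have beta: "beta_N q t N l = (S + t * ((1 - z) * (1 - z * (q * q)) / (z * q * D) - (1 - q) * (1 - q ^ 3) / (q * q * D)))
     / (q * ((1 - z * z * q ^ 4) / (z * (q * q) * D)))"
    unfolding beta_N_def a(3) mult.assoc num S_def N'(3) b(3) by simp
  have Sp: "S = (if p = q then inverse q + q - q * t else - (inverse q + q - t / q)) \<and> (p = q \<or> p = 1 / q)"
  proof -
    have pq: "1 / q \<noteq> q" using square_less_1[OF q0 q1] q0 by (simp add: divide_eq_eq)
    from N consider "N = 1/2" | "N = - (1/2)" by force
    then show ?thesis
    proof cases
      case 1
      have "p = q" "S = inverse q + q - q * t" unfolding p_def S_def 1 using q0 by simp_all
      then show ?thesis by simp
    next
      case 2
      have "p = 1 / q" "S = - (inverse q + q - t / q)"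
        unfolding p_def S_def 2 using q0 by (simp_all add: powr_minus_divide)
      then show ?thesis using pq by simp
    qed
  qed
  have "beta_N q t N l * (1 - z * z * q ^ 4) = z * (q * D) * S + t * ((1 - z) * (1 - z * (q * q)) - z * ((1 - q) * (1 - q ^ 3) / q))"
    unfolding beta using zq4 z q0 D_pos by (simp add: field_simps)
  also have "\<dots> = t + (1 + q * q) * (1 / p - p - t / p) * z + t * q * q * z * z"
  proof (cases "p = q")
    case True
    then have S: "S = inverse q + q - q * t" using Sp by simp
    show ?thesis unfolding S True qD(2) using q0 by (simp add: field_simps power3_eq_cube)
  next
    case False
    then have S: "S = - (inverse q + q - t / q)" and p: "p = 1 / q" using Sp by auto
    show ?thesis unfolding S p qD(2) using q0 by (simp add: field_simps power3_eq_cube)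
  qed
  finally have "beta_N q t N l * (1 - z * z * q ^ 4) = t + (1 + q * q) * (1 / p - p - t / p) * z + t * q * q * z * z" .
  moreover have "B N n * (1 - z * z) * (1 - z * z * q ^ 4) = t + (1 + q * q) * (1 / p - p - t / p) * z + t * q * q * z * z"
    unfolding B_def Let_def z_def[symmetric] p_def[symmetric] using zz zq4 by (simp add: mult_ac)
  ultimately have "beta_N q t N l * (1 - z * z * q ^ 4) = B N n * (1 - z * z) * (1 - z * z * q ^ 4)" by simp
  then have "beta_N q t N l = B N n * (1 - z * z)" using zq4 by (simp add: mult_ac)
  then show ?thesis unfolding l_def z_def .
qed

end

subsection \<open>Recurrences\<close>

text \<open>Clears the denominators in \<open>E_rec\<close> once and for all: \<open>x0\<close>,
  \<open>x1\<close> stand for numerators coming from \<open>E\<close> and \<open>b\<close> for the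
  numerator of \<open>B\<close>. What remains is a polynomial identity.\<close>

lemma E_rec_aux:
  fixes c :: real
  assumes "x1 * (f * f) = x0 * (d * d) + k * c * b * (g * b - t * (d * f))" "c \<noteq> 0" "d \<noteq> 0" "f \<noteq> 0"
  shows "x1 / (c * (d * d)) = x0 / (c * (f * f)) + k * (b / (d * f)) * (g * (b / (d * f)) - t)"
proof -
  let ?K = "c * ((d * d) * (f * f))"
  have K: "?K \<noteq> 0" using assms by simp
  have "x1 / (c * (d * d)) * ?K = x1 * (f * f)" using assms(2-) by simp
  also have "\<dots> = x0 * (d * d) + k * c * b * (g * b - t * (d * f))" by (rule assms)
  also have "\<dots> = (x0 / (c * (f * f)) + k * (b / (d * f)) * (g * (b / (d * f)) - t)) * ?K"
  proof -
    have 1: "x0 / (c * (f * f)) * ?K = x0 * (d * d)" using assms(2-) by simp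
    have b: "b / (d * f) * (d * f) = b" using assms(2-) by simp
    have "k * (b / (d * f)) * (g * (b / (d * f)) - t) * ?K
        = k * c * (b / (d * f) * (d * f)) * (g * (b / (d * f) * (d * f)) - t * (d * f))"
      by (simp only: right_diff_distrib left_diff_distrib mult_ac)
    then show ?thesis unfolding distrib_right 1 b by simp
  qed
  finally show ?thesis using K by simp
qed

lemma E_const_aux:
  fixes c :: real
  assumes "h1 * x1 * (f * f) - h0 * x0 * (d * d) + c * (b * b) * G + c * k * b * (d * f)
      - c * ((d * d) * (f * f)) * s = 0" "c \<noteq> 0" "d \<noteq> 0" "f \<noteq> 0"
  shows "h1 * (x1 / (c * (d * d))) - h0 * (x0 / (c * (f * f))) + (b / (d * f)) * (b / (d * f)) * G
      + k * (b / (d * f)) - s = 0"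
proof -
  let ?K = "c * ((d * d) * (f * f))"
  have K: "?K \<noteq> 0" using assms by simp
  have b: "b / (d * f) * (d * f) = b" using assms(2-) by simp
  have "(b / (d * f)) * (b / (d * f)) * G * ?K = c * ((b / (d * f) * (d * f)) * (b / (d * f) * (d * f))) * G"
    by (simp only: mult_ac)
  then have 1: "(b / (d * f)) * (b / (d * f)) * G * ?K = c * (b * b) * G" unfolding b .
  have "k * (b / (d * f)) * ?K = c * k * (b / (d * f) * (d * f)) * (d * f)" by (simp only: mult_ac)
  then have 2: "k * (b / (d * f)) * ?K = c * k * b * (d * f)" unfolding b .
  have 3: "h1 * (x1 / (c * (d * d))) * ?K = h1 * x1 * (f * f)" "h0 * (x0 / (c * (f * f))) * ?K = h0 * x0 * (d * d)"
    using assms(2-) by simp_all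
  have "(h1 * (x1 / (c * (d * d))) - h0 * (x0 / (c * (f * f))) + (b / (d * f)) * (b / (d * f)) * G
      + k * (b / (d * f)) - s) * ?K = 0"
    unfolding distrib_right left_diff_distrib 1 2 3 using assms(1) by (simp add: mult.commute)
  then show ?thesis using K by simp
qed

lemma E_const_scale:
  fixes s :: real
  assumes "s * H = h" "s * K = k"
  shows "h * x1 * F - s * hz * x0 * dd + c * B * (s * G) + c * (s * g) * b * df - c * e * (s * tt + k * tm)
    = s * (H * x1 * F - hz * x0 * dd + c * B * G + c * g * b * df - c * e * (tt + K * tm))"
  unfolding assms[symmetric] by Groebner_Basis.algebra

context podles
begin

context
  fixes n :: int and N z p :: real
  assumes n: "0 < n" and N: "N \<in> {1/2, - 1/2}"
  defines "z \<equiv> q powi n" and "p \<equiv> q powr (2 * N)"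
begin

private lemma z: "0 < z" "z < 1" "z * z < 1" "q ^ 4 * z * z < 1" "q ^ 8 * z * z < 1"
proof -
  show 1: "0 < z" "z < 1" using q_powi_pos q_powi_less_1[OF n] by (auto simp: z_def)
  show 2: "z * z < 1" by (rule square_less_1[OF 1])
  have *: "q ^ k * z * z < 1" for k
  proof -
    have "q ^ k \<le> 1" using q0 q1 by (intro power_le_one) auto
    then have "q ^ k * (z * z) \<le> 1 * (z * z)" using 1 by (intro mult_right_mono) auto
    then show ?thesis using 2 by (simp add: mult.assoc)
  qed
  show "q ^ 4 * z * z < 1" "q ^ 8 * z * z < 1" by (rule *)+
qed

private lemma p: "0 < p" "p = q \<or> p = 1 / q"
  using q0 p_cases[OF N] by (simp_all add: p_def)

private lemma z2: "q powi (n + 2) = z * (q * q)"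
  using q0 by (simp add: z_def power_int_add power2_eq_square)

lemma B_formula:
  "B N n = (t + (1 + q * q) * (1 / p - p - t / p) * z + t * q * q * z * z) / ((1 - q ^ 4 * z * z) * (1 - z * z))"
  unfolding B_def Let_def z_def p_def ..

text \<open>The component raising l by one in the first, third and fourth relation reduces to this
  recurrence. The step from n to n + 2 is the step from l to l + 1.\<close>

lemma B_rec: "(1 - q ^ 8 * z * z) * B N (n + 2) = q * q * (1 - z * z) * B N n + (1 - q * q) * t"
proof -
  let ?k = "(1 + q * q) * (1 / p - p - t / p)"
  have e: "1 - q ^ 4 * (z * (q * q)) * (z * (q * q)) = 1 - q ^ 8 * z * z"
    "1 - (z * (q * q)) * (z * (q * q)) = 1 - q ^ 4 * z * z"
    by (simp_all add: power_numeral_reduce)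
  have "(1 - q ^ 8 * z * z) * B N (n + 2) = (t + ?k * (z * (q * q)) + t * q * q * (z * (q * q)) * (z * (q * q))) / (1 - q ^ 4 * z * z)"
    unfolding B_def Let_def z2 p_def[symmetric] e using z by simp
  moreover have "q * q * (1 - z * z) * B N n = q * q * (t + ?k * z + t * q * q * z * z) / (1 - q ^ 4 * z * z)"
    unfolding B_formula using z by simp
  moreover have "(1 - q * q) * t = (1 - q * q) * t * (1 - q ^ 4 * z * z) / (1 - q ^ 4 * z * z)" using z by simp
  moreover have "t + ?k * (z * (q * q)) + t * q * q * (z * (q * q)) * (z * (q * q))
     = q * q * (t + ?k * z + t * q * q * z * z) + (1 - q * q) * t * (1 - q ^ 4 * z * z)"
    by (simp add: algebra_simps power4_eq_xxxx)
  ultimately show ?thesis by (metis add_divide_distrib)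
qed

private lemma E0_formula:
  "(1 - z * z / (q * q)) * (E N n * E N n)
    = (1 + q * q) * (1 - z / q) * ((1 - t + p * z) * (1 + (1 - t) * z / p)) / ((1 + q * z) * ((1 - z * z) * (1 - z * z)))"
proof -
  have pos: "1 + q * z \<noteq> 0" "1 + z / q \<noteq> 0" "1 - z * z \<noteq> 0" using z q0 add_pos_pos[of 1 "q * z"] add_pos_pos[of 1 "z / q"] by auto
  have e: "E N n * E N n * ((1 - z * z) * (1 - z * z)) * ((1 + q * z) * (1 + z / q))
      = (1 + q * q) * (1 - t + p * z) * (1 + (1 - t) * z / p)"
    using E_square[OF n, of N] unfolding z_def[symmetric] p_def[symmetric] .
  have "1 - z * z / (q * q) = (1 - z / q) * (1 + z / q)" by (simp add: algebra_simps)
  then have "(1 - z * z / (q * q)) * (E N n * E N n) * ((1 + q * z) * ((1 - z * z) * (1 - z * z)))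
      = (1 - z / q) * (E N n * E N n * ((1 - z * z) * (1 - z * z)) * ((1 + q * z) * (1 + z / q)))"
    by (simp add: mult_ac)
  also have "\<dots> = (1 + q * q) * (1 - z / q) * ((1 - t + p * z) * (1 + (1 - t) * z / p))"
    unfolding e by (simp add: mult_ac)
  finally show ?thesis using pos by (subst nonzero_eq_divide_eq) auto
qed

private lemma E1_formula:
  "(1 - q ^ 6 * z * z) * (E N (n + 2) * E N (n + 2))
    = (1 + q * q) * (1 - q ^ 3 * z) * ((1 - t + p * (z * (q * q))) * (1 + (1 - t) * (z * (q * q)) / p))
      / ((1 + q * z) * ((1 - q ^ 4 * z * z) * (1 - q ^ 4 * z * z)))"
proof -
  have pos: "1 + q * z \<noteq> 0" "1 - q ^ 4 * z * z \<noteq> 0" using z q0 add_pos_pos[of 1 "q * z"] by auto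
  have n2: "0 < n + 2" using n by simp
  let ?z = "z * (q * q)"
  have e: "E N (n+2) * E N (n+2) * ((1 - ?z * ?z) * (1 - ?z * ?z)) * ((1 + q * ?z) * (1 + ?z / q))
      = (1 + q * q) * (1 - t + p * ?z) * (1 + (1 - t) * ?z / p)"
    using E_square[OF n2, of N] unfolding z2 p_def[symmetric] .
  have s: "1 - ?z * ?z = 1 - q ^ 4 * z * z" "1 + ?z / q = 1 + q * z" "1 + q * ?z = 1 + q ^ 3 * z"
    "1 - q ^ 6 * z * z = (1 - q ^ 3 * z) * (1 + q ^ 3 * z)"
    using q0 by (simp_all add: power_numeral_reduce algebra_simps)
  have "(1 - q ^ 6 * z * z) * (E N (n+2) * E N (n+2)) * ((1 + q * z) * ((1 - q ^ 4 * z * z) * (1 - q ^ 4 * z * z)))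
      = (1 - q ^ 3 * z) * (E N (n+2) * E N (n+2) * ((1 - ?z * ?z) * (1 - ?z * ?z)) * ((1 + q * ?z) * (1 + ?z / q)))"
    unfolding s by (simp add: mult_ac)
  also have "\<dots> = (1 + q * q) * (1 - q ^ 3 * z) * ((1 - t + p * ?z) * (1 + (1 - t) * ?z / p))"
    unfolding e by (simp add: mult_ac)
  finally show ?thesis using pos by (subst nonzero_eq_divide_eq) auto
qed

private lemma den: "1 + q * z \<noteq> 0" "1 - q ^ 4 * z * z \<noteq> 0" "1 - z * z \<noteq> 0"
  using z q0 add_pos_pos[of 1 "q * z"] by auto

text \<open>The component of the first relation that preserves l is equivalent to this, once
  \<open>u\<close> is eliminated.\<close>

lemma E_rec:
  "(1 - q ^ 6 * z * z) * (E N (n + 2) * E N (n + 2)) = (1 - z * z / (q * q)) * (E N n * E N n)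
     + (1 - q * q) * B N n * ((1 + q * q * z * z) * B N n - t)"
  unfolding E0_formula E1_formula B_formula
proof (rule E_rec_aux[OF _ den])
  \<comment> \<open>Writing z = q v removes the quotient z/q, so that in both cases for
    \<open>p\<close> only polynomials in q, t and v are left.\<close>
  define v where "v = z / q"
  have v: "z = q * v" using q0 by (simp add: v_def)
  from p(2) show "(1 + q * q) * (1 - q ^ 3 * z) * ((1 - t + p * (z * (q * q))) * (1 + (1 - t) * (z * (q * q)) / p))
      * ((1 - z * z) * (1 - z * z))
    = (1 + q * q) * (1 - z / q) * ((1 - t + p * z) * (1 + (1 - t) * z / p)) * ((1 - q ^ 4 * z * z) * (1 - q ^ 4 * z * z))
    + (1 - q * q) * (1 + q * z) * (t + (1 + q * q) * (1 / p - p - t / p) * z + t * q * q * z * z)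
      * ((1 + q * q * z * z) * (t + (1 + q * q) * (1 / p - p - t / p) * z + t * q * q * z * z)
        - t * ((1 - q ^ 4 * z * z) * (1 - z * z)))"
  proof
    assume pq: "p = q"
    have 1: "z / q = v" "(1 - t) * (z * (q * q)) / q = (1 - t) * v * (q * q)" "(1 - t) * z / q = (1 - t) * v"
      "(1 + q * q) * (1 / q - q - t / q) * z = (1 + q * q) * (1 - q * q - t) * v"
      using q0 by (simp_all add: v field_simps)
    show ?thesis unfolding pq unfolding 1 unfolding v by Groebner_Basis.algebra
  next
    assume pq: "p = 1 / q"
    have 1: "z / q = v" "(1 - t) * (z * (q * q)) / (1 / q) = (1 - t) * v * (q * q * q * q)"
      "(1 - t) * z / (1 / q) = (1 - t) * v * (q * q)" "1 / q * (z * (q * q)) = v * (q * q)" "1 / q * z = v"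
      "(1 + q * q) * (1 / (1 / q) - 1 / q - t / (1 / q)) * z = (1 + q * q) * (q * q - 1 - t * (q * q)) * v"
      using q0 by (simp_all add: v field_simps)
    show ?thesis unfolding pq unfolding 1 unfolding v by Groebner_Basis.algebra
  qed
qed

text \<open>The constant of motion. The third and fourth relation fix its value t^2 + [2]^2 (1 - t)
  through their components that preserve l.\<close>

lemma E_const:
  "(1 + q * q) / (q * q) * ((1 - q ^ 6 * z * z) * (E N (n + 2) * E N (n + 2)))
     - (1 + q * q) * z * z * ((1 - z * z / (q * q)) * (E N n * E N n))
     + B N n * B N n * (q * q * (1 + q * q * z * z) * (1 + q * q * z * z) - (1 + q * q) * (1 + q * q) * z * z)
     + (1 - q * q) * t * (1 + q * q * z * z) * B N n
     - (t * t + (1 + q * q) * (1 + q * q) / (q * q) * (1 - t)) = 0"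
proof -
  define v where "v = z / q"
  have v: "z = q * v" using q0 by (simp add: v_def)
  let ?b = "t + (1 + q * q) * (1 / p - p - t / p) * z + t * q * q * z * z"
  let ?x1 = "(1 + q * q) * (1 - q ^ 3 * z) * ((1 - t + p * (z * (q * q))) * (1 + (1 - t) * (z * (q * q)) / p))"
  let ?x0 = "(1 + q * q) * (1 - z / q) * ((1 - t + p * z) * (1 + (1 - t) * z / p))"
  let ?d = "1 - q ^ 4 * z * z" and ?f = "1 - z * z" and ?h = "1 + q * q"
  have "(?h * ?x1 * (?f * ?f)) - q * q * (?h * z * z) * ?x0 * (?d * ?d)
     + (1 + q * z) * (?b * ?b) * (q * q * (q * q * (1 + q * q * z * z) * (1 + q * q * z * z) - ?h * ?h * z * z))
     + (1 + q * z) * (q * q * ((1 - q * q) * t * (1 + q * q * z * z))) * ?b * (?d * ?f)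
     - (1 + q * z) * ((?d * ?d) * (?f * ?f)) * (q * q * (t * t) + ?h * ?h * (1 - t)) = 0" (is "?L = 0")
    using p(2)
  proof
    assume pq: "p = q"
    have 1: "z / q = v" "(1 - t) * (z * (q * q)) / q = (1 - t) * v * (q * q)" "(1 - t) * z / q = (1 - t) * v"
      "(1 + q * q) * (1 / q - q - t / q) * z = (1 + q * q) * (1 - q * q - t) * v"
      using q0 by (simp_all add: v field_simps)
    show ?thesis unfolding pq unfolding 1 unfolding v by Groebner_Basis.algebra
  next
    assume pq: "p = 1 / q"
    have 1: "z / q = v" "(1 - t) * (z * (q * q)) / (1 / q) = (1 - t) * v * (q * q * q * q)"
      "(1 - t) * z / (1 / q) = (1 - t) * v * (q * q)" "1 / q * (z * (q * q)) = v * (q * q)" "1 / q * z = v"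
      "(1 + q * q) * (1 / (1 / q) - 1 / q - t / (1 / q)) * z = (1 + q * q) * (q * q - 1 - t * (q * q)) * v"
      using q0 by (simp_all add: v field_simps)
    show ?thesis unfolding pq unfolding 1 unfolding v by Groebner_Basis.algebra
  qed
  moreover have "?L = q * q * (?h / (q * q) * ?x1 * (?f * ?f) - ?h * z * z * ?x0 * (?d * ?d)
     + (1 + q * z) * (?b * ?b) * (q * q * (1 + q * q * z * z) * (1 + q * q * z * z) - ?h * ?h * z * z)
     + (1 + q * z) * ((1 - q * q) * t * (1 + q * q * z * z)) * ?b * (?d * ?f)
     - (1 + q * z) * ((?d * ?d) * (?f * ?f)) * (t * t + ?h * ?h / (q * q) * (1 - t)))" (is "_ = q * q * ?M")
  proof -
    have "q * q * (?h / (q * q)) = ?h" "q * q * (?h * ?h / (q * q)) = ?h * ?h" using q0 by simp_all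
    then show ?thesis by (rule E_const_scale)
  qed
  ultimately have "?M = 0" using q0 by simp
  from E_const_aux[OF this den] show ?thesis unfolding E0_formula E1_formula B_formula .
qed

end

end

section \<open>The spinor representation\<close>

text \<open>The label \<open>(l, m)\<close> is recovered from the integers \<open>a = l + m\<close> and \<open>b = l - m\<close>; with vectors
  outside the range set to \<open>0\<close>, the formulas below hold for all integers \<open>a\<close> and \<open>b\<close>.\<close>

definition lab :: "int \<Rightarrow> int \<Rightarrow> real \<Rightarrow> label" where
  "lab a b N = (of_int (a + b) / 2, of_int (a - b) / 2, N)"

definition w :: "int \<Rightarrow> int \<Rightarrow> real \<Rightarrow> spinor" where "w a b N = bv (lab a b N)"

lemma lab_iff: "lab a b N \<in> spin_labels \<longleftrightarrow> 0 \<le> a \<and> 0 \<le> b \<and> odd (a + b) \<and> N \<in> {1/2, - 1/2}"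
proof
  assume "lab a b N \<in> spin_labels"
  then obtain n j :: nat where *: "of_int (a + b) / 2 = real n + 1/2"
    "of_int (a - b) / 2 = - (of_int (a + b) / 2) + real j" "of_int (a - b) / 2 \<le> (of_int (a + b) / 2 :: real)"
    "N \<in> {1/2, - 1/2}" unfolding lab_def spin_labels_def by blast
  have "(of_int (a + b) :: real) = of_int (2 * int n + 1)" using *(1) by simp
  then have 1: "a + b = 2 * int n + 1" by (simp only: of_int_eq_iff)
  have "(of_int a :: real) = of_int (int j)" using *(2) by (simp add: field_simps)
  then have 2: "a = int j" by (simp only: of_int_eq_iff)
  have "(0 :: real) \<le> of_int b" using *(3) by simp
  then show "0 \<le> a \<and> 0 \<le> b \<and> odd (a + b) \<and> N \<in> {1/2, - 1/2}" using 1 2 *(4) by simp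
next
  assume *: "0 \<le> a \<and> 0 \<le> b \<and> odd (a + b) \<and> N \<in> {1/2, - 1/2}"
  then obtain k where k: "a + b = 2 * k + 1" by (elim conjE oddE)
  then have "0 \<le> k" using * by linarith
  have "(of_int (a + b) / 2 :: real) = real (nat k) + 1/2"
    using k \<open>0 \<le> k\<close> by simp
  moreover have "of_int (a - b) / 2 = - (of_int (a + b) / 2) + real (nat a)" using * by (simp add: field_simps)
  moreover have "(of_int (a - b) / 2 :: real) \<le> of_int (a + b) / 2" using * by simp
  ultimately show "lab a b N \<in> spin_labels" using * unfolding lab_def spin_labels_def by blast
qed

lemma label_cases:
  assumes "p \<in> spin_labels"
  obtains a b N where "p = lab a b N" "0 \<le> a" "0 \<le> b" "odd (a + b)" "N \<in> {1/2, - 1/2}"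
proof -
  obtain l m N where p: "p = (l, m, N)" by (cases p)
  with assms obtain n j :: nat where *: "l = real n + 1/2" "m = - l + real j" by (auto simp: spin_labels_def)
  have "p = lab (int j) (2 * int n + 1 - int j) N"
    unfolding p lab_def using * by (simp add: field_simps)
  moreover from this have "lab (int j) (2 * int n + 1 - int j) N \<in> spin_labels" using assms by simp
  ultimately show thesis using that lab_iff by metis
qed

lemma w_zero: "\<not> (0 \<le> a \<and> 0 \<le> b \<and> odd (a + b) \<and> N \<in> {1/2, - 1/2}) \<Longrightarrow> w a b N = 0"
  unfolding w_def lab_iff[symmetric] by (rule bv_outside)

lemma lab_inject: "lab a b N = lab a' b' N' \<longleftrightarrow> a = a' \<and> b = b' \<and> N = N'"
proof
  assume "lab a b N = lab a' b' N'"
  then have "(of_int (a + b) :: real) = of_int (a' + b')" "(of_int (a - b) :: real) = of_int (a' - b')" "N = N'"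
    by (simp_all add: lab_def)
  then have "a + b = a' + b'" "a - b = a' - b'" "N = N'" by (simp_all only: of_int_eq_iff)
  then show "a = a' \<and> b = b' \<and> N = N'" by simp
qed simp

fun idx :: "sphere_gen \<Rightarrow> int" where "idx X_minus = - 1" | "idx X_zero = 0" | "idx X_plus = 1"

lemma sphere_index_eq: "sphere_index x = of_int (idx x)"
  by (cases x) auto

lemma alpha_mid_zero_aux:
  "p \<noteq> 0 \<Longrightarrow> m \<noteq> 0 \<Longrightarrow> d \<noteq> 0 \<Longrightarrow> s \<noteq> 0 \<Longrightarrow>
  p * m * d * (A / (m * s * d) * (F / (p * d)) - Q * (C / (m * d)) * (G / (p * s * d))) = (A * F - Q * C * G) / (d * s)"
  for p m d s :: real
  by (simp add: right_diff_distrib diff_divide_distrib mult_ac)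

context podles
begin

text \<open>Matrix elements into l + 1, l and l - 1. The factors of \<open>alpha_N\<close> and
  \<open>beta_N\<close> that depend on a + b alone have cancelled, apart from \<open>E\<close> and
  \<open>B\<close>.\<close>

fun cu :: "sphere_gen \<Rightarrow> int \<Rightarrow> int \<Rightarrow> real \<Rightarrow> real" where
  "cu X_plus a b N = u (a + 1) * u (a + 2) * E N (a + b + 2)"
| "cu X_zero a b N = s2 * r * q powi a * u (a + 1) * u (b + 1) * E N (a + b + 2)"
| "cu X_minus a b N = q powi a * q powi a * u (b + 1) * u (b + 2) * E N (a + b + 2)"

fun cm :: "sphere_gen \<Rightarrow> int \<Rightarrow> int \<Rightarrow> real \<Rightarrow> real" where
  "cm X_plus a b N = - (s2 * r * q * q powi a * u (a + 1) * u b * B N (a + b))"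
| "cm X_zero a b N = (1 - (1 + q * q) * (q powi a * q powi a)
     + q * q * (q powi a * q powi a) * (q powi b * q powi b)) * B N (a + b)"
| "cm X_minus a b N = s2 / r * q powi a * u a * u (b + 1) * B N (a + b)"

fun cd :: "sphere_gen \<Rightarrow> int \<Rightarrow> int \<Rightarrow> real \<Rightarrow> real" where
  "cd X_plus a b N = - (q * (q powi a * q powi a) * u b * u (b - 1) * E N (a + b))"
| "cd X_zero a b N = s2 / r * q powi a * u a * u b * E N (a + b)"
| "cd X_minus a b N = - (u (a - 1) * u a * E N (a + b) / q)"

context
  fixes a b :: int and N l m :: real
  assumes ab: "0 \<le> a" "0 \<le> b" "odd (a + b)" and N: "N \<in> {1/2, - 1/2}"
  defines "l \<equiv> of_int (a + b) / 2" and "m \<equiv> of_int (a - b) / 2"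
begin

private lemma args:
  "- l + m = of_int (- b)" "l + m = of_int a" "l - m = of_int b" "2 * l = of_int (a + b)"
  "real_of_int k + 1 = of_int (k + 1)" "real_of_int k + 2 = of_int (k + 2)" "real_of_int k - 1 = of_int (k - 1)"
  by (simp_all add: l_def m_def field_simps)

private lemma lm:
  "l + 1 = of_int (a + b + 2) / 2" "m + 2 = of_int (a - b + 4) / 2" "l = of_int (a + b) / 2"
  "m = of_int (a - b) / 2"
  by (simp_all add: l_def m_def field_simps)

private lemma P: "0 < r powi a" "0 < r powi b" "0 < sqrt D" "0 < r"
  using r_pos D_pos by (auto simp: zero_less_power_int)

private lemma ab_pos: "0 < a + b" using ab by presburger

private lemma pow:
  "r powi (a + 1) = r powi a * r" "r powi (a + 2) = r powi a * (r * r)" "r powi (b + 1) = r powi b * r"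
  "r powi (b + 2) = r powi b * (r * r)" "r powi (a + b) = r powi a * r powi b"
  "r powi (a + b + 1) = r powi a * r powi b * r" "r powi (a + b + 2) = r powi a * r powi b * (r * r)"
  "r powi (a - b) = r powi a / r powi b" "r powi (a - b + 4) = r powi a / r powi b * (r * r * r * r)"
  "r powi (a + b - 1) = r powi a * r powi b / r" "r powi (b - 1) = r powi b / r" "r powi (a - 1) = r powi a / r"
  "q powi (- b) = 1 / (r powi b * r powi b)" "q powi (- b - 1) = 1 / (r powi b * r powi b) / q"
  "q powi a = r powi a * r powi a" "q powi (a + 1) = r powi a * r powi a * q"
  "q powi b = r powi b * r powi b" "q powi (a + b) = r powi a * r powi a * r powi b * r powi b"
  "q powi (b + 1) = r powi b * r powi b * q"
  using r_pos q0
  by (simp_all add: power_int_add power_int_diff power_int_minus r_powi_double power2_eq_square power4_eq_xxxx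
      divide_inverse)

private lemma powm: "q powr m = r powi a / r powi b" "q powr (m + 2) = r powi a / r powi b * (r * r * r * r)"
  by (subst lm(4), simp only: q_powr_half pow) (subst lm(2), simp only: q_powr_half pow)

private lemma alpha_up_l: "alpha_N q t N (l + 1) = E N (a + b + 2) * (u (a + b + 1) * u (a + b + 2))"
proof -
  have 1: "a + b + 2 - 1 = a + b + 1" and 2: "0 < a + b + 2" using ab_pos by simp_all
  show ?thesis using alpha_N_eq[OF 2 N] unfolding 1 by (subst lm(1))
qed

private lemma alpha_l: "alpha_N q t N l = E N (a + b) * (u (a + b - 1) * u (a + b))"
  unfolding lm by (rule alpha_N_eq[OF ab_pos N])

private lemma beta_l: "beta_N q t N l = B N (a + b) * (u (a + b) * u (a + b))"
  unfolding lm using beta_N_eq[OF ab_pos N] u_square[of "a + b"] ab_pos by (simp only: less_imp_le)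

private lemma upos: "0 < u (a + b + 1)" "0 < u (a + b + 2)" "0 < u (a + b)"
  using ab_pos by (auto intro: u_pos)

private lemma nz: "r powi a \<noteq> 0" "r powi b \<noteq> 0" "sqrt D \<noteq> 0" "r \<noteq> 0" "u (a + b + 1) \<noteq> 0" "u (a + b + 2) \<noteq> 0"
    "u (a + b) \<noteq> 0"
  using P upos by auto

lemma alpha_up_eq: "alpha_up q t x l m N = cu x a b N"
proof -
  note * = alpha_up_l s2_def[symmetric] powm
  show ?thesis
    by (cases x; simp only: alpha_up.simps cu.simps *; simp only: args;
      simp only: sqrt_qnum_int q_powr_int pow; insert nz r_square q0; simp add: divide_simps;
      (Groebner_Basis.algebra)?)
qed

private lemma qn_2l: "qnum q (2 * l) = u (a + b) * u (a + b) / (q powi (a + b) * D)"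
  unfolding args(4) qnum_int q_powi_double using u_square[of "a + b"] ab_pos by simp

text \<open>In \<open>alpha_down\<close> the factor \<open>u (a + b - 1)\<close> cancels against the
  root of [2l - 1] except at l = 1/2, where both are 0. There the remaining factors of
  \<open>cd\<close> vanish as well, in agreement with division by 0 giving 0.\<close>

private lemma u_down: "u (a + b - 1) = 0 \<Longrightarrow> u a * u (a - 1) = 0 \<and> u a * u b = 0 \<and> u b * u (b - 1) = 0"
proof -
  assume "u (a + b - 1) = 0"
  then have "a + b = 1" using u_pos[of "a + b - 1"] ab_pos by force
  then have "a = 0 \<and> b = 1 \<or> a = 1 \<and> b = 0" using ab by linarith
  then show ?thesis by auto
qed

private lemma qD: "D * q = 1 - q * q"
  using q0 by (simp add: D_def left_diff_distrib)

lemma alpha_mid_eq: "alpha_mid q t x l m N = cm x a b N"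
proof -
  note * = beta_l s2_def[symmetric] powm qn_2l
  have 1: "alpha_mid q t x l m N = cm x a b N" if "x = X_plus \<or> x = X_minus"
    using that
    by (elim disjE; simp only:; simp only: alpha_mid.simps cm.simps *; simp only: args;
      simp only: sqrt_qnum_int q_powr_int pow; insert nz r_square q0 abs_of_pos[OF D_pos]; simp add: divide_simps;
      (Groebner_Basis.algebra)?)
  have 2: "alpha_mid q t X_zero l m N = cm X_zero a b N"
  proof -
    define p2 m2 where "p2 = q powi a" and "m2 = q powi b"
    have pos: "p2 > 0" "m2 > 0" "D > 0" "q > 0" using q_powi_pos D_pos q0 by (auto simp: p2_def m2_def)
    have e: "qnum q (l - m + 1) = (1 - m2 * q * (m2 * q)) / (m2 * q * D)" "qnum q (l + m) = (1 - p2 * p2) / (p2 * D)"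
      "qnum q (l - m) = (1 - m2 * m2) / (m2 * D)" "qnum q (l + m + 1) = (1 - p2 * q * (p2 * q)) / (p2 * q * D)"
      unfolding args qnum_int q_powi_double p2_def m2_def using q0 by (simp_all add: power_int_add)
    have n: "q powi (a + b) = p2 * m2" using q0 by (simp add: p2_def m2_def power_int_add)
    have "alpha_mid q t X_zero l m N = p2 * m2 * D * (qnum q (l - m + 1) * qnum q (l + m) - q\<^sup>2 * qnum q (l - m) * qnum q (l + m + 1)) * B N (a + b)"
      unfolding alpha_mid.simps qn_2l beta_l n using nz by simp
    also have "p2 * m2 * D * (qnum q (l - m + 1) * qnum q (l + m) - q\<^sup>2 * qnum q (l - m) * qnum q (l + m + 1)) =
        ((1 - m2 * q * (m2 * q)) * (1 - p2 * p2) - q\<^sup>2 * (1 - m2 * m2) * (1 - p2 * q * (p2 * q))) / (D * q)"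
      unfolding e by (rule alpha_mid_zero_aux) (use pos in auto)
    also have "\<dots> = (1 - (1 + q * q) * (p2 * p2) + q * q * (p2 * p2) * (m2 * m2))"
    proof -
      have "D * q \<noteq> 0" using pos by simp
      moreover have "(1 - m2 * q * (m2 * q)) * (1 - p2 * p2) - q\<^sup>2 * (1 - m2 * m2) * (1 - p2 * q * (p2 * q))
        = (1 - (1 + q * q) * (p2 * p2) + q * q * (p2 * p2) * (m2 * m2)) * (D * q)"
        unfolding qD by Groebner_Basis.algebra
      ultimately show ?thesis by simp
    qed
    finally show ?thesis by (simp add: p2_def m2_def)
  qed
  show ?thesis using 1 2 by (cases x) auto
qed

lemma alpha_down_eq: "alpha_down q t x l m N = cd x a b N"
proof -
  note * = alpha_l s2_def[symmetric] powm
  show ?thesis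
    by (cases x; simp only: alpha_down.simps cd.simps *; simp only: args;
      simp only: sqrt_qnum_int q_powr_int pow; insert nz r_square q0 u_down; simp add: divide_simps;
      (auto)?; (Groebner_Basis.algebra)?)
qed

end

text \<open>The convention that nonexistent vectors count as 0 is built into the coefficients: a
  step out of the range always carries a factor \<open>u 0\<close>. Products of shifts can therefore
  be estimated without tracking intermediate labels.\<close>

lemma coefficients_vanish:
  assumes "lab a b N \<in> spin_labels"
  shows "lab (a + 1 + idx x) (b + 1 - idx x) N \<notin> spin_labels \<Longrightarrow> cu x a b N' = 0"
    and "lab (a + idx x) (b - idx x) N \<notin> spin_labels \<Longrightarrow> cm x a b N' = 0"
    and "lab (a - 1 + idx x) (b - 1 - idx x) N \<notin> spin_labels \<Longrightarrow> cd x a b N' = 0"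
proof -
  have ab: "0 \<le> a" "0 \<le> b" "odd (a + b)" "N \<in> {1/2, - 1/2}" using assms by (simp_all add: lab_iff)
  have par: "odd (a + 1 + i + (b + 1 - i))" "odd (a + i + (b - i))" "odd (a - 1 + i + (b - 1 - i))" for i
    using ab by presburger+
  have c: "a = 0 \<or> a = 1 \<or> a \<ge> 2" "b = 0 \<or> b = 1 \<or> b \<ge> 2" using ab by auto
  show "cu x a b N' = 0" if "lab (a + 1 + idx x) (b + 1 - idx x) N \<notin> spin_labels"
  proof -
    have "a + 1 + idx x < 0 \<or> b + 1 - idx x < 0" using that par ab(4) unfolding lab_iff by force
    then show ?thesis using ab(1,2) by (cases x) auto
  qed
  show "cm x a b N' = 0" if "lab (a + idx x) (b - idx x) N \<notin> spin_labels"
  proof -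
    have neg: "a + idx x < 0 \<or> b - idx x < 0" using that par ab(4) unfolding lab_iff by force
    show ?thesis
    proof (cases x)
      case X_minus
      then have "a = 0" using neg ab(1,2) by auto
      then show ?thesis unfolding X_minus by simp
    next
      case X_plus
      then have "b = 0" using neg ab(1,2) by auto
      then show ?thesis unfolding X_plus by simp
    qed (use neg ab(1,2) in auto)
  qed
  show "cd x a b N' = 0" if "lab (a - 1 + idx x) (b - 1 - idx x) N \<notin> spin_labels"
  proof -
    have "a - 1 + idx x < 0 \<or> b - 1 - idx x < 0" using that par ab(4) unfolding lab_iff by force
    then show ?thesis using ab(1,2) c by (cases x) auto
  qed
qed

text \<open>Holds for all integers, also if \<open>w a b N\<close> is 0 while a target label exists:
  then some factor \<open>u 0\<close> annihilates the coefficient. This lets products of generators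
  be expanded without case distinctions.\<close>

lemma pi_gen_w:
  "pi_gen q t x (w a b N) = cu x a b N *\<^sub>R w (a + 1 + idx x) (b + 1 - idx x) N
     + cm x a b N *\<^sub>R w (a + idx x) (b - idx x) N + cd x a b N *\<^sub>R w (a - 1 + idx x) (b - 1 - idx x) N"
proof (cases "lab a b N \<in> spin_labels")
  case True
  then have ab: "0 \<le> a" "0 \<le> b" "odd (a + b)" "N \<in> {1/2, - 1/2}" by (simp_all add: lab_iff)
  have lab: "(of_int (a + b) / 2 - 1, of_int (a - b) / 2 + of_int i, N) = lab (a - 1 + i) (b - 1 - i) N"
    "(of_int (a + b) / 2, of_int (a - b) / 2 + of_int i, N) = lab (a + i) (b - i) N"
    "(of_int (a + b) / 2 + 1, of_int (a - b) / 2 + of_int i, N) = lab (a + 1 + i) (b + 1 - i) N" for i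
    by (simp_all add: lab_def field_simps)
  show ?thesis
    unfolding pi_gen_def w_def lab_def[of a b N]
    using True on_basis_bv[of "of_int (a + b) / 2" "of_int (a - b) / 2" N]
    by (simp add: lab_def[of a b N, symmetric] basis_vec_eq sphere_index_eq lab alpha_up_eq[OF ab] alpha_mid_eq[OF ab] alpha_down_eq[OF ab] del: of_int_add of_int_diff)
next
  case False
  have "pi_gen q t x (w a b N) = 0" using False by (simp add: w_def bv_outside pi_gen_def)
  moreover have "cu x a b N *\<^sub>R w (a + 1 + idx x) (b + 1 - idx x) N = 0"
    "cm x a b N *\<^sub>R w (a + idx x) (b - idx x) N = 0" "cd x a b N *\<^sub>R w (a - 1 + idx x) (b - 1 - idx x) N = 0"
  proof -
    have neg: "a < 0 \<or> b < 0" if "odd (a + b)" "N \<in> {1/2, - 1/2}"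
      using False that unfolding lab_iff by force
    have par: "odd (a + 1 + i + (b + 1 - i)) \<longleftrightarrow> odd (a + b)" "odd (a + i + (b - i)) \<longleftrightarrow> odd (a + b)"
      "odd (a - 1 + i + (b - 1 - i)) \<longleftrightarrow> odd (a + b)" for i by presburger+
    have c: "a = - 1 \<or> a = - 2 \<or> a \<ge> 0 \<or> a < - 2" "b = - 1 \<or> b = - 2 \<or> b \<ge> 0 \<or> b < - 2" by linarith+
    show "cu x a b N *\<^sub>R w (a + 1 + idx x) (b + 1 - idx x) N = 0"
    proof (cases "0 \<le> a + 1 + idx x \<and> 0 \<le> b + 1 - idx x \<and> odd (a + b) \<and> N \<in> {1/2, - 1/2}")
      case True
      then have "cu x a b N = 0" using neg c by (cases x) auto
      then show ?thesis by (simp only: scaleR_zero_left)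
    qed (use w_zero par in \<open>metis scaleR_zero_right\<close>)
    show "cm x a b N *\<^sub>R w (a + idx x) (b - idx x) N = 0"
    proof (cases "0 \<le> a + idx x \<and> 0 \<le> b - idx x \<and> odd (a + b) \<and> N \<in> {1/2, - 1/2}")
      case True
      have "cm x a b N = 0"
      proof (cases x)
        case X_minus
        then have "b = - 1" using neg True by auto
        then show ?thesis unfolding X_minus by simp
      next
        case X_plus
        then have "a = - 1" using neg True by auto
        then show ?thesis unfolding X_plus by simp
      qed (use neg True in auto)
      then show ?thesis by (simp only: scaleR_zero_left)
    qed (use w_zero par in \<open>metis scaleR_zero_right\<close>)
    show "cd x a b N *\<^sub>R w (a - 1 + idx x) (b - 1 - idx x) N = 0"
    proof (cases "0 \<le> a - 1 + idx x \<and> 0 \<le> b - 1 - idx x \<and> odd (a + b) \<and> N \<in> {1/2, - 1/2}")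
      case True
      then have "cd x a b N = 0" using neg c by (cases x) auto
      then show ?thesis by (simp only: scaleR_zero_left)
    qed (use w_zero par in \<open>metis scaleR_zero_right\<close>)
  qed
  ultimately show ?thesis by (simp only: add_0)
qed

end

section \<open>Asymptotics of the matrix elements\<close>

text \<open>At a label l + m and l - m are integers, so the floors only convert types.\<close>

definition label_weight :: "(int \<Rightarrow> int \<Rightarrow> real \<Rightarrow> real) \<Rightarrow> label \<Rightarrow> real" where
  "label_weight c = (\<lambda>(l, m, N). c \<lfloor>l + m\<rfloor> \<lfloor>l - m\<rfloor> N)"

lemma label_weight_lab [simp]: "label_weight c (lab a b N) = c a b N"
proof -
  have "(of_int (a + b) / 2 + of_int (a - b) / 2 :: real) = of_int a"
    "(of_int (a + b) / 2 - of_int (a - b) / 2 :: real) = of_int b" by (simp_all add: field_simps)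
  then show ?thesis unfolding label_weight_def lab_def by (simp only: prod.case floor_of_int)
qed

text \<open>The shift changes l by \<open>j\<close> and m by \<open>i\<close>. The sign
  \<open>s = -1\<close> exchanges the two spinor components and is needed for commutators with
  D.\<close>

definition iw :: "(int \<Rightarrow> int \<Rightarrow> real \<Rightarrow> real) \<Rightarrow> int \<Rightarrow> int \<Rightarrow> real \<Rightarrow> spinor \<Rightarrow> spinor" where
  "iw c j i s = wmap (label_weight c) (shift (of_int j) (of_int i) s)"

lemma shift_lab': "shift (of_int j) (of_int i) s (lab a b N) = lab (a + j + i) (b + j - i) (s * N)"
  by (simp add: shift_def lab_def add_divide_distrib diff_divide_distrib)

lemma lab_flip_iff: "s \<in> {1, - 1} \<Longrightarrow> lab a b (s * N) \<in> spin_labels \<longleftrightarrow> lab a b N \<in> spin_labels"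
  by (auto simp: lab_iff)

lemma iw_w:
  assumes "lab a b N \<in> spin_labels"
  shows "iw c j i s (w a b N) = c a b N *\<^sub>R w (a + j + i) (b + j - i) (s * N)"
  using wmap_bv[OF assms] by (simp add: iw_def w_def shift_lab')

lemma fst_lab: "fst (lab a b N) = of_int (a + b) / 2"
  by (simp add: lab_def)

context podles
begin

text \<open>The eigenvalue of \<open>L_pow q al\<close> at l = n/2.\<close>

definition lw :: "real \<Rightarrow> int \<Rightarrow> real" where
  "lw al n = q powr (al * of_int n / 2)"

lemma lw_pos: "0 < lw al n"
  using q0 by (simp add: lw_def)

lemma lw_antimono: "al \<le> al' \<Longrightarrow> 0 \<le> n \<Longrightarrow> lw al' n \<le> lw al n"
  unfolding lw_def using q0 q1 by (intro powr_mono') (auto intro: mult_right_mono)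

lemma lw_add: "lw al (n + k) = lw al n * lw al k"
  by (simp add: lw_def powr_add[symmetric] algebra_simps add_divide_distrib)

lemma q_powi_le_lw: "al \<le> 2 \<Longrightarrow> 0 \<le> n \<Longrightarrow> q powi n \<le> lw al n"
  unfolding q_powr_int[symmetric] lw_def
proof -
  assume "al \<le> 2" "0 \<le> n"
  then have "al * of_int n \<le> 2 * (of_int n :: real)" by (intro mult_right_mono) auto
  then show "q powr of_int n \<le> q powr (al * of_int n / 2)" using q0 q1 by (intro powr_mono') auto
qed

lemma lw_le_1: "0 \<le> al \<Longrightarrow> 0 \<le> n \<Longrightarrow> lw al n \<le> 1"
  using lw_antimono[of 0 al n] q0 by (simp add: lw_def)

lemma lw_L_weight: "lw al (a + b) = (q powr fst (lab a b N)) powr al"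
  by (simp add: lw_def fst_lab powr_powr mult.commute)

text \<open>The weights converge to \<open>\<phi> a\<close> for large l, and \<open>\<phi>\<close>
  converges to \<open>\<kappa>\<close> for large a. The shift moves b by \<open>j - i\<close>; if
  this is nonzero, a factor depending on b changes by O(q^b), and \<open>\<kappa> = 0\<close>
  supplies the missing O(q^a). Bounds on \<open>\<phi>\<close> are required for all integers because
  shifted arguments may be negative. The last clause discards transitions to labels that do not
  exist.\<close>

definition good :: "real \<Rightarrow> int \<Rightarrow> int \<Rightarrow> (int \<Rightarrow> int \<Rightarrow> real \<Rightarrow> real) \<Rightarrow> bool" where
  "good al j i c \<longleftrightarrow> (\<exists>\<phi> \<kappa> C. 0 \<le> C
     \<and> (\<forall>a b N. lab a b N \<in> spin_labels \<longrightarrow> \<bar>c a b N - \<phi> a\<bar> \<le> C * lw al (a + b))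
     \<and> (\<forall>a. \<bar>\<phi> a - \<kappa>\<bar> \<le> C * q powi a) \<and> (j \<noteq> i \<longrightarrow> \<kappa> = 0)
     \<and> (\<forall>a b N. lab a b N \<in> spin_labels \<longrightarrow> lab (a + j + i) (b + j - i) N \<notin> spin_labels \<longrightarrow> c a b N = 0))"

subsection \<open>The reduced matrix elements\<close>

definition rate :: real where "rate = (if t = 1 then 1 else 2)"

definition E_lim :: real where "E_lim = sqrt ((1 + q * q) * (1 - t))"

lemma p_bounds:
  assumes "N \<in> {1/2, - 1/2}"
  shows "0 < q powr (2 * N)" "q powr (2 * N) \<le> 1 / q" "1 / q powr (2 * N) \<le> 1 / q"
proof -
  have "q \<le> 1 / q" using square_less_1[OF q0 q1] q0 by (simp add: pos_le_divide_eq)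
  then show "0 < q powr (2 * N)" "q powr (2 * N) \<le> 1 / q" "1 / q powr (2 * N) \<le> 1 / q"
    using p_cases[OF assms] q0 by auto
qed

text \<open>The square of \<open>E\<close> is a quotient whose numerator tends to (1 + q^2)(1 - t)
  and whose denominator tends to 1, both with error O(q^n).\<close>

lemma E_square_estimate:
  "\<exists>C\<ge>0. \<forall>n>0. \<forall>N\<in>{1/2, - 1/2}. \<bar>(E N n)\<^sup>2 - E_lim\<^sup>2\<bar> \<le> C * q powi n"
proof -
  define h where "h = 1 + q * q"
  \<comment> \<open>A lower bound for the denominator: positive n gives q^n at most q, while the
    factors 1 + q z and 1 + z/q only enlarge it.\<close>
  define \<delta> where "\<delta> = (1 - q * q) * (1 - q * q)"
  have \<delta>: "0 < \<delta>" using square_less_1[OF q0 q1] by (simp add: \<delta>_def)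
  have h: "0 < h" using q0 by (simp add: h_def add_pos_pos)
  define C1 where "C1 = h * (2 / q + 1)"
  define C2 where "C2 = 2 * ((1 + q) * (1 + 1 / q)) + (q + 1 / q + 1)"
  define C where "C = (C1 + h * C2) / \<delta>"
  have C0: "0 \<le> C1" "0 \<le> C2" using q0 h by (auto simp: C1_def C2_def)
  have "\<bar>(E N n)\<^sup>2 - E_lim\<^sup>2\<bar> \<le> C * q powi n" if n: "0 < n" and N: "N \<in> {1/2, - 1/2}" for n N
  proof -
    define z where "z = q powi n"
    define p where "p = q powr (2 * N)"
    have z: "0 < z" "z \<le> q" "z < 1"
    proof -
      have "q powi (n - 1) * q \<le> 1 * q" using n q0 by (intro mult_right_mono q_powi_le_1) auto
      then show "z \<le> q" using q0 by (simp add: z_def power_int_diff)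
      then show "z < 1" using q1 by simp
    qed (simp add: z_def q_powi_pos)
    have p: "0 < p" "p \<le> 1/q" "1/p \<le> 1/q" using p_bounds[OF N] by (auto simp: p_def)
    define d1 where "d1 = (1 - z * z) * (1 - z * z)"
    define d2 where "d2 = (1 + q * z) * (1 + z / q)"
    define num where "num = h * (1 - t + p * z) * (1 + (1 - t) * z / p)"
    have zz: "z * z \<le> z" "z * z \<le> q * q" using z q0 by (auto simp: mult_left_le mult_mono)
    have d1: "\<delta> \<le> d1" "d1 \<le> 1" "1 - 2 * z \<le> d1"
    proof -
      show "\<delta> \<le> d1" unfolding d1_def \<delta>_def using zz square_less_1[OF q0 q1] by (intro mult_mono) auto
      have 1: "1 - z * z \<le> 1" "0 \<le> 1 - z * z" using zz(1) z zero_le_square[of z] by linarith+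
      show "d1 \<le> 1" unfolding d1_def using mult_mono[OF 1(1) 1(1)] 1 by simp
      have "d1 = 1 - 2 * (z * z) + (z * z) * (z * z)" by (simp add: d1_def algebra_simps)
      then show "1 - 2 * z \<le> d1" using zz by (smt (verit) zero_le_square)
    qed
    have d2: "1 \<le> d2" "d2 \<le> (1 + q) * (1 + 1 / q)" "d2 - 1 \<le> z * (q + 1 / q + 1)"
    proof -
      have e: "d2 - 1 = z * (q + 1 / q + z)" using q0 by (simp add: d2_def field_simps)
      have "0 \<le> z * (q + 1 / q + z)" using z q0 by simp
      then show "1 \<le> d2" using e by simp
      show "d2 - 1 \<le> z * (q + 1 / q + 1)" unfolding e using z by (intro mult_left_mono) auto
      show "d2 \<le> (1 + q) * (1 + 1 / q)" unfolding d2_def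
        using z q0 by (intro mult_mono) (auto simp: divide_right_mono mult_left_le)
    qed
    have den: "\<delta> \<le> d1 * d2" using mult_mono[OF d1(1) d2(1)] \<delta> d1 by simp
    have den1: "\<bar>d1 * d2 - 1\<bar> \<le> C2 * z"
    proof -
      have "\<bar>d1 * d2 - 1\<bar> = \<bar>(d1 - 1) * d2 + (d2 - 1)\<bar>" by (simp add: algebra_simps)
      also have "\<dots> \<le> \<bar>d1 - 1\<bar> * d2 + (d2 - 1)" using d2 abs_triangle_ineq[of "(d1 - 1) * d2" "d2 - 1"] by (simp add: abs_mult)
      also have "\<dots> \<le> (2 * z) * ((1 + q) * (1 + 1 / q)) + z * (q + 1 / q + 1)"
        using d1 d2 z by (intro add_mono mult_mono) auto
      finally show ?thesis by (simp add: C2_def algebra_simps)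
    qed
    have num1: "\<bar>num - h * (1 - t)\<bar> \<le> C1 * z"
    proof -
      have e: "num - h * (1 - t) = h * z * (p + (1 - t) * ((1 - t) * (1 / p)) + (1 - t) * z)"
        using p by (simp add: num_def field_simps)
      have "(1 - t) * ((1 - t) * (1 / p)) \<le> 1 * (1 * (1 / q))" using t0 t1 p by (intro mult_mono) auto
      moreover have "(1 - t) * z \<le> 1 * 1" using t0 t1 z by (intro mult_mono) auto
      ultimately have "p + (1 - t) * ((1 - t) * (1 / p)) + (1 - t) * z \<le> 2 / q + 1" using p by simp
      then have "h * z * (p + (1 - t) * ((1 - t) * (1 / p)) + (1 - t) * z) \<le> h * z * (2 / q + 1)"
        using h z by (intro mult_left_mono) auto
      moreover have "0 \<le> h * z * (p + (1 - t) * ((1 - t) * (1 / p)) + (1 - t) * z)"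
        using h z p t1 by (intro mult_nonneg_nonneg add_nonneg_nonneg) auto
      ultimately show ?thesis unfolding e by (simp add: C1_def mult_ac)
    qed
    have "E N n * E N n * d1 * d2 = num"
      using E_square[OF n, of N] unfolding d1_def d2_def num_def h_def z_def p_def by (simp only: mult.assoc)
    then have e: "(E N n)\<^sup>2 = num / (d1 * d2)"
      using den \<delta> by (subst nonzero_eq_divide_eq) (auto simp: power2_eq_square mult.assoc)
    have lim: "E_lim\<^sup>2 = h * (1 - t)" using h t1 by (simp add: E_lim_def h_def)
    have "(E N n)\<^sup>2 - E_lim\<^sup>2 = ((num - h * (1 - t)) - h * (1 - t) * (d1 * d2 - 1)) / (d1 * d2)"
    proof -
      have ne: "d1 * d2 \<noteq> 0" using den \<delta> by linarith
      have eq: "(num - h * (1 - t)) - h * (1 - t) * (d1 * d2 - 1) = num - h * (1 - t) * (d1 * d2)"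
        by (simp add: algebra_simps)
      show ?thesis unfolding e lim eq diff_divide_distrib nonzero_mult_div_cancel_right[OF ne] ..
    qed
    then have "\<bar>(E N n)\<^sup>2 - E_lim\<^sup>2\<bar> = \<bar>(num - h * (1 - t)) - h * (1 - t) * (d1 * d2 - 1)\<bar> / (d1 * d2)"
      using den \<delta> by (simp add: abs_divide)
    also have "\<dots> \<le> (C1 * z + h * (C2 * z)) / \<delta>"
    proof (intro frac_le)
      have "\<bar>h * (1 - t) * (d1 * d2 - 1)\<bar> = h * (1 - t) * \<bar>d1 * d2 - 1\<bar>" using h t1 by (simp add: abs_mult)
      also have "\<dots> \<le> h * 1 * (C2 * z)" using h t0 t1 den1 by (intro mult_mono) auto
      finally show "\<bar>(num - h * (1 - t)) - h * (1 - t) * (d1 * d2 - 1)\<bar> \<le> C1 * z + h * (C2 * z)"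
        using num1 by linarith
      show "0 \<le> C1 * z + h * (C2 * z)" using C0 h z by simp
    qed (use den \<delta> in auto)
    also have "\<dots> = C * z" by (simp add: C_def distrib_right)
    finally show ?thesis by (simp add: z_def)
  qed
  moreover have "0 \<le> C" using C0 h \<delta> by (simp add: C_def)
  ultimately show ?thesis by blast
qed

text \<open>If t is not 1, the limit is positive and dividing by \<open>E N n + E_lim\<close> keeps
  the error O(q^n). If t = 1, the limit is 0 and taking the square root halves the exponent.\<close>

lemma E_estimate:
  "\<exists>C\<ge>0. \<forall>n>0. \<forall>N\<in>{1/2, - 1/2}. \<bar>E N n - E_lim\<bar> \<le> C * lw rate n"
proof -
  obtain C where C: "C \<ge> 0" "\<And>n N. n > 0 \<Longrightarrow> N \<in> {1/2, - 1/2} \<Longrightarrow> \<bar>(E N n)\<^sup>2 - E_lim\<^sup>2\<bar> \<le> C * q powi n"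
    using E_square_estimate by blast
  show ?thesis
  proof (cases "t = 1")
    case True
    have "\<bar>E N n - E_lim\<bar> \<le> sqrt C * lw rate n" if "n > 0" "N \<in> {1/2, - 1/2}" for n N
    proof -
      have "E_lim = 0" by (subst E_lim_def) (simp add: True)
      then have "(E N n)\<^sup>2 \<le> C * q powi n" using C(2)[OF that] by simp
      then have "sqrt ((E N n)\<^sup>2) \<le> sqrt (C * q powi n)" by (rule real_sqrt_le_mono)
      also have "\<dots> = sqrt C * r powi n"
        using r_pos by (simp add: real_sqrt_mult r_powi_double[symmetric] zero_le_power_int less_imp_le)
      also have "r powi n = lw rate n" unfolding lw_def rate_def if_P[OF True] by (simp add: q_powr_half)
      finally show ?thesis using \<open>E_lim = 0\<close> by simp
    qed
    then show ?thesis using C(1) by (intro exI[of _ "sqrt C"]) auto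
  next
    case False
    then have pos: "0 < E_lim" using t1 q0 by (auto simp: E_lim_def intro!: mult_pos_pos add_pos_pos)
    have "\<bar>E N n - E_lim\<bar> \<le> C / E_lim * lw rate n" if "n > 0" "N \<in> {1/2, - 1/2}" for n N
    proof -
      have "\<bar>E N n - E_lim\<bar> * E_lim \<le> \<bar>E N n - E_lim\<bar> * (E N n + E_lim)"
        using E_nonneg[OF that(1)] by (intro mult_left_mono) auto
      also have "\<dots> = \<bar>(E N n)\<^sup>2 - E_lim\<^sup>2\<bar>"
        using E_nonneg[OF that(1), of N] pos by (simp add: power2_eq_square square_diff_square_factored abs_mult mult.commute)
      also have "\<dots> \<le> C * q powi n" by (rule C(2)[OF that])
      also have "q powi n = lw rate n" using False by (simp add: lw_def rate_def q_powr_int)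
      finally show ?thesis using pos by (simp add: pos_le_divide_eq)
    qed
    then show ?thesis using C(1) pos by (intro exI[of _ "C / E_lim"]) auto
  qed
qed

text \<open>Again a quotient with denominator near 1. The linear coefficient of the numerator is
  bounded uniformly in both signs, as p and 1/p are at most 1/q.\<close>

lemma B_estimate:
  "\<exists>C\<ge>0. \<forall>n>0. \<forall>N\<in>{1/2, - 1/2}. \<bar>B N n - t\<bar> \<le> C * lw rate n"
proof -
  define \<delta> where "\<delta> = (1 - q * q) * (1 - q * q)"
  have qq: "q * q < 1" by (rule square_less_1[OF q0 q1])
  have \<delta>: "0 < \<delta>" using qq by (simp add: \<delta>_def)
  define C1 where "C1 = (1 + q * q) * (3 / q) + 1"
  define C where "C = (C1 + 2) / \<delta>"
  have C1: "0 \<le> C1" using q0 by (simp add: C1_def add_nonneg_nonneg)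
  have "\<bar>B N n - t\<bar> \<le> C * lw rate n" if n: "0 < n" and N: "N \<in> {1/2, - 1/2}" for n N
  proof -
    define z where "z = q powi n"
    define p where "p = q powr (2 * N)"
    have z: "0 < z" "z \<le> q" "z < 1"
    proof -
      have "q powi (n - 1) * q \<le> 1 * q" using n q0 by (intro mult_right_mono q_powi_le_1) auto
      then show "z \<le> q" using q0 by (simp add: z_def power_int_diff)
      then show "z < 1" using q1 by simp
    qed (simp add: z_def q_powi_pos)
    have p: "0 < p" "p \<le> 1/q" "1/p \<le> 1/q" using p_bounds[OF N] by (auto simp: p_def)
    define \<kappa> where "\<kappa> = (1 + q * q) * (1 / p - p - t / p)"
    define d where "d = (1 - q ^ 4 * z * z) * (1 - z * z)"
    have zz: "z * z \<le> z" "z * z \<le> q * q" "0 \<le> z * z" using z q0 by (auto simp: mult_left_le mult_mono)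
    have q4: "q ^ 4 * z * z \<le> z * z" "0 \<le> q ^ 4 * z * z"
      using zz q0 q1 mult_right_mono[of "q ^ 4" 1 "z * z"] by (auto simp: power_le_one mult.assoc)
    have d: "\<delta> \<le> d" "\<bar>d - 1\<bar> \<le> 2 * z"
    proof -
      show "\<delta> \<le> d" unfolding d_def \<delta>_def using zz q4 qq by (intro mult_mono) auto
      have "0 \<le> (q ^ 4 * z * z) * (z * z)" by (rule mult_nonneg_nonneg[OF q4(2) zz(3)])
      moreover have "(q ^ 4 * z * z) * (z * z) \<le> q ^ 4 * z * z"
        by (rule mult_left_le[OF _ q4(2)]) (use zz(1) z in linarith)
      moreover have "d - 1 = (q ^ 4 * z * z) * (z * z) - q ^ 4 * z * z - z * z" by (simp add: d_def algebra_simps)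
      ultimately show "\<bar>d - 1\<bar> \<le> 2 * z" using zz q4 by linarith
    qed
    have k: "\<bar>\<kappa>\<bar> \<le> (1 + q * q) * (3 / q)"
    proof -
      have "t / p \<le> 1 * (1 / q)" using t0 t1 p mult_mono[of t 1 "1 / p" "1 / q"] by simp
      moreover have "0 \<le> t / p" "0 \<le> 1 / p" "0 \<le> 1 / q" using t0 p q0 by auto
      ultimately have "\<bar>1 / p - p - t / p\<bar> \<le> 3 * (1 / q)" using p by linarith
      then show ?thesis unfolding \<kappa>_def abs_mult using q0 by (intro mult_mono) auto
    qed
    have B: "B N n = (t + \<kappa> * z + t * q * q * z * z) / d"
      unfolding B_formula[OF n N] \<kappa>_def d_def z_def p_def ..
    have "B N n - t = (\<kappa> * z + t * q * q * z * z - t * (d - 1)) / d"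
      unfolding B using d \<delta> by (simp add: diff_divide_distrib add_divide_distrib algebra_simps)
    then have "\<bar>B N n - t\<bar> = \<bar>\<kappa> * z + t * q * q * z * z - t * (d - 1)\<bar> / d"
      using d \<delta> by (simp add: abs_divide)
    also have "\<dots> \<le> (C1 * z + 2 * z) / \<delta>"
    proof (intro frac_le)
      have "\<bar>\<kappa> * z\<bar> \<le> (1 + q * q) * (3 / q) * z" unfolding abs_mult using k z by (intro mult_mono) auto
      moreover have "t * q * q * z * z \<le> z"
      proof -
        have "(t * (q * q)) * (z * z) \<le> (1 * 1) * z" using t0 t1 q0 qq zz by (intro mult_mono) auto
        then show ?thesis by (simp add: mult_ac)
      qed
      moreover have "0 \<le> t * q * q * z * z" using t0 q0 z by simp
      moreover have "\<bar>t * (d - 1)\<bar> \<le> 1 * (2 * z)" unfolding abs_mult using t0 t1 d by (intro mult_mono) auto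
      moreover have "C1 * z = (1 + q * q) * (3 / q) * z + z" by (simp add: C1_def distrib_right)
      ultimately show "\<bar>\<kappa> * z + t * q * q * z * z - t * (d - 1)\<bar> \<le> C1 * z + 2 * z" by linarith
      show "0 \<le> C1 * z + 2 * z" using C1 z by simp
    qed (use d \<delta> in auto)
    also have "\<dots> = C * q powi n" by (simp add: C_def z_def[symmetric] distrib_right)
    also have "\<dots> \<le> C * lw rate n"
      using n C1 \<delta> by (intro mult_left_mono q_powi_le_lw) (auto simp: rate_def C_def)
    finally show ?thesis .
  qed
  moreover have "0 \<le> C" using C1 \<delta> by (simp add: C_def)
  ultimately show ?thesis by blast
qed

lemma u_le_1: "0 \<le> n \<Longrightarrow> u n \<le> 1"
  using q_powi_pos[of "2 * n"] by (simp add: u_def)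

lemma u_estimate: "0 \<le> n \<Longrightarrow> 1 - u n \<le> q powi n"
proof -
  assume n: "0 \<le> n"
  have "1 - u n \<le> (1 - u n) * (1 + u n)" using u_nonneg[OF n] u_le_1[OF n] by (simp add: mult_right_mono[of 1 "1 + u n" "1 - u n", simplified mult_1] mult_le_cancel_left1)
  also have "\<dots> = q powi n * q powi n" using u_square[OF n] by (simp add: algebra_simps)
  also have "\<dots> \<le> q powi n" using q_powi_le_1[OF n] q_powi_pos[of n] by (simp add: mult_left_le)
  finally show ?thesis .
qed

lemma uu_estimate:
  assumes "0 \<le> n" "0 \<le> k"
  shows "\<bar>u n * u k\<bar> \<le> 1" "\<bar>u n * u k - 1\<bar> \<le> q powi n + q powi k"
proof -
  have 1: "0 \<le> u n" "u n \<le> 1" "0 \<le> u k" "u k \<le> 1" using assms by (auto intro: u_nonneg u_le_1)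
  show "\<bar>u n * u k\<bar> \<le> 1" using 1 mult_mono[of "u n" 1 "u k" 1] by simp
  have "1 - u n * u k = (1 - u n) + u n * (1 - u k)" by (simp add: algebra_simps)
  also have "\<dots> \<le> q powi n + 1 * q powi k"
    using 1 assms by (intro add_mono mult_mono u_estimate) auto
  finally show "\<bar>u n * u k - 1\<bar> \<le> q powi n + q powi k"
    using 1 mult_mono[of "u n" 1 "u k" 1] by simp
qed

subsection \<open>Factorized weights\<close>

text \<open>The matrix elements are products of a function of \<open>a\<close>, a function of \<open>b\<close> and a reduced matrix
  element; the factor in \<open>b\<close> may be replaced by \<open>1\<close> at the cost of an error \<open>q\<^sup>a q\<^sup>b = q\<^sup>2\<^sup>l\<close>.\<close>

lemma goodI:
  fixes f :: "int \<Rightarrow> real" and F :: "int \<Rightarrow> int \<Rightarrow> real" and e :: "int \<Rightarrow> real \<Rightarrow> real"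
  assumes c: "\<And>a b N. 0 \<le> a \<Longrightarrow> 0 \<le> b \<Longrightarrow> c a b N = F a b * e (a + b) N"
    and F: "\<And>a b. 0 \<le> a \<Longrightarrow> 0 \<le> b \<Longrightarrow> \<bar>F a b\<bar> \<le> K"
      "\<And>a b. 0 \<le> a \<Longrightarrow> 0 \<le> b \<Longrightarrow> \<bar>F a b - f a\<bar> \<le> K * (q powi a * q powi b)"
    and f: "\<And>a. 0 \<le> a \<Longrightarrow> \<bar>f a - k\<bar> \<le> K * q powi a"
    and e: "\<And>n N. 0 < n \<Longrightarrow> N \<in> {1/2, - 1/2} \<Longrightarrow> \<bar>e n N - e0\<bar> \<le> M * lw al n"
    and al: "0 \<le> al" "al \<le> 2" and kk: "j \<noteq> i \<Longrightarrow> k = 0"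
    and van: "\<And>a b N. lab a b N \<in> spin_labels \<Longrightarrow> lab (a + j + i) (b + j - i) N \<notin> spin_labels \<Longrightarrow> c a b N = 0"
  shows "good al j i c"
proof -
  have K0: "0 \<le> K" using F(1)[of 0 0] by simp
  have "0 \<le> M * lw al 1" using e[of 1 "1/2"] by force
  then have M0: "0 \<le> M" using lw_pos[of al 1] by (simp add: zero_le_mult_iff)
  \<comment> \<open>The hypothesis on \<open>f\<close> concerns nonnegative arguments only; for the
    others the limit value is taken, which makes the bound trivial.\<close>
  define \<phi> where "\<phi> a = (if 0 \<le> a then f a * e0 else k * e0)" for a
  define C where "C = K * M + K * \<bar>e0\<bar>"
  have C0: "0 \<le> C" using K0 M0 by (simp add: C_def)
  have "\<bar>c a b N - \<phi> a\<bar> \<le> C * lw al (a + b)" if "lab a b N \<in> spin_labels" for a b N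
  proof -
    have ab: "0 \<le> a" "0 \<le> b" "odd (a + b)" "N \<in> {1/2, - 1/2}" using that by (simp_all add: lab_iff)
    then have n: "0 < a + b" by presburger
    have "c a b N - \<phi> a = F a b * (e (a + b) N - e0) + (F a b - f a) * e0"
      using ab by (simp add: c \<phi>_def algebra_simps)
    then have "\<bar>c a b N - \<phi> a\<bar> \<le> \<bar>F a b\<bar> * \<bar>e (a + b) N - e0\<bar> + \<bar>F a b - f a\<bar> * \<bar>e0\<bar>"
      using abs_triangle_ineq[of "F a b * (e (a + b) N - e0)" "(F a b - f a) * e0"] by (simp add: abs_mult)
    also have "\<dots> \<le> K * (M * lw al (a + b)) + (K * lw al (a + b)) * \<bar>e0\<bar>"
    proof (intro add_mono mult_mono)
      show "\<bar>F a b\<bar> \<le> K" by (rule F(1)[OF ab(1,2)])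
      show "\<bar>e (a + b) N - e0\<bar> \<le> M * lw al (a + b)" by (rule e[OF n ab(4)])
      have "\<bar>F a b - f a\<bar> \<le> K * q powi (a + b)" using F(2)[OF ab(1,2)] q0 by (simp add: power_int_add)
      also have "\<dots> \<le> K * lw al (a + b)" using K0 al n by (intro mult_left_mono q_powi_le_lw) auto
      finally show "\<bar>F a b - f a\<bar> \<le> K * lw al (a + b)" .
    qed (use K0 M0 lw_pos in \<open>auto simp: less_imp_le\<close>)
    finally show ?thesis by (simp add: C_def algebra_simps)
  qed
  moreover have "\<bar>\<phi> a - k * e0\<bar> \<le> C * q powi a" for a
  proof (cases "0 \<le> a")
    case True
    have "\<bar>\<phi> a - k * e0\<bar> = \<bar>f a - k\<bar> * \<bar>e0\<bar>"
      using True by (simp add: \<phi>_def abs_mult[symmetric] left_diff_distrib)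
    also have "\<dots> \<le> K * q powi a * \<bar>e0\<bar>" using f[OF True] by (intro mult_right_mono) auto
    also have "\<dots> \<le> C * q powi a" using q_powi_pos[of a] K0 M0 by (simp add: C_def algebra_simps)
    finally show ?thesis .
  next
    case False
    then show ?thesis using C0 q_powi_pos[of a] by (simp add: \<phi>_def)
  qed
  moreover have "j \<noteq> i \<longrightarrow> k * e0 = 0" using kk by auto
  ultimately show ?thesis unfolding good_def using C0 van by blast
qed

lemma q_powi_square_le: "0 \<le> a \<Longrightarrow> q powi a * q powi a \<le> q powi a"
  using q_powi_le_1[of a] q_powi_pos[of a] by (simp add: mult_left_le)

lemma uu_shift:
  assumes "0 \<le> a"
  shows "\<bar>u a * u (a - 1)\<bar> \<le> 1" "\<bar>u a * u (a - 1) - 1\<bar> \<le> (1 + 1 / q) * q powi a"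
    "\<bar>u (a + 1) * u (a + 2)\<bar> \<le> 1" "\<bar>u (a + 1) * u (a + 2) - 1\<bar> \<le> 2 * q powi a"
    "\<bar>u a\<bar> \<le> 1" "\<bar>u a - 1\<bar> \<le> q powi a" "\<bar>u (a + 1)\<bar> \<le> 1" "\<bar>u (a + 1) - 1\<bar> \<le> q powi a"
proof -
  have mono: "q powi (a + 1) \<le> q powi a" "q powi (a + 2) \<le> q powi a"
    using q0 q1 q_powi_pos[of a] mult_left_le[of q "q powi a"] mult_left_le[of "q * q" "q powi a"] square_less_1[OF q0 q1]
    by (simp_all add: power_int_add power2_eq_square mult_le_cancel_left1)
  have "\<bar>u a * u (a - 1)\<bar> \<le> 1 \<and> \<bar>u a * u (a - 1) - 1\<bar> \<le> (1 + 1 / q) * q powi a"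
  \<comment> \<open>At 0 the factor \<open>u 0\<close> gives the value 0. Otherwise a - 1 is
    nonnegative, and q^(a-1) = q^a / q explains the constant 1 + 1/q.\<close>
  proof (cases "a = 0")
    case False
    then have a: "0 \<le> a - 1" using assms by simp
    have "\<bar>u a * u (a - 1) - 1\<bar> \<le> q powi a + q powi (a - 1)" by (rule uu_estimate[OF assms a])
    then show ?thesis using uu_estimate(1)[OF assms a] q0 by (simp add: power_int_diff distrib_right)
  qed (use q0 in auto)
  then show "\<bar>u a * u (a - 1)\<bar> \<le> 1" "\<bar>u a * u (a - 1) - 1\<bar> \<le> (1 + 1 / q) * q powi a" by blast+
  have a1: "0 \<le> a + 1" "0 \<le> a + 2" using assms by auto
  show "\<bar>u (a + 1) * u (a + 2)\<bar> \<le> 1" "\<bar>u (a + 1) * u (a + 2) - 1\<bar> \<le> 2 * q powi a"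
    using uu_estimate[OF a1] mono by auto
  show "\<bar>u a\<bar> \<le> 1" "\<bar>u a - 1\<bar> \<le> q powi a" "\<bar>u (a + 1)\<bar> \<le> 1" "\<bar>u (a + 1) - 1\<bar> \<le> q powi a"
    using u_nonneg[OF assms] u_le_1[OF assms] u_estimate[OF assms] u_nonneg[OF a1(1)] u_le_1[OF a1(1)]
      u_estimate[OF a1(1)] mono by auto
qed

lemma decaying_factor:
  assumes "0 \<le> a" "\<bar>x\<bar> \<le> L" "\<bar>v\<bar> \<le> 1"
  shows "\<bar>x * q powi a * v\<bar> \<le> L * q powi a" "\<bar>x * q powi a * v\<bar> \<le> L"
proof -
  have "\<bar>x * q powi a * v\<bar> \<le> (L * q powi a) * 1"
    unfolding abs_mult using assms q_powi_pos[of a] by (intro mult_mono) auto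
  then show 1: "\<bar>x * q powi a * v\<bar> \<le> L * q powi a" by simp
  also have "\<dots> \<le> L * 1" using assms q_powi_le_1[OF assms(1)] by (intro mult_left_mono) auto
  finally show "\<bar>x * q powi a * v\<bar> \<le> L" by simp
qed

lemma rate_bounds: "0 \<le> rate" "rate \<le> 2" "0 < rate"
  by (auto simp: rate_def)

lemma product_factor:
  fixes x y :: real
  assumes "\<bar>x\<bar> \<le> K" "\<bar>x\<bar> \<le> K * p" "\<bar>y\<bar> \<le> 1" "\<bar>y - 1\<bar> \<le> L * s" "0 \<le> p" "0 \<le> K" "1 \<le> L" "0 \<le> s"
  shows "\<bar>x * y\<bar> \<le> K * L" "\<bar>x * y - x\<bar> \<le> (K * L) * (p * s)" "\<bar>x - 0\<bar> \<le> (K * L) * p"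
proof -
  have KL: "K \<le> K * L" using assms mult_left_mono[of 1 L K] by simp
  have "\<bar>x * y\<bar> \<le> K * 1" unfolding abs_mult using assms by (intro mult_mono) auto
  then show "\<bar>x * y\<bar> \<le> K * L" using KL by simp
  have "x * y - x = x * (y - 1)" by (simp add: algebra_simps)
  moreover have "\<bar>x * (y - 1)\<bar> \<le> (K * p) * (L * s)"
    unfolding abs_mult using assms by (intro mult_mono) auto
  ultimately show "\<bar>x * y - x\<bar> \<le> (K * L) * (p * s)" by (simp add: mult_ac)
  have "K * p \<le> K * L * p" using KL assms by (intro mult_right_mono) auto
  then show "\<bar>x - 0\<bar> \<le> (K * L) * p" using assms by simp
qed

lemma E_shift_estimate:
  assumes "\<And>n N. n > 0 \<Longrightarrow> N \<in> {1/2, - 1/2} \<Longrightarrow> \<bar>E N n - E_lim\<bar> \<le> C * lw rate n" "0 \<le> C" "0 < n" "N \<in> {1/2, - 1/2}"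
  shows "\<bar>E N (n + 2) - E_lim\<bar> \<le> C * lw rate n"
proof -
  have "\<bar>E N (n + 2) - E_lim\<bar> \<le> C * (lw rate n * lw rate 2)" using assms(1)[of "n + 2" N] assms by (simp add: lw_add)
  also have "\<dots> \<le> C * (lw rate n * 1)"
    using assms lw_pos[of rate n] lw_le_1[of rate 2] rate_bounds by (intro mult_left_mono) auto
  finally show ?thesis by simp
qed

text \<open>All matrix elements except the three with \<open>j = i\<close> carry a factor \<open>q\<^sup>a\<close>.\<close>

lemma good_decaying:
  fixes f g :: "int \<Rightarrow> real" and e :: "int \<Rightarrow> real \<Rightarrow> real"
  assumes c: "\<And>a b N. 0 \<le> a \<Longrightarrow> 0 \<le> b \<Longrightarrow> c a b N = f a * g b * e (a + b) N"
    and f: "\<And>a. 0 \<le> a \<Longrightarrow> \<bar>f a\<bar> \<le> K" "\<And>a. 0 \<le> a \<Longrightarrow> \<bar>f a\<bar> \<le> K * q powi a"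
    and g: "\<And>b. 0 \<le> b \<Longrightarrow> \<bar>g b\<bar> \<le> 1" "\<And>b. 0 \<le> b \<Longrightarrow> \<bar>g b - 1\<bar> \<le> L * q powi b" and L: "1 \<le> L"
    and e: "\<And>n N. 0 < n \<Longrightarrow> N \<in> {1/2, - 1/2} \<Longrightarrow> \<bar>e n N - e0\<bar> \<le> M * lw al n"
    and al: "0 \<le> al" "al \<le> 2"
    and van: "\<And>a b N. lab a b N \<in> spin_labels \<Longrightarrow> lab (a + j + i) (b + j - i) N \<notin> spin_labels \<Longrightarrow> c a b N = 0"
  shows "good al j i c"
proof -
  have K: "0 \<le> K" using f(1)[of 0] by simp
  have p: "0 \<le> q powi a" for a using q_powi_pos[of a] by simp
  show ?thesis
    by (rule goodI[where F = "\<lambda>a b. f a * g b" and f = f and K = "K * L" and k = 0, OF c _ _ _ e al _ van])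
      (use product_factor[OF f(1) f(2) g(1) g(2) p K L p] in auto)
qed

text \<open>In the three cases with j = i, namely \<open>cu X_plus\<close>, \<open>cm X_zero\<close>
  and \<open>cd X_minus\<close>, the factor depending on a tends to 1, 1 and -1/q, so nothing has to
  decay. The remaining six fall under \<open>good_decaying\<close>.\<close>

lemma good_coefficients:
  shows "good rate 1 (idx x) (cu x)" and "good rate 0 (idx x) (cm x)" and "good rate (- 1) (idx x) (cd x)"
proof -
  obtain C where C: "0 \<le> C" "\<And>n N. n > 0 \<Longrightarrow> N \<in> {1/2, - 1/2} \<Longrightarrow> \<bar>E N n - E_lim\<bar> \<le> C * lw rate n"
    using E_estimate by blast
  obtain C' where C': "0 \<le> C'" "\<And>n N. n > 0 \<Longrightarrow> N \<in> {1/2, - 1/2} \<Longrightarrow> \<bar>B N n - t\<bar> \<le> C' * lw rate n"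
    using B_estimate by blast
  note C2 = E_shift_estimate[OF C(2,1)]
  note rb = rate_bounds(1,2)
  have pos: "0 < q powi a" for a by (rule q_powi_pos)
  have s2': "\<bar>s2 * r\<bar> \<le> s2 / r" "\<bar>s2 / r\<bar> \<le> s2 / r" "\<bar>- (s2 * r * q)\<bar> \<le> s2 / r"
  proof -
    have "s2 * r \<le> s2 * (1 / r)" using s2_pos r_pos r_less_1 square_less_1[OF r_pos r_less_1]
      by (intro mult_left_mono) (auto simp: pos_le_divide_eq)
    moreover have "s2 * r * q \<le> s2 * r" using s2_pos r_pos q1 by (simp add: mult_left_le)
    moreover have "0 < s2 * r" "0 < s2 / r" "0 < s2 * r * q" using s2_pos r_pos q0 by simp_all
    moreover have "s2 * (1 / r) = s2 / r" by simp
    ultimately show "\<bar>s2 * r\<bar> \<le> s2 / r" "\<bar>s2 / r\<bar> \<le> s2 / r" "\<bar>- (s2 * r * q)\<bar> \<le> s2 / r"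
      by linarith+
  qed
  have qq: "\<bar>q powi a * q powi a\<bar> \<le> 1 * q powi a" "\<bar>q powi a * q powi a\<bar> \<le> 1" if "0 \<le> a" for a
    using q_powi_square_le[OF that] q_powi_le_1[OF that] by auto
  have u1: "\<bar>u a - 1\<bar> \<le> 1 * q powi a" "\<bar>u (a + 1) - 1\<bar> \<le> 1 * q powi a" if "0 \<le> a" for a
    using uu_shift[OF that] by auto
  have vu: "cu x a b N = 0" if "lab a b N \<in> spin_labels" "lab (a + 1 + idx x) (b + 1 - idx x) N \<notin> spin_labels" for a b N x
    using that by (rule coefficients_vanish(1))
  have vm: "cm x a b N = 0" if "lab a b N \<in> spin_labels" "lab (a + 0 + idx x) (b + 0 - idx x) N \<notin> spin_labels" for a b N x
    using that coefficients_vanish(2)[of a b N x] by simp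
  have vd: "cd x a b N = 0" if "lab a b N \<in> spin_labels" "lab (a + - 1 + idx x) (b + - 1 - idx x) N \<notin> spin_labels" for a b N x
    using that coefficients_vanish(3)[of a b N x] by simp
  show "good rate 1 (idx x) (cu x)"
  proof (cases x)
    case X_plus
    show ?thesis unfolding X_plus
      by (rule goodI[where F = "\<lambda>a b. u (a + 1) * u (a + 2)" and f = "\<lambda>a. u (a + 1) * u (a + 2)"
        and e = "\<lambda>n N. E N (n + 2)" and K = 2 and k = 1, OF _ _ _ _ C2 rb _ vu])
        (use uu_shift(3,4) pos in \<open>auto intro: order_trans[where y = 1] simp: less_imp_le\<close>)
  next
    case X_zero
    show ?thesis unfolding X_zero
      by (rule good_decaying[where f = "\<lambda>a. s2 * r * q powi a * u (a + 1)" and g = "\<lambda>b. u (b + 1)"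
        and e = "\<lambda>n N. E N (n + 2)" and K = "s2 / r" and L = 1,
        OF _ decaying_factor(2)[OF _ s2'(1) uu_shift(7)] decaying_factor(1)[OF _ s2'(1) uu_shift(7)]
        uu_shift(7) u1(2) _ C2 rb vu]) auto
  next
    case X_minus
    show ?thesis unfolding X_minus
      by (rule good_decaying[where f = "\<lambda>a. q powi a * q powi a" and g = "\<lambda>b. u (b + 1) * u (b + 2)"
        and e = "\<lambda>n N. E N (n + 2)" and K = 1 and L = 2,
        OF _ qq(2) qq(1) uu_shift(3) uu_shift(4) _ C2 rb vu]) auto
  qed
  show "good rate 0 (idx x) (cm x)"
  proof (cases x)
    case X_plus
    show ?thesis unfolding X_plus
      by (rule good_decaying[where f = "\<lambda>a. - (s2 * r * q) * q powi a * u (a + 1)" and g = u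
        and e = "\<lambda>n N. B N n" and K = "s2 / r" and L = 1,
        OF _ decaying_factor(2)[OF _ s2'(3) uu_shift(7)] decaying_factor(1)[OF _ s2'(3) uu_shift(7)]
        uu_shift(5) u1(1) _ C'(2) rb vm]) auto
  next
    case X_minus
    show ?thesis unfolding X_minus
      by (rule good_decaying[where f = "\<lambda>a. s2 / r * q powi a * u a" and g = "\<lambda>b. u (b + 1)"
        and e = "\<lambda>n N. B N n" and K = "s2 / r" and L = 1,
        OF _ decaying_factor(2)[OF _ s2'(2) uu_shift(5)] decaying_factor(1)[OF _ s2'(2) uu_shift(5)]
        uu_shift(7) u1(2) _ C'(2) rb vm]) auto
  next
    case X_zero
    have h: "q * q < 1" by (rule square_less_1[OF q0 q1])
    have b: "\<bar>1 - (1 + q * q) * (q powi a * q powi a) + q * q * (q powi a * q powi a) * (q powi b * q powi b)\<bar> \<le> 4"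
      "\<bar>q * q * (q powi a * q powi a) * (q powi b * q powi b)\<bar> \<le> 4 * (q powi a * q powi b)"
      "\<bar>(1 + q * q) * (q powi a * q powi a)\<bar> \<le> 4 * q powi a" if "0 \<le> a" "0 \<le> b" for a b
    proof -
      have "(1 + q * q) * (q powi a * q powi a) \<le> 2 * q powi a"
        using h q_powi_square_le[OF that(1)] pos[of a] q0 by (intro mult_mono) auto
      moreover have "0 \<le> (1 + q * q) * (q powi a * q powi a)" using pos[of a] q0 by simp
      moreover have "q powi a \<le> 1" "q powi b \<le> 1" using that by (auto intro: q_powi_le_1)
      moreover have "q * q * (q powi a * q powi a) * (q powi b * q powi b) \<le> (1 * q powi a) * q powi b"
        using h q_powi_square_le[OF that(1)] q_powi_square_le[OF that(2)] pos[of a] pos[of b] q0 by (intro mult_mono) auto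
      moreover have "(1 * q powi a) * q powi b \<le> 1 * 1"
        using that pos[of a] pos[of b] by (intro mult_mono) (auto intro: q_powi_le_1)
      moreover have "0 \<le> q * q * (q powi a * q powi a) * (q powi b * q powi b)" "0 < q powi a" "0 < q powi a * q powi b"
        using pos[of a] pos[of b] q0 by auto
      ultimately show "\<bar>1 - (1 + q * q) * (q powi a * q powi a) + q * q * (q powi a * q powi a) * (q powi b * q powi b)\<bar> \<le> 4"
        "\<bar>q * q * (q powi a * q powi a) * (q powi b * q powi b)\<bar> \<le> 4 * (q powi a * q powi b)"
        "\<bar>(1 + q * q) * (q powi a * q powi a)\<bar> \<le> 4 * q powi a" by (simp_all only: mult_1)
    qed
    show ?thesis unfolding X_zero
    proof (rule goodI[where F = "\<lambda>a b. 1 - (1 + q * q) * (q powi a * q powi a) + q * q * (q powi a * q powi a) * (q powi b * q powi b)"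
        and f = "\<lambda>a. 1 - (1 + q * q) * (q powi a * q powi a)" and e = "\<lambda>n N. B N n" and K = 4 and k = 1,
        OF _ _ _ _ C'(2) rb _ vm])
      fix a b :: int assume ab: "0 \<le> a" "0 \<le> b"
      show "\<bar>1 - (1 + q * q) * (q powi a * q powi a) + q * q * (q powi a * q powi a) * (q powi b * q powi b)\<bar> \<le> 4"
        by (rule b(1)[OF ab])
      show "\<bar>1 - (1 + q * q) * (q powi a * q powi a) + q * q * (q powi a * q powi a) * (q powi b * q powi b)
        - (1 - (1 + q * q) * (q powi a * q powi a))\<bar> \<le> 4 * (q powi a * q powi b)"
        using b(2)[OF ab] by (simp only: add_diff_cancel_left')
    next
      fix a :: int assume a: "0 \<le> a"
      have "1 - (1 + q * q) * (q powi a * q powi a) - 1 = - ((1 + q * q) * (q powi a * q powi a))" by simp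
      then show "\<bar>1 - (1 + q * q) * (q powi a * q powi a) - 1\<bar> \<le> 4 * q powi a"
        using b(3)[OF a order_refl] by (simp only: abs_minus_cancel)
    qed auto
  qed
  show "good rate (- 1) (idx x) (cd x)"
  proof (cases x)
    case X_minus
    have inv: "1 / q \<ge> 1" using q0 q1 by simp
    have "good rate (- 1) (- 1) (cd X_minus)"
    proof (rule goodI[where F = "\<lambda>a b. - (u a * u (a - 1)) / q" and f = "\<lambda>a. - (u a * u (a - 1)) / q"
        and e = "\<lambda>n N. E N n" and K = "(1 + 1 / q) / q" and k = "- 1 / q", OF _ _ _ _ C(2) rb])
      fix a b :: int assume a: "0 \<le> a"
      have "\<bar>- (u a * u (a - 1)) / q\<bar> \<le> 1 / q" using uu_shift(1)[OF a] q0 by (simp add: abs_divide divide_right_mono)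
      also have "\<dots> \<le> (1 + 1 / q) / q" using q0 by (intro divide_right_mono) auto
      finally show "\<bar>- (u a * u (a - 1)) / q\<bar> \<le> (1 + 1 / q) / q" .
      have "- (u a * u (a - 1)) / q - - 1 / q = - (u a * u (a - 1) - 1) / q" by (simp add: diff_divide_distrib)
      then have "\<bar>- (u a * u (a - 1)) / q - - 1 / q\<bar> = \<bar>u a * u (a - 1) - 1\<bar> / q"
        using q0 by (simp add: abs_divide abs_minus_commute)
      also have "\<dots> \<le> (1 + 1 / q) * q powi a / q" using uu_shift(2)[OF a] q0 by (intro divide_right_mono) auto
      finally show "\<bar>- (u a * u (a - 1)) / q - - 1 / q\<bar> \<le> (1 + 1 / q) / q * q powi a" by simp
    qed (use vd[of _ _ _ X_minus] q0 pos in \<open>auto simp: mult_ac less_imp_le\<close>)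
    then show ?thesis unfolding X_minus by simp
  next
    case X_zero
    show ?thesis unfolding X_zero
      by (rule good_decaying[where f = "\<lambda>a. s2 / r * q powi a * u a" and g = u
        and e = "\<lambda>n N. E N n" and K = "s2 / r" and L = 1,
        OF _ decaying_factor(2)[OF _ s2'(2) uu_shift(5)] decaying_factor(1)[OF _ s2'(2) uu_shift(5)]
        uu_shift(5) u1(1) _ C(2) rb vd]) auto
  next
    case X_plus
    have f: "\<bar>- (q * (q powi a * q powi a))\<bar> \<le> 1" "\<bar>- (q * (q powi a * q powi a))\<bar> \<le> 1 * q powi a" if "0 \<le> a" for a
    proof -
      have "q * (q powi a * q powi a) \<le> 1 * (q powi a * q powi a)" using q1 by (intro mult_right_mono) auto
      then show "\<bar>- (q * (q powi a * q powi a))\<bar> \<le> 1" "\<bar>- (q * (q powi a * q powi a))\<bar> \<le> 1 * q powi a"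
        using qq[OF that] q0 pos[of a] mult_pos_pos[OF q0 mult_pos_pos[OF pos[of a] pos[of a]]] by linarith+
    qed
    show ?thesis unfolding X_plus
      by (rule good_decaying[where f = "\<lambda>a. - (q * (q powi a * q powi a))" and g = "\<lambda>b. u b * u (b - 1)"
        and e = "\<lambda>n N. E N n" and K = 1 and L = "1 + 1 / q",
        OF _ f(1) f(2) uu_shift(1) uu_shift(2) _ C(2) rb vd]) (use q0 in auto)
  qed
qed

subsection \<open>The generators as weighted shifts\<close>

lemma good_bounded:
  assumes "good al j i c" "0 \<le> al" "s \<in> {1, - 1}"
  shows "\<exists>K. weight_bounded (label_weight c) (shift (of_int j) (of_int i) s) K"
proof -
  obtain \<phi> \<kappa> C where *: "0 \<le> C"
    "\<And>a b N. lab a b N \<in> spin_labels \<Longrightarrow> \<bar>c a b N - \<phi> a\<bar> \<le> C * lw al (a + b)"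
    "\<And>a. \<bar>\<phi> a - \<kappa>\<bar> \<le> C * q powi a"
    using assms(1) unfolding good_def by metis
  have "\<bar>label_weight c p\<bar> \<le> C + C + \<bar>\<kappa>\<bar>" if "p \<in> spin_labels" for p
  proof -
    obtain a b N where p: "p = lab a b N" "0 \<le> a" "0 \<le> b" using label_cases[OF \<open>p \<in> spin_labels\<close>] by metis
    have "C * lw al (a + b) \<le> C * 1" "C * q powi a \<le> C * 1"
      by (rule mult_left_mono[OF lw_le_1 *(1)] mult_left_mono[OF q_powi_le_1 *(1)]; use p assms(2) in simp)+
    then show ?thesis using *(2)[of a b N] *(3)[of a] that unfolding p by simp
  qed
  then show ?thesis using *(1) unfolding weight_bounded_def by (intro exI[of _ "C + C + \<bar>\<kappa>\<bar>"]) auto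
qed

lemma inverse_maps_shift': "s \<in> {1, - 1} \<Longrightarrow> inverse_maps (shift j i s) (shift (- j) (- i) s)"
  by (rule inverse_maps_shift) auto

lemma bounded_clinear_iw:
  assumes "good al j i c" "0 \<le> al" "s \<in> {1, - 1}"
  shows "bounded_clinear (iw c j i s)"
  unfolding iw_def using good_bounded[OF assms] bounded_clinear_wmap[OF inverse_maps_shift'[OF assms(3)]] by blast

text \<open>The infinite sum defining \<open>pi_gen\<close> splits because each of the three
  families is summable by itself, thanks to the bounded weights.\<close>

lemma pi_gen_eq: "pi_gen q t x v = iw (cd x) (- 1) (idx x) 1 v + iw (cm x) 0 (idx x) 1 v + iw (cu x) 1 (idx x) 1 v"
proof -
  let ?f = "\<lambda>c j i. coeff v i *\<^sub>C (\<lambda>p. label_weight c p *\<^sub>R bv (shift (of_int j) (of_int (idx x)) 1 p)) (Rep_spin_index i)"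
  have hs: "(?f c j has_sum iw c j (idx x) 1 v) UNIV" if good: "good rate j (idx x) c" for c j
  proof -
    obtain K where "weight_bounded (label_weight c) (shift (of_int j) (of_int (idx x)) 1) K"
      using good_bounded[OF good rate_bounds(1), of 1] by auto
    from wmap_has_sum[OF inverse_maps_shift'[of 1] this, of v] show ?thesis by (simp add: iw_def)
  qed
  have "((\<lambda>i. ?f (cd x) (- 1) i + ?f (cm x) 0 i + ?f (cu x) 1 i)
      has_sum (iw (cd x) (- 1) (idx x) 1 v + iw (cm x) 0 (idx x) 1 v + iw (cu x) 1 (idx x) 1 v)) UNIV"
    by (intro has_sum_add hs good_coefficients)
  moreover have "?f (cd x) (- 1) i + ?f (cm x) 0 i + ?f (cu x) 1 i
    = coeff v i *\<^sub>C (\<lambda>(l, m, N). alpha_down q t x l m N *\<^sub>R basis_vec (l - 1) (m + sphere_index x) N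
    + alpha_mid q t x l m N *\<^sub>R basis_vec l (m + sphere_index x) N
    + alpha_up q t x l m N *\<^sub>R basis_vec (l + 1) (m + sphere_index x) N) (Rep_spin_index i)" for i
  proof -
    obtain a b N where p: "Rep_spin_index i = lab a b N" "0 \<le> a" "0 \<le> b" "odd (a + b)" "N \<in> {1/2, - 1/2}"
      using label_cases[OF Rep_spin_index] by metis
    show ?thesis
      unfolding p(1) label_weight_lab
      unfolding lab_def prod.case alpha_up_eq[OF p(2-5)] alpha_mid_eq[OF p(2-5)] alpha_down_eq[OF p(2-5)]
      by (simp add: shift_def basis_vec_eq sphere_index_eq ell2.scale_right_distrib)
  qed
  ultimately show ?thesis unfolding pi_gen_def on_basis_eq by (simp add: infsumI)
qed

lemma bounded_clinear_pi_gen: "bounded_clinear (pi_gen q t x)"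
proof -
  have "pi_gen q t x = (\<lambda>v. iw (cd x) (- 1) (idx x) 1 v + iw (cm x) 0 (idx x) 1 v + iw (cu x) 1 (idx x) 1 v)"
    by (rule ext) (rule pi_gen_eq)
  then show ?thesis
    by (simp only:) (intro bounded_clinear_plus bounded_clinear_iw[OF _ rate_bounds(1)] good_coefficients; simp)
qed

end

section \<open>The relations of the sphere\<close>

context podles
begin

section \<open>Products of two generators\<close>

abbreviation "L \<equiv> pi_gen q t"

definition ri :: real where "ri = inverse r"
definition qi :: real where "qi = inverse q"

lemma inverses: "r * ri = 1" "q * qi = 1" "r * r = q" "ri * ri = qi" "s2 * s2 = q + qi"
  using r_pos q0 r_square s2_square by (auto simp: ri_def qi_def simp flip: inverse_mult_distrib)

text \<open>The coefficients \<open>cu\<close>, \<open>cm\<close>, \<open>cd\<close> again, with n =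
  a + b as a separate argument and divisions replaced by the symbols \<open>qi\<close> and
  \<open>ri\<close>. This keeps the values of \<open>E\<close> and \<open>B\<close> recognizable as
  atoms when a and b are shifted.\<close>

fun up :: "sphere_gen \<Rightarrow> int \<Rightarrow> int \<Rightarrow> int \<Rightarrow> real \<Rightarrow> real" where
  "up X_plus a b n N = u (a + 1) * u (a + 2) * E N (n + 2)"
| "up X_zero a b n N = s2 * r * q powi a * u (a + 1) * u (b + 1) * E N (n + 2)"
| "up X_minus a b n N = q powi a * q powi a * u (b + 1) * u (b + 2) * E N (n + 2)"

fun mid :: "sphere_gen \<Rightarrow> int \<Rightarrow> int \<Rightarrow> int \<Rightarrow> real \<Rightarrow> real" where
  "mid X_plus a b n N = - (s2 * r * q * q powi a * u (a + 1) * u b * B N n)"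
| "mid X_zero a b n N = (1 - (1 + q * q) * (q powi a * q powi a)
     + q * q * (q powi a * q powi a) * (q powi b * q powi b)) * B N n"
| "mid X_minus a b n N = s2 * ri * q powi a * u a * u (b + 1) * B N n"

fun down :: "sphere_gen \<Rightarrow> int \<Rightarrow> int \<Rightarrow> int \<Rightarrow> real \<Rightarrow> real" where
  "down X_plus a b n N = - (q * (q powi a * q powi a) * u b * u (b - 1) * E N n)"
| "down X_zero a b n N = s2 * ri * q powi a * u a * u b * E N n"
| "down X_minus a b n N = - (u (a - 1) * u a * E N n * qi)"

lemma coefficients_eq: "cu x a b N = up x a b (a + b) N" "cm x a b N = mid x a b (a + b) N" "cd x a b N = down x a b (a + b) N"
  by (cases x; simp add: ri_def qi_def divide_inverse)+

text \<open>The product of \<open>x\<close> and \<open>y\<close> has components changing l by 2, 1,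
  0, -1 and -2, with coefficients \<open>K2\<close>, \<open>K1\<close>, \<open>K0\<close>,
  \<open>K3\<close> and \<open>K4\<close> in this order.\<close>

definition K2 where "K2 x y a b n N = up x (a + 1 + idx y) (b + 1 - idx y) (n + 2) N * up y a b n N"
definition K1 where "K1 x y a b n N = up x (a + idx y) (b - idx y) n N * mid y a b n N
  + mid x (a + 1 + idx y) (b + 1 - idx y) (n + 2) N * up y a b n N"
definition K0 where "K0 x y a b n N = up x (a - 1 + idx y) (b - 1 - idx y) (n - 2) N * down y a b n N
  + mid x (a + idx y) (b - idx y) n N * mid y a b n N
  + down x (a + 1 + idx y) (b + 1 - idx y) (n + 2) N * up y a b n N"
definition K3 where "K3 x y a b n N = mid x (a - 1 + idx y) (b - 1 - idx y) (n - 2) N * down y a b n N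
  + down x (a + idx y) (b - idx y) n N * mid y a b n N"
definition K4 where "K4 x y a b n N = down x (a - 1 + idx y) (b - 1 - idx y) (n - 2) N * down y a b n N"

lemmas K_defs = K2_def K1_def K0_def K3_def K4_def

lemma L_w: "L x (w a b N) = up x a b (a + b) N *\<^sub>R w (a + 1 + idx x) (b + 1 - idx x) N
     + mid x a b (a + b) N *\<^sub>R w (a + idx x) (b - idx x) N
     + down x a b (a + b) N *\<^sub>R w (a - 1 + idx x) (b - 1 - idx x) N"
  unfolding pi_gen_w coefficients_eq ..

lemma L_linear: "L x (v + v') = L x v + L x v'" "L x (c *\<^sub>C v) = c *\<^sub>C L x v" "L x (k *\<^sub>R v) = k *\<^sub>R L x v" "L x 0 = 0"
  using bounded_clinear_add[OF bounded_clinear_pi_gen] bounded_clinear_scale[OF bounded_clinear_pi_gen]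
    bounded_clinear_zero[OF bounded_clinear_pi_gen] by (auto simp: scaleR_scaleC)

lemma L_L_w:
  "L x (L y (w a b N)) = (let i = idx x + idx y; n = a + b in
     K2 x y a b n N *\<^sub>R w (a + 2 + i) (b + 2 - i) N + K1 x y a b n N *\<^sub>R w (a + 1 + i) (b + 1 - i) N
     + K0 x y a b n N *\<^sub>R w (a + i) (b - i) N + K3 x y a b n N *\<^sub>R w (a - 1 + i) (b - 1 - i) N
     + K4 x y a b n N *\<^sub>R w (a - 2 + i) (b - 2 - i) N)"
proof -
  have *: "a + 1 + idx y + (b + 1 - idx y) = a + b + 2" "a + idx y + (b - idx y) = a + b"
    "a - 1 + idx y + (b - 1 - idx y) = a + b - 2" by simp_all
  have e: "a + 1 + idx y + 1 + idx x = a + 2 + (idx x + idx y)" "b + 1 - idx y + 1 - idx x = b + 2 - (idx x + idx y)"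
    "a + 1 + idx y + idx x = a + 1 + (idx x + idx y)" "b + 1 - idx y - idx x = b + 1 - (idx x + idx y)"
    "a + 1 + idx y - 1 + idx x = a + (idx x + idx y)" "b + 1 - idx y - 1 - idx x = b - (idx x + idx y)"
    "a + idx y + 1 + idx x = a + 1 + (idx x + idx y)" "b - idx y + 1 - idx x = b + 1 - (idx x + idx y)"
    "a + idx y + idx x = a + (idx x + idx y)" "b - idx y - idx x = b - (idx x + idx y)"
    "a + idx y - 1 + idx x = a - 1 + (idx x + idx y)" "b - idx y - 1 - idx x = b - 1 - (idx x + idx y)"
    "a - 1 + idx y + 1 + idx x = a + (idx x + idx y)" "b - 1 - idx y + 1 - idx x = b - (idx x + idx y)"
    "a - 1 + idx y + idx x = a - 1 + (idx x + idx y)" "b - 1 - idx y - idx x = b - 1 - (idx x + idx y)"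
    "a - 1 + idx y - 1 + idx x = a - 2 + (idx x + idx y)" "b - 1 - idx y - 1 - idx x = b - 2 - (idx x + idx y)"
    by simp_all
  show ?thesis
    unfolding L_w[of y] L_linear unfolding L_w * e Let_def K_defs
    by (simp only: scaleR_add_right scaleR_scaleR scaleR_add_left mult.commute ac_simps)
qed

lemma int_steps:
  "k + 0 = k" "k - 0 = k" "k + 1 + - 1 = k" "k + 1 - - 1 = k + 2" "k + 1 + 1 = k + 2" "k + 1 - 1 = k"
  "k + - 1 = k - 1" "k - - 1 = k + 1" "k - 1 + - 1 = k - 2" "k - 1 - - 1 = k" "k - 1 + 1 = k" "k - 1 - 1 = k - 2"
  "k + 2 + 1 = k + 3" "k + 2 + 2 = k + 4" "k + 1 + 2 = k + 3" "k - 1 + 2 = k + 1" "k - 2 + 1 = k - 1" "k - 2 + 2 = k"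
  "k + 2 - 1 = k + 1" "k - 2 - 1 = k - 3" "k + 2 - 2 = k" for k :: int
  by simp_all

lemma q_steps: "q powi (k + 1) = q powi k * q" "q powi (k + 2) = q powi k * (q * q)" "q powi (k - 1) = q powi k * qi"
  "q powi (k - 2) = q powi k * (qi * qi)"
  using q0 by (simp_all add: power_int_add power_int_diff qi_def divide_inverse power2_eq_square)

fun kinv_factor :: "sphere_gen \<Rightarrow> real" where
  "kinv_factor X_minus = q" | "kinv_factor X_zero = 1" | "kinv_factor X_plus = qi"

lemmas level_simps = K_defs idx.simps int_steps up.simps mid.simps down.simps q_steps

text \<open>All powers, roots and reduced matrix elements that can occur receive names. The
  covariance laws and the relations then turn into polynomial identities in these atoms, modulo the
  squares of the \<open>u\<close> factors and the recurrences.\<close>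

context
  fixes a b n :: int and N X Y U0 U1 U2 U3 Um Ul V0 V1 V2 V3 Vm Vl E0 E2 E4 En B0 B2 Bn rr rj qj ss dd :: real
  assumes ab: "0 \<le> a" "0 \<le> b" and n: "n = a + b"
  defines "X \<equiv> q powi a" and "Y \<equiv> q powi b"
    and "U0 \<equiv> u a" and "U1 \<equiv> u (a + 1)" and "U2 \<equiv> u (a + 2)" and "U3 \<equiv> u (a + 3)" and "Um \<equiv> u (a - 1)" and "Ul \<equiv> u (a - 2)"
    and "V0 \<equiv> u b" and "V1 \<equiv> u (b + 1)" and "V2 \<equiv> u (b + 2)" and "V3 \<equiv> u (b + 3)" and "Vm \<equiv> u (b - 1)" and "Vl \<equiv> u (b - 2)"
    and "E0 \<equiv> E N n" and "E2 \<equiv> E N (n + 2)" and "E4 \<equiv> E N (n + 4)" and "En \<equiv> E N (n - 2)"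
    and "B0 \<equiv> B N n" and "B2 \<equiv> B N (n + 2)" and "Bn \<equiv> B N (n - 2)"
    and "rr \<equiv> r" and "rj \<equiv> ri" and "qj \<equiv> qi" and "ss \<equiv> s2" and "dd \<equiv> D"
begin

private lemmas fold_atoms = X_def[symmetric] Y_def[symmetric] U0_def[symmetric] U1_def[symmetric] U2_def[symmetric]
  U3_def[symmetric] Um_def[symmetric] Ul_def[symmetric] V0_def[symmetric] V1_def[symmetric] V2_def[symmetric]
  V3_def[symmetric] Vm_def[symmetric] Vl_def[symmetric] E0_def[symmetric] E2_def[symmetric] E4_def[symmetric]
  En_def[symmetric] B0_def[symmetric] B2_def[symmetric] Bn_def[symmetric]
  rr_def[symmetric] rj_def[symmetric] qj_def[symmetric] ss_def[symmetric] dd_def[symmetric]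

private lemma inv: "rr * rj = 1" "q * qj = 1" "rr * rr = q" "rj * rj = qj" "ss * ss = q + qj"
  unfolding rr_def rj_def qj_def ss_def by (rule inverses)+

private lemma uu: "U1 * U1 = 1 - X * q * (X * q)" "U2 * U2 = 1 - X * (q * q) * (X * (q * q))"
  "U0 * U0 = 1 - X * X" "V1 * V1 = 1 - Y * q * (Y * q)" "V2 * V2 = 1 - Y * (q * q) * (Y * (q * q))"
  "V0 * V0 = 1 - Y * Y"
  using u_square[of "a + 1"] u_square[of "a + 2"] u_square[of a] u_square[of "b + 1"] u_square[of "b + 2"] u_square[of b] ab
  unfolding U1_def U2_def U0_def V1_def V2_def V0_def
  by (simp_all add: q_steps X_def Y_def)

text \<open>The square of \<open>u (a - 1)\<close> has the expected value only for positive a. The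
  extra factor \<open>u a\<close> makes the equation true at a = 0 as well, and it is present
  wherever the square occurs.\<close>

private lemma uu'': "U0 * (Um * Um) = U0 * (1 - X * qj * (X * qj))" "V0 * (Vm * Vm) = V0 * (1 - Y * qj * (Y * qj))"
proof -
  have *: "u k * (u (k - 1) * u (k - 1)) = u k * (1 - q powi k * qi * (q powi k * qi))" if "0 \<le> k" for k
  proof (cases "k = 0")
    case False
    then show ?thesis using that u_square[of "k - 1"] by (simp add: q_steps)
  qed simp
  show "U0 * (Um * Um) = U0 * (1 - X * qj * (X * qj))" "V0 * (Vm * Vm) = V0 * (1 - Y * qj * (Y * qj))"
    unfolding X_def Y_def Um_def Vm_def U0_def V0_def qj_def using *[OF ab(1)] *[OF ab(2)] by auto
qed

private lemma steps: "k + 1 + 1 + 1 = k + 3" "k + 1 + 1 = k + 2" for k :: int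
  by simp_all

private lemma dd: "dd = qj - q"
  by (simp add: dd_def qj_def D_def qi_def)

lemmas step_simps = idx.simps steps int_steps up.simps mid.simps down.simps q_steps kinv_factor.simps

text \<open>The eighteen identities \<open>f_X_...\<close> and \<open>e_X_...\<close> are the
  components of h x = (h_(1).x) h_(2) for h = f, e and each generator x. They are multiplied by the
  common denominator of the ladder coefficients, whose change with l accounts for the factors
  \<open>qj\<close>, 1 and \<open>q\<close>.\<close>

lemma f_X_minus_0: "up X_minus a b n N * (u (b + 1 - idx X_minus) * u (a + 1 + idx X_minus + 1)) * qj = ss * up X_zero a b n N * (X * rr * dd) + kinv_factor X_minus * up X_minus (a + 1) (b - 1) n N * (u b * u (a + 1))"
  unfolding step_simps fold_atoms
  using inv dd uu uu'' by Groebner_Basis.algebra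

lemma f_X_minus_1: "mid X_minus a b n N * (u (b - idx X_minus) * u (a + idx X_minus + 1)) * 1 = ss * mid X_zero a b n N * (X * rr * dd) + kinv_factor X_minus * mid X_minus (a + 1) (b - 1) n N * (u b * u (a + 1))"
  unfolding step_simps fold_atoms
  using inv dd uu uu'' by Groebner_Basis.algebra

lemma f_X_minus_2: "down X_minus a b n N * (u (b - 1 - idx X_minus) * u (a - 1 + idx X_minus + 1)) * q = ss * down X_zero a b n N * (X * rr * dd) + kinv_factor X_minus * down X_minus (a + 1) (b - 1) n N * (u b * u (a + 1))"
  unfolding step_simps fold_atoms
  using inv dd uu uu'' by Groebner_Basis.algebra

lemma f_X_zero_0: "up X_zero a b n N * (u (b + 1 - idx X_zero) * u (a + 1 + idx X_zero + 1)) * qj = ss * up X_plus a b n N * (X * rr * dd) + kinv_factor X_zero * up X_zero (a + 1) (b - 1) n N * (u b * u (a + 1))"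
  unfolding step_simps fold_atoms
  using inv dd uu uu'' by Groebner_Basis.algebra

lemma f_X_zero_1: "mid X_zero a b n N * (u (b - idx X_zero) * u (a + idx X_zero + 1)) * 1 = ss * mid X_plus a b n N * (X * rr * dd) + kinv_factor X_zero * mid X_zero (a + 1) (b - 1) n N * (u b * u (a + 1))"
  unfolding step_simps fold_atoms
  using inv dd uu uu'' by Groebner_Basis.algebra

lemma f_X_zero_2: "down X_zero a b n N * (u (b - 1 - idx X_zero) * u (a - 1 + idx X_zero + 1)) * q = ss * down X_plus a b n N * (X * rr * dd) + kinv_factor X_zero * down X_zero (a + 1) (b - 1) n N * (u b * u (a + 1))"
  unfolding step_simps fold_atoms
  using inv dd uu uu'' by Groebner_Basis.algebra

lemma f_X_plus_0: "up X_plus a b n N * (u (b + 1 - idx X_plus) * u (a + 1 + idx X_plus + 1)) * qj = kinv_factor X_plus * up X_plus (a + 1) (b - 1) n N * (u b * u (a + 1))"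
  unfolding step_simps fold_atoms
  by simp

lemma f_X_plus_1: "mid X_plus a b n N * (u (b - idx X_plus) * u (a + idx X_plus + 1)) * 1 = kinv_factor X_plus * mid X_plus (a + 1) (b - 1) n N * (u b * u (a + 1))"
  unfolding step_simps fold_atoms
  using inv dd uu uu'' by Groebner_Basis.algebra

lemma f_X_plus_2: "down X_plus a b n N * (u (b - 1 - idx X_plus) * u (a - 1 + idx X_plus + 1)) * q = kinv_factor X_plus * down X_plus (a + 1) (b - 1) n N * (u b * u (a + 1))"
  unfolding step_simps fold_atoms
  using inv dd uu uu'' by Groebner_Basis.algebra

lemma e_X_minus_0: "up X_minus a b n N * (u (b + 1 - idx X_minus + 1) * u (a + 1 + idx X_minus)) * qj = kinv_factor X_minus * up X_minus (a - 1) (b + 1) n N * (u (b + 1) * u a)"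
  unfolding step_simps fold_atoms
  using inv dd uu uu'' by Groebner_Basis.algebra

lemma e_X_minus_1: "mid X_minus a b n N * (u (b - idx X_minus + 1) * u (a + idx X_minus)) * 1 = kinv_factor X_minus * mid X_minus (a - 1) (b + 1) n N * (u (b + 1) * u a)"
  unfolding step_simps fold_atoms
  using inv dd uu uu'' by Groebner_Basis.algebra

lemma e_X_minus_2: "down X_minus a b n N * (u (b - 1 - idx X_minus + 1) * u (a - 1 + idx X_minus)) * q = kinv_factor X_minus * down X_minus (a - 1) (b + 1) n N * (u (b + 1) * u a)"
  unfolding step_simps fold_atoms
  by simp

lemma e_X_zero_0: "up X_zero a b n N * (u (b + 1 - idx X_zero + 1) * u (a + 1 + idx X_zero)) * qj = ss * up X_minus a b n N * (X * rr * dd) + kinv_factor X_zero * up X_zero (a - 1) (b + 1) n N * (u (b + 1) * u a)"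
  unfolding step_simps fold_atoms
  using inv dd uu uu'' by Groebner_Basis.algebra

lemma e_X_zero_1: "mid X_zero a b n N * (u (b - idx X_zero + 1) * u (a + idx X_zero)) * 1 = ss * mid X_minus a b n N * (X * rr * dd) + kinv_factor X_zero * mid X_zero (a - 1) (b + 1) n N * (u (b + 1) * u a)"
  unfolding step_simps fold_atoms
  using inv dd uu uu'' by Groebner_Basis.algebra

lemma e_X_zero_2: "down X_zero a b n N * (u (b - 1 - idx X_zero + 1) * u (a - 1 + idx X_zero)) * q = ss * down X_minus a b n N * (X * rr * dd) + kinv_factor X_zero * down X_zero (a - 1) (b + 1) n N * (u (b + 1) * u a)"
  unfolding step_simps fold_atoms
  using inv dd uu uu'' by Groebner_Basis.algebra

lemma e_X_plus_0: "up X_plus a b n N * (u (b + 1 - idx X_plus + 1) * u (a + 1 + idx X_plus)) * qj = ss * up X_zero a b n N * (X * rr * dd) + kinv_factor X_plus * up X_plus (a - 1) (b + 1) n N * (u (b + 1) * u a)"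
  unfolding step_simps fold_atoms
  using inv dd uu uu'' by Groebner_Basis.algebra

lemma e_X_plus_1: "mid X_plus a b n N * (u (b - idx X_plus + 1) * u (a + idx X_plus)) * 1 = ss * mid X_zero a b n N * (X * rr * dd) + kinv_factor X_plus * mid X_plus (a - 1) (b + 1) n N * (u (b + 1) * u a)"
  unfolding step_simps fold_atoms
  using inv dd uu uu'' by Groebner_Basis.algebra

lemma e_X_plus_2: "down X_plus a b n N * (u (b - 1 - idx X_plus + 1) * u (a - 1 + idx X_plus)) * q = ss * down X_zero a b n N * (X * rr * dd) + kinv_factor X_plus * down X_plus (a - 1) (b + 1) n N * (u (b + 1) * u a)"
  unfolding step_simps fold_atoms
  using inv dd uu uu'' by Groebner_Basis.algebra

context
  assumes n0: "0 < n" and N: "N \<in> {1/2, - 1/2}"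
begin

private lemma XY: "q powi n = X * Y"
  using q0 by (simp add: n X_def Y_def power_int_add)

private lemma Brec: "(1 - q ^ 8 * (X * Y) * (X * Y)) * B2 = q * q * (1 - X * Y * (X * Y)) * B0 + (1 - q * q) * t"
  unfolding B2_def B0_def using B_rec[OF n0 N, unfolded XY] by (simp only: mult.assoc)

private lemma Erec: "(1 - q ^ 6 * (X * Y) * (X * Y)) * (E2 * E2) = (1 - X * Y * (X * Y) * (qj * qj)) * (E0 * E0)
     + (1 - q * q) * B0 * ((1 + q * q * (X * Y) * (X * Y)) * B0 - t)"
  unfolding E2_def E0_def B0_def qj_def qi_def using E_rec[OF n0 N, unfolded XY] by (simp add: divide_inverse)

private lemma Econst: "(1 + q * q) * (qj * qj) * ((1 - q ^ 6 * (X * Y) * (X * Y)) * (E2 * E2))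
     - (1 + q * q) * (X * Y) * (X * Y) * ((1 - X * Y * (X * Y) * (qj * qj)) * (E0 * E0))
     + B0 * B0 * (q * q * (1 + q * q * (X * Y) * (X * Y)) * (1 + q * q * (X * Y) * (X * Y)) - (1 + q * q) * (1 + q * q) * (X * Y) * (X * Y))
     + (1 - q * q) * t * (1 + q * q * (X * Y) * (X * Y)) * B0
     - (t * t + (1 + q * q) * (1 + q * q) * (qj * qj) * (1 - t)) = 0"
  unfolding E2_def E0_def B0_def qj_def qi_def using E_const[OF n0 N, unfolded XY] by (simp add: divide_inverse)

text \<open>The recurrence one step lower is available only from l = 3/2 on. At l = 1/2 the
  components that would require it have no target vector.\<close>

private lemma Brec_down: "(1 - q ^ 4 * (X * Y) * (X * Y)) * B0
    = q * q * (1 - X * Y * (X * Y) * (qj * qj * qj * qj)) * Bn + (1 - q * q) * t" if "3 \<le> n"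
proof -
  have n2: "0 < n - 2" using that by simp
  have z: "q powi (n - 2) = X * Y * (qi * qi)" using XY by (simp add: q_steps)
  have "q ^ 8 * (X * Y * (qi * qi)) * (X * Y * (qi * qi)) = q ^ 4 * (X * Y) * (X * Y)"
    using inverses(2) by Groebner_Basis.algebra
  then have e: "1 - q ^ 8 * (X * Y * (qi * qi)) * (X * Y * (qi * qi)) = 1 - q ^ 4 * (X * Y) * (X * Y)" by simp
  have "n - 2 + 2 = n" by simp
  then show ?thesis
    using B_rec[OF n2 N, unfolded z e] unfolding B0_def Bn_def qj_def by (simp only: mult_ac)
qed

text \<open>The suffixes \<open>up_0\<close>, \<open>up_1\<close>, \<open>up_2\<close>,
  \<open>down_0\<close>, \<open>down_1\<close> refer to the components changing l by 2, 1, 0, -1,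
  -2. Relations 1, 3 and 4 are treated; relation 2 follows later from the involution.\<close>

lemma rel1_up_0:
  shows "K2 X_minus X_zero a b n N - q * q * K2 X_zero X_minus a b n N = 0"
  unfolding level_simps fold_atoms
  by (simp add: mult_ac)

lemma rel1_up_1:
  shows "K1 X_minus X_zero a b n N - q * q * K1 X_zero X_minus a b n N - (1 - q * q) * t * up X_minus a b n N = 0"
  unfolding level_simps fold_atoms
  using inv Brec uu(1,3) by Groebner_Basis.algebra

lemma rel1_up_2:
  shows "K0 X_minus X_zero a b n N - q * q * K0 X_zero X_minus a b n N - (1 - q * q) * t * mid X_minus a b n N = 0"
  unfolding level_simps fold_atoms
  using inv Erec uu uu''(1) by Groebner_Basis.algebra

lemma rel1_down_0:
  assumes "3 \<le> n"
  shows "K3 X_minus X_zero a b n N - q * q * K3 X_zero X_minus a b n N - (1 - q * q) * t * down X_minus a b n N = 0"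
  unfolding level_simps fold_atoms
  using inv Brec_down[OF assms] uu(4,6) by Groebner_Basis.algebra

lemma rel1_down_1:
  assumes "3 \<le> n"
  shows "K4 X_minus X_zero a b n N - q * q * K4 X_zero X_minus a b n N = 0"
  unfolding level_simps fold_atoms
  using inv(2) by Groebner_Basis.algebra

lemma rel3_up_0:
  shows "- (q + qj) * K2 X_minus X_plus a b n N + q * q * K2 X_zero X_zero a b n N = 0"
  unfolding level_simps fold_atoms
  using inv by Groebner_Basis.algebra

lemma rel3_up_1:
  shows "- (q + qj) * K1 X_minus X_plus a b n N + q * q * K1 X_zero X_zero a b n N + (1 - q * q) * t * up X_zero a b n N = 0"
  unfolding level_simps fold_atoms
  using inv Brec uu(2,6) by Groebner_Basis.algebra

lemma rel3_up_2:
  shows "- (q + qj) * K0 X_minus X_plus a b n N + q * q * K0 X_zero X_zero a b n N + (1 - q * q) * t * mid X_zero a b n N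
    - (t * t + (q + qj) * (q + qj) * (1 - t)) = 0"
  unfolding level_simps fold_atoms
  using inv Erec Econst uu(1,2,3,4,6) uu''(2) by Groebner_Basis.algebra

lemma rel3_down_0:
  assumes "3 \<le> n"
  shows "- (q + qj) * K3 X_minus X_plus a b n N + q * q * K3 X_zero X_zero a b n N + (1 - q * q) * t * down X_zero a b n N = 0"
  unfolding level_simps fold_atoms
  using inv Brec_down[OF assms] uu(1) uu''(2) by Groebner_Basis.algebra

lemma rel3_down_1:
  assumes "3 \<le> n"
  shows "- (q + qj) * K4 X_minus X_plus a b n N + q * q * K4 X_zero X_zero a b n N = 0"
  unfolding level_simps fold_atoms
  using inv by Groebner_Basis.algebra

lemma rel4_up_0:
  shows "- (q + qj) * K2 X_plus X_minus a b n N + qj * qj * K2 X_zero X_zero a b n N = 0"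
  unfolding level_simps fold_atoms
  using inv by Groebner_Basis.algebra

lemma rel4_up_1:
  shows "- (q + qj) * K1 X_plus X_minus a b n N + qj * qj * K1 X_zero X_zero a b n N + (1 - qj * qj) * t * up X_zero a b n N = 0"
  unfolding level_simps fold_atoms
  using inv Brec uu(3,5) by Groebner_Basis.algebra

lemma rel4_up_2:
  shows "- (q + qj) * K0 X_plus X_minus a b n N + qj * qj * K0 X_zero X_zero a b n N + (1 - qj * qj) * t * mid X_zero a b n N
    - (t * t + (q + qj) * (q + qj) * (1 - t)) = 0"
  unfolding level_simps fold_atoms
  using inv Erec Econst uu(1,3,4,5,6) uu''(1) by Groebner_Basis.algebra

lemma rel4_down_0:
  assumes "3 \<le> n"
  shows "- (q + qj) * K3 X_plus X_minus a b n N + qj * qj * K3 X_zero X_zero a b n N + (1 - qj * qj) * t * down X_zero a b n N = 0"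
  unfolding level_simps fold_atoms
  using inv Brec_down[OF assms] uu(4) uu''(1) by Groebner_Basis.algebra

lemma rel4_down_1:
  assumes "3 \<le> n"
  shows "- (q + qj) * K4 X_plus X_minus a b n N + qj * qj * K4 X_zero X_zero a b n N = 0"
  unfolding level_simps fold_atoms
  using inv by Groebner_Basis.algebra

end

end

end

text \<open>The identity is extended in one argument at a time: an adjoint of \<open>A\<close>
  exists, and comparing its coefficients with those of \<open>B x\<close> handles the second
  argument; the same with an adjoint of \<open>B\<close> handles the first.\<close>

lemma adjoint_by_basis:
  assumes A: "bounded_clinear A" and B: "bounded_clinear B"
    and *: "\<And>p r. p \<in> spin_labels \<Longrightarrow> r \<in> spin_labels \<Longrightarrow> cinner (B (bv p)) (bv r) = cinner (bv p) (A (bv r))"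
  shows "cinner (B x) y = cinner x (A y)"
proof -
  have step: "cinner (B x) y = cinner x (A y)" if "\<And>r. r \<in> spin_labels \<Longrightarrow> cinner (B x) (bv r) = cinner x (A (bv r))" for x y
  proof -
    obtain A' where A': "\<And>x y. cinner (A' x) y = cinner x (A y)" using adjoint_exists[OF A] by blast
    have "B x = A' x"
    proof (rule cf_eqI)
      fix r assume "r \<in> spin_labels"
      then have "cinner (B x) (bv r) = cinner (A' x) (bv r)" using that A' by simp
      then show "cf (B x) r = cf (A' x) r"
        by (metis cinner_bv cinner_commute)
    qed
    then show ?thesis using A' by simp
  qed
  obtain B' where B': "\<And>x y. cinner (B' x) y = cinner x (B y)" using adjoint_exists[OF B] by blast
  have "cinner (B (bv p)) y = cinner (bv p) (A y)" if "p \<in> spin_labels" for p y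
    by (rule step) (rule *[OF that])
  then have 1: "cinner (A y) (bv p) = cinner y (B (bv p))" if "p \<in> spin_labels" for p y
    using that by (metis cinner_commute)
  have "A y = B' y" for y
  proof (rule cf_eqI)
    fix r assume "r \<in> spin_labels"
    then have "cinner (A y) (bv r) = cinner (B' y) (bv r)" using 1 B' by simp
    then show "cf (A y) r = cf (B' y) r" by (metis cinner_bv cinner_commute)
  qed
  then show ?thesis using B' by (metis cinner_commute)
qed

fun dual :: "sphere_gen \<Rightarrow> sphere_gen" where
  "dual X_minus = X_plus" | "dual X_zero = X_zero" | "dual X_plus = X_minus"

lemma idx_dual: "idx (dual x) = - idx x"
  by (cases x) auto

lemma cf_w: "cf (w a b N) (lab a' b' N') = (if a' = a \<and> b' = b \<and> N' = N \<and> lab a b N \<in> spin_labels then 1 else 0)"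
  by (auto simp: w_def cf_bv' lab_inject)

context podles
begin

lemma relation:
  assumes i: "idx x + idx y = i" "idx x' + idx y' = i" "idx z = i" "k4 = 0 \<or> i = 0"
    and *: "\<And>a b n N. 0 \<le> a \<Longrightarrow> 0 \<le> b \<Longrightarrow> n = a + b \<Longrightarrow> 0 < n \<Longrightarrow> N \<in> {1/2, - 1/2} \<Longrightarrow>
      k1 * K2 x y a b n N + k2 * K2 x' y' a b n N = 0
      \<and> k1 * K1 x y a b n N + k2 * K1 x' y' a b n N + k3 * up z a b n N = 0
      \<and> k1 * K0 x y a b n N + k2 * K0 x' y' a b n N + k3 * mid z a b n N + k4 = 0
      \<and> (3 \<le> n \<longrightarrow> k1 * K3 x y a b n N + k2 * K3 x' y' a b n N + k3 * down z a b n N = 0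
        \<and> k1 * K4 x y a b n N + k2 * K4 x' y' a b n N = 0)"
  shows "k1 *\<^sub>R L x (L y v) + k2 *\<^sub>R L x' (L y' v) + k3 *\<^sub>R L z v + k4 *\<^sub>R v = 0"
proof -
  have "(\<lambda>v. k1 *\<^sub>R L x (L y v) + k2 *\<^sub>R L x' (L y' v) + k3 *\<^sub>R L z v + k4 *\<^sub>R v) = (\<lambda>_. 0)"
  proof (rule bounded_clinear_eq_on_W[OF _ bounded_clinear_0])
  show "bounded_clinear (\<lambda>v. k1 *\<^sub>R L x (L y v) + k2 *\<^sub>R L x' (L y' v) + k3 *\<^sub>R L z v + k4 *\<^sub>R v)"
    using bounded_clinear_comp[OF bounded_clinear_pi_gen bounded_clinear_pi_gen] bounded_clinear_pi_gen bounded_clinear_id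
    by (intro bounded_clinear_plus bounded_clinear_rmult) (simp_all add: o_def id_def)
  fix p assume "p \<in> spin_labels"
  then obtain a b N where p: "p = lab a b N" and ab: "0 \<le> a" "0 \<le> b" "odd (a + b)" and N: "N \<in> {1/2, - 1/2}"
    by (rule label_cases)
  have n: "0 < a + b" using ab by presburger
  have e: "k4 *\<^sub>R w a b N = k4 *\<^sub>R w (a + i) (b - i) N" using i(4) by auto
  let ?n = "a + b"
  note * = *[OF ab(1,2) refl n N]
  have "k1 *\<^sub>R L x (L y (w a b N)) + k2 *\<^sub>R L x' (L y' (w a b N)) + k3 *\<^sub>R L z (w a b N) + k4 *\<^sub>R w a b N
    = (k1 * K2 x y a b ?n N + k2 * K2 x' y' a b ?n N) *\<^sub>R w (a + 2 + i) (b + 2 - i) N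
      + (k1 * K1 x y a b ?n N + k2 * K1 x' y' a b ?n N + k3 * up z a b ?n N) *\<^sub>R w (a + 1 + i) (b + 1 - i) N
      + (k1 * K0 x y a b ?n N + k2 * K0 x' y' a b ?n N + k3 * mid z a b ?n N + k4) *\<^sub>R w (a + i) (b - i) N
      + (k1 * K3 x y a b ?n N + k2 * K3 x' y' a b ?n N + k3 * down z a b ?n N) *\<^sub>R w (a - 1 + i) (b - 1 - i) N
      + (k1 * K4 x y a b ?n N + k2 * K4 x' y' a b ?n N) *\<^sub>R w (a - 2 + i) (b - 2 - i) N"
    unfolding L_L_w L_w[of z] i e Let_def by (simp only: scaleR_add_right scaleR_scaleR scaleR_add_left ac_simps)
  also have "\<dots> = 0"
  proof (cases "3 \<le> a + b")
    case True
    then show ?thesis using * by simp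
  next
    case False
    \<comment> \<open>Here a + b is odd and below 3, hence equal to 1. The coordinates of the
      lowered labels then have negative sum, so these vectors are 0 whatever their
      coefficients.\<close>
    then have "w (a - 1 + i) (b - 1 - i) N = 0" "w (a - 2 + i) (b - 2 - i) N = 0"
      using ab(3) by (auto intro!: w_zero) presburger+
    then show ?thesis using * by simp
  qed
  finally show "k1 *\<^sub>R L x (L y (bv p)) + k2 *\<^sub>R L x' (L y' (bv p)) + k3 *\<^sub>R L z (bv p) + k4 *\<^sub>R bv p = 0"
    unfolding p w_def[symmetric] .
  qed
  then show ?thesis by (rule fun_cong)
qed

lemma relation_1: "1 *\<^sub>R L X_minus (L X_zero v) + - (q * q) *\<^sub>R L X_zero (L X_minus v) + (- ((1 - q * q) * t)) *\<^sub>R L X_minus v + 0 *\<^sub>R v = 0"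
proof (rule relation[where i = "- 1"])
  fix a b n :: int and N :: real assume *: "0 \<le> a" "0 \<le> b" "n = a + b" "0 < n" "N \<in> {1/2, - 1/2}"
  show "1 * K2 X_minus X_zero a b n N + - (q * q) * K2 X_zero X_minus a b n N = 0
      \<and> 1 * K1 X_minus X_zero a b n N + - (q * q) * K1 X_zero X_minus a b n N + (- ((1 - q * q) * t)) * up X_minus a b n N = 0
      \<and> 1 * K0 X_minus X_zero a b n N + - (q * q) * K0 X_zero X_minus a b n N + (- ((1 - q * q) * t)) * mid X_minus a b n N + 0 = 0
      \<and> (3 \<le> n \<longrightarrow> 1 * K3 X_minus X_zero a b n N + - (q * q) * K3 X_zero X_minus a b n N + (- ((1 - q * q) * t)) * down X_minus a b n N = 0
        \<and> 1 * K4 X_minus X_zero a b n N + - (q * q) * K4 X_zero X_minus a b n N = 0)"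
    using rel1_up_0[OF *] rel1_up_1[OF *] rel1_up_2[OF *] rel1_down_0[OF *] rel1_down_1[OF *] by simp
qed simp_all

lemma relation_3: "(- (q + qi)) *\<^sub>R L X_minus (L X_plus v) + (q * q) *\<^sub>R L X_zero (L X_zero v)
   + ((1 - q * q) * t) *\<^sub>R L X_zero v + (- (t * t + (q + qi) * (q + qi) * (1 - t))) *\<^sub>R v = 0"
proof (rule relation[where i = "0"])
  fix a b n :: int and N :: real assume *: "0 \<le> a" "0 \<le> b" "n = a + b" "0 < n" "N \<in> {1/2, - 1/2}"
  show "(- (q + qi)) * K2 X_minus X_plus a b n N + (q * q) * K2 X_zero X_zero a b n N = 0
      \<and> (- (q + qi)) * K1 X_minus X_plus a b n N + (q * q) * K1 X_zero X_zero a b n N + ((1 - q * q) * t) * up X_zero a b n N = 0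
      \<and> (- (q + qi)) * K0 X_minus X_plus a b n N + (q * q) * K0 X_zero X_zero a b n N + ((1 - q * q) * t) * mid X_zero a b n N + (- (t * t + (q + qi) * (q + qi) * (1 - t))) = 0
      \<and> (3 \<le> n \<longrightarrow> (- (q + qi)) * K3 X_minus X_plus a b n N + (q * q) * K3 X_zero X_zero a b n N + ((1 - q * q) * t) * down X_zero a b n N = 0
        \<and> (- (q + qi)) * K4 X_minus X_plus a b n N + (q * q) * K4 X_zero X_zero a b n N = 0)"
    using rel3_up_0[OF *] rel3_up_1[OF *] rel3_up_2[OF *] rel3_down_0[OF *] rel3_down_1[OF *] by simp
qed simp_all

lemma relation_4: "(- (q + qi)) *\<^sub>R L X_plus (L X_minus v) + (qi * qi) *\<^sub>R L X_zero (L X_zero v)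
   + ((1 - qi * qi) * t) *\<^sub>R L X_zero v + (- (t * t + (q + qi) * (q + qi) * (1 - t))) *\<^sub>R v = 0"
proof (rule relation[where i = "0"])
  fix a b n :: int and N :: real assume *: "0 \<le> a" "0 \<le> b" "n = a + b" "0 < n" "N \<in> {1/2, - 1/2}"
  show "(- (q + qi)) * K2 X_plus X_minus a b n N + (qi * qi) * K2 X_zero X_zero a b n N = 0
      \<and> (- (q + qi)) * K1 X_plus X_minus a b n N + (qi * qi) * K1 X_zero X_zero a b n N + ((1 - qi * qi) * t) * up X_zero a b n N = 0
      \<and> (- (q + qi)) * K0 X_plus X_minus a b n N + (qi * qi) * K0 X_zero X_zero a b n N + ((1 - qi * qi) * t) * mid X_zero a b n N + (- (t * t + (q + qi) * (q + qi) * (1 - t))) = 0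
      \<and> (3 \<le> n \<longrightarrow> (- (q + qi)) * K3 X_plus X_minus a b n N + (qi * qi) * K3 X_zero X_zero a b n N + ((1 - qi * qi) * t) * down X_zero a b n N = 0
        \<and> (- (q + qi)) * K4 X_plus X_minus a b n N + (qi * qi) * K4 X_zero X_zero a b n N = 0)"
    using rel4_up_0[OF *] rel4_up_1[OF *] rel4_up_2[OF *] rel4_down_0[OF *] rel4_down_1[OF *] by simp
qed simp_all

subsection \<open>The involution\<close>

fun star_factor :: "sphere_gen \<Rightarrow> real" where
  "star_factor X_minus = - qi" | "star_factor X_zero = 1" | "star_factor X_plus = - q"

lemma star_coefficients:
  "star_factor x * cu (dual x) a b N = cd x (a + 1 - idx x) (b + 1 + idx x) N"
  "star_factor x * cm (dual x) a b N = cm x (a - idx x) (b + idx x) N"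
  "star_factor x * cd (dual x) a b N = cu x (a - 1 - idx x) (b - 1 + idx x) N"
  unfolding coefficients_eq
  by (cases x; simp add: q_steps; insert inverses(2,4) r_pos; simp add: field_simps qi_def ri_def; fail)+

lemma L_star: "cinner (star_factor x *\<^sub>R L (dual x) v) v' = cinner v (L x v')"
proof (rule adjoint_by_basis[OF bounded_clinear_pi_gen bounded_clinear_rmult[OF bounded_clinear_pi_gen]])
  fix p p' assume "p \<in> spin_labels" "p' \<in> spin_labels"
  then obtain a b N a' b' N' where p: "p = lab a b N" "lab a b N \<in> spin_labels" and p': "p' = lab a' b' N'" "lab a' b' N' \<in> spin_labels"
    by (metis label_cases)
  have d: "(a' = a + j - idx x \<and> b' = b + j - - idx x) = (a = a' - j + idx x \<and> b = b' - j - idx x)" for j by auto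
  have 1: "star_factor x * cf (cu (dual x) a b N *\<^sub>R w (a + 1 + - idx x) (b + 1 - - idx x) N) p'
    = cf (cd x a' b' N' *\<^sub>R w (a' - 1 + idx x) (b' - 1 - idx x) N') p"
    using p p' star_coefficients(1)[of x a b N] by (auto simp: cf_w simp flip: of_real_mult)
  have 2: "star_factor x * cf (cm (dual x) a b N *\<^sub>R w (a + - idx x) (b - - idx x) N) p'
    = cf (cm x a' b' N' *\<^sub>R w (a' + idx x) (b' - idx x) N') p"
    using p p' star_coefficients(2)[of x a b N] by (auto simp: cf_w simp flip: of_real_mult)
  have 3: "star_factor x * cf (cd (dual x) a b N *\<^sub>R w (a - 1 + - idx x) (b - 1 - - idx x) N) p'
    = cf (cu x a' b' N' *\<^sub>R w (a' + 1 + idx x) (b' + 1 - idx x) N') p"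
    using p p' star_coefficients(3)[of x a b N] by (auto simp: cf_w simp flip: of_real_mult)
  have "star_factor x * cf (L (dual x) (w a b N)) p' = cf (L x (w a' b' N')) p"
    using 1 2 3 unfolding pi_gen_w idx_dual by (simp add: distrib_left)
  moreover have "cinner (star_factor x *\<^sub>R L (dual x) (bv p)) (bv p') = cnj (cf (star_factor x *\<^sub>R L (dual x) (bv p)) p')"
    by (metis cinner_bv cinner_commute)
  moreover have "cnj (cf (L x (w a' b' N')) p) = cf (L x (w a' b' N')) p"
    unfolding pi_gen_w using p by (simp add: cf_w)
  moreover have "bv p = w a b N" "bv p' = w a' b' N'" using p p' by (simp_all add: w_def)
  ultimately have "cinner (star_factor x *\<^sub>R L (dual x) (bv p)) (bv p') = cf (L x (bv p')) p"
    by simp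
  then show "cinner (star_factor x *\<^sub>R L (dual x) (bv p)) (bv p') = cinner (bv p) (L x (bv p'))"
    unfolding cinner_bv .
qed

subsection \<open>The representation of the quantum sphere\<close>

sublocale rep: free_rep scaleC_ell2 UNIV "pi_gen q t"
  by unfold_locales (auto simp: L_linear ell2.scale_right_distrib ell2.scale_left_distrib)

lemma bounded_clinear_act: "bounded_clinear (rep.act p)"
proof (induction p rule: free_algebra_induct)
  case (scalar c)
  show ?case using bounded_clinear_scaleC[of c] by (simp add: rep.act_scalar)
next
  case (mult p r)
  then show ?case using bounded_clinear_comp[OF mult] by (simp add: rep.act_mult o_def)
next
  case (add p r)
  then show ?case using bounded_clinear_plus[OF add] by (simp add: rep.act_add)
qed (simp add: rep.act_gen bounded_clinear_pi_gen)

lemma sphere_star_gen_eq: "sphere_star_gen q x = real_scalar (star_factor x) * free_gen (dual x)"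
  by (cases x) (simp_all add: qi_def)

abbreviation "sphere_star \<equiv> anti_extension cnj (sphere_star_gen q)"

lemma act_star: "cinner (rep.act (sphere_star p) v) v' = cinner v (rep.act p v')"
proof (induction p arbitrary: v v' rule: free_algebra_induct)
  case (gen x)
  show ?case using L_star[of x v v']
    by (simp add: star_extension_simps sphere_star_gen_eq rep.act_simps scaleR_scaleC)
next
  case (scalar c)
  show ?case by (simp add: star_extension_simps rep.act_simps cinner_scale_left cinner_scale_right)
qed (simp_all add: star_extension_simps rep.act_simps cinner_add_left cinner_add_right)

lemma qnum_2': "qnum q 2 = q + qi"
  by (simp add: qnum_2 qi_def)

definition "rel1 = free_gen X_minus * (free_gen X_zero - real_scalar t) - real_scalar (q^2) * (free_gen X_zero - real_scalar t) * free_gen X_minus"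
definition "rel2 = free_gen X_plus * (free_gen X_zero - real_scalar t) - real_scalar (inverse (q^2)) * (free_gen X_zero - real_scalar t) * free_gen X_plus"
definition "rel3 = - real_scalar (qnum q 2) * free_gen X_minus * free_gen X_plus
  + (real_scalar (q^2) * free_gen X_zero + real_scalar t) * (free_gen X_zero - real_scalar t) - real_scalar ((qnum q 2)^2 * (1 - t))"
definition "rel4 = - real_scalar (qnum q 2) * free_gen X_plus * free_gen X_minus
  + (real_scalar (inverse (q^2)) * free_gen X_zero + real_scalar t) * (free_gen X_zero - real_scalar t) - real_scalar ((qnum q 2)^2 * (1 - t))"

lemma sphere_rels_eq: "sphere_rels q t = {rel1, rel2, rel3, rel4}"
  by (simp add: sphere_rels_def Let_def rel1_def rel2_def rel3_def rel4_def)

text \<open>Read with a = q and b = 1/q. The first two parts show that the involution exchanges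
  relations 1 and 2 up to a scalar, the last two that it fixes relations 3 and 4.\<close>

lemma star_rels_aux:
  fixes p m z :: "sphere_gen free_algebra" and a b x :: complex
  assumes ab: "a * b = 1"
  shows "(z - scalar x) * (scalar (- b) * p) - scalar (- b) * p * ((z - scalar x) * scalar (a * a))
      = scalar a * (p * (z - scalar x) - scalar (b * b) * (z - scalar x) * p)" (is ?A)
    and "(z - scalar x) * (scalar (- a) * m) - scalar (- a) * m * ((z - scalar x) * scalar (b * b))
      = scalar b * (m * (z - scalar x) - scalar (a * a) * (z - scalar x) * m)" (is ?B)
    and "scalar (- a) * m * (scalar (- b) * p * - scalar y) + (z - scalar x) * (z * scalar e + scalar x) - scalar k
      = - scalar y * m * p + (scalar e * z + scalar x) * (z - scalar x) - scalar k" (is ?C)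
    and "scalar (- b) * p * (scalar (- a) * m * - scalar y) + (z - scalar x) * (z * scalar e + scalar x) - scalar k
      = - scalar y * p * m + (scalar e * z + scalar x) * (z - scalar x) - scalar k" (is ?D)
proof -
  have mid: "c * (scalar d * g) = scalar d * (c * g)" for c g :: "sphere_gen free_algebra" and d by (rule scalar_mid)
  have c: "z * scalar d = scalar d * z" "p * scalar d = scalar d * p" "m * scalar d = scalar d * m" for d
    by (rule scalar_central[symmetric])+
  have e: "a * (b * y) = y" "b * (a * y) = y" "b * a = 1" for y using ab by (simp_all add: mult.assoc[symmetric] mult.commute)
  note s = left_diff_distrib right_diff_distrib distrib_left distrib_right mult.assoc mid[of z] mid[of p] mid[of m] c
    scalar_scalar_mult scalar_uminus ab e
  show ?A by (simp add: s mult_ac[where 'a = complex])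
  show ?B by (simp add: s mult_ac[where 'a = complex])
  show ?C by (simp add: s mult_ac[where 'a = complex])
  show ?D by (simp add: s mult_ac[where 'a = complex])
qed

lemma complex_inverses: "complex_of_real q * complex_of_real qi = 1"
  using inverses(2) by (simp flip: of_real_mult)

lemma
  shows star_rel12: "sphere_star rel1 = real_scalar q * rel2" "sphere_star rel2 = real_scalar qi * rel1"
    and star_rel34: "sphere_star rel3 = rel3" "sphere_star rel4 = rel4"
proof -
  have i: "inverse (q * q) = qi * qi" by (simp add: qi_def)
  note s = star_extension_simps sphere_star_gen_eq dual.simps star_factor.simps complex_cnj_complex_of_real complex_cnj_mult
    power2_eq_square of_real_mult of_real_minus i of_real_1 scalar_simps(2) mult_1_left
  note aux = star_rels_aux[OF complex_inverses]
  show "sphere_star rel1 = real_scalar q * rel2" unfolding rel1_def rel2_def s by (rule aux)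
  show "sphere_star rel2 = real_scalar qi * rel1" unfolding rel1_def rel2_def s by (rule aux)
  show "sphere_star rel3 = rel3" unfolding rel3_def s by (rule aux)
  show "sphere_star rel4 = rel4" unfolding rel4_def s by (rule aux)
qed

lemma sphere_star_rels: "p \<in> sphere_rels q t \<Longrightarrow> sphere_star p \<in> genideal free_ring (sphere_rels q t)"
  using genideal_generators[of "sphere_rels q t"] star_rel12 star_rel34
    two_sided_left[OF two_sided_genideal[of "sphere_rels q t"]]
  unfolding sphere_rels_eq by auto

lemma act_rels: "rep.act rel1 v = 0" "rep.act rel2 v = 0" "rep.act rel3 v = 0" "rep.act rel4 v = 0"
proof -
  have i: "inverse (q^2) = qi * qi" by (simp add: qi_def power2_eq_square)
  note s = rep.act_simps scaleR_scaleC L_linear ell2.scale_right_diff_distrib ell2.scale_left_diff_distrib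
    power2_eq_square algebra_simps ell2.scale_left_distrib
  show 1: "rep.act rel1 v = 0" for v
    using relation_1[of v] unfolding rel1_def
    by (simp add: s)
  show "rep.act rel3 v = 0"
    using relation_3[of v] unfolding rel3_def qnum_2'
    by (simp add: s)
  show "rep.act rel4 v = 0"
    using relation_4[of v] unfolding rel4_def qnum_2' i
    by (simp add: s)
  \<comment> \<open>The involution takes relation 1 to a multiple of relation 2, and the adjoint of
    the zero operator is zero.\<close>
  have "cinner (rep.act (sphere_star rel1) v) v' = 0" for v'
    by (simp add: act_star 1)
  then have "rep.act (sphere_star rel1) v = 0"
    by (metis cinner_self_norm norm_eq_zero of_real_eq_0_iff power_eq_0_iff)
  then show "rep.act rel2 v = 0"
    unfolding star_rel12 using q0 by (simp add: rep.act_simps)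
qed

lemma act_sphere_ideal: "p \<in> sphere_ideal q t \<Longrightarrow> rep.act p v = 0"
  using rep.act_genideal[of "{0}" "sphere_rels q t" p v]
  unfolding sphere_ideal_def by (force simp: sphere_rels_eq act_rels L_linear)

abbreviation "SI \<equiv> sphere_ideal q t"

lemma two_sided_SI: "two_sided SI"
  unfolding sphere_ideal_def by (rule two_sided_genideal)

lemma spinor_rep_cls: "spinor_rep q t (cls SI p) = rep.act p"
  unfolding spinor_rep_def
proof (rule the_elem_image[OF cls_self[OF two_sided_SI]])
  fix p' assume "p' \<in> cls SI p"
  then have "rep.act (p' - p) v = 0" for v by (intro act_sphere_ideal) (simp add: cls_mem)
  then show "rep.act p' = rep.act p" by (simp add: fun_eq_iff rep.act_diff)
qed

lemmas sphere_simps = pres_simps[OF sphere_star_rels, folded quantum_sphere_def sphere_ideal_def]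

lemma sphere_star_gen_twice: "sphere_star (sphere_star_gen q x) = free_gen x"
proof -
  have "real_scalar (star_factor (dual x)) * free_gen x * real_scalar (star_factor x) = free_gen x"
    using complex_inverses
    by (cases x) (simp_all add: scalar_central[symmetric, of "_ * free_gen _"] mult.assoc[symmetric] mult.commute[where 'a = complex])
  moreover have "dual (dual x) = x" by (cases x) auto
  ultimately show ?thesis
    by (simp add: sphere_star_gen_eq star_extension_simps)
qed

lemma complex_star_algebra_sphere: "complex_star_algebra (quantum_sphere q t)"
  unfolding quantum_sphere_def
  by (rule complex_star_algebra_presented[OF sphere_star_rels sphere_star_gen_twice])

lemma star_representation_sphere: "star_representation (quantum_sphere q t) (spinor_rep q t)"
  unfolding star_representation_def
  by (auto simp: sphere_simps spinor_rep_cls bounded_clinear_act rep.act_simps act_star fun_eq_iff)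

end

section \<open>The action of the quantum group on spinors\<close>

lemma w_in_W [simp]: "w a b N \<in> W"
  by (simp add: w_def)

lemma on_basis_w:
  assumes "lab a b N \<in> spin_labels"
  shows "on_basis g (w a b N) = g (of_int (a + b) / 2) (of_int (a - b) / 2) N"
  using on_basis_bv[of "of_int (a + b) / 2" "of_int (a - b) / 2" N g] assms by (simp only: w_def lab_def)

text \<open>Linear maps of the algebraic span into itself. The generators of the quantum group may
  be unbounded, so identities between them are tested on basis vectors within \<open>W\<close>
  only.\<close>

definition W_operator :: "(spinor \<Rightarrow> spinor) \<Rightarrow> bool" where
  "W_operator f \<longleftrightarrow> (\<forall>x\<in>W. f x \<in> W) \<and> (\<forall>x\<in>W. \<forall>y\<in>W. f (x + y) = f x + f y)
     \<and> (\<forall>x\<in>W. \<forall>c. f (c *\<^sub>C x) = c *\<^sub>C f x)"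

lemma W_operator_basic:
  "W_operator (\<lambda>x. x)"
  "W_operator f \<Longrightarrow> W_operator (\<lambda>x. c *\<^sub>C f x)" "W_operator f \<Longrightarrow> W_operator (\<lambda>x. k *\<^sub>R f x)"
  "W_operator f \<Longrightarrow> W_operator g \<Longrightarrow> W_operator (\<lambda>x. f x + g x)"
  "W_operator f \<Longrightarrow> W_operator g \<Longrightarrow> W_operator (\<lambda>x. f x - g x)"
  by (auto simp: W_operator_def scaleR_scaleC ell2.scale_right_distrib ell2.scale_right_diff_distrib mult.commute)

lemma W_operator_comp: "W_operator f \<Longrightarrow> W_operator g \<Longrightarrow> W_operator (\<lambda>x. f (g x))"
  by (auto simp: W_operator_def)

lemma W_operator_D:
  assumes "W_operator f" "x \<in> W"
  shows "f x \<in> W" "y \<in> W \<Longrightarrow> f (x + y) = f x + f y" "f (c *\<^sub>C x) = c *\<^sub>C f x" "f (k *\<^sub>R x) = k *\<^sub>R f x"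
    "y \<in> W \<Longrightarrow> f (x - y) = f x - f y" "f 0 = 0"
proof -
  show 1: "f x \<in> W" "y \<in> W \<Longrightarrow> f (x + y) = f x + f y" "f (c *\<^sub>C x) = c *\<^sub>C f x" "f (k *\<^sub>R x) = k *\<^sub>R f x" for y c
    using assms by (auto simp: W_operator_def scaleR_scaleC)
  have "f (0 *\<^sub>C x) = 0 *\<^sub>C f x" by (rule 1)
  then show "f 0 = 0" by simp
  assume y: "y \<in> W"
  have "f (x + (- 1) *\<^sub>C y) = f x + (- 1) *\<^sub>C f y" using assms y unfolding W_operator_def by (metis W_closed(3))
  then show "f (x - y) = f x - f y" by simp
qed

lemma W_operator_eqI:
  assumes "W_operator f" "W_operator g"
    and "\<And>a b N. 0 \<le> a \<Longrightarrow> 0 \<le> b \<Longrightarrow> odd (a + b) \<Longrightarrow> N \<in> {1/2, - 1/2} \<Longrightarrow> f (w a b N) = g (w a b N)"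
  shows "\<forall>x\<in>W. f x = g x"
proof
  fix x assume "x \<in> W"
  then show "f x = g x"
  proof (induction rule: W_induct)
    case zero
    then show ?case using W_operator_D(6)[OF assms(1) W_closed(1)] W_operator_D(6)[OF assms(2) W_closed(1)] by simp
  next
    case (bv p)
    then show ?case using assms(3) by (metis label_cases w_def)
  qed (use assms(1,2) in \<open>auto simp: W_operator_D\<close>)
qed

context podles
begin

abbreviation "U \<equiv> spinor_act_gen q"

definition ladder :: "int \<Rightarrow> int \<Rightarrow> real" where
  "ladder a b = sqrt (qnum q (of_int b)) * sqrt (qnum q (of_int (a + 1)))"

lemma U_in_W: "x \<in> W \<Longrightarrow> U g x \<in> W"
  by (cases g) (auto intro!: on_basis_in_W simp: basis_vec_eq)

lemma U_add: "x \<in> W \<Longrightarrow> y \<in> W \<Longrightarrow> U g (x + y) = U g x + U g y"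
  and U_scale: "x \<in> W \<Longrightarrow> U g (c *\<^sub>C x) = c *\<^sub>C U g x"
  by (cases g; simp add: on_basis_add on_basis_scale)+

lemma U_scaleR: "x \<in> W \<Longrightarrow> U g (c *\<^sub>R x) = c *\<^sub>R U g x"
  by (simp add: scaleR_scaleC U_scale)

lemma U_zero: "U g 0 = 0"
  using U_scale[of 0 g 0] by simp

sublocale urep: free_rep scaleC_ell2 W "spinor_act_gen q"
  by unfold_locales (auto simp: U_in_W U_add U_scale ell2.scale_right_distrib ell2.scale_left_distrib)

text \<open>As for the sphere, valid for all integers: a ladder step from a missing to an existing
  vector carries the factor [0] = 0.\<close>

lemma U_w:
  "U U_k (w a b N) = r powi (a - b) *\<^sub>R w a b N"
  "U U_kinv (w a b N) = r powi (b - a) *\<^sub>R w a b N"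
  "U U_f (w a b N) = ladder a b *\<^sub>R w (a + 1) (b - 1) N"
  "U U_e (w a b N) = ladder (a - 1) (b + 1) *\<^sub>R w (a - 1) (b + 1) N"
proof -
  have "U U_k (w a b N) = r powi (a - b) *\<^sub>R w a b N \<and> U U_kinv (w a b N) = r powi (b - a) *\<^sub>R w a b N
    \<and> U U_f (w a b N) = ladder a b *\<^sub>R w (a + 1) (b - 1) N
    \<and> U U_e (w a b N) = ladder (a - 1) (b + 1) *\<^sub>R w (a - 1) (b + 1) N"
  proof (cases "lab a b N \<in> spin_labels")
    case True
    have 1: "- (of_int (a - b) / 2) = (of_int (b - a) / 2 :: real)"
      "of_int (a + b) / 2 - of_int (a - b) / 2 = (of_int b :: real)"
      "of_int (a + b) / 2 + of_int (a - b) / 2 = (of_int a :: real)"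
      "of_int b + 1 = (of_int (b + 1) :: real)" "of_int a + 1 = (of_int (a + 1) :: real)" by (simp_all add: field_simps)
    have l: "(of_int (a + b) / 2, of_int (a - b) / 2, N) = lab a b N"
      "(of_int (a + b) / 2, of_int (a - b) / 2 + 1, N) = lab (a + 1) (b - 1) N"
      "(of_int (a + b) / 2, of_int (a - b) / 2 - 1, N) = lab (a - 1) (b + 1) N"
      by (simp_all add: lab_def field_simps)
    show ?thesis
      unfolding spinor_act_gen.simps on_basis_w[OF True] basis_vec_eq l w_def[symmetric] 1 q_powr_half ladder_def
      by (simp add: mult.commute)
  next
    case False
    then have 0: "w a b N = 0" by (simp add: w_def bv_outside)
    have neg: "a < 0 \<or> b < 0" if "odd (a + b)" "N \<in> {1/2, - 1/2}"
      using False that unfolding lab_iff by force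
    have s0: "qnum q 0 = 0" by (simp add: qnum_def)
    have "ladder a b *\<^sub>R w (a + 1) (b - 1) N = 0"
    proof (cases "a = - 1")
      case True
      then show ?thesis by (simp add: ladder_def s0)
    next
      case False
      have "w (a + 1) (b - 1) N = 0" using neg False by (intro w_zero) force
      then show ?thesis by simp
    qed
    moreover have "ladder (a - 1) (b + 1) *\<^sub>R w (a - 1) (b + 1) N = 0"
    proof (cases "b = - 1")
      case True
      then show ?thesis by (simp add: ladder_def s0)
    next
      case False
      have "w (a - 1) (b + 1) N = 0" using neg False by (intro w_zero) force
      then show ?thesis by simp
    qed
    ultimately show ?thesis by (simp add: 0 U_zero del: spinor_act_gen.simps)
  qed
  then show "U U_k (w a b N) = r powi (a - b) *\<^sub>R w a b N"
  "U U_kinv (w a b N) = r powi (b - a) *\<^sub>R w a b N"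
  "U U_f (w a b N) = ladder a b *\<^sub>R w (a + 1) (b - 1) N"
  "U U_e (w a b N) = ladder (a - 1) (b + 1) *\<^sub>R w (a - 1) (b + 1) N" by blast+
qed

declare spinor_act_gen.simps [simp del]

lemma ladder_eq: "ladder a b = u b * u (a + 1) / (r * (r powi a * r powi b) * D)"
proof -
  have "sqrt D * sqrt D = D" using D_pos by simp
  then show ?thesis
    unfolding ladder_def sqrt_qnum_int using r_pos by (simp add: power_int_add mult_ac)
qed

lemma ladder_square: "0 \<le> b \<Longrightarrow> - 1 \<le> a \<Longrightarrow> ladder a b * ladder a b = qnum q (of_int b) * qnum q (of_int (a + 1))"
proof -
  have "0 \<le> qnum q (of_int k)" if "0 \<le> k" for k
    unfolding qnum_int using that q_powi_le_1[of "2 * k"] q_powi_pos[of k] D_pos by simp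
  then show "0 \<le> b \<Longrightarrow> - 1 \<le> a \<Longrightarrow> ?thesis" by (simp add: ladder_def mult_ac del: of_int_add)
qed

lemma W_operator_U: "W_operator f \<Longrightarrow> W_operator (\<lambda>x. U g (f x))"
  by (rule W_operator_comp) (auto simp: W_operator_def U_in_W U_add U_scale)

lemmas W_intros = W_operator_U W_operator_basic

subsection \<open>The relations of the quantum group\<close>

lemma U_k_kinv: "\<forall>x\<in>W. U U_k (U U_kinv x) = x" "\<forall>x\<in>W. U U_kinv (U U_k x) = x"
proof -
  have e: "r powi (b - a) * r powi (a - b) = 1" for a b using r_pos by (simp flip: power_int_add)
  show "\<forall>x\<in>W. U U_k (U U_kinv x) = x" "\<forall>x\<in>W. U U_kinv (U U_k x) = x"
    by (intro W_operator_eqI W_intros; simp add: U_w U_scaleR e)+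
qed

lemma U_k_f: "\<forall>x\<in>W. U U_k (U U_f x) = q *\<^sub>R U U_f (U U_k x)"
  and U_k_e: "\<forall>x\<in>W. U U_k (U U_e x) = qi *\<^sub>R U U_e (U U_k x)"
proof -
  have "r powi (k + 2) = q * r powi k" "r powi (k - 2) = qi * r powi k" for k
    using r_pos r_square power_int_add[of r k 2] power_int_diff[of r k 2]
    by (simp_all add: power2_eq_square qi_def divide_inverse mult.commute)
  from this[of "a - b" for a b] have e: "r powi (a + 1 - (b - 1)) = q * r powi (a - b)"
    "r powi (a - 1 - (b + 1)) = qi * r powi (a - b)" for a b
    by (simp_all add: algebra_simps)
  show "\<forall>x\<in>W. U U_k (U U_f x) = q *\<^sub>R U U_f (U U_k x)" "\<forall>x\<in>W. U U_k (U U_e x) = qi *\<^sub>R U U_e (U U_k x)"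
    by (intro W_operator_eqI W_intros; simp only: U_w U_scaleR w_in_W scaleR_scaleR e mult_ac)+
qed

text \<open>Equivalent to [b+1][a] - [b][a+1] = [a-b], the relation between k, e and f on a vector
  with l + m = a and l - m = b.\<close>

lemma qnum_identity:
  "r powi (a - b) * r powi (a - b) - r powi (b - a) * r powi (b - a)
    = (q - qi) * (qnum q (of_int (b + 1)) * qnum q (of_int a) - qnum q (of_int b) * qnum q (of_int (a + 1)))"
proof -
  define X Y where "X = q powi a" and "Y = q powi b"
  have X: "X \<noteq> 0" "Y \<noteq> 0" "q \<noteq> 0" "D \<noteq> 0" using q_powi_pos[of a] q_powi_pos[of b] q0 D_pos by (auto simp: X_def Y_def)
  have "qnum q (of_int (b + 1)) = (1 - q * Y * (q * Y)) / (q * Y * D)" "qnum q (of_int a) = (1 - X * X) / (X * D)"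
    "qnum q (of_int b) = (1 - Y * Y) / (Y * D)" "qnum q (of_int (a + 1)) = (1 - q * X * (q * X)) / (q * X * D)"
    unfolding qnum_int q_powi_double using q0 by (simp_all add: X_def Y_def power_int_add mult.commute)
  moreover have "(1 - q * Y * (q * Y)) / (q * Y * D) * ((1 - X * X) / (X * D)) - (1 - Y * Y) / (Y * D) * ((1 - q * X * (q * X)) / (q * X * D))
    = ((1 - q * Y * (q * Y)) * (1 - X * X) - (1 - Y * Y) * (1 - q * X * (q * X))) / (q * X * Y * D * D)"
    using X by (simp add: field_simps)
  moreover have "(1 - q * Y * (q * Y)) * (1 - X * X) - (1 - Y * Y) * (1 - q * X * (q * X)) = (Y * Y - X * X) * (q * D)"
  proof -
    have "D * q = 1 - q * q" using X by (simp add: D_def left_diff_distrib)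
    then show ?thesis by Groebner_Basis.algebra
  qed
  moreover have "r powi (a - b) * r powi (a - b) = X / Y" "r powi (b - a) * r powi (b - a) = Y / X"
    unfolding r_powi_double using X by (simp_all add: X_def Y_def power_int_diff)
  moreover have "q - qi = - D" by (simp add: D_def qi_def)
  moreover have "X / Y - Y / X = - D * ((Y * Y - X * X) * (q * D) / (q * X * Y * D * D))"
    using X by (simp add: field_simps)
  ultimately show ?thesis by simp
qed

lemma U_fe: "\<forall>x\<in>W. U U_k (U U_k x) - U U_kinv (U U_kinv x) = (q - qi) *\<^sub>R (U U_f (U U_e x) - U U_e (U U_f x))"
proof (intro W_operator_eqI W_intros)
  fix a b N assume ab: "0 \<le> (a::int)" "0 \<le> (b::int)"
  have "U U_f (U U_e (w a b N)) = (qnum q (of_int (b + 1)) * qnum q (of_int a)) *\<^sub>R w a b N"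
    using ladder_square[of "b + 1" "a - 1"] ab by (simp add: U_w U_scaleR mult.commute del: of_int_add)
  moreover have "U U_e (U U_f (w a b N)) = (qnum q (of_int b) * qnum q (of_int (a + 1))) *\<^sub>R w a b N"
    using ladder_square[of b a] ab by (simp add: U_w U_scaleR mult.commute del: of_int_add)
  moreover have "U U_k (U U_k (w a b N)) - U U_kinv (U U_kinv (w a b N))
     = (r powi (a - b) * r powi (a - b) - r powi (b - a) * r powi (b - a)) *\<^sub>R w a b N"
    by (simp add: U_w U_scaleR scaleR_diff_left)
  ultimately show "U U_k (U U_k (w a b N)) - U U_kinv (U U_kinv (w a b N))
      = (q - qi) *\<^sub>R (U U_f (U U_e (w a b N)) - U U_e (U U_f (w a b N)))"
    unfolding qnum_identity[of a b] by (simp only: scaleR_scaleR flip: scaleR_diff_left)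
qed

subsection \<open>Equivariance on generators\<close>

text \<open>The common denominator of the ladder coefficients. It depends on l alone, so e and f
  leave it unchanged, and raising l by j multiplies it by q^j.\<close>

definition lscale :: "int \<Rightarrow> int \<Rightarrow> real" where "lscale a b = r * (r powi a * r powi b) * D"

lemma lscale_pos: "lscale a b \<noteq> 0"
  using r_pos D_pos by (simp add: lscale_def)

lemma ladder_lscale: "ladder a b * lscale a b = u b * u (a + 1)"
  unfolding ladder_eq lscale_def[symmetric] using lscale_pos by simp

lemma lscale_shift: "lscale (a + j + i) (b + j - i) = lscale a b * q powi j"
proof -
  have "r powi (a + j + i) * r powi (b + j - i) = r powi (a + j + i + (b + j - i))"
    by (rule power_int_add[symmetric]) (use r_pos in simp)
  also have "a + j + i + (b + j - i) = a + b + (j + j)" by simp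
  also have "r powi \<dots> = r powi a * r powi b * (r powi j * r powi j)"
    using r_pos by (simp only: power_int_add less_imp_neq[symmetric] simp_thms mult.assoc)
  finally show ?thesis by (simp add: lscale_def r_powi_double)
qed

lemma k_lscale: "r powi (a - b) * lscale a b = q powi a * r * D"
  unfolding r_powi_double[of a, symmetric] lscale_def using r_pos by (simp add: power_int_diff)

lemma lscale_cancel:
  assumes "e1 * uu * c = e2 * x + e3 * vv" "l * G = uu * c" "k * G = x" "m * G = vv" "G \<noteq> 0"
  shows "e1 * l = e2 * k + e3 * (m :: real)"
proof -
  have "e1 * l * G = (e2 * k + e3 * m) * G"
    using assms(1) unfolding mult.assoc assms(2-4)[symmetric] distrib_right by (simp only: mult.assoc)
  then show ?thesis using assms(5) by simp
qed

lemma ladder_shift: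
  "ladder (a + 1 + i) (b + 1 - i) * lscale a b = u (b + 1 - i) * u (a + 1 + i + 1) * qi"
  "ladder (a + i) (b - i) * lscale a b = u (b - i) * u (a + i + 1) * 1"
  "ladder (a - 1 + i) (b - 1 - i) * lscale a b = u (b - 1 - i) * u (a - 1 + i + 1) * q"
proof -
  have *: "ladder (a + j + i) (b + j - i) * lscale a b * q powi j = u (b + j - i) * u (a + j + i + 1)" for j
    using ladder_lscale[of "a + j + i" "b + j - i"] unfolding lscale_shift by (simp add: mult.assoc)
  show "ladder (a + 1 + i) (b + 1 - i) * lscale a b = u (b + 1 - i) * u (a + 1 + i + 1) * qi"
    using *[of 1] q0 by (simp add: qi_def divide_inverse[symmetric] eq_divide_eq)
  show "ladder (a + i) (b - i) * lscale a b = u (b - i) * u (a + i + 1) * 1"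
    using *[of 0] by simp
  show "ladder (a - 1 + i) (b - 1 - i) * lscale a b = u (b - 1 - i) * u (a - 1 + i + 1) * q"
    using *[of "- 1"] q0 by (simp add: field_simps)
qed

lemma ladder_shift_e:
  "ladder (a + 1 + i - 1) (b + 1 - i + 1) * lscale a b = u (b + 1 - i + 1) * u (a + 1 + i) * qi"
  "ladder (a + i - 1) (b - i + 1) * lscale a b = u (b - i + 1) * u (a + i) * 1"
  "ladder (a - 1 + i - 1) (b - 1 - i + 1) * lscale a b = u (b - 1 - i + 1) * u (a - 1 + i) * q"
  "ladder (a - 1) (b + 1) * lscale a b = u (b + 1) * u a"
proof -
  have e: "a + 1 + i - 1 = a + 1 + (i - 1)" "b + 1 - i + 1 = b + 1 - (i - 1)" "a + i - 1 = a + (i - 1)" "b - i + 1 = b - (i - 1)"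
    "a - 1 + i - 1 = a - 1 + (i - 1)" "b - 1 - i + 1 = b - 1 - (i - 1)" "a - 1 = a + (0 - 1)" "b + 1 = b - (0 - 1)"
    by simp_all
  have e': "a + 1 + (i - 1) + 1 = a + 1 + i" "a + (i - 1) + 1 = a + i" "a - 1 + (i - 1) + 1 = a - 1 + i" "a + (0 - 1) + 1 = a" by simp_all
  show "ladder (a + 1 + i - 1) (b + 1 - i + 1) * lscale a b = u (b + 1 - i + 1) * u (a + 1 + i) * qi"
    unfolding e(1,2) ladder_shift e' ..
  show "ladder (a + i - 1) (b - i + 1) * lscale a b = u (b - i + 1) * u (a + i) * 1"
    unfolding e(3,4) ladder_shift e' ..
  show "ladder (a - 1 + i - 1) (b - 1 - i + 1) * lscale a b = u (b - 1 - i + 1) * u (a - 1 + i) * q"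
    unfolding e(5,6) ladder_shift e' ..
  show "ladder (a - 1) (b + 1) * lscale a b = u (b + 1) * u a"
    unfolding e(7,8) ladder_shift e' by simp
qed

lemmas f_steps = lscale_cancel[OF _ ladder_shift(1) k_lscale ladder_lscale lscale_pos]
  lscale_cancel[OF _ ladder_shift(2) k_lscale ladder_lscale lscale_pos]
  lscale_cancel[OF _ ladder_shift(3) k_lscale ladder_lscale lscale_pos]
lemmas e_steps = lscale_cancel[OF _ ladder_shift_e(1) k_lscale ladder_shift_e(4) lscale_pos]
  lscale_cancel[OF _ ladder_shift_e(2) k_lscale ladder_shift_e(4) lscale_pos]
  lscale_cancel[OF _ ladder_shift_e(3) k_lscale ladder_shift_e(4) lscale_pos]

fun f_part where "f_part X_minus v = s2 *\<^sub>R L X_zero v" | "f_part X_zero v = s2 *\<^sub>R L X_plus v" | "f_part X_plus v = 0"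
fun e_part where "e_part X_minus v = 0" | "e_part X_zero v = s2 *\<^sub>R L X_minus v" | "e_part X_plus v = s2 *\<^sub>R L X_zero v"

lemma U_three:
  "U U_f (c1 *\<^sub>R w a1 b1 N + c2 *\<^sub>R w a2 b2 N + c3 *\<^sub>R w a3 b3 N) = (c1 * ladder a1 b1) *\<^sub>R w (a1 + 1) (b1 - 1) N
    + (c2 * ladder a2 b2) *\<^sub>R w (a2 + 1) (b2 - 1) N + (c3 * ladder a3 b3) *\<^sub>R w (a3 + 1) (b3 - 1) N"
  "U U_e (c1 *\<^sub>R w a1 b1 N + c2 *\<^sub>R w a2 b2 N + c3 *\<^sub>R w a3 b3 N) = (c1 * ladder (a1 - 1) (b1 + 1)) *\<^sub>R w (a1 - 1) (b1 + 1) N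
    + (c2 * ladder (a2 - 1) (b2 + 1)) *\<^sub>R w (a2 - 1) (b2 + 1) N + (c3 * ladder (a3 - 1) (b3 + 1)) *\<^sub>R w (a3 - 1) (b3 + 1) N"
  "U U_k (c1 *\<^sub>R w a1 b1 N + c2 *\<^sub>R w a2 b2 N + c3 *\<^sub>R w a3 b3 N) = (c1 * r powi (a1 - b1)) *\<^sub>R w a1 b1 N
    + (c2 * r powi (a2 - b2)) *\<^sub>R w a2 b2 N + (c3 * r powi (a3 - b3)) *\<^sub>R w a3 b3 N"
  by (simp_all add: U_add U_scaleR U_w)

lemma f_L_w:
  assumes ab: "0 \<le> a" "0 \<le> b"
  shows "U U_f (L x (w a b N)) = f_part x (U U_k (w a b N)) + kinv_factor x *\<^sub>R L x (U U_f (w a b N))"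
proof -
  have n: "a + 1 + (b - 1) = a + b" by simp
  note t = up.simps mid.simps down.simps
  show ?thesis
  proof (cases x)
    case X_minus
    note d = f_X_minus_0[OF ab refl, THEN f_steps(1)] f_X_minus_1[OF ab refl, THEN f_steps(2)] f_X_minus_2[OF ab refl, THEN f_steps(3)]
    show ?thesis unfolding X_minus L_w U_w f_part.simps L_linear n U_three d
      by (simp add: algebra_simps del: t)
  next
    case X_zero
    note d = f_X_zero_0[OF ab refl, THEN f_steps(1)] f_X_zero_1[OF ab refl, THEN f_steps(2)] f_X_zero_2[OF ab refl, THEN f_steps(3)]
    show ?thesis unfolding X_zero L_w U_w f_part.simps L_linear n U_three d
      by (simp add: algebra_simps del: t)
  next
    case X_plus
    \<comment> \<open>Since f annihilates the generator of index 1, the first term of the law is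
      missing; a zero summand restores the shape expected by \<open>f_steps\<close>.\<close>
    have z: "x = y \<Longrightarrow> x = 0 * z + y" for x y z :: real by simp
    note d = f_X_plus_0[OF ab refl, THEN z, THEN f_steps(1)] f_X_plus_1[OF ab refl, THEN z, THEN f_steps(2)]
      f_X_plus_2[OF ab refl, THEN z, THEN f_steps(3)]
    show ?thesis unfolding X_plus L_w U_w f_part.simps L_linear n U_three d
      by (simp add: algebra_simps del: t)
  qed
qed

lemma e_L_w:
  assumes ab: "0 \<le> a" "0 \<le> b"
  shows "U U_e (L x (w a b N)) = e_part x (U U_k (w a b N)) + kinv_factor x *\<^sub>R L x (U U_e (w a b N))"
proof -
  have n: "a - 1 + (b + 1) = a + b" by simp
  note t = up.simps mid.simps down.simps
  show ?thesis
  proof (cases x)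
    case X_plus
    note d = e_X_plus_0[OF ab refl, THEN e_steps(1)] e_X_plus_1[OF ab refl, THEN e_steps(2)] e_X_plus_2[OF ab refl, THEN e_steps(3)]
    show ?thesis unfolding X_plus L_w U_w e_part.simps L_linear n U_three d
      by (simp add: algebra_simps del: t)
  next
    case X_zero
    note d = e_X_zero_0[OF ab refl, THEN e_steps(1)] e_X_zero_1[OF ab refl, THEN e_steps(2)] e_X_zero_2[OF ab refl, THEN e_steps(3)]
    show ?thesis unfolding X_zero L_w U_w e_part.simps L_linear n U_three d
      by (simp add: algebra_simps del: t)
  next
    case X_minus
    have z: "x = y \<Longrightarrow> x = 0 * z + y" for x y z :: real by simp
    note d = e_X_minus_0[OF ab refl, THEN z, THEN e_steps(1)] e_X_minus_1[OF ab refl, THEN z, THEN e_steps(2)]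
      e_X_minus_2[OF ab refl, THEN z, THEN e_steps(3)]
    show ?thesis unfolding X_minus L_w U_w e_part.simps L_linear n U_three d
      by (simp add: algebra_simps del: t)
  qed
qed

lemma k_L_w: "U U_k (L x (w a b N)) = q powi idx x *\<^sub>R L x (U U_k (w a b N))"
proof -
  have e: "r powi (a + j + i - (b + j - i)) = q powi i * r powi (a - b)" for j i
  proof -
    have "a + j + i - (b + j - i) = (i + i) + (a - b)" by simp
    then have "r powi (a + j + i - (b + j - i)) = r powi ((i + i) + (a - b))" by (rule arg_cong)
    then show ?thesis using r_pos r_powi_double[of i] by (simp only: power_int_add less_imp_neq[symmetric] simp_thms)
  qed
  show ?thesis
    unfolding L_w U_w L_linear U_three using e[of 1] e[of 0] e[of "- 1"]
    by (simp add: scaleR_add_right mult_ac del: up.simps mid.simps down.simps)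
qed

lemma L_in_W: "x \<in> W \<Longrightarrow> L g x \<in> W"
proof (induction rule: W_induct)
  case (bv p)
  then obtain a b N where "p = lab a b N" by (metis label_cases)
  then show ?case using L_w[of g a b N] by (simp add: w_def del: up.simps mid.simps down.simps)
qed (simp_all add: L_linear)

lemma W_operator_L: "W_operator f \<Longrightarrow> W_operator (\<lambda>x. L g (f x))"
  by (rule W_operator_comp) (auto simp: W_operator_def L_in_W L_linear)

lemma act_in_W: "x \<in> W \<Longrightarrow> rep.act p x \<in> W"
  by (induction p arbitrary: x rule: free_algebra_induct) (auto simp: rep.act_simps L_in_W)

lemma W_operator_act: "W_operator f \<Longrightarrow> W_operator (\<lambda>x. rep.act p (f x))"
  by (rule W_operator_comp) (auto simp: W_operator_def act_in_W rep.act_add_right rep.act_sc)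

lemma act_gen_eq:
  "rep.act (act_gen q U_k x) v = q powi idx x *\<^sub>R L x v" "rep.act (act_gen q U_kinv x) v = kinv_factor x *\<^sub>R L x v"
  "rep.act (act_gen q U_f x) v = f_part x v" "rep.act (act_gen q U_e x) v = e_part x v"
proof -
  show "rep.act (act_gen q U_k x) v = q powi idx x *\<^sub>R L x v"
    by (simp add: rep.act_simps scaleR_scaleC sphere_index_eq q_powr_int)
  have "q powr (- sphere_index x) = kinv_factor x"
    using q0 by (cases x) (simp_all add: qi_def powr_minus)
  then show "rep.act (act_gen q U_kinv x) v = kinv_factor x *\<^sub>R L x v"
    by (simp add: rep.act_simps scaleR_scaleC)
  show "rep.act (act_gen q U_f x) v = f_part x v" "rep.act (act_gen q U_e x) v = e_part x v"
    by (cases x; simp add: rep.act_simps scaleR_scaleC s2_def)+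
qed

lemma equivariant_gen:
  "\<forall>v\<in>W. U U_k (L x v) = rep.act (act_gen q U_k x) (U U_k v)"
  "\<forall>v\<in>W. U U_kinv (L x v) = rep.act (act_gen q U_kinv x) (U U_kinv v)"
  "\<forall>v\<in>W. U U_f (L x v) = rep.act (act_gen q U_f x) (U U_k v) + rep.act (act_gen q U_kinv x) (U U_f v)"
  "\<forall>v\<in>W. U U_e (L x v) = rep.act (act_gen q U_e x) (U U_k v) + rep.act (act_gen q U_kinv x) (U U_e v)"
proof -
  note i = W_operator_eqI W_intros W_operator_L W_operator_act
  show k: "\<forall>v\<in>W. U U_k (L x v) = rep.act (act_gen q U_k x) (U U_k v)"
    by (intro i) (simp only: act_gen_eq k_L_w)
  show "\<forall>v\<in>W. U U_f (L x v) = rep.act (act_gen q U_f x) (U U_k v) + rep.act (act_gen q U_kinv x) (U U_f v)"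
    by (intro i) (simp only: act_gen_eq f_L_w)
  show "\<forall>v\<in>W. U U_e (L x v) = rep.act (act_gen q U_e x) (U U_k v) + rep.act (act_gen q U_kinv x) (U U_e v)"
    by (intro i) (simp only: act_gen_eq e_L_w)
  show "\<forall>v\<in>W. U U_kinv (L x v) = rep.act (act_gen q U_kinv x) (U U_kinv v)"
  proof
    fix v assume v: "v \<in> W"
    \<comment> \<open>The law for the inverse of k is obtained from the law for k by applying the
      inverse on both sides.\<close>
    have "U U_k (L x (U U_kinv v)) = q powi idx x *\<^sub>R L x v"
      using k v U_k_kinv by (simp add: U_in_W act_gen_eq del: act_gen.simps)
    then have "U U_kinv (U U_k (L x (U U_kinv v))) = q powi idx x *\<^sub>R U U_kinv (L x v)"
      using v by (simp add: U_scaleR L_in_W)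
    then have 1: "L x (U U_kinv v) = q powi idx x *\<^sub>R U U_kinv (L x v)"
      using v U_k_kinv by (simp add: L_in_W U_in_W)
    have "kinv_factor x * q powi idx x = 1" using q0 by (cases x) (simp_all add: qi_def)
    then show "U U_kinv (L x v) = rep.act (act_gen q U_kinv x) (U U_kinv v)"
      unfolding act_gen_eq 1 by simp
  qed
qed

end

section \<open>Faithfulness\<close>

context podles
begin

section \<open>Leading terms and independence of the normal monomials\<close>

declare up.simps [simp del] mid.simps [simp del] down.simps [simp del]

lemma up_pos: "0 \<le> a \<Longrightarrow> 0 \<le> b \<Longrightarrow> 0 < n \<Longrightarrow> N \<in> {1/2, - 1/2} \<Longrightarrow> up x a b n N \<noteq> 0"
  using u_pos[of "a + 1"] u_pos[of "a + 2"] u_pos[of "b + 1"] u_pos[of "b + 2"] E_pos[of "n + 2" N] s2_pos r_pos q0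
  by (cases x) (simp_all add: up.simps)

text \<open>Error terms for a leading vector \<open>w A Z N\<close>: lowering both coordinates by
  the same amount keeps m and the sign and makes l smaller.\<close>

definition lower :: "int \<Rightarrow> int \<Rightarrow> real \<Rightarrow> spinor set" where
  "lower A Z N = ell2.span {w (A - int j) (Z - int j) N |j. 1 \<le> j}"

lemma lower_closed:
  "0 \<in> lower A Z N" "x \<in> lower A Z N \<Longrightarrow> y \<in> lower A Z N \<Longrightarrow> x + y \<in> lower A Z N"
  "x \<in> lower A Z N \<Longrightarrow> c *\<^sub>C x \<in> lower A Z N" "x \<in> lower A Z N \<Longrightarrow> k *\<^sub>R x \<in> lower A Z N"
  unfolding lower_def by (auto intro: ell2.span_zero ell2.span_add ell2.span_scale simp: scaleR_scaleC)

lemma w_in_lower: "1 \<le> j \<Longrightarrow> w (A - j) (Z - j) N \<in> lower A Z N"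
  unfolding lower_def by (rule ell2.span_base) (auto intro!: exI[of _ "nat j"])

lemma cf_lower:
  assumes "x \<in> lower A Z N" "A \<le> a' \<or> a' - b' \<noteq> A - Z"
  shows "cf x (lab a' b' N') = 0"
  using assms(1) unfolding lower_def
proof (induction rule: ell2.span_induct_alt)
  case (step c y z)
  then obtain j where "y = w (A - int j) (Z - int j) N" "1 \<le> j" by blast
  then show ?case using step assms(2) by (auto simp: cf_w)
qed simp

lemma L_lower: "v \<in> lower A Z N \<Longrightarrow> L x v \<in> lower (A + 1 + idx x) (Z + 1 - idx x) N"
  unfolding lower_def[of A]
proof (induction rule: ell2.span_induct_alt)
  case base
  show ?case by (simp add: L_linear lower_closed)
next
  case (step c y z)
  then obtain j where j: "y = w (A - int j) (Z - int j) N" "1 \<le> j" by blast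
  have "w (A - int j + k + idx x) (Z - int j + k - idx x) N \<in> lower (A + 1 + idx x) (Z + 1 - idx x) N" if "k \<le> 1" for k
    using w_in_lower[of "int j + 1 - k" "A + 1 + idx x" "Z + 1 - idx x" N] that j(2) by (simp add: algebra_simps)
  from this[of 1] this[of 0] this[of "- 1"] show ?case
    using step(2) unfolding j L_linear L_w by (intro lower_closed) simp_all
qed

definition leading :: "spinor \<Rightarrow> int \<Rightarrow> int \<Rightarrow> real \<Rightarrow> bool" where
  "leading v A Z N \<longleftrightarrow> 0 \<le> A \<and> 0 \<le> Z \<and> odd (A + Z) \<and> (\<exists>c z. c \<noteq> 0 \<and> z \<in> lower A Z N \<and> v = c *\<^sub>R w A Z N + z)"

lemma leading_L:
  assumes "leading v A Z N" "N \<in> {1/2, - 1/2}"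
  shows "leading (L x v) (A + 1 + idx x) (Z + 1 - idx x) N"
proof -
  obtain c z where *: "0 \<le> A" "0 \<le> Z" "odd (A + Z)" "c \<noteq> 0" "z \<in> lower A Z N" "v = c *\<^sub>R w A Z N + z"
    using assms(1) by (auto simp: leading_def)
  have n: "0 < A + Z" using * by presburger
  let ?l = "lower (A + 1 + idx x) (Z + 1 - idx x) N"
  have "w (A + k + idx x) (Z + k - idx x) N \<in> ?l" if "k \<le> 0" for k
    using w_in_lower[of "1 - k" "A + 1 + idx x" "Z + 1 - idx x" N] that by (simp add: algebra_simps)
  from this[of 0] this[of "- 1"]
  have low: "c *\<^sub>R (mid x A Z (A + Z) N *\<^sub>R w (A + idx x) (Z - idx x) N
       + down x A Z (A + Z) N *\<^sub>R w (A - 1 + idx x) (Z - 1 - idx x) N) + L x z \<in> ?l"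
    using L_lower[OF *(5)] by (intro lower_closed) simp_all
  have "L x v = (c * up x A Z (A + Z) N) *\<^sub>R w (A + 1 + idx x) (Z + 1 - idx x) N +
     (c *\<^sub>R (mid x A Z (A + Z) N *\<^sub>R w (A + idx x) (Z - idx x) N
       + down x A Z (A + Z) N *\<^sub>R w (A - 1 + idx x) (Z - 1 - idx x) N) + L x z)"
    unfolding * L_linear L_w by (simp add: scaleR_add_right)
  moreover have "c * up x A Z (A + Z) N \<noteq> 0" using * up_pos[OF *(1,2) n assms(2)] by simp
  moreover have "0 \<le> A + 1 + idx x" "0 \<le> Z + 1 - idx x" using *(1,2) by (cases x; simp)+
  moreover have "odd (A + 1 + idx x + (Z + 1 - idx x))" using *(3) by simp
  ultimately show ?thesis using low unfolding leading_def by blast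
qed

lemma leading_power:
  assumes "leading (rep.act p v) A Z N" "N \<in> {1/2, - 1/2}"
  shows "leading (rep.act (free_gen x ^ n * p) v) (A + int n * (1 + idx x)) (Z + int n * (1 - idx x)) N"
proof (induction n)
  case (Suc n)
  have "A + int n * (1 + idx x) + 1 + idx x = A + int (Suc n) * (1 + idx x)"
    "Z + int n * (1 - idx x) + 1 - idx x = Z + int (Suc n) * (1 - idx x)" by (simp_all add: algebra_simps)
  then show ?case
    using leading_L[OF Suc assms(2), of x] by (simp only: power_Suc mult.assoc rep.act_mult[OF UNIV_I, of "free_gen x"] rep.act_gen)
qed (use assms in simp)

fun tip :: "int \<Rightarrow> sphere_gen" where "tip i = (if 0 \<le> i then X_plus else X_minus)"

definition monomial :: "int \<times> nat \<Rightarrow> sphere_gen free_algebra" where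
  "monomial = (\<lambda>(i, k). free_gen (tip i) ^ nat \<bar>i\<bar> * free_gen X_zero ^ k)"

text \<open>The top component of the monomial with index (i, k) raises m by i and l by k + |i|, so
  different indices lead to different labels. It is nonzero because all \<open>up\<close>
  coefficients at existing labels are.\<close>

lemma leading_monomial:
  assumes "N \<in> {1/2, - 1/2}" "0 \<le> a" "0 \<le> b" "odd (a + b)"
  shows "leading (rep.act (monomial (i, k)) (w a b N)) (a + int k + \<bar>i\<bar> + i) (b + int k + \<bar>i\<bar> - i) N"
proof -
  have "leading (rep.act 1 (w a b N)) a b N"
    using assms lower_closed(1)[of a b N] unfolding leading_def
    by (intro conjI exI[of _ 1] exI[of _ 0]) (simp_all add: rep.act_one)
  from leading_power[OF leading_power[OF this assms(1), of X_zero k] assms(1), of "tip i" "nat \<bar>i\<bar>"]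
  have *: "leading (rep.act (monomial (i, k)) (w a b N)) (a + int k + int (nat \<bar>i\<bar>) * (1 + idx (tip i)))
      (b + int k + int (nat \<bar>i\<bar>) * (1 - idx (tip i))) N" by (simp add: monomial_def)
  have "a + int k + int (nat \<bar>i\<bar>) * (1 + idx (tip i)) = a + int k + \<bar>i\<bar> + i"
    "b + int k + int (nat \<bar>i\<bar>) * (1 - idx (tip i)) = b + int k + \<bar>i\<bar> - i" by auto
  then show ?thesis using * by (simp only:)
qed

lemma cf_leading:
  assumes "leading v A Z N" "N \<in> {1/2, - 1/2}"
  shows "cf v (lab A Z N) \<noteq> 0" "A < a' \<or> a' - b' \<noteq> A - Z \<Longrightarrow> cf v (lab a' b' N) = 0"
proof -
  obtain c z where *: "0 \<le> A" "0 \<le> Z" "odd (A + Z)" "c \<noteq> 0" "z \<in> lower A Z N" "v = c *\<^sub>R w A Z N + z"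
    using assms(1) by (auto simp: leading_def)
  show "cf v (lab A Z N) \<noteq> 0" using * assms(2) cf_lower[OF *(5), of A Z N] by (auto simp: cf_w lab_iff)
  show "cf v (lab a' b' N) = 0" if "A < a' \<or> a' - b' \<noteq> A - Z"
    using * that cf_lower[OF *(5), of a' b' N] by (auto simp: cf_w)
qed

definition normal_form :: "(int \<times> nat \<Rightarrow>\<^sub>0 complex) \<Rightarrow> sphere_gen free_algebra" where
  "normal_form = lin_sum (\<lambda>i c. scalar c * monomial i)"

lemma normal_form_add: "normal_form (f + g) = normal_form f + normal_form g"
  unfolding normal_form_def by (rule lin_sum_add) (simp_all add: scalar_add algebra_simps)

lemma normal_form_single: "normal_form (Poly_Mapping.single i c) = scalar c * monomial i"
  unfolding normal_form_def by (rule lin_sum_single) simp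

text \<open>Different i change m differently and cannot interfere. For any occurring i, the term
  with the largest k is the only one that reaches the top label, so its coefficient would have to
  vanish.\<close>

lemma normal_form_faithful:
  assumes "\<And>v. rep.act (normal_form f) v = 0"
  shows "f = 0"
proof (rule ccontr)
  assume "f \<noteq> 0"
  then obtain i0 where "i0 \<in> fst ` Poly_Mapping.keys f" by fastforce
  define K where "K = {k. (i0, k) \<in> Poly_Mapping.keys f}"
  have "K \<subseteq> snd ` Poly_Mapping.keys f" unfolding K_def by force
  then have fin: "finite K" by (rule finite_subset) simp
  have "K \<noteq> {}" using \<open>i0 \<in> _\<close> unfolding K_def by force
  define k0 where "k0 = Max K"
  have k0: "(i0, k0) \<in> Poly_Mapping.keys f" "\<And>k. (i0, k) \<in> Poly_Mapping.keys f \<Longrightarrow> k \<le> k0"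
    using Max_in[OF fin \<open>K \<noteq> {}\<close>] Max_ge[OF fin] by (auto simp: k0_def K_def)
  let ?v = "w 1 0 (1/2)"
  let ?p = "lab (1 + int k0 + \<bar>i0\<bar> + i0) (0 + int k0 + \<bar>i0\<bar> - i0) (1/2)"
  have lead: "leading (rep.act (monomial (i, k)) ?v) (1 + int k + \<bar>i\<bar> + i) (0 + int k + \<bar>i\<bar> - i) (1/2)" for i k
    by (rule leading_monomial) auto
  have "cf (rep.act (normal_form g) ?v) ?p = lin_sum (\<lambda>i c. c * cf (rep.act (monomial i) ?v) ?p) g" for g
  proof (induction g rule: poly_mapping_induct_single)
    case (single i c)
    show ?case by (simp add: normal_form_single lin_sum_single rep.act_simps)
  next
    case (add g h)
    have "lin_sum (\<lambda>i c. c * cf (rep.act (monomial i) ?v) ?p) (g + h)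
      = lin_sum (\<lambda>i c. c * cf (rep.act (monomial i) ?v) ?p) g + lin_sum (\<lambda>i c. c * cf (rep.act (monomial i) ?v) ?p) h"
      by (rule lin_sum_add) (simp_all add: algebra_simps)
    then show ?case using add by (simp add: normal_form_add rep.act_simps)
  qed
  from this[of f] have "0 = (\<Sum>i\<in>Poly_Mapping.keys f. Poly_Mapping.lookup f i * cf (rep.act (monomial i) ?v) ?p)"
    unfolding lin_sum_def using assms by simp
  also have "\<dots> = (\<Sum>i\<in>{(i0, k0)}. Poly_Mapping.lookup f i * cf (rep.act (monomial i) ?v) ?p)"
  proof (rule sum.mono_neutral_right)
    show "\<forall>i\<in>Poly_Mapping.keys f - {(i0, k0)}. Poly_Mapping.lookup f i * cf (rep.act (monomial i) ?v) ?p = 0"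
    proof
      fix j assume j: "j \<in> Poly_Mapping.keys f - {(i0, k0)}"
      obtain i k where ik: "j = (i, k)" by (cases j)
      have "cf (rep.act (monomial (i, k)) ?v) ?p = 0"
        by (rule cf_leading(2)[OF lead]) (use j k0(2)[of k] in \<open>auto simp: ik\<close>)
      then show "Poly_Mapping.lookup f j * cf (rep.act (monomial j) ?v) ?p = 0" by (simp add: ik)
    qed
  qed (use k0 in auto)
  also have "\<dots> \<noteq> 0"
    using k0(1) cf_leading(1)[OF lead[of i0 k0]] by (simp add: in_keys_iff)
  finally show False by simp
qed

section \<open>Reduction to normal form modulo the relations\<close>

definition normal :: "sphere_gen free_algebra \<Rightarrow> bool" where
  "normal p \<longleftrightarrow> (\<exists>f. p - normal_form f \<in> SI)"

lemmas SI_rules = two_sided_zero[OF two_sided_SI] two_sided_add[OF two_sided_SI] two_sided_left[OF two_sided_SI]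
  two_sided_right[OF two_sided_SI] two_sided_diff[OF two_sided_SI] two_sided_uminus[OF two_sided_SI]

lemma normal_add: "normal p \<Longrightarrow> normal p' \<Longrightarrow> normal (p + p')"
proof -
  assume "normal p" "normal p'"
  then obtain f g where "p - normal_form f \<in> SI" "p' - normal_form g \<in> SI" by (auto simp: normal_def)
  then have "(p - normal_form f) + (p' - normal_form g) \<in> SI" by (rule SI_rules)
  then show ?thesis unfolding normal_def by (intro exI[of _ "f + g"]) (simp add: normal_form_add algebra_simps)
qed

lemma normal_cong: "p - p' \<in> SI \<Longrightarrow> normal p' \<Longrightarrow> normal p"
  unfolding normal_def using SI_rules(2) by fastforce

lemma normal_monomial: "normal (scalar c * monomial i)"
  unfolding normal_def by (rule exI[of _ "Poly_Mapping.single i c"]) (simp add: normal_form_single SI_rules)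

lemma normal_scalar: "normal p \<Longrightarrow> normal (scalar c * p)"
proof -
  assume "normal p"
  then obtain f where f: "p - normal_form f \<in> SI" by (auto simp: normal_def)
  have "normal (scalar c * normal_form g)" for g
    by (induction g rule: poly_mapping_induct_single)
      (simp_all add: normal_form_single normal_form_add distrib_left normal_add normal_monomial flip: mult.assoc)
  then show ?thesis
    by (rule normal_cong[rotated]) (use SI_rules(3)[OF f, of "scalar c"] in \<open>simp add: right_diff_distrib\<close>)
qed

lemma normal_left:
  assumes "\<And>i. normal (g * monomial i)" "normal p"
  shows "normal (g * p)"
proof -
  obtain f where f: "p - normal_form f \<in> SI" using assms(2) by (auto simp: normal_def)
  have "normal (g * normal_form h)" for h
  proof (induction h rule: poly_mapping_induct_single)
    case (single i c)
    show ?case by (simp add: normal_form_single scalar_mid normal_scalar assms(1))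
  qed (simp add: normal_form_add distrib_left normal_add)
  then show ?thesis
    by (rule normal_cong[rotated]) (use SI_rules(3)[OF f, of g] in \<open>simp add: right_diff_distrib\<close>)
qed

lemma rels_SI: "rel1 \<in> SI" "rel2 \<in> SI" "rel3 \<in> SI" "rel4 \<in> SI"
  using genideal_generators[of "sphere_rels q t"] by (auto simp: sphere_ideal_def sphere_rels_eq)

lemma scalar_diff: "scalar (a - b) = scalar a - scalar b"
  using scalar_add[of a "- b"] by (simp add: scalar_uminus)

text \<open>The first two relations, solved for the product with the generator of index 0 on the
  left.\<close>

lemma commute_zero:
  assumes "g = X_minus \<or> g = X_plus"
  shows "\<exists>\<alpha> \<beta>. free_gen X_zero * free_gen g - (scalar \<alpha> * (free_gen g * free_gen X_zero) + scalar \<beta> * free_gen g) \<in> SI"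
proof -
  note s = left_diff_distrib right_diff_distrib distrib_left distrib_right mult.assoc scalar_scalar_mult scalar_uminus
    scalar_add scalar_diff
  have *: "\<exists>\<alpha> \<beta>. z * x - (scalar \<alpha> * (x * z) + scalar \<beta> * x) \<in> SI"
    if "x * (z - scalar c) - scalar a * (z - scalar c) * x \<in> SI" "a \<noteq> 0" for a c x z
  proof -
    have e: "a * (c * inverse a) = c" using that(2) by simp
    have "scalar (- inverse a) * (x * (z - scalar c) - scalar a * (z - scalar c) * x)
      = z * x - (scalar (inverse a) * (x * z) + scalar (c - inverse a * c) * x)"
      by (simp add: s e scalar_mid[of x] scalar_central[of _ x, symmetric] that(2) mult.commute[of "inverse a"])
    then show ?thesis using SI_rules(3)[OF that(1)] by metis
  qed
  from assms show ?thesis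
    using *[OF rels_SI(1)[unfolded rel1_def]] *[OF rels_SI(2)[unfolded rel2_def]] q0 by auto
qed

text \<open>The last two relations, solved for the product of the generators of index 1 and -1 in
  either order; [2] is nonzero.\<close>

lemma opposite_product:
  assumes "g = X_minus \<or> g = X_plus"
  shows "\<exists>\<alpha> \<beta> \<gamma>. free_gen (dual g) * free_gen g
    - (scalar \<alpha> * (free_gen X_zero * free_gen X_zero) + scalar \<beta> * free_gen X_zero + scalar \<gamma>) \<in> SI"
proof -
  note s = left_diff_distrib right_diff_distrib distrib_left distrib_right mult.assoc scalar_scalar_mult scalar_uminus
    scalar_add scalar_diff
  have *: "\<exists>\<alpha> \<beta> \<gamma>. x * y - (scalar \<alpha> * (z * z) + scalar \<beta> * z + scalar \<gamma>) \<in> SI"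
    if "- scalar a * x * y + (scalar b * z + scalar c) * (z - scalar c) - scalar d \<in> SI" "a \<noteq> 0" for a b c d x y z
  proof -
    have "scalar (- inverse a) * (- scalar a * x * y + (scalar b * z + scalar c) * (z - scalar c) - scalar d)
      = x * y - (scalar (inverse a * b) * (z * z) + scalar (inverse a * c - inverse a * (b * c)) * z + scalar (- inverse a * (c * c + d)))"
      by (simp add: s scalar_mid[of z] scalar_central[of _ z, symmetric] that(2) mult.commute[of "inverse a"])
    then show ?thesis using SI_rules(3)[OF that(1)] by metis
  qed
  have "complex_of_real (qnum q 2) \<noteq> 0" using s2_pos s2_square qnum_2 by (metis mult_eq_0_iff of_real_eq_0_iff order_less_irrefl)
  then show ?thesis
    using assms *[OF rels_SI(3)[unfolded rel3_def]] *[OF rels_SI(4)[unfolded rel4_def]] by (elim disjE) simp_all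
qed

lemma commute_zero_power:
  assumes "g = X_minus \<or> g = X_plus"
  shows "\<exists>\<alpha> \<beta>. free_gen X_zero * free_gen g ^ n - (scalar \<alpha> * (free_gen g ^ n * free_gen X_zero) + scalar \<beta> * free_gen g ^ n) \<in> SI"
proof (induction n)
  case 0
  show ?case by (rule exI[of _ 1], rule exI[of _ 0]) (simp add: SI_rules)
next
  case (Suc n)
  let ?x = "free_gen g" and ?z = "free_gen X_zero"
  obtain a b where 1: "?z * ?x ^ n - (scalar a * (?x ^ n * ?z) + scalar b * ?x ^ n) \<in> SI" using Suc by blast
  obtain c d where 2: "?z * ?x - (scalar c * (?x * ?z) + scalar d * ?x) \<in> SI" using commute_zero[OF assms] by blast
  have "(?z * ?x - (scalar c * (?x * ?z) + scalar d * ?x)) * ?x ^ n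
    + scalar c * ?x * (?z * ?x ^ n - (scalar a * (?x ^ n * ?z) + scalar b * ?x ^ n)) \<in> SI"
    by (intro SI_rules(2) SI_rules(4)[OF 2] SI_rules(3)[OF 1])
  also have "(?z * ?x - (scalar c * (?x * ?z) + scalar d * ?x)) * ?x ^ n
    + scalar c * ?x * (?z * ?x ^ n - (scalar a * (?x ^ n * ?z) + scalar b * ?x ^ n))
    = ?z * ?x ^ Suc n - (scalar (c * a) * (?x ^ Suc n * ?z) + scalar (d + c * b) * ?x ^ Suc n)"
    by (simp add: distrib_left distrib_right left_diff_distrib right_diff_distrib mult.assoc scalar_mid[of ?x] scalar_scalar_mult scalar_add)
  finally show ?case by blast
qed

lemma tip_cases: "tip i = X_minus \<or> tip i = X_plus" by simp

lemma normal_zero: "normal p \<Longrightarrow> normal (free_gen X_zero * p)"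
proof (rule normal_left)
  fix j :: "int \<times> nat"
  obtain i k where j: "j = (i, k)" by (cases j)
  let ?x = "free_gen (tip i) ^ nat \<bar>i\<bar>" and ?z = "free_gen X_zero"
  obtain a b where "?z * ?x - (scalar a * (?x * ?z) + scalar b * ?x) \<in> SI"
    using commute_zero_power[OF tip_cases] by blast
  from SI_rules(4)[OF this, of "?z ^ k"]
  have "?z * monomial j - (scalar a * monomial (i, Suc k) + scalar b * monomial (i, k)) \<in> SI"
    by (simp add: j monomial_def left_diff_distrib distrib_right mult.assoc del: tip.simps)
  then show "normal (?z * monomial j)"
    by (rule normal_cong) (intro normal_add normal_monomial)
qed

text \<open>The opposite generator cancels one power of the tip and leaves a quadratic polynomial in
  the generator of index 0, whose left multiplication is already known to preserve normal
  elements.\<close>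

lemma normal_tip_step:
  assumes "g = X_minus \<or> g = X_plus" "i \<noteq> 0" "tip i = g"
  shows "normal (free_gen (dual g) * monomial (i, k))"
proof -
  let ?x = "free_gen g" and ?y = "free_gen (dual g)" and ?z = "free_gen X_zero"
  obtain a b c where *: "?y * ?x - (scalar a * (?z * ?z) + scalar b * ?z + scalar c) \<in> SI"
    using opposite_product[OF assms(1)] by blast
  define i' where "i' = (if g = X_plus then i - 1 else i + 1)"
  have n: "nat \<bar>i\<bar> = Suc (nat \<bar>i'\<bar>)" "i' = 0 \<or> tip i' = g"
    using assms by (auto simp: i'_def split: if_splits)
  then have m: "monomial (i, k) = ?x * monomial (i', k)"
    using assms(3) by (auto simp: monomial_def mult.assoc simp del: tip.simps)
  have 1: "?y * monomial (i, k) - (scalar a * (?z * (?z * monomial (i', k))) + scalar b * (?z * monomial (i', k)) + scalar c * monomial (i', k)) \<in> SI"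
    using SI_rules(4)[OF *, of "monomial (i', k)"]
    by (simp add: m left_diff_distrib distrib_right mult.assoc)
  have "normal (monomial (i', k))" using normal_monomial[of 1] by simp
  then show ?thesis
    by (intro normal_cong[OF 1] normal_add normal_scalar normal_zero)
qed

lemma normal_all: "normal p"
proof (induction p rule: poly_mapping_induct_single)
  case (single v c)
  obtain ws where v: "v = Word ws" by (cases v)
  have m: "normal (monomial i)" for i using normal_monomial[of 1] by simp
  have plus: "normal (free_gen X_plus * monomial j)" for j
  proof -
    obtain i k where j: "j = (i, k)" by (cases j)
    show ?thesis
    proof (cases "0 \<le> i")
      case True
      then have "free_gen X_plus * monomial j = monomial (i + 1, k)"
        by (simp add: j monomial_def nat_add_distrib mult.assoc)
      then show ?thesis by (simp add: m)
    next
      case False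
      then show ?thesis using normal_tip_step[of X_minus i k] by (simp add: j)
    qed
  qed
  have minus: "normal (free_gen X_minus * monomial j)" for j
  proof -
    obtain i k where j: "j = (i, k)" by (cases j)
    show ?thesis
    proof (cases "0 < i")
      case False
      then have "nat \<bar>i - 1\<bar> = Suc (nat \<bar>i\<bar>)" by simp
      then have "free_gen X_minus * monomial j = monomial (i - 1, k)"
        using False by (cases "i = 0") (simp_all add: j monomial_def mult.assoc)
      then show ?thesis by (simp add: m)
    next
      case True
      then show ?thesis using normal_tip_step[of X_plus i k] by (simp add: j)
    qed
  qed
  have "normal (free_gen g * p)" if "normal p" for g p
    using normal_zero normal_left[OF plus] normal_left[OF minus] that by (cases g) auto
  then have "normal (prod_list (map free_gen ws))"
    using m[of "(0, 0)"] by (induction ws) (simp_all add: monomial_def)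
  moreover have "Poly_Mapping.single v c = scalar c * prod_list (map free_gen ws)"
    by (simp add: v word_single[symmetric] scalar_mult_single)
  ultimately show ?case using normal_scalar by simp
qed (rule normal_add)

text \<open>Spanning by normal monomials together with their independence as operators identifies
  the ideal with the kernel. Questions about the ideal thereby become operator identities, which is
  also how the quantum group action is shown to descend.\<close>

lemma SI_iff: "p \<in> SI \<longleftrightarrow> (\<forall>v. rep.act p v = 0)"
proof
  assume 0: "\<forall>v. rep.act p v = 0"
  obtain f where f: "p - normal_form f \<in> SI" using normal_all by (auto simp: normal_def)
  then have "rep.act (normal_form f) v = 0" for v
    using act_sphere_ideal[OF f, of v] 0 by (simp add: rep.act_diff)
  then have "f = 0" by (rule normal_form_faithful)
  then show "p \<in> SI" using f by (simp add: normal_form_def)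
qed (simp add: act_sphere_ideal)

lemma SI_iff_W: "p \<in> SI \<longleftrightarrow> (\<forall>v\<in>W. rep.act p v = 0)"
  unfolding SI_iff
  using bounded_clinear_eq_on_W[OF bounded_clinear_act[of p] bounded_clinear_0] by (metis bv_in_W)

lemma inj_spinor_rep: "inj_on (spinor_rep q t) (carrier (quantum_sphere q t))"
proof (rule inj_onI)
  fix x y assume "x \<in> carrier (quantum_sphere q t)" "y \<in> carrier (quantum_sphere q t)" and eq: "spinor_rep q t x = spinor_rep q t y"
  then obtain p p' where *: "x = cls SI p" "y = cls SI p'" by (auto simp: sphere_simps)
  then have "p - p' \<in> SI" using eq by (simp add: spinor_rep_cls SI_iff rep.act_diff fun_eq_iff)
  then show "x = y" by (simp add: * cls_eq_iff[OF two_sided_SI])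
qed

end

section \<open>Equivariance\<close>

context podles
begin

declare act_gen.simps [simp del]

lemma U_diff: "x \<in> W \<Longrightarrow> y \<in> W \<Longrightarrow> U g (x - y) = U g x - U g y"
  using W_operator_D(5)[OF W_operator_U[OF W_operator_basic(1)]] .

lemma act_right:
  "rep.act p (x + y) = rep.act p x + rep.act p y" "rep.act p (x - y) = rep.act p x - rep.act p y"
  "rep.act p (c *\<^sub>C x) = c *\<^sub>C rep.act p x" "rep.act p (k *\<^sub>R x) = k *\<^sub>R rep.act p x"
  using bounded_clinear_act[of p] bounded_clinear_add bounded_clinear_diff bounded_clinear_scale
  by (auto simp: scaleR_scaleC)

subsection \<open>The action on the sphere\<close>

lemma act_letters_equivariant:
  "v \<in> W \<Longrightarrow> U U_k (foldr L xs v) = rep.act (act_letters q U_k xs) (U U_k v)"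
  "v \<in> W \<Longrightarrow> U U_kinv (foldr L xs v) = rep.act (act_letters q U_kinv xs) (U U_kinv v)"
  "v \<in> W \<Longrightarrow> U U_f (foldr L xs v) = rep.act (act_letters q U_f xs) (U U_k v) + rep.act (act_letters q U_kinv xs) (U U_f v)"
  "v \<in> W \<Longrightarrow> U U_e (foldr L xs v) = rep.act (act_letters q U_e xs) (U U_k v) + rep.act (act_letters q U_kinv xs) (U U_e v)"
proof -
  have W: "foldr L xs v \<in> W" if "v \<in> W" for xs v using that by (induction xs) (auto simp: L_in_W)
  show 1: "U U_k (foldr L xs v) = rep.act (act_letters q U_k xs) (U U_k v)" if "v \<in> W" for xs v
    by (induction xs) (simp_all add: rep.act_simps equivariant_gen W that)
  show 2: "U U_kinv (foldr L xs v) = rep.act (act_letters q U_kinv xs) (U U_kinv v)" if "v \<in> W" for xs v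
    by (induction xs) (simp_all add: rep.act_simps equivariant_gen W that)
  show "v \<in> W \<Longrightarrow> U U_f (foldr L xs v) = rep.act (act_letters q U_f xs) (U U_k v) + rep.act (act_letters q U_kinv xs) (U U_f v)"
    by (induction xs) (simp_all add: rep.act_simps equivariant_gen W 1 2 act_right)
  show "v \<in> W \<Longrightarrow> U U_e (foldr L xs v) = rep.act (act_letters q U_e xs) (U U_k v) + rep.act (act_letters q U_kinv xs) (U U_e v)"
    by (induction xs) (simp_all add: rep.act_simps equivariant_gen W 1 2 act_right)
qed

lemma act_free_eq: "act_free q g = lin_sum (\<lambda>w c. scalar c * act_letters q g (letters w))"
  by (rule ext) (simp add: act_free_def lin_sum_def)

lemma act_free_add: "act_free q g (x + y) = act_free q g x + act_free q g y"
  unfolding act_free_eq by (rule lin_sum_add) (simp_all add: scalar_add distrib_right)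

lemma act_free_single: "act_free q g (Poly_Mapping.single xs c) = scalar c * act_letters q g (letters xs)"
  unfolding act_free_eq by (rule lin_sum_single) simp

lemma act_free_scalar: "act_free q g (scalar c * x) = scalar c * act_free q g x"
  by (induction x rule: poly_mapping_induct_single)
    (simp_all add: scalar_mult_single act_free_single act_free_add distrib_left scalar_scalar_mult)

sublocale srep: free_rep "\<lambda>c x. scalar c * x" UNIV "act_free q"
  by unfold_locales (simp_all add: act_free_add act_free_scalar scalar_add scalar_scalar_mult distrib_left distrib_right)

lemma act_free_equivariant:
  "v \<in> W \<Longrightarrow> U U_k (rep.act p v) = rep.act (act_free q U_k p) (U U_k v)"
  "v \<in> W \<Longrightarrow> U U_kinv (rep.act p v) = rep.act (act_free q U_kinv p) (U U_kinv v)"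
  "v \<in> W \<Longrightarrow> U U_f (rep.act p v) = rep.act (act_free q U_f p) (U U_k v) + rep.act (act_free q U_kinv p) (U U_f v)"
  "v \<in> W \<Longrightarrow> U U_e (rep.act p v) = rep.act (act_free q U_e p) (U U_k v) + rep.act (act_free q U_kinv p) (U U_e v)"
proof -
  have W: "foldr L xs v \<in> W" if "v \<in> W" for xs v using that by (induction xs) (auto simp: L_in_W)
  note s = rep.act_single rep.act_simps act_free_single act_free_add U_scale U_add W act_in_W act_letters_equivariant
    ell2.scale_right_distrib
  show "v \<in> W \<Longrightarrow> U U_k (rep.act p v) = rep.act (act_free q U_k p) (U U_k v)"
    by (induction p rule: poly_mapping_induct_single) (simp_all add: s)
  show "v \<in> W \<Longrightarrow> U U_kinv (rep.act p v) = rep.act (act_free q U_kinv p) (U U_kinv v)"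
    by (induction p rule: poly_mapping_induct_single) (simp_all add: s)
  show "v \<in> W \<Longrightarrow> U U_f (rep.act p v) = rep.act (act_free q U_f p) (U U_k v) + rep.act (act_free q U_kinv p) (U U_f v)"
    by (induction p rule: poly_mapping_induct_single) (simp_all add: s)
  show "v \<in> W \<Longrightarrow> U U_e (rep.act p v) = rep.act (act_free q U_e p) (U U_k v) + rep.act (act_free q U_kinv p) (U U_e v)"
    by (induction p rule: poly_mapping_induct_single) (simp_all add: s)
qed

lemma U_kinv_f: "x \<in> W \<Longrightarrow> U U_kinv (U U_f x) = qi *\<^sub>R U U_f (U U_kinv x)"
  and U_kinv_e: "x \<in> W \<Longrightarrow> U U_kinv (U U_e x) = q *\<^sub>R U U_e (U U_kinv x)"
proof -
  assume x: "x \<in> W"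
  have "U U_k (U U_f (U U_kinv x)) = q *\<^sub>R U U_f x" "U U_k (U U_e (U U_kinv x)) = qi *\<^sub>R U U_e x"
    using x U_k_f U_k_e U_k_kinv by (simp_all add: U_in_W)
  then have "U U_kinv (U U_k (U U_f (U U_kinv x))) = q *\<^sub>R U U_kinv (U U_f x)"
    "U U_kinv (U U_k (U U_e (U U_kinv x))) = qi *\<^sub>R U U_kinv (U U_e x)"
    using x by (simp_all add: U_scaleR U_in_W)
  then have 1: "U U_f (U U_kinv x) = q *\<^sub>R U U_kinv (U U_f x)" "U U_e (U U_kinv x) = qi *\<^sub>R U U_kinv (U U_e x)"
    using x U_k_kinv by (simp_all add: U_in_W)
  show "U U_kinv (U U_f x) = qi *\<^sub>R U U_f (U U_kinv x)" "U U_kinv (U U_e x) = q *\<^sub>R U U_e (U U_kinv x)"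
    unfolding 1 using inverses(2) by (simp_all add: mult.commute)
qed

lemmas U_rewrites = U_k_kinv[rule_format] U_k_f[rule_format] U_k_e[rule_format] U_kinv_f U_kinv_e

text \<open>This is h.x = h_(1) x S(h_(2)) inside the representation, written out for the
  generators. It expresses the action through operators, so it visibly depends on \<open>p\<close>
  only through the operator of \<open>p\<close>.\<close>

lemma act_free_conjugate:
  assumes v: "v \<in> W"
  shows "rep.act (act_free q U_k p) v = U U_k (rep.act p (U U_kinv v))"
    and "rep.act (act_free q U_kinv p) v = U U_kinv (rep.act p (U U_k v))"
    and "rep.act (act_free q U_f p) v = U U_f (rep.act p (U U_kinv v)) - q *\<^sub>R U U_kinv (rep.act p (U U_f v))"
    and "rep.act (act_free q U_e p) v = U U_e (rep.act p (U U_kinv v)) - qi *\<^sub>R U U_kinv (rep.act p (U U_e v))"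
proof -
  have k: "rep.act (act_free q U_k p) v = U U_k (rep.act p (U U_kinv v))"
    "rep.act (act_free q U_kinv p) v = U U_kinv (rep.act p (U U_k v))" if "v \<in> W" for v
    using that by (simp_all add: act_free_equivariant U_in_W U_rewrites)
  show "rep.act (act_free q U_k p) v = U U_k (rep.act p (U U_kinv v))"
    "rep.act (act_free q U_kinv p) v = U U_kinv (rep.act p (U U_k v))" by (rule k[OF v])+
  show "rep.act (act_free q U_f p) v = U U_f (rep.act p (U U_kinv v)) - q *\<^sub>R U U_kinv (rep.act p (U U_f v))"
    using v by (simp add: act_free_equivariant(3) U_in_W U_rewrites k(2) act_right U_scaleR act_in_W)
  show "rep.act (act_free q U_e p) v = U U_e (rep.act p (U U_kinv v)) - qi *\<^sub>R U U_kinv (rep.act p (U U_e v))"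
    using v by (simp add: act_free_equivariant(4) U_in_W U_rewrites k(2) act_right U_scaleR act_in_W)
qed

lemma act_free_SI: "x \<in> SI \<Longrightarrow> act_free q g x \<in> SI"
  unfolding SI_iff_W by (cases g) (simp_all add: act_free_conjugate U_in_W U_zero)

lemma srep_SI: "x \<in> SI \<Longrightarrow> srep.act P x \<in> SI"
  by (induction P arbitrary: x rule: free_algebra_induct) (auto simp: srep.act_simps SI_rules act_free_SI)

section \<open>Descent of the action to both quotients\<close>

abbreviation "UI \<equiv> U_ideal q"

lemma two_sided_UI: "two_sided UI"
  unfolding U_ideal_def by (rule two_sided_genideal)

definition "urel1 = free_gen U_k * free_gen U_kinv - 1"
definition "urel2 = free_gen U_kinv * free_gen U_k - 1"
definition "urel3 = free_gen U_k * free_gen U_k - free_gen U_kinv * free_gen U_kinv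
  - real_scalar (q - inverse q) * (free_gen U_f * free_gen U_e - free_gen U_e * free_gen U_f)"
definition "urel4 = free_gen U_k * free_gen U_f - real_scalar q * free_gen U_f * free_gen U_k"
definition "urel5 = free_gen U_k * free_gen U_e - real_scalar (inverse q) * free_gen U_e * free_gen U_k"

lemmas urel_defs = urel1_def urel2_def urel3_def urel4_def urel5_def

lemma U_rels_eq: "U_rels q = {urel1, urel2, urel3, urel4, urel5}"
  by (simp add: U_rels_def Let_def urel_defs)

lemma urep_rels: "P \<in> U_rels q \<Longrightarrow> x \<in> W \<Longrightarrow> urep.act P x = 0"
  using U_fe[rule_format, of x] unfolding U_rels_eq qi_def
  by (auto simp: urel_defs urep.act_simps U_in_W U_rewrites scaleR_scaleC qi_def ell2.scale_right_diff_distrib)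

lemma urep_UI: "P \<in> UI \<Longrightarrow> x \<in> W \<Longrightarrow> urep.act P x = 0"
  using urep.act_genideal[of "{0}" "U_rels q" P x] urep_rels
  unfolding U_ideal_def by (force simp: U_zero)

text \<open>Membership in the ideal is tested on \<open>W\<close>, where the conjugation formulas
  reduce each relation to the corresponding relation of the spinor action.\<close>

lemma srep_rels: "P \<in> U_rels q \<Longrightarrow> srep.act P x \<in> SI"
proof -
  note s = srep.act_simps rep.act_simps act_free_conjugate U_in_W act_in_W U_rewrites act_right U_scaleR U_diff
    scaleR_diff_right
  have e: "qi * q = 1" using inverses(2) by (simp add: mult.commute)
  have "srep.act urel1 x \<in> SI" "srep.act urel2 x \<in> SI" "srep.act urel4 x \<in> SI" "srep.act urel5 x \<in> SI"
    unfolding SI_iff_W urel_defs qi_def[symmetric]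
    by (simp_all add: s e inverses flip: scaleR_scaleC)
  moreover have "srep.act urel3 x \<in> SI"
    unfolding SI_iff_W
  proof
    fix v assume v: "v \<in> W"
    let ?X = "rep.act x" and ?k = "U U_kinv"
    \<comment> \<open>The terms with e and f on opposite sides of x cancel in the commutator, by the
      rules for moving the inverse of k past e and f.\<close>
    have f: "rep.act (act_free q U_f (act_free q U_e x)) v - rep.act (act_free q U_e (act_free q U_f x)) v
      = (U U_f (U U_e (?X (?k (?k v)))) - U U_e (U U_f (?X (?k (?k v)))))
        - ?k (?k (?X (U U_f (U U_e v) - U U_e (U U_f v))))"
      using v by (simp add: s e inverses algebra_simps)
    have "(q - qi) *\<^sub>R (rep.act (act_free q U_f (act_free q U_e x)) v - rep.act (act_free q U_e (act_free q U_f x)) v)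
      = U U_k (U U_k (?X (?k (?k v)))) - ?k (?k (?X (?k (?k v))))
        - ?k (?k (?X (U U_k (U U_k v) - ?k (?k v))))"
      unfolding f scaleR_diff_right using v U_fe
      by (simp add: U_in_W act_in_W act_right U_scaleR U_diff flip: scaleR_diff_right)
    also have "\<dots> = rep.act (act_free q U_k (act_free q U_k x)) v - rep.act (act_free q U_kinv (act_free q U_kinv x)) v"
      using v by (simp add: s)
    finally show "rep.act (srep.act urel3 x) v = 0"
      unfolding urel_defs qi_def[symmetric]
      by (simp add: srep.act_simps rep.act_simps scaleR_scaleC)
  qed
  ultimately show "P \<in> U_rels q \<Longrightarrow> srep.act P x \<in> SI" unfolding U_rels_eq by auto
qed

lemma srep_UI: "P \<in> UI \<Longrightarrow> srep.act P x \<in> SI"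
  using srep.act_genideal[of SI "U_rels q" P x] srep_rels SI_rules act_free_SI
  unfolding U_ideal_def by simp

lemma spinor_act_cls: "x \<in> W \<Longrightarrow> spinor_act q (cls UI P) x = urep.act P x"
  unfolding spinor_act_def
proof (rule the_elem_image[OF cls_self[OF two_sided_UI]])
  fix P' assume "x \<in> W" "P' \<in> cls UI P"
  then have "urep.act (P' - P) x = 0" by (intro urep_UI) (simp_all add: cls_mem)
  then show "urep.act P' x = urep.act P x" by (simp add: urep.act_diff)
qed

lemma sphere_act_cls: "sphere_act q t (cls UI P) (cls SI p) = cls SI (srep.act P p)"
proof -
  let ?f = "\<lambda>(P, p). cls SI (srep.act P p)"
  have "the_elem (?f ` (cls UI P \<times> cls SI p)) = ?f (P, p)"
  proof (rule the_elem_image)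
    show "(P, p) \<in> cls UI P \<times> cls SI p" by (simp add: cls_mem SI_rules two_sided_zero[OF two_sided_UI])
    fix y assume "y \<in> cls UI P \<times> cls SI p"
    then obtain P' p' where y: "y = (P', p')" "P' - P \<in> UI" "p' - p \<in> SI" by (auto simp: cls_mem)
    have "srep.act (P' - P) p' + srep.act P (p' - p) \<in> SI"
      using y by (intro SI_rules(2) srep_UI srep_SI)
    moreover have "srep.act P p' = srep.act P (p' - p) + srep.act P p"
      using srep.act_add_right[of "p' - p" p P] by simp
    ultimately have "srep.act P' p' - srep.act P p \<in> SI"
      by (simp add: srep.act_diff)
    then show "?f y = ?f (P, p)" by (simp add: y cls_eq_iff[OF two_sided_SI])
  qed
  then show ?thesis unfolding sphere_act_def cls_def[symmetric] by simp
qed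

section \<open>Sweedler sums\<close>

lemma free_coproduct_eq: "free_coproduct = lin_sum (\<lambda>w c. scalar c * prod_list (map coproduct_gen (letters w)))"
  by (rule ext) (simp add: free_coproduct_def lin_sum_def)

context
  fixes p :: "sphere_gen free_algebra" and \<xi> :: spinor
  assumes \<xi>: "\<xi> \<in> W"
begin

text \<open>The linear extension of u \<otimes> v \<mapsto> (u.p) (v \<xi>) to the tensor square of
  the free algebra, the right-hand side of the equivariance condition for fixed p and \<xi>.\<close>

definition pairing :: "((u_gen word \<times> u_gen word) \<Rightarrow>\<^sub>0 complex) \<Rightarrow> spinor" where
  "pairing = lin_sum (\<lambda>(u, v) c. c *\<^sub>C rep.act (foldr (act_free q) (letters u) p) (foldr U (letters v) \<xi>))"

lemma pairing_add: "pairing (x + y) = pairing x + pairing y"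
  unfolding pairing_def by (rule lin_sum_add) (auto simp: ell2.scale_left_distrib)

lemma pairing_single: "pairing (Poly_Mapping.single (x, y) c) = c *\<^sub>C rep.act (foldr (act_free q) (letters x) p) (foldr U (letters y) \<xi>)"
  unfolding pairing_def by (subst lin_sum_single) auto

lemma pairing_scalar: "pairing (scalar c * x) = c *\<^sub>C pairing x"
proof (induction x rule: poly_mapping_induct_single)
  case (single w d)
  obtain u v where "w = (u, v)" by (cases w)
  then show ?case by (simp add: scalar_mult_single pairing_single)
qed (simp add: distrib_left pairing_add ell2.scale_right_distrib)

lemma pairing_W: "pairing x \<in> W"
proof (induction x rule: poly_mapping_induct_single)
  case (single w d)
  obtain u v where "w = (u, v)" by (cases w)
  then show ?case by (simp add: pairing_single act_in_W urep.foldr_V \<xi>)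
qed (simp add: pairing_add)

text \<open>The equivariance law for a single generator. Multiplicativity of the coproduct then
  propagates it to words.\<close>

lemma pairing_coproduct: "pairing (coproduct_gen g * x) = U g (pairing x)"
proof (induction x rule: poly_mapping_induct_single)
  case (single w c)
  obtain u v where w: "w = (u, v)" by (cases w)
  let ?\<eta> = "foldr U (letters v) \<xi>" and ?x = "foldr (act_free q) (letters u) p"
  have W: "?\<eta> \<in> W" by (simp add: urep.foldr_V \<xi>)
  have "pairing (tensor g h * Poly_Mapping.single w c) = c *\<^sub>C rep.act (act_free q g ?x) (U h ?\<eta>)" for g h
    by (simp add: tensor_def mult_single w plus_prod_def plus_word_def pairing_single)
  then show ?case
    using W by (cases g) (simp_all add: distrib_right pairing_add w pairing_single act_free_equivariant U_scale act_in_W ell2.scale_right_distrib)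
next
  case (add x y)
  then show ?case by (simp add: distrib_left pairing_add U_add pairing_W)
qed

lemma pairing_free_coproduct: "pairing (free_coproduct P) = urep.act P (rep.act p \<xi>)"
proof (induction P rule: poly_mapping_induct_single)
  case (single w c)
  have "pairing (prod_list (map coproduct_gen gs)) = foldr U gs (rep.act p \<xi>)" for gs
  proof (induction gs)
    case Nil
    have "pairing (Poly_Mapping.single (0, 0) 1) = rep.act p \<xi>"
      by (simp add: pairing_single zero_word_def)
    then show ?case by (simp flip: zero_prod_def)
  qed (simp add: pairing_coproduct)
  then show ?case
    by (simp add: free_coproduct_eq lin_sum_single pairing_scalar urep.act_single)
next
  case (add P P')
  have "free_coproduct (P + P') = free_coproduct P + free_coproduct P'"
    unfolding free_coproduct_eq by (rule lin_sum_add) (simp_all add: scalar_add distrib_right)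
  then show ?case using add by (simp add: pairing_add urep.act_add)
qed

text \<open>The sum runs over a representative of h in the free algebra. Independence of the choice
  is automatic, since the value is the action of the representative on a vector of \<open>W\<close>,
  and this action annihilates the ideal.\<close>

lemma sweedler_pairing:
  "sweedler q (cls UI P) (\<lambda>h1 h2. spinor_rep q t (sphere_act q t h1 (cls SI p)) (spinor_act q h2 \<xi>))
    = urep.act P (rep.act p \<xi>)"
proof -
  let ?S = "\<lambda>P. \<Sum>(u, v)\<in>Poly_Mapping.keys (free_coproduct P). Poly_Mapping.lookup (free_coproduct P) (u, v) *\<^sub>C
       spinor_rep q t (sphere_act q t (cls UI (Poly_Mapping.single u 1)) (cls SI p))
        (spinor_act q (cls UI (Poly_Mapping.single v 1)) \<xi>)"
  have S: "?S P = urep.act P (rep.act p \<xi>)" for P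
  proof -
    have "?S P = pairing (free_coproduct P)"
      unfolding pairing_def lin_sum_def
      by (rule sum.cong) (auto simp: sphere_act_cls spinor_act_cls[OF \<xi>] spinor_rep_cls srep.act_single urep.act_single)
    then show ?thesis by (simp add: pairing_free_coproduct)
  qed
  have "the_elem (?S ` cls UI P) = ?S P"
  proof (rule the_elem_image[OF cls_self[OF two_sided_UI]])
    fix P' assume "P' \<in> cls UI P"
    then have "urep.act (P' - P) (rep.act p \<xi>) = 0" by (intro urep_UI) (simp_all add: cls_mem act_in_W \<xi>)
    then show "?S P' = ?S P" unfolding S by (simp add: urep.act_diff)
  qed
  then show ?thesis unfolding sweedler_def cls_def[symmetric] S .
qed

end

subsection \<open>The involution and the antipode\<close>

abbreviation "U_star \<equiv> anti_extension cnj U_star_gen"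
abbreviation "U_antipode \<equiv> anti_extension id (antipode_gen q)"

lemma UI_rels: "urel1 \<in> UI" "urel2 \<in> UI" "urel3 \<in> UI" "urel4 \<in> UI" "urel5 \<in> UI"
  using genideal_generators[of "U_rels q"] by (auto simp: U_ideal_def U_rels_eq)

lemmas UI_rules = two_sided_add[OF two_sided_UI] two_sided_left[OF two_sided_UI]
  two_sided_right[OF two_sided_UI] two_sided_diff[OF two_sided_UI] two_sided_uminus[OF two_sided_UI]

lemma inverse_scalars: "complex_of_real q * inverse (complex_of_real q) = 1" "inverse (complex_of_real q) * complex_of_real q = 1"
  "complex_of_real q * (inverse (complex_of_real q) * z) = z" "inverse (complex_of_real q) * (complex_of_real q * z) = z"
  using q0 by simp_all

lemma U_star_rels: "P \<in> U_rels q \<Longrightarrow> U_star P \<in> UI"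
proof -
  have c: "free_gen g * scalar d = scalar d * free_gen g" "free_gen g * (scalar d * p) = scalar d * (free_gen g * p)" for g d and p :: "u_gen free_algebra"
    by (rule scalar_central[symmetric], rule scalar_mid)
  note s = star_extension_simps c left_diff_distrib right_diff_distrib scalar_scalar_mult inverse_scalars mult.assoc scalar_uminus
    scalar_diff scalar_simps(2) mult_1_left
  have "U_star urel1 = urel2" "U_star urel2 = urel1"
    unfolding urel_defs using star_extension_simps(6)[of U_star_gen 1] by (simp_all add: s)
  moreover have "U_star urel3 = urel3"
    unfolding urel_defs by (simp add: s)
  moreover have "U_star urel4 = - real_scalar q * urel5" "U_star urel5 = - real_scalar (inverse q) * urel4"
    unfolding urel_defs by (simp_all add: s)
  ultimately show "P \<in> U_rels q \<Longrightarrow> U_star P \<in> UI"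
    unfolding U_rels_eq using UI_rels UI_rules(2,5) by auto
qed

lemma U_antipode_rels: "P \<in> U_rels q \<Longrightarrow> U_antipode P \<in> UI"
proof -
  have c: "free_gen g * scalar d = scalar d * free_gen g" "free_gen g * (scalar d * p) = scalar d * (free_gen g * p)" for g d and p :: "u_gen free_algebra"
    by (rule scalar_central[symmetric], rule scalar_mid)
  note s = id_extension_simps c left_diff_distrib right_diff_distrib distrib_left distrib_right scalar_scalar_mult inverse_scalars mult.assoc scalar_uminus
    scalar_diff scalar_simps(2) mult_1_left
  let ?k = "free_gen U_k" and ?i = "free_gen U_kinv" and ?f = "free_gen U_f" and ?e = "free_gen U_e"
  have 1: "U_antipode 1 = 1" using id_extension_simps(6)[of "antipode_gen q" 1] by simp
  have "U_antipode urel1 = urel1" "U_antipode urel2 = urel2"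
    unfolding urel_defs by (simp_all add: s 1)
  moreover have "U_antipode urel3 = - urel3"
    unfolding urel_defs by (simp add: s algebra_simps)
  \<comment> \<open>Multiplying k f - q f k by the inverse of k on both sides gives the image under
    the antipode up to a scalar; the two correction terms cancel k against its inverse.\<close>
  moreover have "U_antipode urel4 = - real_scalar q * (?i * urel4 * ?i - urel2 * (?f * ?i) + real_scalar q * (?i * ?f) * urel1)"
    unfolding urel_defs by (simp add: s)
  moreover have "U_antipode urel5 = - real_scalar (inverse q) * (?i * urel5 * ?i - urel2 * (?e * ?i) + real_scalar (inverse q) * (?i * ?e) * urel1)"
    unfolding urel_defs by (simp add: s)
  moreover have "?i * urel4 * ?i - urel2 * (?f * ?i) + real_scalar q * (?i * ?f) * urel1 \<in> UI"
    "?i * urel5 * ?i - urel2 * (?e * ?i) + real_scalar (inverse q) * (?i * ?e) * urel1 \<in> UI"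
    by (intro UI_rules(1) UI_rules(4) UI_rules(2)[OF UI_rels(1)] UI_rules(3)[OF UI_rels(2)]
      UI_rules(3)[OF UI_rules(2)[OF UI_rels(4)]] UI_rules(3)[OF UI_rules(2)[OF UI_rels(5)]])+
  ultimately show "P \<in> U_rels q \<Longrightarrow> U_antipode P \<in> UI"
    unfolding U_rels_eq using UI_rels UI_rules(2,5) by auto
qed

lemmas Uq_simps = pres_simps[where s = U_star_gen and R = "U_rels q", folded Uq_su2_def U_ideal_def, OF U_star_rels]

lemma Uq_star: "cstar (Uq_su2 q) (cls UI P) = cls UI (U_star P)"
  by (simp add: Uq_simps)

lemma antipode_cls: "antipode q (cls UI P) = cls UI (U_antipode P)"
  unfolding antipode_def
proof (rule coset_map_cls[OF two_sided_UI])
  show "P \<in> UI \<Longrightarrow> U_antipode P \<in> UI" for P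
    using genideal_mapsto[OF two_sided_UI, of U_antipode "U_rels q"] U_antipode_rels
    by (simp add: id_extension_simps U_ideal_def)
qed (simp add: id_extension_simps)

section \<open>The conjugation and the quantum group\<close>

definition sphase :: "int \<Rightarrow> int \<Rightarrow> real" where
  "sphase a b = (-1) powi \<lfloor>of_int (a - b) / 2 + 1/2 :: real\<rfloor>"

lemma conjugation_w: "conjugation (w a b N) = sphase a b *\<^sub>R w b a (- N)"
proof (cases "lab a b N \<in> spin_labels")
  case True
  have "reflect (lab a b N) = lab b a (- N)"
    by (simp add: reflect_def lab_def minus_divide_left add.commute)
  then show ?thesis using conjugation_bv[OF True] by (simp add: w_def sphase_def lab_def[of a b])
next
  case False
  then have "lab b a (- N) \<notin> spin_labels" by (auto simp: lab_iff add.commute)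
  then show ?thesis using False by (simp add: w_def bv_outside)
qed

lemma sphase_step: "sphase (a + 1) (b - 1) = - sphase a b" "sphase (a - 1) (b + 1) = - sphase a b"
proof -
  show *: "sphase (a + 1) (b - 1) = - sphase a b" for a b
  proof -
    have "of_int (a + 1 - (b - 1)) / 2 + 1/2 = (of_int (a - b) / 2 + 1/2 :: real) + 1" by (simp add: field_simps)
    then have "\<lfloor>of_int (a + 1 - (b - 1)) / 2 + 1/2 :: real\<rfloor> = \<lfloor>of_int (a - b) / 2 + 1/2 :: real\<rfloor> + 1"
      by (simp only: one_add_floor)
    then show ?thesis by (simp add: sphase_def power_int_add)
  qed
  show "sphase (a - 1) (b + 1) = - sphase a b" using *[of "a - 1" "b + 1"] by simp
qed

lemma sphase_swap: "odd (a + b) \<Longrightarrow> sphase a b * sphase b a = - 1"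
proof -
  assume "odd (a + b)"
  then have "odd (a - b)" by simp
  then obtain k where k: "a - b = 2 * k + 1" by (rule oddE)
  then have "b - a = 2 * (- k - 1) + 1" by simp
  then have "of_int (a - b) / 2 + 1/2 = (of_int (k + 1) :: real)" "of_int (b - a) / 2 + 1/2 = (of_int (- k) :: real)"
    unfolding \<open>b - a = _\<close> k by (simp_all add: field_simps)
  then have "sphase a b * sphase b a = (-1) powi (k + 1) * (-1) powi (- k)"
    unfolding sphase_def by (simp only: floor_of_int)
  also have "\<dots> = (-1) powi (k + 1 + - k)" by (rule power_int_add[symmetric]) simp
  finally show ?thesis by simp
qed

fun U_dual where "U_dual U_k = U_kinv" | "U_dual U_kinv = U_k" | "U_dual U_e = U_f" | "U_dual U_f = U_e"
fun U_sign :: "u_gen \<Rightarrow> real" where "U_sign U_k = 1" | "U_sign U_kinv = 1" | "U_sign U_e = - 1" | "U_sign U_f = - 1"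

lemma conjugation_scaleR: "conjugation (k *\<^sub>R x) = k *\<^sub>R conjugation x"
  by (simp add: scaleR_scaleC conjugation_scale)

lemma W_operator_conjugate: "W_operator f \<Longrightarrow> W_operator (\<lambda>x. conjugation (f (conjugation x)))"
  by (auto simp: W_operator_def conjugation_in_W conjugation_add conjugation_scale)

text \<open>Reflecting m exchanges a and b, hence e and f, with the same ladder coefficients. The
  phase alternates between neighbouring m, which gives the sign.\<close>

lemma conjugation_U:
  assumes "x \<in> W"
  shows "conjugation (U g x) = U_sign g *\<^sub>R U (U_dual g) (conjugation x)"
proof -
  \<comment> \<open>Conjugating on both sides makes the maps linear, so that they can be compared on
    basis vectors by \<open>W_operator_eqI\<close>.\<close>
  have "\<forall>x\<in>W. conjugation (U g (conjugation x)) = (- U_sign g) *\<^sub>R U (U_dual g) x"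
  proof (intro W_operator_eqI W_operator_conjugate W_intros)
    fix a b :: int and N :: real assume "odd (a + b)"
    from sphase_swap[OF this] have p: "sphase a b * (sphase b a * z) = - z" for z by (simp flip: mult.assoc)
    have l: "ladder (b - 1) (a + 1) = ladder a b" "ladder b a = ladder (a - 1) (b + 1)"
      by (simp_all add: ladder_def mult.commute)
    show "conjugation (U g (conjugation (w a b N))) = (- U_sign g) *\<^sub>R U (U_dual g) (w a b N)"
      by (cases g) (simp_all add: conjugation_w U_scaleR U_w conjugation_scaleR l sphase_step mult_ac p)
  qed
  moreover have "- conjugation x \<in> W" using assms by (simp add: conjugation_in_W)
  ultimately have "conjugation (U g (conjugation (- conjugation x))) = (- U_sign g) *\<^sub>R U (U_dual g) (- conjugation x)"
    by (rule bspec)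
  then show ?thesis
    using U_scaleR[OF conjugation_in_W[OF assms], of "U_dual g" "- 1"] by (simp add: conjugation_minus conjugation_square)
qed

lemma modular_U_k: "wmap (m_weight q) id = U U_k"
  by (simp add: wmap_def spinor_act_gen.simps basis_vec_eq)

text \<open>The map from h to S(h)^*. Composed of two antimultiplicative maps, it is multiplicative,
  so T h = S(h)^* T only has to be verified on generators.\<close>

definition twisted_star :: "u_gen free_algebra \<Rightarrow> u_gen free_algebra" where
  "twisted_star P = U_star (U_antipode P)"

lemma twisted_star_simps:
  "twisted_star (x + y) = twisted_star x + twisted_star y" "twisted_star (x * y) = twisted_star x * twisted_star y"
  "twisted_star (scalar c) = scalar (cnj c)"
  by (simp_all add: twisted_star_def star_extension_simps id_extension_simps)

lemma U_minus: "x \<in> W \<Longrightarrow> U g (- x) = - U g x"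
  using U_scaleR[of x g "- 1"] by simp

lemma twisted_star_gen:
  "x \<in> W \<Longrightarrow> urep.act (twisted_star (free_gen g)) (conjugation (U U_k x)) = conjugation (U U_k (U g x))"
  using q0
  by (cases g) (simp_all add: twisted_star_def star_extension_simps id_extension_simps urep.act_simps
    U_in_W conjugation_in_W conjugation_U U_rewrites U_scaleR conjugation_scaleR scaleR_scaleC U_scale U_minus
    conjugation_scale conjugation_minus qi_def)

lemma twisted_star_intertwines:
  "x \<in> W \<Longrightarrow> urep.act (twisted_star P) (conjugation (U U_k x)) = conjugation (U U_k (urep.act P x))"
proof (induction P arbitrary: x rule: free_algebra_induct)
  case (mult P R)
  then show ?case by (simp add: twisted_star_simps urep.act_mult urep.act_V U_in_W conjugation_in_W)
qed (simp_all add: twisted_star_gen twisted_star_simps urep.act_simps urep.act_V U_add U_scale conjugation_add conjugation_scale)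

lemma commutes_with_urep:
  assumes "W_operator f" "\<And>g. \<forall>x\<in>W. f (U g x) = U g (f x)" "x \<in> W"
  shows "f (urep.act P x) = urep.act P (f x)"
  using assms(3)
proof (induction P arbitrary: x rule: free_algebra_induct)
  case (mult P R)
  then show ?case using W_operator_D[OF assms(1)] by (simp add: urep.act_mult urep.act_V)
qed (use assms(2) W_operator_D[OF assms(1)] in \<open>simp_all add: urep.act_simps urep.act_V\<close>)

lemma W_operator_wmap: "(\<And>p. p \<in> spin_labels \<Longrightarrow> \<sigma> p \<in> spin_labels) \<Longrightarrow> W_operator (wmap c \<sigma>)"
  by (auto simp: W_operator_def wmap_def on_basis_add on_basis_scale intro!: on_basis_in_W)

lemma wmap_dirac_w: "wmap (dirac_weight c1 c2) flip (w a b N) = (c1 * (of_int (a + b) / 2) + c2) *\<^sub>R w a b (- N)"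
proof (cases "lab a b N \<in> spin_labels")
  case True
  then show ?thesis using wmap_bv[OF True] by (simp add: w_def) (simp add: lab_def flip_def)
next
  case False
  then have "lab a b (- N) \<notin> spin_labels" by (auto simp: lab_iff)
  then show ?thesis using False by (simp add: w_def bv_outside wmap_def)
qed

lemma grading_w: "grading (w a b N) = sgn N *\<^sub>R w a b N"
proof (cases "lab a b N \<in> spin_labels")
  case True
  then show ?thesis using wmap_bv[OF True] by (simp add: w_def grading_eq) (simp add: lab_def)
next
  case False
  then show ?thesis by (simp add: w_def bv_outside wmap_def grading_eq)
qed

lemma equivariant_podles: "equivariant q t (spinor_rep q t) (dirac c1 c2) conjugation grading"
proof -
  define T where "T = wmap (dirac_weight c1 c2) flip"
  have D: "W_operator T" unfolding T_def
    by (rule W_operator_wmap) (simp add: label_involution_iff[OF label_involution_flip])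
  have DU: "\<forall>x\<in>W. T (U g x) = U g (T x)" for g
  proof (rule W_operator_eqI)
    show "W_operator (\<lambda>x. T (U g x))" by (rule W_operator_comp[OF D]) (intro W_intros)
    show "W_operator (\<lambda>x. U g (T x))" by (rule W_operator_U[OF D])
    show "T (U g (w a b N)) = U g (T (w a b N))" for a b N
      by (cases g) (simp_all add: U_w W_operator_D(4)[OF D] wmap_dirac_w[of c1 c2, folded T_def] U_scaleR mult.commute)
  qed
  have G: "W_operator grading" unfolding grading_eq by (rule W_operator_wmap) simp
  have GU: "\<forall>x\<in>W. grading (U g x) = U g (grading x)" for g
  proof (rule W_operator_eqI)
    show "W_operator (\<lambda>x. grading (U g x))" by (rule W_operator_comp[OF G]) (intro W_intros)
    show "W_operator (\<lambda>x. U g (grading x))" by (rule W_operator_U[OF G])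
    show "grading (U g (w a b N)) = U g (grading (w a b N))" for a b N
      by (cases g) (simp_all add: U_w W_operator_D(4)[OF G] grading_w U_scaleR mult.commute)
  qed
  have dirac: "x \<in> W \<Longrightarrow> (x, T x) \<in> dirac c1 c2" for x
    unfolding dirac_eq T_def by (intro wmap_in_permutation_graph label_involution_flip dirac_weight_flip)
  show ?thesis
    unfolding equivariant_def
  proof (intro conjI ballI)
    fix a \<xi> assume "a \<in> carrier (quantum_sphere q t)" "\<xi> \<in> W"
    then show "spinor_rep q t a \<xi> \<in> W" by (auto simp: sphere_simps spinor_rep_cls act_in_W)
  next
    fix h a \<xi> assume "h \<in> carrier (Uq_su2 q)" "a \<in> carrier (quantum_sphere q t)" and \<xi>: "\<xi> \<in> W"
    then obtain P p where *: "h = cls UI P" "a = cls SI p" by (auto simp: sphere_simps Uq_simps)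
    show "spinor_act q h (spinor_rep q t a \<xi>) = sweedler q h (\<lambda>h1 h2. spinor_rep q t (sphere_act q t h1 a) (spinor_act q h2 \<xi>))"
      unfolding * sweedler_pairing[OF \<xi>] by (simp add: spinor_rep_cls spinor_act_cls act_in_W \<xi>)
  next
    fix \<xi> assume \<xi>: "\<xi> \<in> W"
    show "\<exists>\<eta>\<in>W. (\<xi>, \<eta>) \<in> dirac c1 c2
        \<and> (\<forall>h\<in>carrier (Uq_su2 q). (spinor_act q h \<xi>, spinor_act q h \<eta>) \<in> dirac c1 c2)"
    proof (intro bexI conjI ballI)
      show 1: "T \<xi> \<in> W" using W_operator_D[OF D \<xi>] by simp
      show "(\<xi>, T \<xi>) \<in> dirac c1 c2" by (rule dirac[OF \<xi>])
      fix h assume "h \<in> carrier (Uq_su2 q)"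
      then obtain P where "h = cls UI P" by (auto simp: Uq_simps)
      then show "(spinor_act q h \<xi>, spinor_act q h (T \<xi>)) \<in> dirac c1 c2"
        using dirac[of "urep.act P \<xi>"] \<xi> 1 by (simp add: spinor_act_cls urep.act_V commutes_with_urep[OF D DU])
    qed
  next
    fix \<xi> assume \<xi>: "\<xi> \<in> W"
    show 1: "grading \<xi> \<in> W" using W_operator_D[OF G \<xi>] by simp
    fix h assume "h \<in> carrier (Uq_su2 q)"
    then obtain P where "h = cls UI P" by (auto simp: Uq_simps)
    then show "grading (spinor_act q h \<xi>) = spinor_act q h (grading \<xi>)"
      using \<xi> 1 by (simp add: spinor_act_cls commutes_with_urep[OF G GU])
  next
    fix \<xi> assume "\<xi> \<in> W"
    then show "conjugation \<xi> \<in> W" by (rule conjugation_in_W)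
  next
    show "\<exists>T. closed_antilinear T \<and> antiunitary_part T conjugation
      \<and> (\<forall>\<xi>\<in>W. \<exists>\<eta>\<in>W. (\<xi>, \<eta>) \<in> T \<and> (\<forall>h\<in>carrier (Uq_su2 q).
        (spinor_act q h \<xi>, spinor_act q (cstar (Uq_su2 q) (antipode q h)) \<eta>) \<in> T))"
    proof (intro exI conjI ballI)
      show "closed_antilinear (T_graph q)" "antiunitary_part (T_graph q) conjugation"
        using closed_antilinear_T[OF q0] antiunitary_part_T[OF q0] .
      fix \<xi> assume \<xi>: "\<xi> \<in> W"
      note TW = T_graph_W[OF q0, unfolded modular_U_k]
      show "\<exists>\<eta>\<in>W. (\<xi>, \<eta>) \<in> T_graph q \<and> (\<forall>h\<in>carrier (Uq_su2 q).
        (spinor_act q h \<xi>, spinor_act q (cstar (Uq_su2 q) (antipode q h)) \<eta>) \<in> T_graph q)"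
      proof (intro bexI[of _ "conjugation (U U_k \<xi>)"] conjI ballI)
        show "(\<xi>, conjugation (U U_k \<xi>)) \<in> T_graph q" by (rule TW[OF \<xi>])
        show 1: "conjugation (U U_k \<xi>) \<in> W" using \<xi> by (simp add: conjugation_in_W U_in_W)
        fix h assume "h \<in> carrier (Uq_su2 q)"
        then obtain P where h: "h = cls UI P" by (auto simp: Uq_simps)
        show "(spinor_act q h \<xi>, spinor_act q (cstar (Uq_su2 q) (antipode q h)) (conjugation (U U_k \<xi>))) \<in> T_graph q"
        unfolding h antipode_cls Uq_star twisted_star_def[symmetric] spinor_act_cls[OF 1] spinor_act_cls[OF \<xi>] twisted_star_intertwines[OF \<xi>]
        by (rule TW) (simp add: urep.act_V \<xi>)
      qed
    qed
  qed
qed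

end

section \<open>Commutators modulo an operator ideal\<close>

definition commutes_modulo :: "'i op set \<Rightarrow> 'i op \<Rightarrow> 'i op \<Rightarrow> bool" where
  "commutes_modulo I S T \<longleftrightarrow> bounded_clinear S \<and> bounded_clinear T \<and> commutator S T \<in> I"

lemma commutes_modulo_swap:
  assumes "operator_ideal I" "commutes_modulo I S T"
  shows "commutes_modulo I T S"
proof -
  have "commutator T S = (\<lambda>x. (- 1) *\<^sub>C commutator S T x)" by (simp add: commutator_def)
  then show ?thesis using assms ideal_cmult[OF assms(1), of "commutator S T" "- 1"] by (simp add: commutes_modulo_def)
qed

lemma commutes_modulo_add:
  assumes "operator_ideal I" "commutes_modulo I S T" "commutes_modulo I S' T"
  shows "commutes_modulo I (\<lambda>x. S x + S' x) T"
proof -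
  have "commutator (\<lambda>x. S x + S' x) T = (\<lambda>x. commutator S T x + commutator S' T x)"
    using assms by (auto simp: commutator_def commutes_modulo_def bounded_clinear_add)
  then show ?thesis using assms ideal_plus[OF assms(1)] by (simp add: commutes_modulo_def bounded_clinear_plus)
qed

lemma commutes_modulo_scale:
  assumes "operator_ideal I" "commutes_modulo I S T"
  shows "commutes_modulo I (\<lambda>x. c *\<^sub>C S x) T"
proof -
  have "commutator (\<lambda>x. c *\<^sub>C S x) T = (\<lambda>x. c *\<^sub>C commutator S T x)"
    using assms by (auto simp: commutator_def commutes_modulo_def bounded_clinear_scale ell2.scale_right_diff_distrib)
  then show ?thesis using assms ideal_cmult[OF assms(1)] by (simp add: commutes_modulo_def bounded_clinear_cmult)
qed

lemma commutes_modulo_comp: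
  assumes I: "operator_ideal I" and *: "commutes_modulo I S T" "commutes_modulo I S' T"
  shows "commutes_modulo I (\<lambda>x. S (S' x)) T"
proof -
  have "commutator (\<lambda>x. S (S' x)) T = (\<lambda>x. S (commutator S' T x) + commutator S T (S' x))"
    using * by (auto simp: commutator_def commutes_modulo_def bounded_clinear_diff)
  moreover have "(\<lambda>x. S (commutator S' T x)) \<in> I" "(\<lambda>x. commutator S T (S' x)) \<in> I"
    using * ideal_left[OF I] ideal_right[OF I] by (auto simp: commutes_modulo_def)
  ultimately show ?thesis
    using * ideal_plus[OF I] bounded_clinear_comp[of S S'] by (simp add: commutes_modulo_def o_def)
qed

lemma commutes_modulo_id: "operator_ideal I \<Longrightarrow> bounded_clinear T \<Longrightarrow> commutes_modulo I (\<lambda>x. x) T"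
  using ideal_zero[of I] bounded_clinear_id by (simp add: commutes_modulo_def commutator_def id_def)

lemma commutes_modulo_zero: "operator_ideal I \<Longrightarrow> bounded_clinear T \<Longrightarrow> commutes_modulo I (\<lambda>x. 0) T"
  using ideal_zero[of I] bounded_clinear_0 by (simp add: commutes_modulo_def commutator_def bounded_clinear_zero)

section \<open>Reality\<close>

context podles
begin

subsection \<open>The opposite representation\<close>

definition opp :: "(spinor \<Rightarrow> spinor) \<Rightarrow> spinor \<Rightarrow> spinor" where
  "opp S = (\<lambda>v. - conjugation (S (conjugation v)))"

lemma opp_eq: "conjugation \<circ> S \<circ> inv_into UNIV conjugation = opp S" if "bounded_clinear S"
  using bounded_clinear_minus[OF that] by (auto simp: inv_conjugation opp_def conjugation_minus)

lemma bounded_clinear_opp: "bounded_clinear S \<Longrightarrow> bounded_clinear (opp S)"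
proof -
  assume S: "bounded_clinear S"
  obtain K where K: "\<And>x. norm (S x) \<le> K * norm x" using bounded_clinear_bounded[OF S] by blast
  show ?thesis
    by (rule bounded_clinearI[where K = K])
      (use K[of "conjugation _"] in \<open>simp_all add: opp_def conjugation_add conjugation_scale norm_conjugation
        bounded_clinear_add[OF S] bounded_clinear_scale[OF S]\<close>)
qed

lemma opp_simps:
  "opp (\<lambda>v. S v + S' v) = (\<lambda>v. opp S v + opp S' v)" "opp (\<lambda>v. c *\<^sub>C S v) = (\<lambda>v. cnj c *\<^sub>C opp S v)"
  "bounded_clinear S \<Longrightarrow> opp (\<lambda>v. S (S' v)) = (\<lambda>v. opp S (opp S' v))" "opp (\<lambda>v. v) = (\<lambda>v. v)"
  by (auto simp: opp_def conjugation_add conjugation_scale conjugation_square conjugation_minus bounded_clinear_minus)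

text \<open>How conjugation by J transforms weights: l + m and l - m are exchanged, the sign N is
  reversed, and \<open>k\<close> collects the phases.\<close>

definition mirror :: "real \<Rightarrow> (int \<Rightarrow> int \<Rightarrow> real \<Rightarrow> real) \<Rightarrow> int \<Rightarrow> int \<Rightarrow> real \<Rightarrow> real" where
  "mirror k c = (\<lambda>a b N. k * c b a (- N))"

lemma lab_swap: "lab b a (- N) \<in> spin_labels \<longleftrightarrow> lab a b N \<in> spin_labels"
  by (auto simp: lab_iff add.commute)

lemma bounded_clinear_mirror:
  assumes "good al j i c" "0 \<le> al"
  shows "bounded_clinear (iw (mirror k c) j i' 1)"
proof -
  obtain K where K: "weight_bounded (label_weight c) (shift (of_int j) (of_int i) 1) K"
    using good_bounded[OF assms, of 1] by auto
  obtain \<phi> \<kappa> C where *: "0 \<le> C"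
    "\<And>a b N. lab a b N \<in> spin_labels \<Longrightarrow> \<bar>c a b N - \<phi> a\<bar> \<le> C * lw al (a + b)"
    "\<And>a. \<bar>\<phi> a - \<kappa>\<bar> \<le> C * q powi a"
    using assms(1) unfolding good_def by metis
  have "\<bar>label_weight (mirror k c) p\<bar> \<le> \<bar>k\<bar> * (C + C + \<bar>\<kappa>\<bar>)" if "p \<in> spin_labels" for p
  proof -
    obtain a b N where p: "p = lab a b N" "0 \<le> a" "0 \<le> b" using label_cases[OF \<open>p \<in> spin_labels\<close>] by metis
    have l: "lab b a (- N) \<in> spin_labels" using that by (simp add: p lab_swap)
    have "C * lw al (b + a) \<le> C * 1" "C * q powi b \<le> C * 1"
      by (rule mult_left_mono[OF lw_le_1 *(1)] mult_left_mono[OF q_powi_le_1 *(1)]; use p assms(2) in simp)+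
    then have "\<bar>c b a (- N)\<bar> \<le> C + C + \<bar>\<kappa>\<bar>" using *(2)[OF l] *(3)[of b] by simp
    then show ?thesis by (simp add: p mirror_def abs_mult mult_left_mono)
  qed
  then have "weight_bounded (label_weight (mirror k c)) (shift (of_int j) (of_int i') 1) (\<bar>k\<bar> * (C + C + \<bar>\<kappa>\<bar>))"
    using *(1) unfolding weight_bounded_def by simp
  then show ?thesis unfolding iw_def using bounded_clinear_wmap[OF inverse_maps_shift'] by auto
qed

definition isign :: "int \<Rightarrow> real" where "isign i = (-1) powi i"

lemma sphase_shift: "sphase (a + i) (b - i) = isign i * sphase a b"
proof -
  have "of_int (a + i - (b - i)) / 2 + 1/2 = (of_int (a - b) / 2 + 1/2 :: real) + of_int i" by (simp add: field_simps)
  then have "sphase (a + i) (b - i) = (-1) powi (\<lfloor>of_int (a - b) / 2 + 1/2 :: real\<rfloor> + i)"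
    by (simp only: sphase_def floor_add_int)
  also have "\<dots> = sphase a b * isign i" unfolding sphase_def isign_def by (rule power_int_add) simp
  finally show ?thesis by simp
qed

text \<open>The conjugated generator changes m in the opposite direction. Its phases at source and
  target combine to a sign depending only on the change of m, so the weights remain of the form
  covered by \<open>mirror\<close>.\<close>

lemma opp_L: "opp (L x) = (\<lambda>v. iw (mirror (isign (idx x)) (cd x)) (- 1) (- idx x) 1 v
    + iw (mirror (isign (idx x)) (cm x)) 0 (- idx x) 1 v + iw (mirror (isign (idx x)) (cu x)) 1 (- idx x) 1 v)"
proof (rule bounded_clinear_eq_on_W)
  show "bounded_clinear (opp (L x))" by (rule bounded_clinear_opp[OF bounded_clinear_pi_gen])
  show "bounded_clinear (\<lambda>v. iw (mirror (isign (idx x)) (cd x)) (- 1) (- idx x) 1 v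
    + iw (mirror (isign (idx x)) (cm x)) 0 (- idx x) 1 v + iw (mirror (isign (idx x)) (cu x)) 1 (- idx x) 1 v)"
    by (intro bounded_clinear_plus bounded_clinear_mirror[OF good_coefficients(1) rate_bounds(1)]
      bounded_clinear_mirror[OF good_coefficients(2) rate_bounds(1)] bounded_clinear_mirror[OF good_coefficients(3) rate_bounds(1)])
  fix p assume "p \<in> spin_labels"
  then obtain a b N where p: "p = lab a b N" "odd (a + b)" by (metis label_cases)
  have l: "lab a b N \<in> spin_labels" using p \<open>p \<in> spin_labels\<close> by simp
  have s: "sphase a b * sphase (b + j + idx x) (a + j - idx x) = - isign (idx x)" for j
  proof -
    have d: "b + j + idx x - (a + j - idx x) = b + idx x - (a - idx x)" by simp
    have "sphase (b + j + idx x) (a + j - idx x) = sphase (b + idx x) (a - idx x)"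
      unfolding sphase_def d ..
    also have "\<dots> = isign (idx x) * sphase b a" by (rule sphase_shift)
    finally show ?thesis using sphase_swap[OF p(2)] by (metis mult.left_commute mult_minus_right mult.right_neutral)
  qed
  have "opp (L x) (w a b N) = - (sphase a b *\<^sub>R conjugation (cu x b a (- N) *\<^sub>R w (b + 1 + idx x) (a + 1 - idx x) (- N)
     + cm x b a (- N) *\<^sub>R w (b + idx x) (a - idx x) (- N) + cd x b a (- N) *\<^sub>R w (b - 1 + idx x) (a - 1 - idx x) (- N)))"
    unfolding opp_def conjugation_w L_linear pi_gen_w conjugation_scaleR ..
  also have "\<dots> = (- (sphase a b * sphase (b + 1 + idx x) (a + 1 - idx x)) * cu x b a (- N)) *\<^sub>R w (a + 1 - idx x) (b + 1 + idx x) N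
     + (- (sphase a b * sphase (b + 0 + idx x) (a + 0 - idx x)) * cm x b a (- N)) *\<^sub>R w (a - idx x) (b + idx x) N
     + (- (sphase a b * sphase (b + - 1 + idx x) (a + - 1 - idx x)) * cd x b a (- N)) *\<^sub>R w (a - 1 - idx x) (b - 1 + idx x) N"
    by (simp add: conjugation_add conjugation_scaleR conjugation_w scaleR_add_right mult_ac)
  finally show "opp (L x) (bv p) = iw (mirror (isign (idx x)) (cd x)) (- 1) (- idx x) 1 (bv p)
    + iw (mirror (isign (idx x)) (cm x)) 0 (- idx x) 1 (bv p) + iw (mirror (isign (idx x)) (cu x)) 1 (- idx x) 1 (bv p)"
    unfolding s p w_def[symmetric] iw_w[OF l] by (simp add: mirror_def)
qed

subsection \<open>Commutators of weighted shifts\<close>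

context
  fixes al :: real
  assumes al: "0 < al" "al \<le> 2"
begin

abbreviation "LI \<equiv> operator_ideal hull {L_pow q al}"

lemma LI: "operator_ideal LI"
  by (rule L_ideal[OF q0 q1 al(1)])

text \<open>Both orders of the product are first compared with products of the limit functions, with
  errors O(q^(al l)). The limit products differ by O(q^a q^b), because a nonzero constant limit
  occurs only where the argument of the other factor is not shifted.\<close>

lemma commutator_estimate:
  fixes f h :: "int \<Rightarrow> int \<Rightarrow> real \<Rightarrow> real"
  assumes f: "good al j i f" and h: "good al j' i' h" and s: "s \<in> {1, - 1}"
  shows "\<exists>C\<ge>0. \<forall>a b N. lab a b N \<in> spin_labels \<longrightarrow>
    \<bar>h b a (- N) * f (a + j' - i') (b + j' + i') N - f a b N * h (b + j - i) (a + j + i) (- (s * N))\<bar> \<le> C * lw al (a + b)"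
proof -
  obtain \<phi> \<kappa> C where f: "0 \<le> C"
    "\<And>a b N. lab a b N \<in> spin_labels \<Longrightarrow> \<bar>f a b N - \<phi> a\<bar> \<le> C * lw al (a + b)"
    "\<And>a. \<bar>\<phi> a - \<kappa>\<bar> \<le> C * q powi a" "j \<noteq> i \<Longrightarrow> \<kappa> = 0"
    "\<And>a b N. lab a b N \<in> spin_labels \<Longrightarrow> lab (a + j + i) (b + j - i) N \<notin> spin_labels \<Longrightarrow> f a b N = 0"
    using f unfolding good_def by metis
  obtain \<psi> \<nu> C' where h: "0 \<le> C'"
    "\<And>a b N. lab a b N \<in> spin_labels \<Longrightarrow> \<bar>h a b N - \<psi> a\<bar> \<le> C' * lw al (a + b)"
    "\<And>a. \<bar>\<psi> a - \<nu>\<bar> \<le> C' * q powi a" "j' \<noteq> i' \<Longrightarrow> \<nu> = 0"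
    "\<And>a b N. lab a b N \<in> spin_labels \<Longrightarrow> lab (a + j' + i') (b + j' - i') N \<notin> spin_labels \<Longrightarrow> h a b N = 0"
    using h unfolding good_def by metis
  define K where "K = \<bar>\<kappa>\<bar> + C * (1 + q powi (j' - i'))"
  define K' where "K' = \<bar>\<nu>\<bar> + C' * (1 + q powi (j - i))"
  have K: "0 \<le> K" "0 \<le> K'" using f(1) h(1) q_powi_pos[of "j' - i'"] q_powi_pos[of "j - i"] by (auto simp: K_def K'_def)
  have \<phi>: "\<bar>\<phi> a\<bar> \<le> K" "\<bar>\<phi> (a + (j' - i'))\<bar> \<le> K" if "0 \<le> a" for a
  proof -
    have e: "C * q powi a \<le> C * 1" "C * q powi (a + (j' - i')) \<le> C * (1 * q powi (j' - i'))"
    proof -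
      show "C * q powi a \<le> C * 1" using f(1) q_powi_le_1[OF that] by (rule mult_left_mono[rotated])
      have "q powi (a + (j' - i')) = q powi a * q powi (j' - i')" by (rule power_int_add) (use q0 in simp)
      also have "\<dots> \<le> 1 * q powi (j' - i')" using q_powi_le_1[OF that] q_powi_pos[of "j' - i'"] by (intro mult_right_mono) auto
      finally show "C * q powi (a + (j' - i')) \<le> C * (1 * q powi (j' - i'))" using f(1) by (rule mult_left_mono)
    qed
    have "0 \<le> C * q powi (j' - i')" using f(1) q_powi_pos[of "j' - i'"] by simp
    then show "\<bar>\<phi> a\<bar> \<le> K" "\<bar>\<phi> (a + (j' - i'))\<bar> \<le> K"
      using f(3)[of a] f(3)[of "a + (j' - i')"] e f(1) by (auto simp: K_def distrib_left)
  qed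
  have \<psi>: "\<bar>\<psi> a\<bar> \<le> K'" "\<bar>\<psi> (a + (j - i))\<bar> \<le> K'" if "0 \<le> a" for a
  proof -
    have e: "C' * q powi a \<le> C' * 1" "C' * q powi (a + (j - i)) \<le> C' * (1 * q powi (j - i))"
    proof -
      show "C' * q powi a \<le> C' * 1" using h(1) q_powi_le_1[OF that] by (rule mult_left_mono[rotated])
      have "q powi (a + (j - i)) = q powi a * q powi (j - i)" by (rule power_int_add) (use q0 in simp)
      also have "\<dots> \<le> 1 * q powi (j - i)" using q_powi_le_1[OF that] q_powi_pos[of "j - i"] by (intro mult_right_mono) auto
      finally show "C' * q powi (a + (j - i)) \<le> C' * (1 * q powi (j - i))" using h(1) by (rule mult_left_mono)
    qed
    have "0 \<le> C' * q powi (j - i)" using h(1) q_powi_pos[of "j - i"] by simp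
    then show "\<bar>\<psi> a\<bar> \<le> K'" "\<bar>\<psi> (a + (j - i))\<bar> \<le> K'"
      using h(3)[of a] h(3)[of "a + (j - i)"] e h(1) by (auto simp: K'_def distrib_left)
  qed
  text \<open>The alternative \<open>x = 0\<close> covers paths through a label that does not exist.\<close>
  have product: "\<bar>x * y - x' * y'\<bar> \<le> (M * (c' * k') + M * c + c * (c' * k')) * W"
    if "\<bar>x - x'\<bar> \<le> c * W" "\<bar>y - y'\<bar> \<le> c' * (k' * W) \<or> x = 0" "\<bar>x'\<bar> \<le> M" "\<bar>y'\<bar> \<le> M" "0 \<le> c" "0 \<le> c'" "0 \<le> k'" "0 \<le> W" "W \<le> 1" "0 \<le> M"
    for x y x' y' c c' k' W M :: real
    using that(2)
  proof
    assume y: "\<bar>y - y'\<bar> \<le> c' * (k' * W)"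
    have "x * y - x' * y' = (x - x') * y' + x' * (y - y') + (x - x') * (y - y')" by (simp add: algebra_simps)
    then have "\<bar>x * y - x' * y'\<bar> \<le> \<bar>x - x'\<bar> * \<bar>y'\<bar> + \<bar>x'\<bar> * \<bar>y - y'\<bar> + \<bar>x - x'\<bar> * \<bar>y - y'\<bar>"
      using abs_triangle_ineq[of "(x - x') * y'" "x' * (y - y')"]
        abs_triangle_ineq[of "(x - x') * y' + x' * (y - y')" "(x - x') * (y - y')"] by (simp only: abs_mult)
    also have "\<dots> \<le> c * W * M + M * (c' * (k' * W)) + c * 1 * (c' * (k' * W))"
    proof (intro add_mono mult_mono)
      have "c * W \<le> c * 1" using that by (intro mult_left_mono)
      then show "\<bar>x - x'\<bar> \<le> c * 1" using that(1) by linarith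
    qed (use that y in auto)
    finally show ?thesis by (simp add: algebra_simps)
  next
    assume x: "x = 0"
    have "\<bar>x * y - x' * y'\<bar> = \<bar>x'\<bar> * \<bar>y'\<bar>" by (simp add: x abs_mult)
    also have "\<dots> \<le> c * W * M" using that by (intro mult_mono) (auto simp: x)
    also have "\<dots> \<le> (M * (c' * k') + M * c + c * (c' * k')) * W"
      using that by (simp add: algebra_simps add_nonneg_nonneg)
    finally show ?thesis .
  qed
  define M where "M = K + K'"
  \<comment> \<open>The intermediate label has a + b changed by \<open>2 * j'\<close>, respectively
    \<open>2 * j\<close>; these factors convert the error there to the error at the source.\<close>
  define k1 where "k1 = lw al (2 * j')"
  define k2 where "k2 = lw al (2 * j)"
  define G where "G = M * (C * k1) + M * C' + C' * (C * k1) + (M * (C' * k2) + M * C + C * (C' * k2)) + C * C' * (q powi (j' - i') + q powi (j - i))"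
  have kp: "0 \<le> k1" "0 \<le> k2" "0 \<le> M" using lw_pos[of al] K by (auto simp: k1_def k2_def M_def less_imp_le)
  have "\<bar>h b a (- N) * f (a + j' - i') (b + j' + i') N - f a b N * h (b + j - i) (a + j + i) (- (s * N))\<bar> \<le> G * lw al (a + b)"
    if l: "lab a b N \<in> spin_labels" for a b N
  proof -
    have ab: "0 \<le> a" "0 \<le> b" using l by (simp_all add: lab_iff)
    define V where "V = lw al (a + b)"
    have V: "0 \<le> V" "V \<le> 1" using lw_pos[of al "a + b"] lw_le_1[of al "a + b"] al ab by (auto simp: V_def)
    have l': "lab b a (- N) \<in> spin_labels" using l by (simp add: lab_swap)
    have sum: "a + j' - i' + (b + j' + i') = a + b + 2 * j'" "b + j - i + (a + j + i) = a + b + 2 * j" by simp_all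
    have 1: "\<bar>h b a (- N) * f (a + j' - i') (b + j' + i') N - \<psi> b * \<phi> (a + (j' - i'))\<bar>
        \<le> (M * (C * k1) + M * C' + C' * (C * k1)) * V"
    proof (rule product)
      show "\<bar>h b a (- N) - \<psi> b\<bar> \<le> C' * V" using h(2)[OF l'] by (simp add: V_def add.commute)
      show "\<bar>f (a + j' - i') (b + j' + i') N - \<phi> (a + (j' - i'))\<bar> \<le> C * (k1 * V) \<or> h b a (- N) = 0"
      proof (cases "lab (a + j' - i') (b + j' + i') N \<in> spin_labels")
        case True
        from f(2)[OF this] show ?thesis unfolding sum lw_add[of al "a + b"] by (simp add: k1_def V_def mult_ac add_diff_eq)
      next
        case False
        then have "lab (b + j' + i') (a + j' - i') (- N) \<notin> spin_labels" by (simp add: lab_swap)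
        then show ?thesis using h(5)[OF l'] by simp
      qed
      show "\<bar>\<psi> b\<bar> \<le> M" "\<bar>\<phi> (a + (j' - i'))\<bar> \<le> M" using \<psi>[OF ab(2)] \<phi>[OF ab(1)] K by (auto simp: M_def)
    qed (use f(1) h(1) V kp in auto)
    have 2: "\<bar>f a b N * h (b + j - i) (a + j + i) (- (s * N)) - \<phi> a * \<psi> (b + (j - i))\<bar>
        \<le> (M * (C' * k2) + M * C + C * (C' * k2)) * V"
    proof (rule product)
      show "\<bar>f a b N - \<phi> a\<bar> \<le> C * V" using f(2)[OF l] by (simp add: V_def)
      show "\<bar>h (b + j - i) (a + j + i) (- (s * N)) - \<psi> (b + (j - i))\<bar> \<le> C' * (k2 * V) \<or> f a b N = 0"
      proof (cases "lab (a + j + i) (b + j - i) N \<in> spin_labels")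
        case True
        then have "lab (b + j - i) (a + j + i) (- (s * N)) \<in> spin_labels" using s by (simp add: lab_swap lab_flip_iff del: insert_iff)
        from h(2)[OF this] show ?thesis unfolding sum lw_add[of al "a + b"] by (simp add: k2_def V_def mult_ac add_diff_eq)
      next
        case False
        then show ?thesis using f(5)[OF l] by simp
      qed
      show "\<bar>\<phi> a\<bar> \<le> M" "\<bar>\<psi> (b + (j - i))\<bar> \<le> M" using \<psi>[OF ab(2)] \<phi>[OF ab(1)] K by (auto simp: M_def)
    qed (use f(1) h(1) V kp in auto)
    have 3: "\<bar>\<psi> b * \<phi> (a + (j' - i')) - \<phi> a * \<psi> (b + (j - i))\<bar> \<le> C * C' * (q powi (j' - i') + q powi (j - i)) * V"
    proof -
      have "\<nu> * (\<phi> (a + (j' - i')) - \<phi> a) = 0" using h(4) by (cases "j' = i'") auto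
      moreover have "\<kappa> * (\<psi> b - \<psi> (b + (j - i))) = 0" using f(4) by (cases "j = i") auto
      \<comment> \<open>Subtracting the limits from both factors leaves two products of decaying
        terms and two corrections, which are the vanishing expressions just established.\<close>
      moreover have "p * f1 - f0 * p1 = (p - v) * (f1 - k) - (f0 - k) * (p1 - v) + v * (f1 - f0) + k * (p - p1)" for p f1 f0 p1 v k :: real
        by (simp add: algebra_simps)
      ultimately have e: "\<psi> b * \<phi> (a + (j' - i')) - \<phi> a * \<psi> (b + (j - i))
        = (\<psi> b - \<nu>) * (\<phi> (a + (j' - i')) - \<kappa>) - (\<phi> a - \<kappa>) * (\<psi> (b + (j - i)) - \<nu>)"
        by (metis add.right_neutral)
      have "\<bar>(\<psi> b - \<nu>) * (\<phi> (a + (j' - i')) - \<kappa>)\<bar> \<le> (C' * q powi b) * (C * q powi (a + (j' - i')))"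
        unfolding abs_mult by (intro mult_mono f(3) h(3)) (use h(1) q_powi_pos[of b] in auto)
      moreover have "\<bar>(\<phi> a - \<kappa>) * (\<psi> (b + (j - i)) - \<nu>)\<bar> \<le> (C * q powi a) * (C' * q powi (b + (j - i)))"
        unfolding abs_mult by (intro mult_mono f(3) h(3)) (use f(1) q_powi_pos[of a] in auto)
      moreover have "(C' * q powi b) * (C * q powi (a + (j' - i'))) + (C * q powi a) * (C' * q powi (b + (j - i)))
        = C * C' * (q powi (j' - i') + q powi (j - i)) * q powi (a + b)"
      proof -
        have "q powi (a + (j' - i')) = q powi a * q powi (j' - i')" "q powi (b + (j - i)) = q powi b * q powi (j - i)"
        "q powi (a + b) = q powi a * q powi b" by (rule power_int_add; use q0 in simp)+
        then show ?thesis by (simp only: distrib_left distrib_right mult_ac)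
      qed
      moreover have "C * C' * (q powi (j' - i') + q powi (j - i)) * q powi (a + b) \<le> C * C' * (q powi (j' - i') + q powi (j - i)) * V"
        unfolding V_def using f(1) h(1) al ab q_powi_pos[of "j' - i'"] q_powi_pos[of "j - i"]
        by (intro mult_left_mono q_powi_le_lw) auto
      ultimately show ?thesis unfolding e by linarith
    qed
    show ?thesis using 1 2 3 unfolding V_def[symmetric] G_def distrib_right by linarith
  qed
  moreover have "0 \<le> G" unfolding G_def using kp f(1) h(1) q_powi_pos[of "j' - i'"] q_powi_pos[of "j - i"] by simp
  ultimately show ?thesis by blast
qed

text \<open>The commutator is itself a weighted shift, so the estimate of its weights suffices for
  membership in the ideal. If an intermediate label does not exist, the weight of that path is 0 by
  the last clause of \<open>good\<close>.\<close>

lemma commutes_modulo_iw: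
  assumes f: "good al j i f" and h: "good al j' i' h" and s: "s \<in> {1, - 1}"
  shows "commutes_modulo LI (iw f j i s) (iw (mirror k h) j' (- i') 1)"
proof -
  let ?F = "iw f j i s" and ?H = "iw (mirror k h) j' (- i') 1"
  define c where "c a b N = k * (h b a (- N) * f (a + j' - i') (b + j' + i') N - f a b N * h (b + j - i) (a + j + i) (- (s * N)))" for a b N
  obtain C where C: "0 \<le> C" "\<And>a b N. lab a b N \<in> spin_labels \<Longrightarrow>
    \<bar>h b a (- N) * f (a + j' - i') (b + j' + i') N - f a b N * h (b + j - i) (a + j + i) (- (s * N))\<bar> \<le> C * lw al (a + b)"
    using commutator_estimate[OF f h s] by metis
  have b: "bounded_clinear ?F" "bounded_clinear ?H"
    using bounded_clinear_iw[OF f _ s] bounded_clinear_mirror[OF h] al by auto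
  have cb: "\<bar>label_weight c p\<bar> \<le> (\<bar>k\<bar> * C) * L_weight q al p" if "p \<in> spin_labels" for p
  proof -
    obtain a b N where p: "p = lab a b N" using label_cases[OF \<open>p \<in> spin_labels\<close>] by metis
    show ?thesis using mult_left_mono[OF C(2)[of a b N], of "\<bar>k\<bar>"] that
      by (simp add: p c_def abs_mult lw_L_weight[symmetric] mult.assoc)
  qed
  have I: "iw c (j + j') (i - i') s \<in> LI"
    unfolding iw_def by (rule wmap_in_L_ideal[OF q0 q1 al(1) inverse_maps_shift'[OF s] cb]) (use C(1) in auto)
  have "commutator ?F ?H = iw c (j + j') (i - i') s"
  proof (rule bounded_clinear_eq_on_W)
    show "bounded_clinear (commutator ?F ?H)"
      unfolding commutator_def using bounded_clinear_minus'[OF bounded_clinear_comp[OF b] bounded_clinear_comp[OF b(2) b(1)]]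
      by (simp add: o_def)
    show "bounded_clinear (iw c (j + j') (i - i') s)" using ideal_bounded[OF LI I] .
    fix p assume p0: "p \<in> spin_labels"
    then obtain a b N where p: "p = lab a b N" by (metis label_cases)
    have l: "lab a b N \<in> spin_labels" using p0 p by simp
    let ?t = "w (a + (j + j') + (i - i')) (b + (j + j') - (i - i')) (s * N)"
    have 1: "?F (?H (w a b N)) = (k * (h b a (- N) * f (a + j' - i') (b + j' + i') N)) *\<^sub>R ?t"
    proof (cases "lab (a + j' - i') (b + j' + i') N \<in> spin_labels")
      case True
      have e: "a + j' - i' + j + i = a + (j + j') + (i - i')" "b + j' + i' + j - i = b + (j + j') - (i - i')" by simp_all
      show ?thesis using bounded_clinear_scale[OF b(1)] iw_w[OF l, of "mirror k h" j' "- i'" 1] iw_w[OF True, of f j i s]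
        unfolding e by (simp add: mirror_def scaleR_scaleC)
    next
      case False
      then have "h b a (- N) = 0"
        using good_def[THEN iffD1, OF h] l by (metis lab_swap)
      then show ?thesis using iw_w[OF l, of "mirror k h" j' "- i'" 1] bounded_clinear_zero[OF b(1)] by (simp add: mirror_def)
    qed
    have 2: "?H (?F (w a b N)) = (k * (f a b N * h (b + j - i) (a + j + i) (- (s * N)))) *\<^sub>R ?t"
    proof (cases "lab (a + j + i) (b + j - i) (s * N) \<in> spin_labels")
      case True
      have e: "a + j + i + j' + - i' = a + (j + j') + (i - i')" "b + j - i + j' - - i' = b + (j + j') - (i - i')" by simp_all
      show ?thesis using bounded_clinear_scale[OF b(2)] iw_w[OF l, of f j i s] iw_w[OF True, of "mirror k h" j' "- i'" 1]
        unfolding e by (simp add: mirror_def scaleR_scaleC mult_ac)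
    next
      case False
      then have "f a b N = 0"
        using good_def[THEN iffD1, OF f] l lab_flip_iff[OF s] by metis
      then show ?thesis using iw_w[OF l, of f j i s] bounded_clinear_zero[OF b(2)] by simp
    qed
    show "commutator ?F ?H (bv p) = iw c (j + j') (i - i') s (bv p)"
      unfolding p w_def[symmetric] commutator_def 1 2 unfolding iw_w[OF l] c_def by (simp add: algebra_simps)
  qed
  then show ?thesis using b I by (simp add: commutes_modulo_def)
qed

end

section \<open>Commutators with the Dirac operator\<close>

lemma good_mono: "good al j i c \<Longrightarrow> al' \<le> al \<Longrightarrow> good al' j i c"
proof -
  assume "good al j i c" and al: "al' \<le> al"
  then obtain \<phi> \<kappa> C where *: "0 \<le> C"
    "\<And>a b N. lab a b N \<in> spin_labels \<Longrightarrow> \<bar>c a b N - \<phi> a\<bar> \<le> C * lw al (a + b)"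
    "\<And>a. \<bar>\<phi> a - \<kappa>\<bar> \<le> C * q powi a" "j \<noteq> i \<longrightarrow> \<kappa> = 0"
    "\<And>a b N. lab a b N \<in> spin_labels \<Longrightarrow> lab (a + j + i) (b + j - i) N \<notin> spin_labels \<Longrightarrow> c a b N = 0"
    unfolding good_def by metis
  have "\<bar>c a b N - \<phi> a\<bar> \<le> C * lw al' (a + b)" if l: "lab a b N \<in> spin_labels" for a b N
  proof -
    have "C * lw al (a + b) \<le> C * lw al' (a + b)"
      by (rule mult_left_mono[OF lw_antimono[OF al] *(1)]) (use l in \<open>simp add: lab_iff\<close>)
    then show ?thesis using *(2)[OF l] by linarith
  qed
  then show "good al' j i c" unfolding good_def using * by blast
qed

text \<open>Absorbs the factor l contributed by D at the price of an arbitrarily small loss in the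
  exponent; this is why the exponent must be strictly below \<open>rate\<close>. The bound comes
  from x \<le> exp x.\<close>

lemma linear_decay:
  assumes "0 < \<delta>"
  shows "\<exists>M\<ge>0. \<forall>n\<ge>0. of_int n * lw \<delta> n \<le> M"
proof -
  define c where "c = \<delta> / 2 * - ln q"
  have c: "0 < c" using assms q0 q1 by (simp add: c_def mult_pos_neg)
  have "of_int n * lw \<delta> n \<le> 1 / c" if "0 \<le> n" for n
  proof -
    have l: "lw \<delta> n = exp (- (c * of_int n))" using q0 by (simp add: lw_def powr_def c_def)
    have "c * of_int n \<le> exp (c * of_int n)" using exp_ge_add_one_self[of "c * of_int n"] by linarith
    then have "c * of_int n * exp (- (c * of_int n)) \<le> exp (c * of_int n) * exp (- (c * of_int n))"
      by (intro mult_right_mono) auto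
    then have "c * (of_int n * lw \<delta> n) \<le> 1" unfolding l by (simp add: exp_minus mult.assoc)
    then show ?thesis using c by (simp add: pos_le_divide_eq mult.commute)
  qed
  then show ?thesis using c by (intro exI[of _ "1 / c"]) auto
qed

context
  fixes c1 c2 :: real
begin

text \<open>The weight of the part of [D, x] that changes l by \<open>j\<close>. In D x the
  eigenvalue is taken at l + j and the weight at N; in x D the sign is flipped first, so the
  eigenvalue is taken at l and the weight at -N.\<close>

definition dcoef :: "int \<Rightarrow> (int \<Rightarrow> int \<Rightarrow> real \<Rightarrow> real) \<Rightarrow> int \<Rightarrow> int \<Rightarrow> real \<Rightarrow> real" where
  "dcoef j c = (\<lambda>a b N. (c1 * (of_int (a + b) / 2 + of_int j) + c2) * c a b N - (c1 * (of_int (a + b) / 2) + c2) * c a b (- N))"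

text \<open>The growing part is l times the difference of the weights at N and -N. Both have the
  same limit \<open>\<phi>\<close>, so this is l times an exponentially small error, and the limit
  of the commutator weights is c1 j \<open>\<phi>\<close>.\<close>

lemma good_dirac:
  assumes "good al' j i c" "al < al'"
  shows "good al j i (dcoef j c)"
proof -
  obtain \<phi> \<kappa> C where *: "0 \<le> C"
    "\<And>a b N. lab a b N \<in> spin_labels \<Longrightarrow> \<bar>c a b N - \<phi> a\<bar> \<le> C * lw al' (a + b)"
    "\<And>a. \<bar>\<phi> a - \<kappa>\<bar> \<le> C * q powi a" "j \<noteq> i \<longrightarrow> \<kappa> = 0"
    "\<And>a b N. lab a b N \<in> spin_labels \<Longrightarrow> lab (a + j + i) (b + j - i) N \<notin> spin_labels \<Longrightarrow> c a b N = 0"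
    using assms(1) unfolding good_def by metis
  have fl: "lab a b (- N) \<in> spin_labels \<longleftrightarrow> lab a b N \<in> spin_labels" for a b N by (auto simp: lab_iff)
  obtain M where M: "0 \<le> M" "\<And>n. 0 \<le> n \<Longrightarrow> of_int n * lw (al' - al) n \<le> M"
    using linear_decay[of "al' - al"] assms(2) by auto
  define k where "k = \<bar>c1 * of_int j\<bar>"
  define G where "G = C * (k + 2 * \<bar>c2\<bar> + \<bar>c1\<bar> * M) + k * C"
  have G: "C * (k + 2 * \<bar>c2\<bar> + \<bar>c1\<bar> * M) \<le> G" "k * C \<le> G" "0 \<le> G"
    using *(1) M(1) by (simp_all add: G_def k_def)
  have "\<bar>dcoef j c a b N - c1 * of_int j * \<phi> a\<bar> \<le> G * lw al (a + b)" if l: "lab a b N \<in> spin_labels" for a b N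
  proof -
    have n: "0 \<le> a + b" using l by (simp add: lab_iff)
    define y where "y = c1 * (of_int (a + b) / 2) + c2"
    define V where "V = lw al' (a + b)"
    have V: "0 \<le> V" using lw_pos[of al'] by (simp add: V_def less_imp_le)
    have 1: "\<bar>c a b N - \<phi> a\<bar> \<le> C * V" "\<bar>c a b (- N) - \<phi> a\<bar> \<le> C * V"
      using *(2)[OF l] *(2)[of a b "- N"] l by (simp_all add: fl V_def)
    have "(c1 * (h + k) + c2) * A - (c1 * h + c2) * A' - c1 * k * f = c1 * k * (A - f) + (c1 * h + c2) * ((A - f) - (A' - f))"
      for h k A A' f :: real by (simp add: algebra_simps)
    then have "dcoef j c a b N - c1 * of_int j * \<phi> a = c1 * of_int j * (c a b N - \<phi> a) + y * ((c a b N - \<phi> a) - (c a b (- N) - \<phi> a))"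
      unfolding dcoef_def y_def .
    also have "\<bar>\<dots>\<bar> \<le> k * \<bar>c a b N - \<phi> a\<bar> + \<bar>y\<bar> * (\<bar>c a b N - \<phi> a\<bar> + \<bar>c a b (- N) - \<phi> a\<bar>)"
      unfolding k_def abs_mult[symmetric]
      by (rule order.trans[OF abs_triangle_ineq]) (auto simp: abs_mult intro!: mult_left_mono)
    also have "\<dots> \<le> k * (C * V) + (\<bar>c1\<bar> * (of_int (a + b) / 2) + \<bar>c2\<bar>) * (C * V + C * V)"
    proof (intro add_mono mult_mono 1)
      have "\<bar>c1 * (of_int (a + b) / 2)\<bar> = \<bar>c1\<bar> * (of_int (a + b) / 2)" using n by (simp add: abs_mult)
      then show "\<bar>y\<bar> \<le> \<bar>c1\<bar> * (of_int (a + b) / 2) + \<bar>c2\<bar>"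
        unfolding y_def using abs_triangle_ineq[of "c1 * (of_int (a + b) / 2)" c2] by linarith
      then show "0 \<le> \<bar>c1\<bar> * (of_int (a + b) / 2) + \<bar>c2\<bar>" by linarith
    qed (simp_all add: k_def)
    also have "\<dots> = C * ((k + 2 * \<bar>c2\<bar>) * V + \<bar>c1\<bar> * (of_int (a + b) * V))"
      by (simp add: algebra_simps)
    also have "\<dots> \<le> C * ((k + 2 * \<bar>c2\<bar>) * lw al (a + b) + \<bar>c1\<bar> * (M * lw al (a + b)))"
    proof (intro mult_left_mono add_mono *(1))
      show "V \<le> lw al (a + b)" unfolding V_def by (rule lw_antimono) (use assms(2) n in auto)
      have "V = lw (al' - al) (a + b) * lw al (a + b)"
        unfolding V_def lw_def powr_add[symmetric] by (simp add: algebra_simps diff_divide_distrib add_divide_distrib)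
      then show "of_int (a + b) * V \<le> M * lw al (a + b)"
        using mult_right_mono[OF M(2)[OF n], of "lw al (a + b)"] lw_pos[of al "a + b"] by (simp add: mult.assoc)
    qed (simp_all add: k_def)
    also have "\<dots> = C * (k + 2 * \<bar>c2\<bar> + \<bar>c1\<bar> * M) * lw al (a + b)" by (simp add: algebra_simps)
    also have "\<dots> \<le> G * lw al (a + b)" using G(1) lw_pos[of al "a + b"] by (intro mult_right_mono) auto
    finally show ?thesis .
  qed
  moreover have "\<bar>c1 * of_int j * \<phi> a - c1 * of_int j * \<kappa>\<bar> \<le> G * q powi a" for a
  proof -
    have "\<bar>c1 * of_int j * \<phi> a - c1 * of_int j * \<kappa>\<bar> = k * \<bar>\<phi> a - \<kappa>\<bar>"
      unfolding k_def abs_mult[symmetric] right_diff_distrib ..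
    also have "\<dots> \<le> k * (C * q powi a)" using *(3) by (intro mult_left_mono) (simp_all add: k_def)
    also have "\<dots> \<le> G * q powi a" using G(2) q_powi_pos[of a] by (simp add: mult.assoc[symmetric] mult_right_mono)
    finally show ?thesis .
  qed
  moreover have "dcoef j c a b N = 0" if "lab a b N \<in> spin_labels" "lab (a + j + i) (b + j - i) N \<notin> spin_labels" for a b N
    using *(5)[OF that] *(5)[of a b "- N"] that by (simp add: dcoef_def fl)
  moreover have "j \<noteq> i \<longrightarrow> c1 * of_int j * \<kappa> = 0" using *(4) by simp
  ultimately show ?thesis
    unfolding good_def using G(3) by (intro exI[of _ "\<lambda>a. c1 * of_int j * \<phi> a"] exI[of _ "c1 * of_int j * \<kappa>"] exI[of _ G]) blast
qed

definition dirac_commutator :: "sphere_gen \<Rightarrow> spinor \<Rightarrow> spinor" where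
  "dirac_commutator x v = iw (dcoef (- 1) (cd x)) (- 1) (idx x) (- 1) v + iw (dcoef 0 (cm x)) 0 (idx x) (- 1) v
     + iw (dcoef 1 (cu x)) 1 (idx x) (- 1) v"

abbreviation "dirac_W \<equiv> wmap (dirac_weight c1 c2) flip"

lemma W_operator_iw: "W_operator (iw c j i s)"
  by (auto simp: W_operator_def iw_def wmap_def on_basis_add on_basis_scale intro!: on_basis_in_W)

lemma dirac_commutator_W: "\<forall>v\<in>W. dirac_W (L x v) = L x (dirac_W v) + dirac_commutator x v"
proof -
  define T where "T = dirac_W"
  have D: "W_operator T" unfolding T_def
    by (rule W_operator_wmap) (simp add: label_involution_iff[OF label_involution_flip])
  have Tw: "T (w a b N) = (c1 * (of_int (a + b) / 2) + c2) *\<^sub>R w a b (- N)" for a b N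
    unfolding T_def by (rule wmap_dirac_w)
  have "\<forall>v\<in>W. T (L x v) = L x (T v) + dirac_commutator x v"
  proof (rule W_operator_eqI)
    show "W_operator (\<lambda>v. T (L x v))" by (rule W_operator_comp[OF D]) (intro W_operator_L W_intros)
    show "W_operator (\<lambda>v. L x (T v) + dirac_commutator x v)"
      unfolding dirac_commutator_def by (intro W_intros W_operator_iw W_operator_L D)
    fix a b :: int and N :: real assume "0 \<le> a" "0 \<le> b" "odd (a + b)" "N \<in> {1/2, - 1/2}"
    then have l: "lab a b N \<in> spin_labels" by (simp add: lab_iff)
    have e: "of_int (a + 1 + idx x + (b + 1 - idx x)) / 2 = of_int (a + b) / 2 + (1 :: real)"
      "of_int (a - 1 + idx x + (b - 1 - idx x)) / 2 = of_int (a + b) / 2 + (- 1 :: real)"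
      "a + idx x + (b - idx x) = a + b" by (simp_all add: field_simps)
    have ww: "w (a + 1 + idx x) (b + 1 - idx x) N \<in> W" "w (a + idx x) (b - idx x) N \<in> W" "w (a - 1 + idx x) (b - 1 - idx x) N \<in> W" by simp_all
    have "T (L x (w a b N)) = (cu x a b N * (c1 * (of_int (a + b) / 2 + 1) + c2)) *\<^sub>R w (a + 1 + idx x) (b + 1 - idx x) (- N)
       + (cm x a b N * (c1 * (of_int (a + b) / 2) + c2)) *\<^sub>R w (a + idx x) (b - idx x) (- N)
       + (cd x a b N * (c1 * (of_int (a + b) / 2 + - 1) + c2)) *\<^sub>R w (a - 1 + idx x) (b - 1 - idx x) (- N)"
      unfolding pi_gen_w by (simp only: W_operator_D(2)[OF D] W_operator_D(4)[OF D] W_closed w_in_W Tw e scaleR_scaleR)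
    moreover have "L x (T (w a b N)) = (c1 * (of_int (a + b) / 2) + c2) *\<^sub>R (cu x a b (- N) *\<^sub>R w (a + 1 + idx x) (b + 1 - idx x) (- N)
       + cm x a b (- N) *\<^sub>R w (a + idx x) (b - idx x) (- N) + cd x a b (- N) *\<^sub>R w (a - 1 + idx x) (b - 1 - idx x) (- N))"
      unfolding Tw L_linear pi_gen_w ..
    moreover have "dirac_commutator x (w a b N) = dcoef (- 1) (cd x) a b N *\<^sub>R w (a - 1 + idx x) (b - 1 - idx x) (- N)
       + dcoef 0 (cm x) a b N *\<^sub>R w (a + idx x) (b - idx x) (- N) + dcoef 1 (cu x) a b N *\<^sub>R w (a + 1 + idx x) (b + 1 - idx x) (- N)"
      unfolding dirac_commutator_def iw_w[OF l] by simp
    ultimately show "T (L x (w a b N)) = L x (T (w a b N)) + dirac_commutator x (w a b N)"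
      by (simp add: dcoef_def scaleR_add_right scaleR_diff_left mult.commute)
  qed
  then show ?thesis unfolding T_def .
qed

text \<open>D is the closure of its restriction to \<open>W\<close>, and (x, y) \<mapsto> (S x, S y
  + K x) is continuous, so the commutator identity passes from \<open>W\<close> to the full
  domain.\<close>

lemma is_bounded_commutatorI:
  assumes S: "bounded_clinear S" and B': "bounded_clinear K"
    and W: "\<And>x. x \<in> W \<Longrightarrow> S x \<in> W" "\<And>x. x \<in> W \<Longrightarrow> dirac_W (S x) = S (dirac_W x) + K x"
  shows "is_bounded_commutator (dirac c1 c2) S K"
proof -
  have cl: "dirac c1 c2 = closure ((\<lambda>x. (x, dirac_W x)) ` W)"
    unfolding dirac_eq by (rule closure_permutation_graph[symmetric]) (rule label_involution_flip dirac_weight_flip)+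
  have lin: "bounded_linear S" "bounded_linear K" using S B' by (auto simp: bounded_clinear_def)
  have 1: "closed ((\<lambda>z. (S (fst z), S (snd z) + K (fst z))) -` dirac c1 c2)"
    unfolding cl
    by (intro closed_vimage closed_closure continuous_intros bounded_linear.continuous_on[OF lin(1)] bounded_linear.continuous_on[OF lin(2)])
  have 2: "(\<lambda>x. (x, dirac_W x)) ` W \<subseteq> (\<lambda>z. (S (fst z), S (snd z) + K (fst z))) -` dirac c1 c2"
  proof
    fix z assume "z \<in> (\<lambda>x. (x, dirac_W x)) ` W"
    then obtain x where z: "z = (x, dirac_W x)" "x \<in> W" by blast
    have "(S x, dirac_W (S x)) \<in> dirac c1 c2" unfolding cl
      by (rule closure_subset[THEN subsetD], rule image_eqI[of _ _ "S x"]) (simp_all add: W(1)[OF z(2)])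
    then show "z \<in> (\<lambda>z. (S (fst z), S (snd z) + K (fst z))) -` dirac c1 c2"
      unfolding z vimage_def mem_Collect_eq fst_conv snd_conv W(2)[OF z(2)] .
  qed
  have "dirac c1 c2 \<subseteq> (\<lambda>z. (S (fst z), S (snd z) + K (fst z))) -` dirac c1 c2"
    by (subst (1) cl) (rule closure_minimal[OF 2 1])
  then have "(S x, S y + K x) \<in> dirac c1 c2" if "(x, y) \<in> dirac c1 c2" for x y
    using subsetD[OF _ that] by (metis (no_types, lifting) fst_conv snd_conv vimageD)
  then show ?thesis unfolding is_bounded_commutator_def using B' by blast
qed

context
  fixes al :: real
  assumes al: "0 < al" "al < rate"
begin

lemma al_le_2: "al \<le> 2"
  using al by (auto simp: rate_def split: if_splits)

abbreviation "LI2 \<equiv> operator_ideal hull {L_pow q al}"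

lemmas LI_facts = LI[OF al(1) al_le_2]

lemma commutes_modulo_three:
  assumes "commutes_modulo LI2 S1 T" "commutes_modulo LI2 S2 T" "commutes_modulo LI2 S3 T"
  shows "commutes_modulo LI2 (\<lambda>v. S1 v + S2 v + S3 v) T"
  using assms by (intro commutes_modulo_add[OF LI_facts])

lemma commutes_modulo_opp_L:
  assumes "good al j i f" "s \<in> {1, - 1}"
  shows "commutes_modulo LI2 (iw f j i s) (opp (L y))"
proof -
  note g = good_coefficients[THEN good_mono[OF _ less_imp_le[OF al(2)]]]
  note c = commutes_modulo_iw[OF al(1) al_le_2 assms(1) _ assms(2), THEN commutes_modulo_swap[OF LI_facts]]
  show ?thesis unfolding opp_L
    by (rule commutes_modulo_swap[OF LI_facts], rule commutes_modulo_three) (rule c[OF g(3)] c[OF g(2)] c[OF g(1)])+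
qed

lemma commutes_modulo_gens: "commutes_modulo LI2 (L x) (opp (L y))" "commutes_modulo LI2 (dirac_commutator x) (opp (L y))"
proof -
  note g = good_coefficients[THEN good_mono[OF _ less_imp_le[OF al(2)]]]
  note d = good_coefficients[THEN good_dirac[OF _ al(2)]]
  have L: "L x = (\<lambda>v. iw (cd x) (- 1) (idx x) 1 v + iw (cm x) 0 (idx x) 1 v + iw (cu x) 1 (idx x) 1 v)"
    by (rule ext) (rule pi_gen_eq)
  show "commutes_modulo LI2 (L x) (opp (L y))" unfolding L
    by (rule commutes_modulo_three; rule commutes_modulo_opp_L[OF g(3)] commutes_modulo_opp_L[OF g(2)] commutes_modulo_opp_L[OF g(1)]; simp)
  have d': "dirac_commutator x = (\<lambda>v. iw (dcoef (- 1) (cd x)) (- 1) (idx x) (- 1) v + iw (dcoef 0 (cm x)) 0 (idx x) (- 1) v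
     + iw (dcoef 1 (cu x)) 1 (idx x) (- 1) v)" by (rule ext) (rule dirac_commutator_def)
  show "commutes_modulo LI2 (dirac_commutator x) (opp (L y))" unfolding d'
    by (rule commutes_modulo_three; rule commutes_modulo_opp_L[OF d(3)] commutes_modulo_opp_L[OF d(2)] commutes_modulo_opp_L[OF d(1)]; simp)
qed

lemma commutes_modulo_opp_act:
  assumes "bounded_clinear S" "\<And>y. commutes_modulo LI2 S (opp (L y))"
  shows "commutes_modulo LI2 S (opp (rep.act p))"
proof -
  have "commutes_modulo LI2 (opp (rep.act p)) S"
  proof (induction p rule: free_algebra_induct)
    case (scalar c)
    have "opp (rep.act (scalar c)) = (\<lambda>v. cnj c *\<^sub>C v)"
      by (simp add: rep.act_scalar[abs_def] opp_simps)
    then show ?case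
      using commutes_modulo_scale[OF LI_facts commutes_modulo_id[OF LI_facts assms(1)]] by simp
  next
    case (gen g)
    have "rep.act (free_gen g) = L g" by (rule ext) (rule rep.act_gen)
    then show ?case using commutes_modulo_swap[OF LI_facts assms(2)] by simp
  next
    case (add p r)
    have "rep.act (p + r) = (\<lambda>v. rep.act p v + rep.act r v)" by (rule ext) (rule rep.act_add)
    then show ?case using commutes_modulo_add[OF LI_facts add] by (simp add: opp_simps)
  next
    case (mult p r)
    have "rep.act (p * r) = (\<lambda>v. rep.act p (rep.act r v))" by (rule ext) (rule rep.act_mult[OF UNIV_I])
    then show ?case using commutes_modulo_comp[OF LI_facts mult] by (simp add: opp_simps bounded_clinear_act)
  qed
  then show ?thesis by (rule commutes_modulo_swap[OF LI_facts])
qed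

lemma commutes_modulo_act: "commutes_modulo LI2 (rep.act p) (opp (rep.act p'))"
proof (induction p rule: free_algebra_induct)
  case (scalar c)
  have "rep.act (scalar c) = (\<lambda>v. c *\<^sub>C v)" by (rule ext) (rule rep.act_scalar)
  then show ?case
    using commutes_modulo_scale[OF LI_facts commutes_modulo_id[OF LI_facts bounded_clinear_opp[OF bounded_clinear_act]]] by simp
next
  case (gen g)
  have "rep.act (free_gen g) = L g" by (rule ext) (rule rep.act_gen)
  then show ?case using commutes_modulo_opp_act[OF bounded_clinear_pi_gen commutes_modulo_gens(1)] by simp
next
  case (add p r)
  have "rep.act (p + r) = (\<lambda>v. rep.act p v + rep.act r v)" by (rule ext) (rule rep.act_add)
  then show ?case using commutes_modulo_add[OF LI_facts add] by simp
next
  case (mult p r)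
  have "rep.act (p * r) = (\<lambda>v. rep.act p (rep.act r v))" by (rule ext) (rule rep.act_mult[OF UNIV_I])
  then show ?case using commutes_modulo_comp[OF LI_facts mult] by simp
qed

lemma dirac_linear:
  "(x, y) \<in> dirac c1 c2 \<Longrightarrow> (x', y') \<in> dirac c1 c2 \<Longrightarrow> (x + x', y + y') \<in> dirac c1 c2"
  "(x, y) \<in> dirac c1 c2 \<Longrightarrow> (c *\<^sub>C x, c *\<^sub>C y) \<in> dirac c1 c2"
  unfolding dirac_eq by (erule (1) permutation_graph_closed_add) (erule permutation_graph_closed_scale)

text \<open>The commutator has no closed formula for general elements, so its existence and its
  commutation with the opposite algebra are carried through one induction, with the Leibniz rule for
  products.\<close>

lemma dirac_commutator_act:
  "\<exists>K. is_bounded_commutator (dirac c1 c2) (rep.act p) K \<and> (\<forall>r. commutes_modulo LI2 K (opp (rep.act r)))"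
proof (induction p rule: free_algebra_induct)
  case (scalar c)
  have "is_bounded_commutator (dirac c1 c2) (rep.act (scalar c)) (\<lambda>_. 0)"
    unfolding is_bounded_commutator_def using dirac_linear(2) by (auto simp: rep.act_scalar bounded_clinear_0)
  then show ?case using commutes_modulo_zero[OF LI_facts bounded_clinear_opp[OF bounded_clinear_act]] by blast
next
  case (gen g)
  have 1: "rep.act (free_gen g) = L g" by (rule ext) (rule rep.act_gen)
  have K: "bounded_clinear (dirac_commutator g)" using commutes_modulo_gens(2)[of g] by (simp add: commutes_modulo_def)
  have "is_bounded_commutator (dirac c1 c2) (L g) (dirac_commutator g)"
    by (rule is_bounded_commutatorI[OF bounded_clinear_pi_gen K L_in_W]) (simp_all add: dirac_commutator_W)
  then show ?case unfolding 1 using commutes_modulo_opp_act[OF K commutes_modulo_gens(2)] by blast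
next
  case (add p p')
  then obtain K K' where *: "is_bounded_commutator (dirac c1 c2) (rep.act p) K" "\<And>r. commutes_modulo LI2 K (opp (rep.act r))"
    "is_bounded_commutator (dirac c1 c2) (rep.act p') K'" "\<And>r. commutes_modulo LI2 K' (opp (rep.act r))" by blast
  have "is_bounded_commutator (dirac c1 c2) (rep.act (p + p')) (\<lambda>v. K v + K' v)"
    unfolding is_bounded_commutator_def
  proof (intro conjI bounded_clinear_plus ballI, safe)
    show "bounded_clinear K" "bounded_clinear K'" using * by (simp_all add: is_bounded_commutator_def)
    fix x y assume "(x, y) \<in> dirac c1 c2"
    then have "(rep.act p x, rep.act p y + K x) \<in> dirac c1 c2" "(rep.act p' x, rep.act p' y + K' x) \<in> dirac c1 c2"
      using *(1,3) unfolding is_bounded_commutator_def by auto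
    from dirac_linear(1)[OF this] show "(rep.act (p + p') x, rep.act (p + p') y + (K x + K' x)) \<in> dirac c1 c2"
      by (simp add: rep.act_add algebra_simps)
  qed
  then show ?case using commutes_modulo_add[OF LI_facts *(2) *(4)] by blast
next
  case (mult p p')
  then obtain K K' where *: "is_bounded_commutator (dirac c1 c2) (rep.act p) K" "\<And>r. commutes_modulo LI2 K (opp (rep.act r))"
    "is_bounded_commutator (dirac c1 c2) (rep.act p') K'" "\<And>r. commutes_modulo LI2 K' (opp (rep.act r))" by blast
  have b: "bounded_clinear K" "bounded_clinear K'" using * by (simp_all add: is_bounded_commutator_def)
  have "is_bounded_commutator (dirac c1 c2) (rep.act (p * p')) (\<lambda>v. rep.act p (K' v) + K (rep.act p' v))"
    unfolding is_bounded_commutator_def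
  proof (intro conjI bounded_clinear_plus ballI, safe)
    show "bounded_clinear (\<lambda>v. rep.act p (K' v))" "bounded_clinear (\<lambda>v. K (rep.act p' v))"
      using bounded_clinear_comp[OF bounded_clinear_act b(2)] bounded_clinear_comp[OF b(1) bounded_clinear_act] by (simp_all add: o_def)
    fix x y assume "(x, y) \<in> dirac c1 c2"
    then have "(rep.act p' x, rep.act p' y + K' x) \<in> dirac c1 c2" using *(3) unfolding is_bounded_commutator_def by auto
    then have "(rep.act p (rep.act p' x), rep.act p (rep.act p' y + K' x) + K (rep.act p' x)) \<in> dirac c1 c2"
      using *(1) unfolding is_bounded_commutator_def by auto
    then show "(rep.act (p * p') x, rep.act (p * p') y + (rep.act p (K' x) + K (rep.act p' x))) \<in> dirac c1 c2"
      by (simp add: rep.act_mult act_right add.assoc)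
  qed
  then show ?case
    \<comment> \<open>The Leibniz expression also contains the elements \<open>p\<close> and
      \<open>p'\<close> themselves, so the order-zero condition \<open>commutes_modulo_act\<close>
      is needed here.\<close>
    using commutes_modulo_add[OF LI_facts commutes_modulo_comp[OF LI_facts commutes_modulo_act *(4)]
      commutes_modulo_comp[OF LI_facts *(2) commutes_modulo_act]] by blast
qed

lemma grading_act: "grading (rep.act p v) = rep.act p (grading v)"
proof (induction p arbitrary: v rule: free_algebra_induct)
  case (gen x)
  have "(\<lambda>v. grading (L x v)) = (\<lambda>v. L x (grading v))"
  proof (rule bounded_clinear_eq_on_W)
    show "bounded_clinear (\<lambda>v. grading (L x v))" "bounded_clinear (\<lambda>v. L x (grading v))"
      using bounded_clinear_comp[OF bounded_clinear_grading bounded_clinear_pi_gen]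
        bounded_clinear_comp[OF bounded_clinear_pi_gen bounded_clinear_grading] by (simp_all add: o_def)
    fix p assume "p \<in> spin_labels"
    then obtain a b N where p: "p = lab a b N" by (metis label_cases)
    have sc: "grading (v + v') = grading v + grading v'" "grading (k *\<^sub>R v) = k *\<^sub>R grading v" for v v' k
      using bounded_clinear_add[OF bounded_clinear_grading] bounded_clinear_scale[OF bounded_clinear_grading] by (auto simp: scaleR_scaleC)
    show "grading (L x (bv p)) = L x (grading (bv p))"
      unfolding p w_def[symmetric] grading_w L_linear pi_gen_w sc by (simp add: scaleR_add_right mult.commute)
  qed
  then show ?case by (simp add: rep.act_gen fun_eq_iff)
qed (use bounded_clinear_add[OF bounded_clinear_grading] bounded_clinear_scale[OF bounded_clinear_grading] in
    \<open>simp_all add: rep.act_simps\<close>)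

lemma real_even_spectral_triple_podles:
  assumes "c1 \<noteq> 0"
  shows "real_even_spectral_triple LI2 (quantum_sphere q t) (spinor_rep q t) (dirac c1 c2) conjugation grading"
  unfolding real_even_spectral_triple_def
proof (intro conjI allI)
  have c: "a \<in> carrier (quantum_sphere q t) \<longleftrightarrow> (\<exists>p. a = cls SI p)" for a by (auto simp: sphere_simps)
  have ex: "\<exists>K. is_bounded_commutator (dirac c1 c2) (rep.act p) K" for p
    using dirac_commutator_act by blast
  show "spectral_triple (quantum_sphere q t) (spinor_rep q t) (dirac c1 c2)"
    unfolding spectral_triple_def
    using ex complex_star_algebra_sphere star_representation_sphere inj_spinor_rep dirac_selfadjoint
      dirac_compact_resolvent[OF assms] by (auto simp: c spinor_rep_cls)
  show "even_structure (quantum_sphere q t) (spinor_rep q t) (dirac c1 c2) grading"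
    by (rule even_structure_dirac) (auto simp: c spinor_rep_cls grading_act)
  show "conjugation (grading x) = - grading (conjugation x)" for x by (rule conjugation_anticommutes_grading)
  show "real_structure LI2 (quantum_sphere q t) (spinor_rep q t) (dirac c1 c2) conjugation"
    unfolding real_structure_def
  proof (intro conjI ballI allI)
    show "operator_ideal LI2" by (rule LI_facts)
    show "infinitesimal_of_arbitrary_order S" if "S \<in> LI2" for S
      using L_ideal_infinitesimal[OF q0 q1 al(1) that] .
    show "antiunitary conjugation" by (rule antiunitary_conjugation)
    show "conjugation (conjugation x) = - x" for x by (rule conjugation_square)
    show "dirac c1 c2 O op_graph conjugation = op_graph conjugation O dirac c1 c2" by (rule dirac_commutes_conjugation)
    fix a assume "a \<in> carrier (quantum_sphere q t)"
    then obtain p where a: "a = cls SI p" unfolding c by blast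
    show "commutator (spinor_rep q t a) (conjugation \<circ> spinor_rep q t b \<circ> inv_into UNIV conjugation) \<in> LI2"
      if "b \<in> carrier (quantum_sphere q t)" for b
      using that commutes_modulo_act[of p]
      by (auto simp: c a spinor_rep_cls opp_eq[OF bounded_clinear_act] commutes_modulo_def)
    obtain K where K: "is_bounded_commutator (dirac c1 c2) (rep.act p) K" "\<And>r. commutes_modulo LI2 K (opp (rep.act r))"
      using dirac_commutator_act by blast
    show "\<exists>K. is_bounded_commutator (dirac c1 c2) (spinor_rep q t a) K
      \<and> (\<forall>b\<in>carrier (quantum_sphere q t). commutator K (conjugation \<circ> spinor_rep q t b \<circ> inv_into UNIV conjugation) \<in> LI2)"
      using K by (intro exI[of _ K]) (auto simp: c a spinor_rep_cls opp_eq[OF bounded_clinear_act] commutes_modulo_def)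
  qed
qed

end

end

end

theorem proposition7p2:
  fixes q t c1 c2 :: real
  assumes "0 < q" "q < 1" "0 \<le> t" "t \<le> 1" "c1 \<noteq> 0"
  shows "equivariant q t (spinor_rep q t) (dirac c1 c2) conjugation grading \<and>
    (\<forall>\<alpha>. 0 < \<alpha> \<and> \<alpha> < (if t \<noteq> 1 then 2 else 1) \<longrightarrow>
      real_even_spectral_triple (operator_ideal hull {L_pow q \<alpha>})
        (quantum_sphere q t) (spinor_rep q t) (dirac c1 c2) conjugation grading)"
proof -
  interpret podles q t by unfold_locales (use assms in auto)
  show ?thesis
    using equivariant_podles real_even_spectral_triple_podles assms(5) by (auto simp: rate_def)
qed

end
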